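(* Let $(g,\eta)$ and $(\bar g,\bar\eta)$ be two pairs, each consisting of a terminal value $\Omega\to\mathbb R$ and a generator $\Omega\times[0,T]\times\mathbb R\times\mathbb R^d\times\mathcal P_2(\mathbb R)\times\mathcal P_2(\mathbb R^d)\to\mathbb R$. Suppose each pair, written generically $(f,\zeta_T)$, satisfies the following, where $\theta:\Omega\times[0,T]\to\mathbb R^+$ is $\mathbb F$-progressively measurable, $\phi:[0,\infty)\to[0,\infty)$ is nondecreasing and continuous, and $\gamma,K,K_1,K_3>0$ are constants: (a) $d\mathbb P\times dt$-a.e. $(\omega,t)$, for all $(y,z,\mu_1,\mu_2)$, $|f(\omega,t,y,z,\mu_1,\mu_2)|\le\theta_t(\omega)+K|y|+\frac\gamma2|z|^2+K\mathcal W_2(\mu_1,\delta_{\{0\}})$; (b) $d\mathbb P\times dt$-a.e. $(\omega,t)$, for all $y,\bar y\in\mathbb R$, $z,\bar z\in\mathbb R^d$, $\mu_1,\bar\mu_1\in\mathcal P_2(\mathbb R)$, $\mu_2,\bar\mu_2\in\mathcal P_2(\mathbb R^d)$, $$\begin{aligned}&|f(\omega,t,y,z,\mu_1,\mu_2)-f(\omega,t,\bar y,\bar z,\bar\mu_1,\bar\mu_2)|\le K\big(|y-\bar y|+\mathcal W_2(\mu_1,\bar\mu_1)\big)\\&\quad+\phi\big(|y|\vee|\bar y|\vee\mathcal W_2(\mu_1,\delta_{\{0\}})\vee\mathcal W_2(\bar\mu_1,\delta_{\{0\}})\big)\big[(1+|z|+|\bar z|)|z-\bar z|+\mathcal W_2(\mu_2,\bar\mu_2)\big];\end{aligned}$$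 (c) $\|\zeta_T\|_\infty\le K_1$ and $\big\|\int_0^T|\theta_t|^2dt\big\|_\infty\le K_3$. Denote by $(Y,Z)$ and $(\bar Y,\bar Z)$ the global adapted solutions of the mean-field BSDEs $$Y_t=\eta+\int_t^Tg(s,Y_s,Z_s,\mathbb P_{Y_s},\mathbb P_{Z_s})ds-\int_t^TZ_sdW_s,\qquad \bar Y_t=\bar\eta+\int_t^T\bar g(s,\bar Y_s,\bar Z_s,\mathbb P_{\bar Y_s},\mathbb P_{\bar Z_s})ds-\int_t^T\bar Z_sdW_s,\quad t\in[0,T].$$ In addition, suppose that (i) one of the two generators $g$ and $\bar g$ does not depend on $\mu_2$; (ii) the other one of the two generators, call it $h$, is nondecreasing with respect to $\mu_1$ in the following sense: there exists a positive constant $K$ such that for every $(\omega,t)\in\Omega\times[0,T]$, $y\in\mathbb R$, $z\in\mathbb R^d$, $\xi,\bar\xi\in L^2_{\mathscr F_t}(\Omega;\mathbb R)$ and $\zeta\in L^2_{\mathscr F_t}(\Omega;\mathbb R^d)$, $$h(\omega,t,y,z,\mathbb P_\xi,\mathbb P_\zeta)-h(\omega,t,y,z,\mathbb P_{\bar\xi},\mathbb P_\zeta)\le K\|(\xi-\bar\xi)^+\|_{L^2(\Omega)}.$$ Then, if $\eta\le\bar\eta$ and $g\le\bar g$ (for all values of the arguments $(t,y,z,\mu_1,\mu_2)$), $\mathbb P$-a.s., we have for every $t\in[0,T]$ $$Y_t\le\bar Y_t,\qquad\mathbb P\text{-a.s.}$$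
   Context: $(\Omega,\mathscr F,\mathbb F,\mathbb P)$ is a complete filtered probability space carrying a $d$-dimensional standard Brownian motion $W$; $\mathbb F=\{\mathscr F_t\}$ is the natural filtration of $W$ augmented by the $\mathbb P$-null sets; $T>0$ is fixed. $\mathbb P_\xi$ is the law of $\xi$, $a^+=\max(a,0)$, $\|\xi\|_\infty=\operatorname{ess\,sup}|\xi|$, $\|\xi\|_{L^2(\Omega)}=(\mathbb E|\xi|^2)^{1/2}$, $L^2_{\mathscr F_t}(\Omega;\cdot)$ is the space of square-integrable $\mathscr F_t$-measurable variables, and $\delta_{\{0\}}$ is the Dirac measure at $0$. $\mathcal P_2(\mathbb R^k)$ is the set of Borel probability measures on $\mathbb R^k$ with finite second moment, with the 2-Wasserstein metric $\mathcal W_2$. The global adapted solutions are the unique solutions in $S^\infty_{\mathbb F}(0,T;\mathbb R)\times\mathcal Z^2_{\mathbb F}(0,T;\mathbb R^d)$, which exist under (a)-(c). Here $S^\infty_{\mathbb F}(0,T;\mathbb R)$ is the space of essentially bounded $\mathbb F$-adapted continuous processes and $\mathcal Z^2_{\mathbb F}(0,T;\mathbb R^d)$ the space of $\mathbb F$-progressively measurable $Z$ with $\mathbb E\int_0^T|Z_s|^2ds<\infty$ and $\sup_\tau\|\mathbb E[\int_\tau^T|Z_s|^2ds\mid\mathscr F_\tau]\|_\infty<\infty$, the supremum over $\mathbb F$-stopping times $\tau$ valued in $[0,T]$. Implicit measurability convention: terminal values are $\mathscr F_T$-measurable and generators are $\mathbb F$-progressively measurable for fixed $(y,z,\mu_1,\mu_2)$.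 *)

theory Defs
  imports "HOL-Probability.Probability"
begin

section \<open>The space of measures with finite second moment and the 2-Wasserstein metric\<close>

definition P2 :: "'a::euclidean_space measure set" where
  "P2 = {\<mu>. prob_space \<mu> \<and> sets \<mu> = sets borel \<and> (\<integral>\<^sup>+ x. ennreal ((norm x)\<^sup>2) \<partial>\<mu>) < \<infinity>}"

definition couplings ::
    "'a::euclidean_space measure \<Rightarrow> 'a measure \<Rightarrow> ('a \<times> 'a) measure set" where
  "couplings \<mu> \<nu> =
     {\<pi>. sets \<pi> = sets (borel \<Otimes>\<^sub>M borel) \<and> distr \<pi> borel fst = \<mu> \<and> distr \<pi> borel snd = \<nu>}"

definition wasserstein2 :: "'a::euclidean_space measure \<Rightarrow> 'a measure \<Rightarrow> real" where
  "wasserstein2 \<mu> \<nu> =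
     sqrt (enn2real (INF \<pi>\<in>couplings \<mu> \<nu>. \<integral>\<^sup>+ p. ennreal ((dist (fst p) (snd p))\<^sup>2) \<partial>\<pi>))"

abbreviation law :: "'w measure \<Rightarrow> ('w \<Rightarrow> 'a::euclidean_space) \<Rightarrow> 'a measure" where
  "law M \<xi> \<equiv> distr M borel \<xi>"


section \<open>Square-integrable and essentially bounded random variables\<close>

text \<open>The first argument carries the probability, the second one only the $\sigma$-algebra.\<close>

definition L2_space :: "'w measure \<Rightarrow> 'w measure \<Rightarrow> ('w \<Rightarrow> 'a::euclidean_space) set" where
  "L2_space M G = {\<xi> \<in> borel_measurable G. integrable M (\<lambda>\<omega>. (norm (\<xi> \<omega>))\<^sup>2)}"

definition L2_norm :: "'w measure \<Rightarrow> ('w \<Rightarrow> 'a::euclidean_space) \<Rightarrow> real" where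
  "L2_norm M \<xi> = sqrt (\<integral>\<omega>. (norm (\<xi> \<omega>))\<^sup>2 \<partial>M)"

definition Linf_norm :: "'w measure \<Rightarrow> ('w \<Rightarrow> 'a::euclidean_space) \<Rightarrow> ennreal" where
  "Linf_norm M \<xi> = esssup M (\<lambda>\<omega>. ennreal (norm (\<xi> \<omega>)))"


section \<open>Brownian motion and its augmented natural filtration\<close>

definition history :: "'w measure \<Rightarrow> (real \<Rightarrow> 'w \<Rightarrow> 'a::euclidean_space) \<Rightarrow> real \<Rightarrow> 'w set set" where
  "history M W t = {W s -` A \<inter> space M | s A. 0 \<le> s \<and> s \<le> t \<and> A \<in> sets borel}"

definition brownian_motion :: "'w measure \<Rightarrow> (real \<Rightarrow> 'w \<Rightarrow> real ^ 'd) \<Rightarrow> bool" where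
  "brownian_motion M W \<longleftrightarrow>
     (\<forall>t\<ge>0. W t \<in> borel_measurable M) \<and>
     (AE \<omega> in M. W 0 \<omega> = 0) \<and>
     (AE \<omega> in M. continuous_on {0..} (\<lambda>t. W t \<omega>)) \<and>
     (\<forall>s t. 0 \<le> s \<and> s < t \<longrightarrow>
        distributed M lborel (\<lambda>\<omega>. W t \<omega> - W s \<omega>)
          (\<lambda>x. ennreal (\<Prod>i\<in>UNIV. normal_density 0 (sqrt (t - s)) (x $ i))) \<and>
        prob_space.indep_set M (sigma_sets (space M) (history M W s))
          {(\<lambda>\<omega>. W t \<omega> - W s \<omega>) -` A \<inter> space M | A. A \<in> sets borel})"

text \<open>The filtration is indexed by all of \<^typ>\<open>real\<close>, in order to fit the locale
  \<^locale>\<open>filtration\<close>; at negative times it only consists of events of probability 0 or 1.\<close>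

definition brownian_filtration ::
    "'w measure \<Rightarrow> (real \<Rightarrow> 'w \<Rightarrow> 'a::euclidean_space) \<Rightarrow> real \<Rightarrow> 'w measure" where
  "brownian_filtration M W t = sigma (space M) (history M W t \<union> null_sets M)"

lemma filtration_brownian_filtration: "filtration (space M) (brownian_filtration M W)"
proof
  have sub: "history M W t \<union> null_sets M \<subseteq> Pow (space M)" for t
    using sets.sets_into_space by (fastforce simp: history_def)
  show "space (brownian_filtration M W t) = space M" for t
    using sub by (simp add: brownian_filtration_def)
  show "sets (brownian_filtration M W s) \<subseteq> sets (brownian_filtration M W t)" if "s \<le> t" for s t
  proof -
    have "history M W s \<subseteq> history M W t"
      using that by (fastforce simp: history_def)
    then show ?thesis
      using sub by (auto simp: brownian_filtration_def intro!: sigma_sets_mono')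
  qed
qed

locale brownian_basis = prob_space M + complete_measure M
  for M :: "'w measure" and W :: "real \<Rightarrow> 'w \<Rightarrow> real ^ 'd" +
  assumes brownian_motion: "brownian_motion M W"


section \<open>Spaces of processes\<close>

definition prog_measurable ::
    "(real \<Rightarrow> 'w measure) \<Rightarrow> real \<Rightarrow> (real \<Rightarrow> 'w \<Rightarrow> 'a::topological_space) \<Rightarrow> bool" where
  "prog_measurable F T X \<longleftrightarrow>
     (\<forall>t\<in>{0..T}. (\<lambda>(s, \<omega>). X s \<omega>) \<in> borel_measurable (restrict_space borel {0..t} \<Otimes>\<^sub>M F t))"

definition S_inf ::
    "'w measure \<Rightarrow> (real \<Rightarrow> 'w measure) \<Rightarrow> real \<Rightarrow> (real \<Rightarrow> 'w \<Rightarrow> real) set" where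
  "S_inf M F T =
     {Y. (\<forall>t\<in>{0..T}. Y t \<in> borel_measurable (F t)) \<and>
         (AE \<omega> in M. continuous_on {0..T} (\<lambda>t. Y t \<omega>)) \<and>
         (\<exists>C. AE \<omega> in M. \<forall>t\<in>{0..T}. \<bar>Y t \<omega>\<bar> \<le> C)}"

definition Z2_space ::
    "'w measure \<Rightarrow> (real \<Rightarrow> 'w measure) \<Rightarrow> real \<Rightarrow> (real \<Rightarrow> 'w \<Rightarrow> real ^ 'd) set" where
  "Z2_space M F T =
     {Z. prog_measurable F T Z \<and>
         (\<integral>\<^sup>+ \<omega>. (\<integral>\<^sup>+ s\<in>{0..T}. ennreal ((norm (Z s \<omega>))\<^sup>2) \<partial>lborel) \<partial>M) < \<infinity> \<and>
         (SUP \<tau>\<in>{\<tau>. stopping_time F \<tau> \<and> (\<forall>\<omega>\<in>space M. \<tau> \<omega> \<in> {0..T})}.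
            esssup M (nn_cond_exp M (filtration.pre_sigma (space M) F \<tau>)
              (\<lambda>\<omega>. \<integral>\<^sup>+ s\<in>{\<tau> \<omega>..T}. ennreal ((norm (Z s \<omega>))\<^sup>2) \<partial>lborel))) < \<infinity>}"


section \<open>The It\^o integral\<close>

text \<open>A step process on $[a,b]$ is given by a partition
  $a = \tau_0 \le \dots \le \tau_n = b$ and bounded $\mathcal{F}_{\tau_i}$-measurable $\xi_i$; it is
  the process $\sum_{i<n} \xi_i 1_{(\tau_i,\tau_{i+1}]}$.\<close>

definition step_process ::
    "'w measure \<Rightarrow> (real \<Rightarrow> 'w measure) \<Rightarrow> real \<Rightarrow> real \<Rightarrow>
     nat \<Rightarrow> (nat \<Rightarrow> real) \<Rightarrow> (nat \<Rightarrow> 'w \<Rightarrow> real ^ 'd) \<Rightarrow> bool" where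
  "step_process M F a b n \<tau> \<xi> \<longleftrightarrow>
     \<tau> 0 = a \<and> \<tau> n = b \<and> (\<forall>i<n. \<tau> i \<le> \<tau> (Suc i)) \<and>
     (\<forall>i<n. \<xi> i \<in> borel_measurable (F (\<tau> i)) \<and> (\<exists>C. \<forall>\<omega>\<in>space M. norm (\<xi> i \<omega>) \<le> C))"

definition step_value ::
    "nat \<Rightarrow> (nat \<Rightarrow> real) \<Rightarrow> (nat \<Rightarrow> 'w \<Rightarrow> real ^ 'd) \<Rightarrow> real \<Rightarrow> 'w \<Rightarrow> real ^ 'd" where
  "step_value n \<tau> \<xi> s \<omega> = (\<Sum>i<n. indicat_real {\<tau> i<..\<tau> (Suc i)} s *\<^sub>R \<xi> i \<omega>)"

definition step_integral ::
    "(real \<Rightarrow> 'w \<Rightarrow> real ^ 'd) \<Rightarrow> nat \<Rightarrow> (nat \<Rightarrow> real) \<Rightarrow> (nat \<Rightarrow> 'w \<Rightarrow> real ^ 'd) \<Rightarrow> 'w \<Rightarrow> real" where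
  "step_integral W n \<tau> \<xi> \<omega> = (\<Sum>i<n. \<xi> i \<omega> \<bullet> (W (\<tau> (Suc i)) \<omega> - W (\<tau> i) \<omega>))"

text \<open>\<open>has_ito_integral M F W a b Z I\<close> says that $I$ is a version of $\int_a^b Z_s\,dW_s$: the
  $L^2(\Omega)$-limit of the integrals of step processes that converge to $Z$ in
  $L^2(\Omega\times[a,b])$. By the It\^o isometry $I$ is determined up to a null set.\<close>

definition has_ito_integral ::
    "'w measure \<Rightarrow> (real \<Rightarrow> 'w measure) \<Rightarrow> (real \<Rightarrow> 'w \<Rightarrow> real ^ 'd) \<Rightarrow> real \<Rightarrow> real \<Rightarrow>
     (real \<Rightarrow> 'w \<Rightarrow> real ^ 'd) \<Rightarrow> ('w \<Rightarrow> real) \<Rightarrow> bool" where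
  "has_ito_integral M F W a b Z I \<longleftrightarrow>
     I \<in> borel_measurable M \<and>
     (\<exists>n \<tau> \<xi>.
        (\<forall>k. step_process M F a b (n k) (\<tau> k) (\<xi> k)) \<and>
        (\<lambda>k. \<integral>\<^sup>+ \<omega>. (\<integral>\<^sup>+ s\<in>{a..b}.
            ennreal ((norm (step_value (n k) (\<tau> k) (\<xi> k) s \<omega> - Z s \<omega>))\<^sup>2) \<partial>lborel) \<partial>M)
          \<longlonglongrightarrow> 0 \<and>
        (\<lambda>k. \<integral>\<^sup>+ \<omega>. ennreal ((step_integral W (n k) (\<tau> k) (\<xi> k) \<omega> - I \<omega>)\<^sup>2) \<partial>M)
          \<longlonglongrightarrow> 0)"


section \<open>Mean-field BSDEs\<close>

text \<open>Generators are total functions on all measures; only their values at arguments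
  from \<^const>\<open>P2\<close> are ever constrained.\<close>

type_synonym ('w, 'd) generator =
  "'w \<Rightarrow> real \<Rightarrow> real \<Rightarrow> real ^ 'd \<Rightarrow> real measure \<Rightarrow> (real ^ 'd) measure \<Rightarrow> real"

definition measurable_data ::
    "(real \<Rightarrow> 'w measure) \<Rightarrow> real \<Rightarrow> ('w, 'd::finite) generator \<Rightarrow> ('w \<Rightarrow> real) \<Rightarrow> bool" where
  "measurable_data F T f \<zeta> \<longleftrightarrow>
     \<zeta> \<in> borel_measurable (F T) \<and>
     (\<forall>y z. \<forall>\<mu>1\<in>P2. \<forall>\<mu>2\<in>P2. prog_measurable F T (\<lambda>t \<omega>. f \<omega> t y z \<mu>1 \<mu>2))"

definition growth_condition ::
    "'w measure \<Rightarrow> real \<Rightarrow> (real \<Rightarrow> 'w \<Rightarrow> real) \<Rightarrow> real \<Rightarrow> real \<Rightarrow> ('w, 'd::finite) generator \<Rightarrow> bool" where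
  "growth_condition M T \<theta> \<gamma> K f \<longleftrightarrow>
     (AE (\<omega>, t) in M \<Otimes>\<^sub>M restrict_space lborel {0..T}.
        \<forall>y z. \<forall>\<mu>1\<in>P2. \<forall>\<mu>2\<in>P2.
          \<bar>f \<omega> t y z \<mu>1 \<mu>2\<bar>
            \<le> \<theta> t \<omega> + K * \<bar>y\<bar> + \<gamma> / 2 * (norm z)\<^sup>2 + K * wasserstein2 \<mu>1 (return borel 0))"

definition lipschitz_condition ::
    "'w measure \<Rightarrow> real \<Rightarrow> (real \<Rightarrow> real) \<Rightarrow> real \<Rightarrow> ('w, 'd::finite) generator \<Rightarrow> bool" where
  "lipschitz_condition M T \<phi> K f \<longleftrightarrow>
     (AE (\<omega>, t) in M \<Otimes>\<^sub>M restrict_space lborel {0..T}.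
        \<forall>y y' z z'. \<forall>\<mu>1\<in>P2. \<forall>\<mu>1'\<in>P2. \<forall>\<mu>2\<in>P2. \<forall>\<mu>2'\<in>P2.
          \<bar>f \<omega> t y z \<mu>1 \<mu>2 - f \<omega> t y' z' \<mu>1' \<mu>2'\<bar>
            \<le> K * (\<bar>y - y'\<bar> + wasserstein2 \<mu>1 \<mu>1') +
              \<phi> (max (max \<bar>y\<bar> \<bar>y'\<bar>)
                     (max (wasserstein2 \<mu>1 (return borel 0)) (wasserstein2 \<mu>1' (return borel 0)))) *
              ((1 + norm z + norm z') * norm (z - z') + wasserstein2 \<mu>2 \<mu>2'))"

definition quadratic_data ::
    "'w measure \<Rightarrow> (real \<Rightarrow> 'w measure) \<Rightarrow> real \<Rightarrow> ('w, 'd::finite) generator \<Rightarrow> ('w \<Rightarrow> real) \<Rightarrow> bool" where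
  "quadratic_data M F T f \<zeta> \<longleftrightarrow>
     measurable_data F T f \<zeta> \<and>
     (\<exists>\<theta> \<phi> \<gamma> K K1 K3.
        prog_measurable F T \<theta> \<and> (\<forall>\<omega>\<in>space M. \<forall>t\<in>{0..T}. 0 \<le> \<theta> t \<omega>) \<and>
        mono_on {0..} \<phi> \<and> continuous_on {0..} \<phi> \<and> (\<forall>x\<ge>0. 0 \<le> \<phi> x) \<and>
        0 < \<gamma> \<and> 0 < K \<and> 0 < K1 \<and> 0 < K3 \<and>
        growth_condition M T \<theta> \<gamma> K f \<and>
        lipschitz_condition M T \<phi> K f \<and>
        Linf_norm M \<zeta> \<le> ennreal K1 \<and>
        esssup M (\<lambda>\<omega>. \<integral>\<^sup>+ t\<in>{0..T}. ennreal ((\<theta> t \<omega>)\<^sup>2) \<partial>lborel) \<le> ennreal K3)"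

text \<open>The $ds$-integrals are taken with respect to \<^const>\<open>lebesgue\<close> rather than
  \<^const>\<open>lborel\<close>: on the null set of times at which the law of $Z_s$ is not in \<^const>\<open>P2\<close>,
  the integrand need not be Borel measurable.\<close>

definition global_solution ::
    "'w measure \<Rightarrow> (real \<Rightarrow> 'w measure) \<Rightarrow> (real \<Rightarrow> 'w \<Rightarrow> real ^ 'd) \<Rightarrow> real \<Rightarrow>
     ('w, 'd::finite) generator \<Rightarrow> ('w \<Rightarrow> real) \<Rightarrow>
     (real \<Rightarrow> 'w \<Rightarrow> real) \<Rightarrow> (real \<Rightarrow> 'w \<Rightarrow> real ^ 'd) \<Rightarrow> bool" where
  "global_solution M F W T f \<zeta> Y Z \<longleftrightarrow>
     Y \<in> S_inf M F T \<and> Z \<in> Z2_space M F T \<and>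
     (AE \<omega> in M. set_integrable lebesgue {0..T}
        (\<lambda>s. f \<omega> s (Y s \<omega>) (Z s \<omega>) (law M (Y s)) (law M (Z s)))) \<and>
     (\<forall>t\<in>{0..T}. \<exists>I. has_ito_integral M F W t T Z I \<and>
        (AE \<omega> in M.
           Y t \<omega> = \<zeta> \<omega>
             + (LINT s:{t..T}|lebesgue. f \<omega> s (Y s \<omega>) (Z s \<omega>) (law M (Y s)) (law M (Z s)))
             - I \<omega>))"

definition independent_of_mu2 :: "'w measure \<Rightarrow> real \<Rightarrow> ('w, 'd::finite) generator \<Rightarrow> bool" where
  "independent_of_mu2 M T f \<longleftrightarrow>
     (\<forall>\<omega>\<in>space M. \<forall>t\<in>{0..T}. \<forall>y z. \<forall>\<mu>1\<in>P2. \<forall>\<mu>2\<in>P2. \<forall>\<mu>2'\<in>P2.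
        f \<omega> t y z \<mu>1 \<mu>2 = f \<omega> t y z \<mu>1 \<mu>2')"

definition nondecreasing_mu1 ::
    "'w measure \<Rightarrow> (real \<Rightarrow> 'w measure) \<Rightarrow> real \<Rightarrow> ('w, 'd::finite) generator \<Rightarrow> bool" where
  "nondecreasing_mu1 M F T h \<longleftrightarrow>
     (\<exists>K>0. \<forall>\<omega>\<in>space M. \<forall>t\<in>{0..T}. \<forall>y z.
        \<forall>\<xi>\<in>L2_space M (F t). \<forall>\<xi>'\<in>L2_space M (F t). \<forall>\<zeta>\<in>L2_space M (F t).
          h \<omega> t y z (law M \<xi>) (law M \<zeta>) - h \<omega> t y z (law M \<xi>') (law M \<zeta>)
            \<le> K * L2_norm M (\<lambda>\<omega>'. max (\<xi> \<omega>' - \<xi>' \<omega>') 0))"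

end

theory Submission
  imports Defs
begin

text \<open>
  Let $D = Y - \bar Y$ and $m = \bar Y + \int_0^\cdot (\theta_r + c)\,dr$. The drift of $-D$ is at
  most $K|D| + L(1+|Z|+|\bar Z|)|Z-\bar Z| + K\|D^+\|_{L^2}$ and that of $-m$ at most
  $\frac\gamma2|\bar Z|^2$; independence of one generator of $\mu_2$ is what allows both generators to be
  evaluated at the same $\mu_2$. No change of measure is used. Instead one looks for
  $\Phi(D,m) = \alpha(D)\,e^{v(m)}$, with $\alpha$ a $p$-th power of $D^+/(1+D^+)$, whose second order
  terms absorb the quadratic drift. For the quadratic form in $(Z-\bar Z,\bar Z)$ to be nonnegative one
  needs, for large $p$, approximately $(v'+2L)^2 \le v'' + v'^2 - \gamma v'$: the squares of $v'$ cancel,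
  and a logistic $v$ with a large factor and its inflection point to the right of the (bounded) range of
  $m$ satisfies the remaining linear inequality. Then
  $E\,\Phi_t \le C \int_t^T E\,\Phi_r\,dr$, where the mean-field term enters through
  $(E (D^+)^2)^{p/2} \le E (D^+)^p$, and Gronwall's lemma gives $D_t^+ = 0$.

  Only an inequality in expectation is needed from Ito's formula. It is obtained by summing third order
  Taylor expansions over a uniform grid, using nothing about stochastic integrals but the isometry.
\<close>

section \<open>Brownian increments and the augmented filtration\<close>

text \<open>The coefficient of Z - Zb in the drift grows like |Z| + |Zb|, which is unbounded. A
  function of D alone supplies second order terms in |Z - Zb|^2 only, and these cannot dominate the
  cross term 2 L |Zb| |Z - Zb| where |Zb| is large. The variable m is there to supply |Zb|^2, with
  coefficient v'' + v'^2 - \<gamma> v', at the price of a second cross term of size v' |Zb| |Z -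
  Zb|. For \<alpha> a p-th power, the product of the diagonal coefficients carries p (p - 1) and the
  square of the cross coefficient carries p^2, so v'^2 cancels only as p grows; the strict gap in 4
  L v' + 4 L^2 < v'' - \<gamma> v' pays for finite p and for lower order losses. An exponential v
  would satisfy this inequality as well, and D^+ could replace its saturation; but stochastic
  increments are unbounded, so the Taylor remainders must be uniform on the whole line. This is why
  both factors are built from bounded functions, with bounded derivatives.\<close>

lemma lborel_prod_Basis:
  fixes f :: "'a::euclidean_space \<Rightarrow> real \<Rightarrow> real"
  assumes int: "\<And>b. b \<in> Basis \<Longrightarrow> integrable lborel (f b)"
  shows "integrable lborel (\<lambda>x. \<Prod>b\<in>Basis. f b (x \<bullet> b))"
    and "(\<integral>x. (\<Prod>b\<in>Basis. f b (x \<bullet> b)) \<partial>lborel) = (\<Prod>b\<in>Basis. \<integral>x. f b x \<partial>lborel)"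
proof -
  interpret product_sigma_finite "\<lambda>_::'a. lborel :: real measure"
    by standard
  have [measurable]: "b \<in> Basis \<Longrightarrow> f b \<in> borel_measurable borel" for b
    using int borel_measurable_integrable by force
  have eq: "(\<Prod>b\<in>Basis. f b ((\<Sum>c\<in>Basis. x c *\<^sub>R c) \<bullet> b)) = (\<Prod>b\<in>Basis. f b (x b))" for x :: "'a \<Rightarrow> real"
    by (intro prod.cong refl) simp
  have [measurable]: "(\<lambda>x. \<Prod>b\<in>Basis. f b (x \<bullet> b)) \<in> borel_measurable borel"
    by measurable
  show "integrable lborel (\<lambda>x. \<Prod>b\<in>Basis. f b (x \<bullet> b))"
    by (subst lborel_eq, subst integrable_distr_eq)
       (simp_all add: eq product_integrable_prod int del: inner_sum_left_Basis)
  show "(\<integral>x. (\<Prod>b\<in>Basis. f b (x \<bullet> b)) \<partial>lborel) = (\<Prod>b\<in>Basis. \<integral>x. f b x \<partial>lborel)"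
    by (subst lborel_eq, subst integral_distr) (simp_all add: eq product_integral_prod int)
qed

text \<open>Carries the product formula from the index set \<open>Basis\<close> to coordinates
  through the bijection \<open>axis\<close>, since the density of a Brownian increment is a product
  over coordinates.\<close>

lemma lborel_prod_vec:
  fixes f :: "'d::finite \<Rightarrow> real \<Rightarrow> real"
  assumes int: "\<And>i. integrable lborel (f i)"
  shows "integrable lborel (\<lambda>x :: real ^ 'd. \<Prod>i\<in>UNIV. f i (x $ i))"
    and "(\<integral>x. (\<Prod>i\<in>UNIV. f i (x $ i)) \<partial>(lborel :: (real ^ 'd) measure)) = (\<Prod>i\<in>UNIV. \<integral>x. f i x \<partial>lborel)"
proof -
  define e :: "'d \<Rightarrow> real ^ 'd" where "e = (\<lambda>i. axis i 1)"
  have inj: "inj e"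
    by (auto simp: e_def inj_on_def axis_eq_axis)
  have B: "(Basis :: (real ^ 'd) set) = range e"
    by (auto simp: e_def Basis_vec_def)
  have reindex: "(\<Prod>b\<in>Basis. h (inv e b) b) = (\<Prod>i\<in>UNIV. h i (e i))" for h :: "'d \<Rightarrow> real ^ 'd \<Rightarrow> real"
    unfolding B by (subst prod.reindex[OF inj]) (simp add: inv_f_f[OF inj])
  note * = lborel_prod_Basis[where f = "\<lambda>b. f (inv e b)" and 'a = "real ^ 'd", OF int]
  from *(1) show "integrable lborel (\<lambda>x :: real ^ 'd. \<Prod>i\<in>UNIV. f i (x $ i))"
    by (simp add: reindex[where h = "\<lambda>i b. f i (_ \<bullet> b)"]) (simp add: e_def inner_axis)
  from *(2) show "(\<integral>x. (\<Prod>i\<in>UNIV. f i (x $ i)) \<partial>(lborel :: (real ^ 'd) measure)) = (\<Prod>i\<in>UNIV. \<integral>x. f i x \<partial>lborel)"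
    by (simp add: reindex[where h = "\<lambda>i b. f i (_ \<bullet> b)"] reindex[where h = "\<lambda>i b. integral\<^sup>L lborel (f i)"])
       (simp add: e_def inner_axis)
qed

text \<open>The product density absorbs a product of coordinate functions factor by factor, so the
  moments of the vector reduce to those of the one-dimensional normal law.\<close>

lemma gaussian_vec_prod:
  fixes X :: "'w \<Rightarrow> real ^ 'd" and f :: "'d::finite \<Rightarrow> real \<Rightarrow> real"
  assumes X: "distributed M lborel X (\<lambda>x. ennreal (\<Prod>i\<in>UNIV. normal_density 0 \<sigma> (x $ i)))"
    and int: "\<And>i. integrable lborel (\<lambda>x. normal_density 0 \<sigma> x * f i x)"
    and [measurable]: "\<And>i. f i \<in> borel_measurable borel"
  shows "integrable M (\<lambda>\<omega>. \<Prod>i\<in>UNIV. f i (X \<omega> $ i))"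
    and "(\<integral>\<omega>. (\<Prod>i\<in>UNIV. f i (X \<omega> $ i)) \<partial>M) = (\<Prod>i\<in>UNIV. \<integral>x. normal_density 0 \<sigma> x * f i x \<partial>lborel)"
proof -
  have m: "(\<lambda>x :: real ^ 'd. \<Prod>i\<in>UNIV. f i (x $ i)) \<in> borel_measurable lborel"
    by measurable
  note * = lborel_prod_vec[where f = "\<lambda>i x. normal_density 0 \<sigma> x * f i x", OF int]
  show "integrable M (\<lambda>\<omega>. \<Prod>i\<in>UNIV. f i (X \<omega> $ i))"
    using *(1) distributed_integrable[OF X m]
    by (simp add: prod.distrib prod_nonneg normal_density_nonneg)
  show "(\<integral>\<omega>. (\<Prod>i\<in>UNIV. f i (X \<omega> $ i)) \<partial>M) = (\<Prod>i\<in>UNIV. \<integral>x. normal_density 0 \<sigma> x * f i x \<partial>lborel)"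
    using *(2) distributed_integral[OF X m]
    by (simp add: prod.distrib prod_nonneg normal_density_nonneg)
qed

text \<open>First and second moments yield the isometry; the fourth moment serves to bound the third
  absolute moment of an increment.\<close>

lemma gaussian_vec_moment:
  fixes X :: "'w \<Rightarrow> real ^ 'd::finite"
  assumes X: "distributed M lborel X (\<lambda>x. ennreal (\<Prod>i\<in>UNIV. normal_density 0 \<sigma> (x $ i)))"
    and \<sigma>: "0 < \<sigma>"
  shows "integrable M (\<lambda>\<omega>. X \<omega> $ a)" "(\<integral>\<omega>. X \<omega> $ a \<partial>M) = 0"
    and "integrable M (\<lambda>\<omega>. X \<omega> $ a * X \<omega> $ b)" "(\<integral>\<omega>. X \<omega> $ a * X \<omega> $ b \<partial>M) = (if a = b then \<sigma>\<^sup>2 else 0)"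
    and "integrable M (\<lambda>\<omega>. (X \<omega> $ a) ^ 4)" "(\<integral>\<omega>. (X \<omega> $ a) ^ 4 \<partial>M) = 3 * \<sigma> ^ 4"
proof -
  note nm = integrable_normal_moment[OF \<sigma>, of 0]
  have int: "integrable lborel (\<lambda>x. normal_density 0 \<sigma> x * x ^ k)" for k
    using nm[of k] by simp
  have v0: "(\<integral>x. normal_density 0 \<sigma> x \<partial>lborel) = 1" using \<sigma> by simp
  have v1: "(\<integral>x. normal_density 0 \<sigma> x * x \<partial>lborel) = 0"
    using integral_normal_moment_nz_1[OF \<sigma>, of 0] by simp
  have v2: "(\<integral>x. normal_density 0 \<sigma> x * x\<^sup>2 \<partial>lborel) = \<sigma>\<^sup>2"
    using integral_normal_moment_even[OF \<sigma>, of 0 1] by (simp add: field_simps fact_numeral power2_eq_square)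
  have v4: "(\<integral>x. normal_density 0 \<sigma> x * x ^ 4 \<partial>lborel) = 3 * \<sigma> ^ 4"
    using integral_normal_moment_even[OF \<sigma>, of 0 2] \<sigma> by (simp add: field_simps fact_numeral power2_eq_square power4_eq_xxxx)
  have one: "(\<Prod>i\<in>UNIV. if i = a then y i else 1) = y a" for y :: "'d \<Rightarrow> real" and a
    by simp
  have single: "integrable M (\<lambda>\<omega>. (X \<omega> $ a) ^ k)" 
     "(\<integral>\<omega>. (X \<omega> $ a) ^ k \<partial>M) = (\<integral>x. normal_density 0 \<sigma> x * x ^ k \<partial>lborel)" for k a
  proof -
    define f where "f = (\<lambda>i x. if i = a then x ^ k else (1::real))"
    have i: "integrable lborel (\<lambda>x. normal_density 0 \<sigma> x * f i x)" for i
      using int[of k] integrable_normal_density[OF \<sigma>] by (cases "i = a") (simp_all add: f_def)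
    have m: "f i \<in> borel_measurable borel" for i
      unfolding f_def by simp
    have e: "(\<Prod>i\<in>UNIV. f i (x $ i)) = (x $ a) ^ k" for x :: "real ^ 'd"
      unfolding f_def by simp
    have "(\<Prod>i\<in>UNIV. \<integral>x. normal_density 0 \<sigma> x * f i x \<partial>lborel) =
       (\<Prod>i\<in>UNIV. if i = a then \<integral>x. normal_density 0 \<sigma> x * x ^ k \<partial>lborel else 1)"
      using v0 by (intro prod.cong refl) (auto simp: f_def)
    with gaussian_vec_prod[where f = f, OF X i m] show "integrable M (\<lambda>\<omega>. (X \<omega> $ a) ^ k)" 
     "(\<integral>\<omega>. (X \<omega> $ a) ^ k \<partial>M) = (\<integral>x. normal_density 0 \<sigma> x * x ^ k \<partial>lborel)"
      by (simp_all add: e)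
  qed
  show "integrable M (\<lambda>\<omega>. X \<omega> $ a)" "(\<integral>\<omega>. X \<omega> $ a \<partial>M) = 0"
    using single[of a 1] v1 by simp_all
  show "integrable M (\<lambda>\<omega>. (X \<omega> $ a) ^ 4)" "(\<integral>\<omega>. (X \<omega> $ a) ^ 4 \<partial>M) = 3 * \<sigma> ^ 4"
    using single[of a 4] v4 by simp_all
  show "integrable M (\<lambda>\<omega>. X \<omega> $ a * X \<omega> $ b)" "(\<integral>\<omega>. X \<omega> $ a * X \<omega> $ b \<partial>M) = (if a = b then \<sigma>\<^sup>2 else 0)"
  proof -
    show "integrable M (\<lambda>\<omega>. X \<omega> $ a * X \<omega> $ b)"
    proof (rule Bochner_Integration.integrable_bound)
      show "integrable M (\<lambda>\<omega>. (X \<omega> $ a) ^ 2 + (X \<omega> $ b) ^ 2)"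
        using single(1) by simp
      show "AE \<omega> in M. norm (X \<omega> $ a * X \<omega> $ b) \<le> norm ((X \<omega> $ a) ^ 2 + (X \<omega> $ b) ^ 2)"
      proof (intro AE_I2)
        fix \<omega>
        have "\<bar>x * y\<bar> \<le> x\<^sup>2 + y\<^sup>2" for x y :: real
        proof -
          have "2 * (\<bar>x\<bar> * \<bar>y\<bar>) \<le> x\<^sup>2 + y\<^sup>2"
            using sum_squares_bound[of "\<bar>x\<bar>" "\<bar>y\<bar>"] by (simp add: mult.assoc)
          moreover have "0 \<le> \<bar>x\<bar> * \<bar>y\<bar>" by simp
          ultimately show ?thesis unfolding abs_mult by linarith
        qed
        then show "norm (X \<omega> $ a * X \<omega> $ b) \<le> norm ((X \<omega> $ a) ^ 2 + (X \<omega> $ b) ^ 2)"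
          by simp
      qed
      show "(\<lambda>\<omega>. X \<omega> $ a * X \<omega> $ b) \<in> borel_measurable M"
        using single(1)[of _ 1] by (intro borel_measurable_times) auto
    qed
    show "(\<integral>\<omega>. X \<omega> $ a * X \<omega> $ b \<partial>M) = (if a = b then \<sigma>\<^sup>2 else 0)"
    proof (cases "a = b")
      case True
      then show ?thesis using single(2)[of a 2] v2 by (simp add: power2_eq_square)
    next
      case False
      \<comment> \<open>The coordinates a and b are distinct here, and each of the two factors is
        centred, so the product of the coordinate integrals contains a zero.\<close>
      define f where "f = (\<lambda>i x. if i = a \<or> i = b then x else (1::real))"
      have i: "integrable lborel (\<lambda>x. normal_density 0 \<sigma> x * f i x)" for i
        using int[of 1] integrable_normal_density[OF \<sigma>] by (cases "i = a \<or> i = b") (simp_all add: f_def)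
      have m: "f i \<in> borel_measurable borel" for i
        unfolding f_def by simp
      have e: "(\<Prod>i\<in>UNIV. f i (x $ i)) = x $ a * x $ b" for x :: "real ^ 'd"
      proof -
        have "(\<Prod>i\<in>UNIV. f i (x $ i)) = (\<Prod>i\<in>UNIV. (if i = a then x $ i else 1) * (if i = b then x $ i else 1))"
          using False by (intro prod.cong refl) (auto simp: f_def)
        then show ?thesis by (simp add: prod.distrib)
      qed
      have "(\<Prod>i\<in>UNIV. \<integral>x. normal_density 0 \<sigma> x * f i x \<partial>lborel) = 0"
        using v1 by (intro prod_zero) (auto simp: f_def intro!: exI[of _ a])
      with gaussian_vec_prod(2)[where f = f, OF X i m] False show ?thesis
        by (simp add: e)
    qed
  qed
qed

text \<open>Probabilities do not see null sets, and the events that agree almost everywhere with an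
  event of the smaller sigma-algebra themselves form a sigma-algebra that contains the null sets.
  The induction over \<open>sigma_sets\<close> is this closure argument.\<close>

lemma (in prob_space) indep_set_augment:
  assumes indep: "indep_set (sigma_sets (space M) H) B"
  shows "indep_set (sigma_sets (space M) (H \<union> null_sets M)) B"
proof -
  define S where "S = sigma_sets (space M) H"
  have S: "S \<subseteq> events" and B: "B \<subseteq> events"
    and prod: "\<And>a b. a \<in> S \<Longrightarrow> b \<in> B \<Longrightarrow> prob (a \<inter> b) = prob a * prob b"
    using indep by (auto simp: indep_sets2_eq S_def)
  have approx: "a \<in> events \<and> (\<exists>c\<in>S. AE x in M. x \<in> a \<longleftrightarrow> x \<in> c)"
    if "a \<in> sigma_sets (space M) (H \<union> null_sets M)" for a
    using that
  proof induction
    case (Basic a)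
    show ?case
    proof (cases "a \<in> H")
      case True
      then show ?thesis using S by (auto simp: S_def intro!: bexI[of _ a])
    next
      case False
      with Basic have "a \<in> null_sets M" by simp
      then show ?thesis
        using AE_not_in[of a M] by (auto simp: S_def intro!: bexI[of _ "{}"] sigma_sets.Empty)
    qed
  next
    case Empty
    then show ?case by (auto simp: S_def intro!: bexI[of _ "{}"] sigma_sets.Empty)
  next
    case (Compl a)
    then obtain c where c: "c \<in> S" "AE x in M. x \<in> a \<longleftrightarrow> x \<in> c" by auto
    have "space M - c \<in> S" using c by (auto simp: S_def intro: sigma_sets.Compl)
    moreover have "AE x in M. x \<in> space M - a \<longleftrightarrow> x \<in> space M - c" using c(2) by auto
    ultimately show ?case using Compl by blast
  next
    case (Union a)
    then have "\<forall>i::nat. \<exists>c. c \<in> S \<and> (AE x in M. x \<in> a i \<longleftrightarrow> x \<in> c)" by blast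
    then obtain c where c: "\<And>i. c i \<in> S" "\<And>i. AE x in M. x \<in> a i \<longleftrightarrow> x \<in> c i" by metis
    have "(\<Union>i. c i) \<in> S" using c(1) by (auto simp: S_def intro: sigma_sets.Union)
    moreover have "AE x in M. \<forall>i. x \<in> a i \<longleftrightarrow> x \<in> c i" using c(2) by (simp add: AE_all_countable)
    then have "AE x in M. x \<in> (\<Union>i. a i) \<longleftrightarrow> x \<in> (\<Union>i. c i)" by auto
    ultimately show ?case using Union by blast
  qed
  show ?thesis
    unfolding indep_sets2_eq
  proof (intro conjI ballI)
    show "sigma_sets (space M) (H \<union> null_sets M) \<subseteq> events" using approx by blast
    show "B \<subseteq> events" by fact
    fix a b assume a: "a \<in> sigma_sets (space M) (H \<union> null_sets M)" and b: "b \<in> B"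
    obtain c where c: "c \<in> S" "AE x in M. x \<in> a \<longleftrightarrow> x \<in> c" and a': "a \<in> events"
      using approx[OF a] by auto
    have "prob (a \<inter> b) = prob (c \<inter> b)" "prob a = prob c"
      using c a' b B S by (auto intro!: measure_eq_AE)
    then show "prob (a \<inter> b) = prob a * prob b" using prod[OF c(1) b] by simp
  qed
qed

section \<open>Adaptedness and independence of Brownian increments\<close>

context brownian_basis
begin

abbreviation F :: "real \<Rightarrow> 'w measure" where "F \<equiv> brownian_filtration M W"

lemma W_measurable: "0 \<le> t \<Longrightarrow> W t \<in> borel_measurable M"
  using brownian_motion by (auto simp: brownian_motion_def)

lemma generator_F: "history M W t \<union> null_sets M \<subseteq> Pow (space M)"
  using sets.sets_into_space by (fastforce simp: history_def)

lemma space_F[simp]: "space (F t) = space M"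
  using generator_F by (simp add: brownian_filtration_def)

lemma sets_F: "sets (F t) = sigma_sets (space M) (history M W t \<union> null_sets M)"
  using generator_F by (simp add: brownian_filtration_def)

lemma subalgebra_F: "subalgebra M (F t)"
  unfolding subalgebra_def sets_F
  by (auto simp: history_def intro!: sets.sigma_sets_subset measurable_sets[OF W_measurable])

lemma subalgebra_F_mono: "s \<le> t \<Longrightarrow> subalgebra (F t) (F s)"
  using filtration.sets_F_mono[OF filtration_brownian_filtration[of M W]]
  by (auto simp: subalgebra_def)

lemma measurable_F_M: "X \<in> measurable (F t) N \<Longrightarrow> X \<in> measurable M N"
  using measurable_from_subalg[OF subalgebra_F] by blast

lemma measurable_F_mono: "X \<in> measurable (F s) N \<Longrightarrow> s \<le> t \<Longrightarrow> X \<in> measurable (F t) N"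
  using measurable_from_subalg[OF subalgebra_F_mono] by blast

lemma W_adapted: "0 \<le> s \<Longrightarrow> s \<le> t \<Longrightarrow> W s \<in> borel_measurable (F t)"
  by (rule measurableI) (auto simp: sets_F history_def)

lemma null_sets_F: "N \<in> null_sets M \<Longrightarrow> N \<in> sets (F t)"
  by (auto simp: sets_F)

lemma W_increment:
  assumes "0 \<le> s" "s < t"
  shows "distributed M lborel (\<lambda>\<omega>. W t \<omega> - W s \<omega>) (\<lambda>x. ennreal (\<Prod>i\<in>UNIV. normal_density 0 (sqrt (t - s)) (x $ i)))"
    and "indep_set (sets (F s)) {(\<lambda>\<omega>. W t \<omega> - W s \<omega>) -` A \<inter> space M | A. A \<in> sets borel}"
  using brownian_motion assms
  by (auto simp: brownian_motion_def sets_F intro: indep_set_augment)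

text \<open>Independence is available for two systems of events that are closed under intersection.
  It therefore passes to the sigma-algebras they generate, which contain those of X and of h applied
  to the increment.\<close>

lemma increment_indep_var:
  fixes h :: "real ^ 'd \<Rightarrow> 'c::topological_space"
  assumes st: "0 \<le> s" "s < t" and X: "X \<in> borel_measurable (F s)" and h: "h \<in> borel_measurable borel"
  shows "indep_var borel X borel (\<lambda>\<omega>. h (W t \<omega> - W s \<omega>))"
  unfolding indep_var_eq
proof (intro conjI)
  show "random_variable borel X" using X by (rule measurable_F_M)
  have "random_variable borel (\<lambda>\<omega>. W t \<omega> - W s \<omega>)"
    using st by (intro borel_measurable_diff W_measurable) auto
  with h show "random_variable borel (\<lambda>\<omega>. h (W t \<omega> - W s \<omega>))"
    by (rule measurable_compose[rotated])
  let ?D = "{(\<lambda>\<omega>. W t \<omega> - W s \<omega>) -` A \<inter> space M | A. A \<in> sets borel}"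
  have "indep_set (sigma_sets (space M) (sets (F s))) (sigma_sets (space M) ?D)"
  proof (rule indep_set_sigma_sets[OF W_increment(2)[OF st]])
    show "Int_stable (sets (F s))" by (auto simp: Int_stable_def)
    show "Int_stable ?D"
    proof (rule Int_stableI, clarsimp)
      fix A B :: "(real ^ 'd) set" assume "A \<in> sets borel" "B \<in> sets borel"
      then show "\<exists>C. (\<lambda>\<omega>. W t \<omega> - W s \<omega>) -` A \<inter> space M \<inter> ((\<lambda>\<omega>. W t \<omega> - W s \<omega>) -` B \<inter> space M) =
         (\<lambda>\<omega>. W t \<omega> - W s \<omega>) -` C \<inter> space M \<and> C \<in> sets borel"
        by (intro exI[of _ "A \<inter> B"]) auto
    qed
  qed
  moreover have "sigma_sets (space M) {X -` A \<inter> space M |A. A \<in> sets borel} \<subseteq> sigma_sets (space M) (sets (F s))"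
    using measurable_sets[OF X] by (intro sigma_sets_mono') auto
  moreover have "sigma_sets (space M) {(\<lambda>\<omega>. h (W t \<omega> - W s \<omega>)) -` A \<inter> space M |A. A \<in> sets borel} \<subseteq> sigma_sets (space M) ?D"
  proof (rule sigma_sets_mono', safe)
    fix A :: "'c set" assume "A \<in> sets borel"
    then have "h -` A \<in> sets borel"
      using measurable_sets[OF h, of A] by simp
    then show "\<exists>B. (\<lambda>\<omega>. h (W t \<omega> - W s \<omega>)) -` A \<inter> space M = (\<lambda>\<omega>. W t \<omega> - W s \<omega>) -` B \<inter> space M \<and> B \<in> sets borel"
      by (intro exI[of _ "h -` A"]) auto
  qed
  ultimately show "indep_set (sigma_sets (space M) {X -` A \<inter> space M |A. A \<in> sets borel})
     (sigma_sets (space M) {(\<lambda>\<omega>. h (W t \<omega> - W s \<omega>)) -` A \<inter> space M | A. A \<in> sets borel})"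
    unfolding indep_sets2_eq by (meson subset_iff)
qed

lemma increment_indep_integral:
  fixes \<kappa> :: "'w \<Rightarrow> real" and h :: "real ^ 'd \<Rightarrow> real"
  assumes st: "0 \<le> s" "s < t" and \<kappa>: "\<kappa> \<in> borel_measurable (F s)" "integrable M \<kappa>"
    and h: "h \<in> borel_measurable borel" "integrable M (\<lambda>\<omega>. h (W t \<omega> - W s \<omega>))"
  shows "integrable M (\<lambda>\<omega>. \<kappa> \<omega> * h (W t \<omega> - W s \<omega>))"
    and "(\<integral>\<omega>. \<kappa> \<omega> * h (W t \<omega> - W s \<omega>) \<partial>M) = (\<integral>\<omega>. \<kappa> \<omega> \<partial>M) * (\<integral>\<omega>. h (W t \<omega> - W s \<omega>) \<partial>M)"
proof -
  have iv: "indep_var borel \<kappa> borel (\<lambda>\<omega>. h (W t \<omega> - W s \<omega>))"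
    by (rule increment_indep_var[OF st \<kappa>(1) h(1)])
  show "integrable M (\<lambda>\<omega>. \<kappa> \<omega> * h (W t \<omega> - W s \<omega>))"
    by (rule indep_var_integrable[OF iv \<kappa>(2) h(2)])
  show "(\<integral>\<omega>. \<kappa> \<omega> * h (W t \<omega> - W s \<omega>) \<partial>M) = (\<integral>\<omega>. \<kappa> \<omega> \<partial>M) * (\<integral>\<omega>. h (W t \<omega> - W s \<omega>) \<partial>M)"
    by (rule indep_var_lebesgue_integral[OF iv \<kappa>(2) h(2)])
qed

end

section \<open>The isometry for limits of elementary integrands\<close>

definition sq_int :: "'x measure \<Rightarrow> ('x \<Rightarrow> 'b::euclidean_space) \<Rightarrow> bool" where
  "sq_int N f \<longleftrightarrow> f \<in> borel_measurable N \<and> integrable N (\<lambda>x. (norm (f x))\<^sup>2)"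

lemma norm_add_sq_le: "(norm (x + y))\<^sup>2 \<le> 2 * (norm x)\<^sup>2 + 2 * (norm (y::'b::real_normed_vector))\<^sup>2"
proof -
  have "(norm (x + y))\<^sup>2 \<le> (norm x + norm y)\<^sup>2"
    by (intro power_mono norm_triangle_ineq) auto
  also have "\<dots> \<le> 2 * (norm x)\<^sup>2 + 2 * (norm y)\<^sup>2"
    using sum_squares_bound[of "norm x" "norm y"] by (simp add: power2_sum)
  finally show ?thesis .
qed

lemma sq_int_measurable[measurable_dest]: "sq_int N f \<Longrightarrow> f \<in> borel_measurable N"
  by (simp add: sq_int_def)

lemma sq_int_scaleR:
  assumes "sq_int N f" shows "sq_int N (\<lambda>x. c *\<^sub>R f x)"
  using assms by (auto simp: sq_int_def power_mult_distrib)

lemma sq_int_add: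
  assumes f: "sq_int N f" and g: "sq_int N g" shows "sq_int N (\<lambda>x. f x + g x)"
  unfolding sq_int_def
proof
  note [measurable] = sq_int_measurable[OF f] sq_int_measurable[OF g]
  show "(\<lambda>x. f x + g x) \<in> borel_measurable N" by measurable
  show "integrable N (\<lambda>x. (norm (f x + g x))\<^sup>2)"
  proof (rule Bochner_Integration.integrable_bound)
    show "integrable N (\<lambda>x. 2 * (norm (f x))\<^sup>2 + 2 * (norm (g x))\<^sup>2)"
      using f g by (simp add: sq_int_def)
    show "AE x in N. norm ((norm (f x + g x))\<^sup>2) \<le> norm (2 * (norm (f x))\<^sup>2 + 2 * (norm (g x))\<^sup>2)"
      using norm_add_sq_le by (auto intro!: AE_I2)
  qed measurable
qed

lemma sq_int_diff:
  assumes f: "sq_int N f" and g: "sq_int N g" shows "sq_int N (\<lambda>x. f x - g x)"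
  using sq_int_add[OF f sq_int_scaleR[OF g, of "-1"]] by simp

text \<open>Cauchy-Schwarz with a bounded weight. The weight \<xi> is carried along from here on
  because it later becomes a product of derivatives of the test function at the left end of a grid
  cell.\<close>

lemma sq_int_inner:
  assumes f: "sq_int N f" and g: "sq_int N g"
    and [measurable]: "\<xi> \<in> borel_measurable N" and \<xi>: "\<And>x. x \<in> space N \<Longrightarrow> \<bar>\<xi> x\<bar> \<le> C" and C: "0 \<le> C"
  shows "integrable N (\<lambda>x. \<xi> x * (f x \<bullet> g x))"
    and "\<bar>\<integral>x. \<xi> x * (f x \<bullet> g x) \<partial>N\<bar> \<le> C * (sqrt (\<integral>x. (norm (f x))\<^sup>2 \<partial>N) * sqrt (\<integral>x. (norm (g x))\<^sup>2 \<partial>N))"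
proof -
  note [measurable] = sq_int_measurable[OF f] sq_int_measurable[OF g]
  have pt: "\<bar>\<xi> x * (f x \<bullet> g x)\<bar> \<le> C * (norm (f x) * norm (g x))" if "x \<in> space N" for x
    unfolding abs_mult using \<xi>[OF that] C Cauchy_Schwarz_ineq2[of "f x" "g x"] by (intro mult_mono) auto
  have int: "integrable N (\<lambda>x. norm (f x) * norm (g x))"
  proof (rule Bochner_Integration.integrable_bound)
    show "integrable N (\<lambda>x. (norm (f x))\<^sup>2 + (norm (g x))\<^sup>2)"
      using f g by (simp add: sq_int_def)
    show "AE x in N. norm (norm (f x) * norm (g x)) \<le> norm ((norm (f x))\<^sup>2 + (norm (g x))\<^sup>2)"
    proof (intro AE_I2)
      fix x
      have "2 * (norm (f x) * norm (g x)) \<le> (norm (f x))\<^sup>2 + (norm (g x))\<^sup>2"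
        using sum_squares_bound[of "norm (f x)" "norm (g x)"] by (simp add: mult.assoc)
      moreover have "0 \<le> norm (f x) * norm (g x)" by simp
      ultimately have "norm (f x) * norm (g x) \<le> (norm (f x))\<^sup>2 + (norm (g x))\<^sup>2" by linarith
      then show "norm (norm (f x) * norm (g x)) \<le> norm ((norm (f x))\<^sup>2 + (norm (g x))\<^sup>2)"
        by (simp add: abs_mult)
    qed
  qed measurable
  show int': "integrable N (\<lambda>x. \<xi> x * (f x \<bullet> g x))"
    by (rule Bochner_Integration.integrable_bound[OF integrable_mult_right[OF int, of C]])
       (use pt C in \<open>auto intro!: AE_I2 simp: abs_mult\<close>)
  have fg: "integrable N (\<lambda>x. (norm (f x))\<^sup>2)" "integrable N (\<lambda>x. (norm (g x))\<^sup>2)"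
    using f g by (auto simp: sq_int_def)
  have "(\<integral>\<^sup>+x. ennreal (norm (f x)) * ennreal (norm (g x)) \<partial>N)\<^sup>2
      \<le> (\<integral>\<^sup>+x. (ennreal (norm (f x)))\<^sup>2 \<partial>N) * (\<integral>\<^sup>+x. (ennreal (norm (g x)))\<^sup>2 \<partial>N)"
    by (rule Cauchy_Schwarz_nn_integral) measurable
  also have "\<dots> = ennreal ((\<integral>x. (norm (f x))\<^sup>2 \<partial>N) * (\<integral>x. (norm (g x))\<^sup>2 \<partial>N))"
    using fg by (simp add: ennreal_power nn_integral_eq_integral ennreal_mult')
  also have "(\<integral>\<^sup>+x. ennreal (norm (f x)) * ennreal (norm (g x)) \<partial>N) = ennreal (\<integral>x. norm (f x) * norm (g x) \<partial>N)"
    using int by (simp add: ennreal_mult'[symmetric] nn_integral_eq_integral)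
  finally have "(\<integral>x. norm (f x) * norm (g x) \<partial>N)\<^sup>2 \<le> (\<integral>x. (norm (f x))\<^sup>2 \<partial>N) * (\<integral>x. (norm (g x))\<^sup>2 \<partial>N)"
    by (simp add: ennreal_power)
  then have cs: "(\<integral>x. norm (f x) * norm (g x) \<partial>N) \<le> sqrt (\<integral>x. (norm (f x))\<^sup>2 \<partial>N) * sqrt (\<integral>x. (norm (g x))\<^sup>2 \<partial>N)"
    by (metis real_le_rsqrt real_sqrt_mult)
  have "\<bar>\<integral>x. \<xi> x * (f x \<bullet> g x) \<partial>N\<bar> \<le> (\<integral>x. \<bar>\<xi> x * (f x \<bullet> g x)\<bar> \<partial>N)"
    by (rule integral_abs_bound)
  also have "\<dots> \<le> (\<integral>x. C * (norm (f x) * norm (g x)) \<partial>N)"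
    using int int' pt by (intro integral_mono) auto
  also have "\<dots> \<le> C * (sqrt (\<integral>x. (norm (f x))\<^sup>2 \<partial>N) * sqrt (\<integral>x. (norm (g x))\<^sup>2 \<partial>N))"
    using cs C by (simp add: mult_left_mono)
  finally show "\<bar>\<integral>x. \<xi> x * (f x \<bullet> g x) \<partial>N\<bar> \<le> C * (sqrt (\<integral>x. (norm (f x))\<^sup>2 \<partial>N) * sqrt (\<integral>x. (norm (g x))\<^sup>2 \<partial>N))" .
qed

text \<open>The distance is written as a nonnegative integral, the form in which the definition of
  the Ito integral supplies it; that the limit is square integrable is then a consequence.\<close>

definition tendsto_L2 :: "'x measure \<Rightarrow> (nat \<Rightarrow> 'x \<Rightarrow> 'b::euclidean_space) \<Rightarrow> ('x \<Rightarrow> 'b) \<Rightarrow> bool" where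
  "tendsto_L2 N fs f \<longleftrightarrow> (\<forall>k. sq_int N (fs k)) \<and> f \<in> borel_measurable N \<and>
     (\<lambda>k. \<integral>\<^sup>+x. ennreal ((norm (fs k x - f x))\<^sup>2) \<partial>N) \<longlonglongrightarrow> 0"

lemma tendsto_L2_sq_int:
  assumes "tendsto_L2 N fs f" shows "sq_int N f"
proof -
  from assms have fs: "\<And>k. sq_int N (fs k)" and [measurable]: "f \<in> borel_measurable N"
    and lim: "(\<lambda>k. \<integral>\<^sup>+x. ennreal ((norm (fs k x - f x))\<^sup>2) \<partial>N) \<longlonglongrightarrow> 0"
    by (auto simp: tendsto_L2_def)
  note [measurable] = sq_int_measurable[OF fs]
  from order_tendstoD(2)[OF lim, of 1] obtain k where "(\<integral>\<^sup>+x. ennreal ((norm (fs k x - f x))\<^sup>2) \<partial>N) < 1"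
    by (auto simp: eventually_sequentially)
  then have "integrable N (\<lambda>x. (norm (fs k x - f x))\<^sup>2)"
    by (intro integrableI_bounded) (auto elim: order_less_trans)
  then have "sq_int N (\<lambda>x. fs k x - f x)"
    by (auto simp: sq_int_def)
  from sq_int_diff[OF fs[of k] this] show ?thesis by simp
qed

lemma tendsto_L2_real:
  assumes "tendsto_L2 N fs f"
  shows "(\<lambda>k. \<integral>x. (norm (fs k x - f x))\<^sup>2 \<partial>N) \<longlonglongrightarrow> 0"
proof -
  from assms have fs: "\<And>k. sq_int N (fs k)"
    and lim: "(\<lambda>k. \<integral>\<^sup>+x. ennreal ((norm (fs k x - f x))\<^sup>2) \<partial>N) \<longlonglongrightarrow> 0"
    by (auto simp: tendsto_L2_def)
  have "integrable N (\<lambda>x. (norm (fs k x - f x))\<^sup>2)" for k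
    using sq_int_diff[OF fs[of k] tendsto_L2_sq_int[OF assms]] by (simp add: sq_int_def)
  with lim have "(\<lambda>k. ennreal (\<integral>x. (norm (fs k x - f x))\<^sup>2 \<partial>N)) \<longlonglongrightarrow> ennreal 0"
    by (simp add: nn_integral_eq_integral)
  then show ?thesis
    by (subst (asm) tendsto_ennreal_iff) auto
qed

text \<open>Expanding both factors around their limits leaves three error integrals, each with a
  factor that tends to 0 in L2.\<close>

lemma tendsto_L2_inner:
  assumes f: "tendsto_L2 N fs f" and g: "tendsto_L2 N gs g"
    and \<xi>m: "\<xi> \<in> borel_measurable N" and \<xi>: "\<And>x. x \<in> space N \<Longrightarrow> \<bar>\<xi> x\<bar> \<le> C" and C: "0 \<le> C"
  shows "(\<lambda>k. \<integral>x. \<xi> x * (fs k x \<bullet> gs k x) \<partial>N) \<longlonglongrightarrow> (\<integral>x. \<xi> x * (f x \<bullet> g x) \<partial>N)"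
proof -
  have sf: "sq_int N f" and sg: "sq_int N g" using f g by (auto dest: tendsto_L2_sq_int)
  have sfs: "sq_int N (\<lambda>x. fs k x - f x)" and sgs: "sq_int N (\<lambda>x. gs k x - g x)" for k
    using f g sf sg by (auto simp: tendsto_L2_def intro: sq_int_diff)
  note bnd = sq_int_inner[OF _ _ \<xi>m \<xi> C]
  let ?d = "\<lambda>k. sqrt (\<integral>x. (norm (fs k x - f x))\<^sup>2 \<partial>N)" and ?e = "\<lambda>k. sqrt (\<integral>x. (norm (gs k x - g x))\<^sup>2 \<partial>N)"
  let ?f = "sqrt (\<integral>x. (norm (f x))\<^sup>2 \<partial>N)" and ?g = "sqrt (\<integral>x. (norm (g x))\<^sup>2 \<partial>N)"
  have d: "?d \<longlonglongrightarrow> 0" "?e \<longlonglongrightarrow> 0"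
    using tendsto_real_sqrt[OF tendsto_L2_real[OF f]] tendsto_real_sqrt[OF tendsto_L2_real[OF g]] by simp_all
  have "(\<lambda>k. C * (?d k * ?e k) + C * (?d k * ?g) + C * (?f * ?e k)) \<longlonglongrightarrow> C * (0 * 0) + C * (0 * ?g) + C * (?f * 0)"
    by (intro tendsto_intros d)
  then have lim: "(\<lambda>k. C * (?d k * ?e k) + C * (?d k * ?g) + C * (?f * ?e k)) \<longlonglongrightarrow> 0" by simp
  have le: "\<bar>(\<integral>x. \<xi> x * (fs k x \<bullet> gs k x) \<partial>N) - (\<integral>x. \<xi> x * (f x \<bullet> g x) \<partial>N)\<bar>
     \<le> C * (?d k * ?e k) + C * (?d k * ?g) + C * (?f * ?e k)" for k
  proof -
    have "(\<integral>x. \<xi> x * (fs k x \<bullet> gs k x) \<partial>N) = (\<integral>x. \<xi> x * ((fs k x - f x) \<bullet> (gs k x - g x)) +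
        \<xi> x * ((fs k x - f x) \<bullet> g x) + \<xi> x * (f x \<bullet> (gs k x - g x)) + \<xi> x * (f x \<bullet> g x) \<partial>N)"
      by (intro Bochner_Integration.integral_cong refl) (simp add: inner_simps algebra_simps)
    also have "\<dots> = (\<integral>x. \<xi> x * ((fs k x - f x) \<bullet> (gs k x - g x)) \<partial>N) + (\<integral>x. \<xi> x * ((fs k x - f x) \<bullet> g x) \<partial>N)
        + (\<integral>x. \<xi> x * (f x \<bullet> (gs k x - g x)) \<partial>N) + (\<integral>x. \<xi> x * (f x \<bullet> g x) \<partial>N)"
      using bnd(1)[OF sfs[of k] sgs[of k]] bnd(1)[OF sfs[of k] sg] bnd(1)[OF sf sgs[of k]] bnd(1)[OF sf sg] by simp
    finally show ?thesis
      using bnd(2)[OF sfs[of k] sgs[of k]] bnd(2)[OF sfs[of k] sg] bnd(2)[OF sf sgs[of k]] by linarith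
  qed
  have "(\<lambda>k. (\<integral>x. \<xi> x * (fs k x \<bullet> gs k x) \<partial>N) - (\<integral>x. \<xi> x * (f x \<bullet> g x) \<partial>N)) \<longlonglongrightarrow> 0"
    by (rule Lim_null_comparison[OF _ lim]) (use le in auto)
  then show ?thesis by (simp add: LIM_zero_iff)
qed

lemma (in pair_sigma_finite) has_bochner_integral_mult:
  fixes f g :: "_ \<Rightarrow> real"
  assumes f: "has_bochner_integral M1 f a" and g: "has_bochner_integral M2 g b"
  shows "has_bochner_integral (M1 \<Otimes>\<^sub>M M2) (\<lambda>p. f (fst p) * g (snd p)) (a * b)"
proof -
  have i: "integrable M1 f" "integrable M2 g" and ab: "a = integral\<^sup>L M1 f" "b = integral\<^sup>L M2 g"
    using f g by (auto simp: has_bochner_integral_iff)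
  have [measurable]: "f \<in> borel_measurable M1" "g \<in> borel_measurable M2" using i by auto
  have int: "integrable (M1 \<Otimes>\<^sub>M M2) (\<lambda>p. f (fst p) * g (snd p))"
    by (rule Fubini_integrable) (use i in \<open>auto simp: abs_mult\<close>)
  then show ?thesis
    using integral_fst'[OF int] by (simp add: has_bochner_integral_iff ab)
qed

section \<open>Products of increments with adapted weights\<close>

context brownian_basis
begin

lemma increment_moments:
  fixes \<kappa> :: "'w \<Rightarrow> real"
  assumes st: "0 \<le> s" "s \<le> t" and \<kappa>: "\<kappa> \<in> borel_measurable (F s)" "integrable M \<kappa>"
  shows "has_bochner_integral M (\<lambda>\<omega>. \<kappa> \<omega> * (W t \<omega> - W s \<omega>) $ a) 0"
    and "has_bochner_integral M (\<lambda>\<omega>. \<kappa> \<omega> * ((W t \<omega> - W s \<omega>) $ a * (W t \<omega> - W s \<omega>) $ b))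
           ((if a = b then t - s else 0) * (\<integral>\<omega>. \<kappa> \<omega> \<partial>M))"
proof -
  consider "s = t" | "s < t" using st by linarith
  then have "has_bochner_integral M (\<lambda>\<omega>. \<kappa> \<omega> * (W t \<omega> - W s \<omega>) $ a) 0 \<and>
    has_bochner_integral M (\<lambda>\<omega>. \<kappa> \<omega> * ((W t \<omega> - W s \<omega>) $ a * (W t \<omega> - W s \<omega>) $ b))
           ((if a = b then t - s else 0) * (\<integral>\<omega>. \<kappa> \<omega> \<partial>M))"
  proof cases
    case 1
    then show ?thesis by (simp add: has_bochner_integral_zero)
  next
    case 2
    then have pos: "0 < sqrt (t - s)" by simp
    note mom = gaussian_vec_moment[OF W_increment(1)[OF st(1) 2] pos]
    have m: "(\<lambda>x :: real ^ 'd. x $ a) \<in> borel_measurable borel" "(\<lambda>x :: real ^ 'd. x $ a * x $ b) \<in> borel_measurable borel"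
      by measurable
    show ?thesis
      using increment_indep_integral[OF st(1) 2 \<kappa> m(1) mom(1)] increment_indep_integral[OF st(1) 2 \<kappa> m(2) mom(3)]
        mom(2)[of a] mom(4)[of a b] 2
      by (simp add: has_bochner_integral_iff)
  qed
  then show "has_bochner_integral M (\<lambda>\<omega>. \<kappa> \<omega> * (W t \<omega> - W s \<omega>) $ a) 0"
    and "has_bochner_integral M (\<lambda>\<omega>. \<kappa> \<omega> * ((W t \<omega> - W s \<omega>) $ a * (W t \<omega> - W s \<omega>) $ b))
           ((if a = b then t - s else 0) * (\<integral>\<omega>. \<kappa> \<omega> \<partial>M))" by auto
qed

lemma increment_component_integrable:
  assumes "0 \<le> s" "s \<le> t" shows "integrable M (\<lambda>\<omega>. (W t \<omega> - W s \<omega>) $ a)"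
proof -
  have "has_bochner_integral M (\<lambda>\<omega>. 1 * (W t \<omega> - W s \<omega>) $ a) 0"
    by (rule increment_moments(1)[OF assms]) simp_all
  then show ?thesis unfolding mult_1 by (rule integrable.intros)
qed

lemma integrable_bounded_mult:
  fixes \<kappa> X :: "'w \<Rightarrow> real"
  assumes "\<kappa> \<in> borel_measurable M" "\<And>\<omega>. \<omega> \<in> space M \<Longrightarrow> \<bar>\<kappa> \<omega>\<bar> \<le> C" "integrable M X"
  shows "integrable M (\<lambda>\<omega>. \<kappa> \<omega> * X \<omega>)"
proof (rule Bochner_Integration.integrable_bound[OF integrable_mult_right[OF assms(3), of C]])
  show "(\<lambda>\<omega>. \<kappa> \<omega> * X \<omega>) \<in> borel_measurable M" using assms(1,3) by auto
  show "AE \<omega> in M. norm (\<kappa> \<omega> * X \<omega>) \<le> norm (C * X \<omega>)"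
  proof (intro AE_I2)
    fix \<omega> assume "\<omega> \<in> space M"
    with assms(2) have "\<bar>\<kappa> \<omega>\<bar> \<le> \<bar>C\<bar>" by force
    then show "norm (\<kappa> \<omega> * X \<omega>) \<le> norm (C * X \<omega>)" by (simp add: abs_mult mult_right_mono)
  qed
qed

text \<open>The length of the intersection makes one formula serve disjoint, nested and overlapping
  intervals, so elementary integrands never have to be refined to a common partition. Only s \<le> u
  is treated; the other order follows by exchanging the increments.\<close>

lemma increment_product_component:
  fixes \<kappa> :: "'w \<Rightarrow> real"
  assumes st: "0 \<le> s" "s \<le> t" and uv: "s \<le> u" "u \<le> v" 
    and \<kappa>: "\<kappa> \<in> borel_measurable (F u)" "\<And>\<omega>. \<omega> \<in> space M \<Longrightarrow> \<bar>\<kappa> \<omega>\<bar> \<le> C"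
  shows "has_bochner_integral M (\<lambda>\<omega>. \<kappa> \<omega> * ((W t \<omega> - W s \<omega>) $ a * (W v \<omega> - W u \<omega>) $ b))
           ((if a = b then measure lborel ({s<..t} \<inter> {u<..v}) else 0) * (\<integral>\<omega>. \<kappa> \<omega> \<partial>M))"
proof -
  have \<kappa>M: "\<kappa> \<in> borel_measurable M" by (rule measurable_F_M[OF \<kappa>(1)])
  have int\<kappa>: "integrable M (\<lambda>\<omega>. \<kappa> \<omega> * (W y \<omega> - W x \<omega>) $ c)" if "0 \<le> x" "x \<le> y" for x y c
    by (rule integrable_bounded_mult[OF \<kappa>M \<kappa>(2) increment_component_integrable[OF that]])
  have mF: "(\<lambda>\<omega>. \<kappa> \<omega> * (W y \<omega> - W x \<omega>) $ c) \<in> borel_measurable (F r)" if "0 \<le> x" "x \<le> y" "y \<le> r" "u \<le> r" for x y c r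
  proof -
    have "(\<lambda>x. x $ c) \<in> borel_measurable (borel :: (real ^ 'd) measure)" by measurable
    then show ?thesis using that
      by (intro borel_measurable_times measurable_F_mono[OF \<kappa>(1)] 
          measurable_compose[OF borel_measurable_diff[OF W_adapted W_adapted]]) auto
  qed
  show ?thesis
  proof (cases "t \<le> u")
    case True
    then have "{s<..t} \<inter> {u<..v} = {}" by auto
    with True st uv int\<kappa>[of s t a] mF[of s t u a]
      increment_moments(1)[of u v "\<lambda>\<omega>. \<kappa> \<omega> * (W t \<omega> - W s \<omega>) $ a" b] 
    show ?thesis by (auto simp add: mult.assoc)
  next
    case False
    \<comment> \<open>\<open>w\<close> is the end of the overlap. Cut at u and w, the product splits
      into the overlap term, which gives the covariance, three mixed terms in which an increment
      multiplies a factor known at its start, which vanish in mean, and the product of the pieces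
      beyond w, one of which is 0.\<close>
    define w where "w = min t v"
    have w: "u \<le> w" "w \<le> t" "w \<le> v" "w = t \<or> w = v" using False uv by (auto simp: w_def)
    have u: "0 \<le> u" using st uv by linarith
    have eq: "{s<..t} \<inter> {u<..v} = {u<..w}" using uv by (auto simp: w_def)
    have ms: "measure lborel ({s<..t} \<inter> {u<..v}) = w - u"
      unfolding eq using w by simp
    have i\<kappa>: "integrable M \<kappa>"
      by (rule integrable_const_bound[of _ C]) (use \<kappa>(2) \<kappa>M in auto)
    note hb = has_bochner_integral_add[OF has_bochner_integral_add[OF has_bochner_integral_add[OF 
       increment_moments(2)[OF u w(1) \<kappa>(1) i\<kappa>, of a b]
       increment_moments(1)[OF u uv(2) mF[OF st(1) uv(1) order_refl order_refl] int\<kappa>[OF st(1) uv(1)], of a b]]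
       increment_moments(1)[OF _ w(3) mF[OF u w(1) order_refl w(1)] int\<kappa>[OF u w(1)], of a b]]
       increment_moments(1)[OF _ w(2) mF[OF u w(1) order_refl w(1)] int\<kappa>[OF u w(1)], of b a]]
    have z: "(W t \<omega> - W w \<omega>) $ a * (W v \<omega> - W w \<omega>) $ b = 0" for \<omega>
      using w(4) by auto
    have alg: "k * ((ut - us) * (vt - vu)) =
       k * ((uw - uu) * (vw - vu)) + k * (uu - us) * (vt - vu) + k * (uw - uu) * (vt - vw) + k * (vw - vu) * (ut - uw)"
       if "(ut - uw) * (vt - vw) = 0" for k ut us vt vu uw uu vw :: real
    proof -
      have "k * ((ut - us) * (vt - vu)) = k * ((uw - uu) * (vw - vu)) + k * (uu - us) * (vt - vu) +
         k * (uw - uu) * (vt - vw) + k * (vw - vu) * (ut - uw) + k * ((ut - uw) * (vt - vw))"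
        by (simp add: algebra_simps)
      with that show ?thesis by simp
    qed
    show ?thesis
    proof (rule iffD1[OF has_bochner_integral_cong[OF refl] hb])
      fix \<omega>
      have 0: "(W t \<omega> $ a - W w \<omega> $ a) * (W v \<omega> $ b - W w \<omega> $ b) = 0"
        using z[of \<omega>] by (simp only: vector_minus_component)
      show "\<kappa> \<omega> * ((W w \<omega> - W u \<omega>) $ a * (W w \<omega> - W u \<omega>) $ b) +
         \<kappa> \<omega> * (W u \<omega> - W s \<omega>) $ a * (W v \<omega> - W u \<omega>) $ b +
         \<kappa> \<omega> * (W w \<omega> - W u \<omega>) $ a * (W v \<omega> - W w \<omega>) $ b +
         \<kappa> \<omega> * (W w \<omega> - W u \<omega>) $ b * (W t \<omega> - W w \<omega>) $ a =
         \<kappa> \<omega> * ((W t \<omega> - W s \<omega>) $ a * (W v \<omega> - W u \<omega>) $ b)"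
        unfolding vector_minus_component by (rule alg[OF 0, symmetric])
    qed (use ms u w in simp_all)
  qed
qed

text \<open>The coordinates of both integrands join the weight, which is measurable at the later of
  the two left ends; pairs of different coordinates contribute nothing.\<close>

lemma increment_product:
  assumes s: "0 \<le> c" "c \<le> s" "s \<le> t" and u: "c \<le> u" "u \<le> v"
    and \<xi>: "\<xi> \<in> borel_measurable (F c)" "\<And>\<omega>. \<omega> \<in> space M \<Longrightarrow> \<bar>\<xi> \<omega>\<bar> \<le> C"
    and \<alpha>: "\<alpha> \<in> borel_measurable (F s)" "\<And>\<omega>. \<omega> \<in> space M \<Longrightarrow> norm (\<alpha> \<omega>) \<le> A"
    and \<beta>: "\<beta> \<in> borel_measurable (F u)" "\<And>\<omega>. \<omega> \<in> space M \<Longrightarrow> norm (\<beta> \<omega>) \<le> B"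
  shows "has_bochner_integral M (\<lambda>\<omega>. \<xi> \<omega> * ((\<alpha> \<omega> \<bullet> (W t \<omega> - W s \<omega>)) * (\<beta> \<omega> \<bullet> (W v \<omega> - W u \<omega>))))
           (measure lborel ({s<..t} \<inter> {u<..v}) * (\<integral>\<omega>. \<xi> \<omega> * (\<alpha> \<omega> \<bullet> \<beta> \<omega>) \<partial>M))"
proof -
  define r where "r = max s u"
  have cm: "(\<lambda>x. x $ i) \<in> borel_measurable (borel :: (real ^ 'd) measure)" for i by measurable
  have m\<xi>: "\<xi> \<in> borel_measurable (F r)" and m\<alpha>: "\<alpha> \<in> borel_measurable (F r)" and m\<beta>: "\<beta> \<in> borel_measurable (F r)"
    using s u by (auto simp: r_def intro: measurable_F_mono[OF \<xi>(1)] measurable_F_mono[OF \<alpha>(1)] measurable_F_mono[OF \<beta>(1)])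
  have m: "(\<lambda>\<omega>. \<xi> \<omega> * (\<alpha> \<omega> $ i * \<beta> \<omega> $ j)) \<in> borel_measurable (F r)" for i j
    using m\<xi> measurable_compose[OF m\<alpha> cm] measurable_compose[OF m\<beta> cm] by (intro borel_measurable_times)
  have b: "\<bar>\<xi> \<omega> * (\<alpha> \<omega> $ i * \<beta> \<omega> $ j)\<bar> \<le> C * (A * B)" if "\<omega> \<in> space M" for i j \<omega>
  proof -
    have "\<bar>\<alpha> \<omega> $ i\<bar> \<le> A" "\<bar>\<beta> \<omega> $ j\<bar> \<le> B"
      using \<alpha>(2)[OF that] \<beta>(2)[OF that] component_le_norm_cart[of "\<alpha> \<omega>" i] component_le_norm_cart[of "\<beta> \<omega>" j] by linarith+
    then show ?thesis
      unfolding abs_mult using \<xi>(2)[OF that] by (intro mult_mono') auto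
  qed
  have i: "integrable M (\<lambda>\<omega>. \<xi> \<omega> * (\<alpha> \<omega> $ i * \<beta> \<omega> $ j))" for i j
    by (rule integrable_const_bound[of _ "C * (A * B)"]) (use b measurable_F_M[OF m] in auto)
  have base: "has_bochner_integral M (\<lambda>\<omega>. (\<xi> \<omega> * (\<alpha> \<omega> $ i * \<beta> \<omega> $ j)) * ((W t \<omega> - W s \<omega>) $ i * (W v \<omega> - W u \<omega>) $ j))
           ((if i = j then measure lborel ({s<..t} \<inter> {u<..v}) else 0) * (\<integral>\<omega>. \<xi> \<omega> * (\<alpha> \<omega> $ i * \<beta> \<omega> $ j) \<partial>M))" for i j
  proof (cases "s \<le> u")
    case True
    then have "r = u" by (simp add: r_def)
    then show ?thesis using increment_product_component[of s t u v, OF _ s(3) True u(2) m[unfolded \<open>r = u\<close>] b, of i j i j] s by simp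
  next
    case False
    then have "r = s" by (simp add: r_def)
    then show ?thesis using increment_product_component[of u v s t, OF _ u(2) _ s(3) m[unfolded \<open>r = s\<close>] b, of i j j i] s u False
      by (subst mult.commute[of "(W t _ - W s _) $ i"], subst Int_commute[of "{s<..t}"], subst eq_commute[of i]) simp
  qed
  have "has_bochner_integral M (\<lambda>\<omega>. \<Sum>i\<in>UNIV. \<Sum>j\<in>UNIV. (\<xi> \<omega> * (\<alpha> \<omega> $ i * \<beta> \<omega> $ j)) * ((W t \<omega> - W s \<omega>) $ i * (W v \<omega> - W u \<omega>) $ j))
     (\<Sum>i\<in>UNIV. \<Sum>j\<in>UNIV. (if i = j then measure lborel ({s<..t} \<inter> {u<..v}) else 0) * (\<integral>\<omega>. \<xi> \<omega> * (\<alpha> \<omega> $ i * \<beta> \<omega> $ j) \<partial>M))"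
    by (intro has_bochner_integral_sum base)
  also have "(\<lambda>\<omega>. \<Sum>i\<in>UNIV. \<Sum>j\<in>UNIV. (\<xi> \<omega> * (\<alpha> \<omega> $ i * \<beta> \<omega> $ j)) * ((W t \<omega> - W s \<omega>) $ i * (W v \<omega> - W u \<omega>) $ j))
    = (\<lambda>\<omega>. \<xi> \<omega> * ((\<alpha> \<omega> \<bullet> (W t \<omega> - W s \<omega>)) * (\<beta> \<omega> \<bullet> (W v \<omega> - W u \<omega>))))"
    by (simp only: inner_vec_def sum_product) (simp add: sum_distrib_left ac_simps)
  also have "(\<Sum>i\<in>UNIV. \<Sum>j\<in>UNIV. (if i = j then measure lborel ({s<..t} \<inter> {u<..v}) else 0) * (\<integral>\<omega>. \<xi> \<omega> * (\<alpha> \<omega> $ i * \<beta> \<omega> $ j) \<partial>M))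
     = (\<Sum>i\<in>UNIV. measure lborel ({s<..t} \<inter> {u<..v}) * (\<integral>\<omega>. \<xi> \<omega> * (\<alpha> \<omega> $ i * \<beta> \<omega> $ i) \<partial>M))"
    by (simp add: if_distrib[of "\<lambda>x. x * _"] cong: if_cong)
  also have "\<dots> = measure lborel ({s<..t} \<inter> {u<..v}) * (\<integral>\<omega>. \<xi> \<omega> * (\<alpha> \<omega> \<bullet> \<beta> \<omega>) \<partial>M)"
    using i by (simp add: inner_vec_def sum_distrib_left)
  finally show ?thesis .
qed


section \<open>Elementary integrands, their integrals and the limits of these\<close>

sublocale P: pair_sigma_finite M "lborel :: real measure" ..

abbreviation P :: "('w \<times> real) measure" where "P \<equiv> M \<Otimes>\<^sub>M lborel"

text \<open>An elementary integrand is a list of triples: left end, right end and a bounded value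
  known at the left end. Intervals may overlap and come in any order, so addition is concatenation
  and proofs go by induction on the list.\<close>

definition elem_ok :: "real \<Rightarrow> (real \<times> real \<times> ('w \<Rightarrow> real ^ 'd)) list \<Rightarrow> bool" where
  "elem_ok a L \<longleftrightarrow> (\<forall>(u, v, \<xi>) \<in> set L. a \<le> u \<and> u \<le> v \<and> \<xi> \<in> borel_measurable (F u) \<and>
     (\<exists>C. \<forall>\<omega>\<in>space M. norm (\<xi> \<omega>) \<le> C))"

definition elem_val :: "(real \<times> real \<times> ('w \<Rightarrow> real ^ 'd)) list \<Rightarrow> 'w \<times> real \<Rightarrow> real ^ 'd" where
  "elem_val L p = (\<Sum>(u, v, \<xi>)\<leftarrow>L. indicat_real {u<..v} (snd p) *\<^sub>R \<xi> (fst p))"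

definition elem_int :: "(real \<times> real \<times> ('w \<Rightarrow> real ^ 'd)) list \<Rightarrow> 'w \<Rightarrow> real" where
  "elem_int L \<omega> = (\<Sum>(u, v, \<xi>)\<leftarrow>L. \<xi> \<omega> \<bullet> (W v \<omega> - W u \<omega>))"

lemma elem_Nil[simp]: "elem_ok a []" "elem_val [] p = 0" "elem_int [] \<omega> = 0"
  by (simp_all add: elem_ok_def elem_val_def elem_int_def)

lemma elem_Cons:
  "elem_ok a ((u, v, \<xi>) # L) \<longleftrightarrow> a \<le> u \<and> u \<le> v \<and> \<xi> \<in> borel_measurable (F u) \<and>
     (\<exists>C. \<forall>\<omega>\<in>space M. norm (\<xi> \<omega>) \<le> C) \<and> elem_ok a L"
  "elem_val ((u, v, \<xi>) # L) p = indicat_real {u<..v} (snd p) *\<^sub>R \<xi> (fst p) + elem_val L p"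
  "elem_int ((u, v, \<xi>) # L) \<omega> = \<xi> \<omega> \<bullet> (W v \<omega> - W u \<omega>) + elem_int L \<omega>"
  by (simp_all add: elem_ok_def elem_val_def elem_int_def)

lemma elem_append:
  "elem_ok a (L @ L') \<longleftrightarrow> elem_ok a L \<and> elem_ok a L'"
  "elem_val (L @ L') p = elem_val L p + elem_val L' p"
  "elem_int (L @ L') \<omega> = elem_int L \<omega> + elem_int L' \<omega>"
  by (simp_all add: elem_ok_def elem_val_def elem_int_def ball_Un)

lemma elem_uminus:
  assumes "elem_ok a L"
  shows "\<exists>L'. elem_ok a L' \<and> (\<forall>p. elem_val L' p = - elem_val L p) \<and> (\<forall>\<omega>. elem_int L' \<omega> = - elem_int L \<omega>)"
  using assms
proof (induction L)
  case Nil
  then show ?case by (intro exI[of _ "[]"]) simp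
next
  case (Cons e L)
  obtain u v \<xi> where e: "e = (u, v, \<xi>)" by (cases e)
  with Cons obtain L' where L': "elem_ok a L'" "\<And>p. elem_val L' p = - elem_val L p" "\<And>\<omega>. elem_int L' \<omega> = - elem_int L \<omega>"
    by (auto simp: elem_Cons)
  with Cons.prems e show ?case
    by (intro exI[of _ "(u, v, \<lambda>\<omega>. - \<xi> \<omega>) # L'"]) (auto simp: elem_Cons)
qed

lemma elem_ok_mono: "elem_ok b L \<Longrightarrow> a \<le> b \<Longrightarrow> elem_ok a L"
  by (fastforce simp: elem_ok_def)

lemma elem_measurable:
  assumes "elem_ok a L" "0 \<le> a"
  shows "elem_val L \<in> borel_measurable P" "elem_int L \<in> borel_measurable M"
proof -
  have "elem_val L \<in> borel_measurable P \<and> elem_int L \<in> borel_measurable M"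
    using assms
  proof (induction L)
    case Nil
    have "elem_val [] = (\<lambda>_. 0)" "elem_int [] = (\<lambda>_. 0)" by auto
    then show ?case by simp
  next
    case (Cons e L)
    obtain u v \<xi> where e: "e = (u, v, \<xi>)" by (cases e)
    with Cons have [measurable]: "elem_val L \<in> borel_measurable P" "elem_int L \<in> borel_measurable M"
      and ok: "0 \<le> u" "0 \<le> v" and [measurable]: "\<xi> \<in> borel_measurable M" 
      by (auto simp: elem_Cons intro: measurable_F_M)
    have [measurable]: "W u \<in> borel_measurable M" "W v \<in> borel_measurable M" using ok by (auto intro: W_measurable)
    have "elem_val (e # L) = (\<lambda>p. indicat_real {u<..v} (snd p) *\<^sub>R \<xi> (fst p) + elem_val L p)"
      "elem_int (e # L) = (\<lambda>\<omega>. \<xi> \<omega> \<bullet> (W v \<omega> - W u \<omega>) + elem_int L \<omega>)"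
      by (auto simp: e elem_Cons)
    then show ?case by simp
  qed
  then show "elem_val L \<in> borel_measurable P" "elem_int L \<in> borel_measurable M" by auto
qed

text \<open>Bilinearity over the two lists reduces the claim to \<open>increment_product\<close>.
  The existential form, with one value x for both integrals, lets the induction carry integrability
  and equality together.\<close>

lemma elem_isometry:
  assumes a: "0 \<le> a" and L: "elem_ok a L" "elem_ok a L'"
    and \<xi>: "\<xi> \<in> borel_measurable (F a)" "\<And>\<omega>. \<omega> \<in> space M \<Longrightarrow> \<bar>\<xi> \<omega>\<bar> \<le> C"
  shows "\<exists>x. has_bochner_integral M (\<lambda>\<omega>. \<xi> \<omega> * (elem_int L \<omega> * elem_int L' \<omega>)) x \<and>
     has_bochner_integral P (\<lambda>p. \<xi> (fst p) * (elem_val L p \<bullet> elem_val L' p)) x"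
  using L(1)
proof (induction L)
  case Nil
  then show ?case by (auto intro!: exI[of _ 0] has_bochner_integral_zero)
next
  case (Cons e L)
  obtain s t \<alpha> where e: "e = (s, t, \<alpha>)" by (cases e)
  from Cons.prems obtain A where ok: "a \<le> s" "s \<le> t" "\<alpha> \<in> borel_measurable (F s)" "\<And>\<omega>. \<omega> \<in> space M \<Longrightarrow> norm (\<alpha> \<omega>) \<le> A"
    and okL: "elem_ok a L"
    by (auto simp: e elem_Cons)
  have "\<exists>x. has_bochner_integral M (\<lambda>\<omega>. \<xi> \<omega> * ((\<alpha> \<omega> \<bullet> (W t \<omega> - W s \<omega>)) * elem_int L' \<omega>)) x \<and>
     has_bochner_integral P (\<lambda>p. \<xi> (fst p) * ((indicat_real {s<..t} (snd p) *\<^sub>R \<alpha> (fst p)) \<bullet> elem_val L' p)) x"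
    using L(2)
  proof (induction L')
    case Nil
    then show ?case by (auto intro!: exI[of _ 0] has_bochner_integral_zero)
  next
    case (Cons e' L')
    obtain u v \<beta> where e': "e' = (u, v, \<beta>)" by (cases e')
    from Cons.prems obtain B where ok': "a \<le> u" "u \<le> v" "\<beta> \<in> borel_measurable (F u)" "\<And>\<omega>. \<omega> \<in> space M \<Longrightarrow> norm (\<beta> \<omega>) \<le> B"
      and okL': "elem_ok a L'"
      by (auto simp: e' elem_Cons)
    from Cons.IH[OF okL'] obtain x where x:
      "has_bochner_integral M (\<lambda>\<omega>. \<xi> \<omega> * ((\<alpha> \<omega> \<bullet> (W t \<omega> - W s \<omega>)) * elem_int L' \<omega>)) x"
      "has_bochner_integral P (\<lambda>p. \<xi> (fst p) * ((indicat_real {s<..t} (snd p) *\<^sub>R \<alpha> (fst p)) \<bullet> elem_val L' p)) x" by blast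
    let ?y = "measure lborel ({s<..t} \<inter> {u<..v}) * (\<integral>\<omega>. \<xi> \<omega> * (\<alpha> \<omega> \<bullet> \<beta> \<omega>) \<partial>M)"
    have y: "has_bochner_integral M (\<lambda>\<omega>. \<xi> \<omega> * ((\<alpha> \<omega> \<bullet> (W t \<omega> - W s \<omega>)) * (\<beta> \<omega> \<bullet> (W v \<omega> - W u \<omega>)))) ?y"
      by (rule increment_product[OF a ok(1,2) ok'(1,2) \<xi> ok(3,4) ok'(3,4)])
    have [measurable]: "\<xi> \<in> borel_measurable M" "\<alpha> \<in> borel_measurable M" "\<beta> \<in> borel_measurable M"
      using \<xi>(1) ok(3) ok'(3) by (auto intro: measurable_F_M)
    have "integrable M (\<lambda>\<omega>. \<xi> \<omega> * (\<alpha> \<omega> \<bullet> \<beta> \<omega>))"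
    proof (rule integrable_const_bound[of _ "C * (A * B)"])
      show "AE \<omega> in M. norm (\<xi> \<omega> * (\<alpha> \<omega> \<bullet> \<beta> \<omega>)) \<le> C * (A * B)"
      proof (intro AE_I2)
        fix \<omega> assume \<omega>: "\<omega> \<in> space M"
        have "\<bar>\<alpha> \<omega> \<bullet> \<beta> \<omega>\<bar> \<le> A * B"
          using mult_mono'[OF ok(4)[OF \<omega>] ok'(4)[OF \<omega>]] Cauchy_Schwarz_ineq2[of "\<alpha> \<omega>" "\<beta> \<omega>"] by (simp add: order_trans)
        then show "norm (\<xi> \<omega> * (\<alpha> \<omega> \<bullet> \<beta> \<omega>)) \<le> C * (A * B)"
          using \<xi>(2)[OF \<omega>] unfolding real_norm_def abs_mult[of "\<xi> \<omega>"] by (intro mult_mono') auto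
      qed
    qed measurable
    then have hb: "has_bochner_integral M (\<lambda>\<omega>. \<xi> \<omega> * (\<alpha> \<omega> \<bullet> \<beta> \<omega>)) (\<integral>\<omega>. \<xi> \<omega> * (\<alpha> \<omega> \<bullet> \<beta> \<omega>) \<partial>M)"
      by (simp add: has_bochner_integral_iff)
    have hi: "has_bochner_integral lborel (indicat_real ({s<..t} \<inter> {u<..v})) (measure lborel ({s<..t} \<inter> {u<..v}))"
    proof (rule has_bochner_integral_real_indicator)
      have "{s<..t} \<inter> {u<..v} \<subseteq> {s..t}" by auto
      then show "emeasure lborel ({s<..t} \<inter> {u<..v}) < \<infinity>"
        using emeasure_bounded_finite[OF bounded_subset[OF bounded_closed_interval]] by simp
    qed simp
    have y': "has_bochner_integral P (\<lambda>p. \<xi> (fst p) * ((indicat_real {s<..t} (snd p) *\<^sub>R \<alpha> (fst p)) \<bullet> (indicat_real {u<..v} (snd p) *\<^sub>R \<beta> (fst p)))) ?y"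
      using P.has_bochner_integral_mult[OF hb hi] unfolding indicator_inter_arith
      by (simp add: ac_simps)
    show ?case
      using has_bochner_integral_add[OF y x(1)] has_bochner_integral_add[OF y' x(2)]
      by (intro exI[of _ "?y + x"]) (simp add: e' elem_Cons inner_add_right algebra_simps)
  qed
  then obtain y where y: "has_bochner_integral M (\<lambda>\<omega>. \<xi> \<omega> * ((\<alpha> \<omega> \<bullet> (W t \<omega> - W s \<omega>)) * elem_int L' \<omega>)) y"
     "has_bochner_integral P (\<lambda>p. \<xi> (fst p) * ((indicat_real {s<..t} (snd p) *\<^sub>R \<alpha> (fst p)) \<bullet> elem_val L' p)) y" by blast
  from Cons.IH[OF okL] obtain x where x: "has_bochner_integral M (\<lambda>\<omega>. \<xi> \<omega> * (elem_int L \<omega> * elem_int L' \<omega>)) x"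
     "has_bochner_integral P (\<lambda>p. \<xi> (fst p) * (elem_val L p \<bullet> elem_val L' p)) x" by blast
  show ?case
    using has_bochner_integral_add[OF y(1) x(1)] has_bochner_integral_add[OF y(2) x(2)]
    by (intro exI[of _ "y + x"]) (simp add: e elem_Cons inner_add_left algebra_simps)
qed

lemma elem_mean:
  assumes a: "0 \<le> a" and L: "elem_ok a L"
    and \<xi>: "\<xi> \<in> borel_measurable (F a)" "\<And>\<omega>. \<omega> \<in> space M \<Longrightarrow> \<bar>\<xi> \<omega>\<bar> \<le> C"
  shows "has_bochner_integral M (\<lambda>\<omega>. \<xi> \<omega> * elem_int L \<omega>) 0"
  using L(1)
proof (induction L)
  case Nil
  then show ?case by (auto intro!: has_bochner_integral_zero)
next
  case (Cons e L)
  obtain s t \<alpha> where e: "e = (s, t, \<alpha>)" by (cases e)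
  from Cons.prems obtain A where ok: "a \<le> s" "s \<le> t" "\<alpha> \<in> borel_measurable (F s)" "\<And>\<omega>. \<omega> \<in> space M \<Longrightarrow> norm (\<alpha> \<omega>) \<le> A"
    and okL: "elem_ok a L"
    by (auto simp: e elem_Cons)
  have "has_bochner_integral M (\<lambda>\<omega>. \<Sum>i\<in>UNIV. (\<xi> \<omega> * \<alpha> \<omega> $ i) * (W t \<omega> - W s \<omega>) $ i) (\<Sum>i\<in>(UNIV::'d set). 0)"
  proof (intro has_bochner_integral_sum increment_moments(1))
    fix i
    have cm: "(\<lambda>x. x $ i) \<in> borel_measurable (borel :: (real ^ 'd) measure)" by measurable
    show m: "(\<lambda>\<omega>. \<xi> \<omega> * \<alpha> \<omega> $ i) \<in> borel_measurable (F s)"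
      using ok(1) measurable_F_mono[OF \<xi>(1)] measurable_compose[OF ok(3) cm] by (intro borel_measurable_times) auto
    show "integrable M (\<lambda>\<omega>. \<xi> \<omega> * \<alpha> \<omega> $ i)"
    proof (rule integrable_const_bound[of _ "C * A"])
      show "AE \<omega> in M. norm (\<xi> \<omega> * \<alpha> \<omega> $ i) \<le> C * A"
      proof (intro AE_I2)
        fix \<omega> assume \<omega>: "\<omega> \<in> space M"
        have "\<bar>\<alpha> \<omega> $ i\<bar> \<le> A"
          using ok(4)[OF \<omega>] component_le_norm_cart[of "\<alpha> \<omega>" i] by linarith
        then show "norm (\<xi> \<omega> * \<alpha> \<omega> $ i) \<le> C * A"
          using \<xi>(2)[OF \<omega>] unfolding real_norm_def abs_mult by (intro mult_mono') auto
      qed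
    qed (rule measurable_F_M[OF m])
  qed (use a ok in auto)
  then have "has_bochner_integral M (\<lambda>\<omega>. \<xi> \<omega> * (\<alpha> \<omega> \<bullet> (W t \<omega> - W s \<omega>))) 0"
    by (simp add: inner_vec_def sum_distrib_left mult.assoc)
  from has_bochner_integral_add[OF this Cons.IH[OF okL]]
  show ?case by (simp add: e elem_Cons algebra_simps)
qed

lemma elem_sq_int:
  assumes "0 \<le> a" "elem_ok a L"
  shows "sq_int P (elem_val L)" "sq_int M (elem_int L)"
proof -
  obtain x where "has_bochner_integral M (\<lambda>\<omega>. 1 * (elem_int L \<omega> * elem_int L \<omega>)) x"
    "has_bochner_integral P (\<lambda>p. 1 * (elem_val L p \<bullet> elem_val L p)) x"
    using elem_isometry[OF assms(1,2,2) borel_measurable_const, of 1 1] by auto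
  then have i: "integrable M (\<lambda>\<omega>. elem_int L \<omega> * elem_int L \<omega>)" "integrable P (\<lambda>p. elem_val L p \<bullet> elem_val L p)"
    by (auto simp: has_bochner_integral_iff)
  show "sq_int P (elem_val L)"
    using i elem_measurable[OF assms(2,1)] by (simp add: sq_int_def power2_norm_eq_inner)
  show "sq_int M (elem_int L)"
    using i elem_measurable[OF assms(2,1)] by (simp add: sq_int_def power2_eq_square)
qed

text \<open>The number $a$ bounds the integration times from below, so that $I$ is orthogonal to bounded
  $\mathcal F_a$-measurable weights.\<close>

definition ito :: "real \<Rightarrow> ('w \<times> real \<Rightarrow> real ^ 'd) \<Rightarrow> ('w \<Rightarrow> real) \<Rightarrow> bool" where
  "ito a f I \<longleftrightarrow> (\<exists>L. (\<forall>k. elem_ok a (L k)) \<and>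
     tendsto_L2 P (\<lambda>k. elem_val (L k)) f \<and> tendsto_L2 M (\<lambda>k. elem_int (L k)) I)"

lemma ito_sq_int: assumes "ito a f I" shows "sq_int P f" "sq_int M I"
  using assms by (auto simp: ito_def intro: tendsto_L2_sq_int)

lemma ito_mono: "ito b f I \<Longrightarrow> a \<le> b \<Longrightarrow> ito a f I"
  unfolding ito_def using elem_ok_mono by blast

lemma ito_elem:
  assumes "0 \<le> a" "elem_ok a L" shows "ito a (elem_val L) (elem_int L)"
  unfolding ito_def tendsto_L2_def
  using assms elem_sq_int[OF assms] by (intro exI[of _ "\<lambda>_. L"]) (auto intro: sq_int_measurable)

lemma tendsto_L2_diff:
  assumes f: "tendsto_L2 N fs f" and g: "tendsto_L2 N gs g"
  shows "tendsto_L2 N (\<lambda>k x. fs k x - gs k x) (\<lambda>x. f x - g x)"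
proof -
  have [measurable]: "f \<in> borel_measurable N" "g \<in> borel_measurable N" 
      "\<And>k. fs k \<in> borel_measurable N" "\<And>k. gs k \<in> borel_measurable N"
    using f g by (auto simp: tendsto_L2_def sq_int_def)
  have le: "(\<integral>\<^sup>+x. ennreal ((norm (fs k x - gs k x - (f x - g x)))\<^sup>2) \<partial>N)
     \<le> 2 * (\<integral>\<^sup>+x. ennreal ((norm (fs k x - f x))\<^sup>2) \<partial>N) + 2 * (\<integral>\<^sup>+x. ennreal ((norm (gs k x - g x))\<^sup>2) \<partial>N)" for k
  proof -
    have "(\<integral>\<^sup>+x. ennreal ((norm (fs k x - gs k x - (f x - g x)))\<^sup>2) \<partial>N)
      \<le> (\<integral>\<^sup>+x. 2 * ennreal ((norm (fs k x - f x))\<^sup>2) + 2 * ennreal ((norm (gs k x - g x))\<^sup>2) \<partial>N)"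
    proof (intro nn_integral_mono)
      fix x
      have "(norm (fs k x - gs k x - (f x - g x)))\<^sup>2 \<le> 2 * (norm (fs k x - f x))\<^sup>2 + 2 * (norm (- (gs k x - g x)))\<^sup>2"
        using norm_add_sq_le[of "fs k x - f x" "- (gs k x - g x)"] by (simp add: algebra_simps)
      then have "ennreal ((norm (fs k x - gs k x - (f x - g x)))\<^sup>2) \<le> ennreal (2 * (norm (fs k x - f x))\<^sup>2 + 2 * (norm (gs k x - g x))\<^sup>2)"
        by (intro ennreal_leI) (simp add: norm_minus_commute)
      then show "ennreal ((norm (fs k x - gs k x - (f x - g x)))\<^sup>2) \<le> 2 * ennreal ((norm (fs k x - f x))\<^sup>2) + 2 * ennreal ((norm (gs k x - g x))\<^sup>2)"
        by (simp add: ennreal_mult')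
    qed
    also have "\<dots> = 2 * (\<integral>\<^sup>+x. ennreal ((norm (fs k x - f x))\<^sup>2) \<partial>N) + 2 * (\<integral>\<^sup>+x. ennreal ((norm (gs k x - g x))\<^sup>2) \<partial>N)"
      by (simp add: nn_integral_add nn_integral_cmult)
    finally show ?thesis .
  qed
  have "(\<lambda>k. 2 * (\<integral>\<^sup>+x. ennreal ((norm (fs k x - f x))\<^sup>2) \<partial>N) + 2 * (\<integral>\<^sup>+x. ennreal ((norm (gs k x - g x))\<^sup>2) \<partial>N)) \<longlonglongrightarrow> 2 * 0 + 2 * 0"
    using f g unfolding tendsto_L2_def by (intro tendsto_add ennreal_tendsto_cmult) auto
  then have lim0: "(\<lambda>k. 2 * (\<integral>\<^sup>+x. ennreal ((norm (fs k x - f x))\<^sup>2) \<partial>N) + 2 * (\<integral>\<^sup>+x. ennreal ((norm (gs k x - g x))\<^sup>2) \<partial>N)) \<longlonglongrightarrow> 0"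
    by simp
  have "(\<lambda>k. \<integral>\<^sup>+x. ennreal ((norm (fs k x - gs k x - (f x - g x)))\<^sup>2) \<partial>N) \<longlonglongrightarrow> 0"
    by (rule tendsto_sandwich[OF _ _ tendsto_const lim0]) (use le in auto)
  then show ?thesis
    using f g by (auto simp: tendsto_L2_def sq_int_diff)
qed

text \<open>Concatenating an approximating list for f with a negated one for g approximates the
  difference.\<close>

lemma ito_diff:
  assumes "ito a f I" "ito a g J" 
  shows "ito a (\<lambda>p. f p - g p) (\<lambda>\<omega>. I \<omega> - J \<omega>)"
proof -
  from assms obtain L L' where L: "\<And>k. elem_ok a (L k)" "\<And>k. elem_ok a (L' k)"
    "tendsto_L2 P (\<lambda>k. elem_val (L k)) f" "tendsto_L2 M (\<lambda>k. elem_int (L k)) I"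
    "tendsto_L2 P (\<lambda>k. elem_val (L' k)) g" "tendsto_L2 M (\<lambda>k. elem_int (L' k)) J"
    by (auto simp: ito_def)
  have "\<forall>k. \<exists>K. elem_ok a K \<and> (\<forall>p. elem_val K p = - elem_val (L' k) p) \<and> (\<forall>\<omega>. elem_int K \<omega> = - elem_int (L' k) \<omega>)"
    using elem_uminus[OF L(2)] by blast
  then obtain K where K: "\<And>k. elem_ok a (K k)" "\<And>k p. elem_val (K k) p = - elem_val (L' k) p" "\<And>k \<omega>. elem_int (K k) \<omega> = - elem_int (L' k) \<omega>"
    by metis
  have "elem_val (L k @ K k) = (\<lambda>p. elem_val (L k) p - elem_val (L' k) p)" 
    "elem_int (L k @ K k) = (\<lambda>p. elem_int (L k) p - elem_int (L' k) p)" for k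
    by (auto simp: elem_append K)
  then show ?thesis
    unfolding ito_def using tendsto_L2_diff[OF L(3) L(5)] tendsto_L2_diff[OF L(4) L(6)] L K
    by (intro exI[of _ "\<lambda>k. L k @ K k"]) (auto simp: elem_append(1))
qed

text \<open>Both sides of \<open>elem_isometry\<close> are weighted inner products, and these are
  continuous in L2 by \<open>tendsto_L2_inner\<close>.\<close>

lemma ito_isometry:
  assumes a: "0 \<le> a" and f: "ito a f I" and g: "ito a g J"
    and \<xi>: "\<xi> \<in> borel_measurable (F a)" "\<And>\<omega>. \<omega> \<in> space M \<Longrightarrow> \<bar>\<xi> \<omega>\<bar> \<le> C"
  shows "(\<integral>\<omega>. \<xi> \<omega> * (I \<omega> * J \<omega>) \<partial>M) = (\<integral>p. \<xi> (fst p) * (f p \<bullet> g p) \<partial>P)"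
proof -
  from f g obtain L L' where L: "\<And>k. elem_ok a (L k)" "\<And>k. elem_ok a (L' k)"
    "tendsto_L2 P (\<lambda>k. elem_val (L k)) f" "tendsto_L2 M (\<lambda>k. elem_int (L k)) I"
    "tendsto_L2 P (\<lambda>k. elem_val (L' k)) g" "tendsto_L2 M (\<lambda>k. elem_int (L' k)) J"
    by (auto simp: ito_def)
  have [measurable]: "\<xi> \<in> borel_measurable M" using \<xi>(1) by (rule measurable_F_M)
  have b: "\<And>\<omega>. \<omega> \<in> space M \<Longrightarrow> \<bar>\<xi> \<omega>\<bar> \<le> \<bar>C\<bar>" using \<xi>(2) by fastforce
  have 1: "(\<lambda>k. \<integral>\<omega>. \<xi> \<omega> * (elem_int (L k) \<omega> \<bullet> elem_int (L' k) \<omega>) \<partial>M) \<longlonglongrightarrow> (\<integral>\<omega>. \<xi> \<omega> * (I \<omega> \<bullet> J \<omega>) \<partial>M)"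
    by (rule tendsto_L2_inner[OF L(4) L(6) _ b]) auto
  have 2: "(\<lambda>k. \<integral>p. \<xi> (fst p) * (elem_val (L k) p \<bullet> elem_val (L' k) p) \<partial>P) \<longlonglongrightarrow> (\<integral>p. \<xi> (fst p) * (f p \<bullet> g p) \<partial>P)"
    by (rule tendsto_L2_inner[OF L(3) L(5), of _ "\<bar>C\<bar>"]) (auto intro: b simp: space_pair_measure)
  have "(\<integral>\<omega>. \<xi> \<omega> * (elem_int (L k) \<omega> \<bullet> elem_int (L' k) \<omega>) \<partial>M) = (\<integral>p. \<xi> (fst p) * (elem_val (L k) p \<bullet> elem_val (L' k) p) \<partial>P)" for k
    using elem_isometry[OF a L(1)[of k] L(2)[of k] \<xi>] by (auto simp: has_bochner_integral_iff)
  with 1 2 show ?thesis using LIMSEQ_unique by fastforce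
qed

lemma sq_int_const: "sq_int M (\<lambda>_. c)"
  by (simp add: sq_int_def)

lemma ito_mean:
  assumes a: "0 \<le> a" and f: "ito a f I"
    and \<xi>: "\<xi> \<in> borel_measurable (F a)" "\<And>\<omega>. \<omega> \<in> space M \<Longrightarrow> \<bar>\<xi> \<omega>\<bar> \<le> C"
  shows "(\<integral>\<omega>. \<xi> \<omega> * I \<omega> \<partial>M) = 0"
proof -
  from f obtain L where L: "\<And>k. elem_ok a (L k)" "tendsto_L2 M (\<lambda>k. elem_int (L k)) I"
    by (auto simp: ito_def)
  have m: "\<xi> \<in> borel_measurable M" using \<xi>(1) by (rule measurable_F_M)
  have b: "\<And>\<omega>. \<omega> \<in> space M \<Longrightarrow> \<bar>\<xi> \<omega>\<bar> \<le> \<bar>C\<bar>" using \<xi>(2) by fastforce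
  have "tendsto_L2 M (\<lambda>_ _. 1 :: real) (\<lambda>_. 1)" by (auto simp: tendsto_L2_def sq_int_const)
  from tendsto_L2_inner[OF L(2) this m b]
  have "(\<lambda>k. \<integral>\<omega>. \<xi> \<omega> * elem_int (L k) \<omega> \<partial>M) \<longlonglongrightarrow> (\<integral>\<omega>. \<xi> \<omega> * I \<omega> \<partial>M)" by simp
  moreover have "(\<integral>\<omega>. \<xi> \<omega> * elem_int (L k) \<omega> \<partial>M) = 0" for k
    using elem_mean[OF a L(1) \<xi>] by (auto simp: has_bochner_integral_iff)
  ultimately show ?thesis by (simp add: LIMSEQ_const_iff)
qed

text \<open>Step processes on [a, b] vanish off (a, b]. Hence their convergence on [a, b] is
  convergence on the whole product space towards Z cut off outside (a, b], the point a being a null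
  set.\<close>

lemma has_ito_integral_ito:
  assumes I: "has_ito_integral M F W a b Z I" and a: "0 \<le> a" "a \<le> b"
    and f: "(\<lambda>p. indicat_real {a<..b} (snd p) *\<^sub>R Z (snd p) (fst p)) \<in> borel_measurable P"
  shows "ito a (\<lambda>p. indicat_real {a<..b} (snd p) *\<^sub>R Z (snd p) (fst p)) I"
proof -
  let ?f = "\<lambda>p. indicat_real {a<..b} (snd p) *\<^sub>R Z (snd p) (fst p)"
  from I obtain n \<tau> \<xi> where sp: "\<And>k. step_process M F a b (n k) (\<tau> k) (\<xi> k)"
    and lim: "(\<lambda>k. \<integral>\<^sup>+ \<omega>. (\<integral>\<^sup>+ s\<in>{a..b}.
            ennreal ((norm (step_value (n k) (\<tau> k) (\<xi> k) s \<omega> - Z s \<omega>))\<^sup>2) \<partial>lborel) \<partial>M) \<longlonglongrightarrow> 0"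
      "(\<lambda>k. \<integral>\<^sup>+ \<omega>. ennreal ((step_integral W (n k) (\<tau> k) (\<xi> k) \<omega> - I \<omega>)\<^sup>2) \<partial>M) \<longlonglongrightarrow> 0"
    and [measurable]: "I \<in> borel_measurable M"
    unfolding has_ito_integral_def by auto
  define L where "L k = map (\<lambda>i. (\<tau> k i, \<tau> k (Suc i), \<xi> k i)) [0..<n k]" for k
  have mono: "\<tau> k i \<le> \<tau> k j" if "i \<le> j" "j \<le> n k" for k i j
    using that sp[of k] by (induction j rule: dec_induct) (auto simp: step_process_def intro: order_trans)
  have bnds: "a \<le> \<tau> k i" "\<tau> k i \<le> b" if "i \<le> n k" for k i
    using mono[of 0 i k] mono[of i "n k" k] that sp[of k] by (auto simp: step_process_def)
  have ok: "elem_ok a (L k)" for k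
    using sp[of k] bnds by (auto simp: L_def elem_ok_def step_process_def)
  have val: "elem_val (L k) p = step_value (n k) (\<tau> k) (\<xi> k) (snd p) (fst p)" for k p
    by (simp add: L_def elem_val_def step_value_def comp_def interv_sum_list_conv_sum_set_nat atLeast0LessThan)
  have int: "elem_int (L k) \<omega> = step_integral W (n k) (\<tau> k) (\<xi> k) \<omega>" for k \<omega>
    by (simp add: L_def elem_int_def step_integral_def comp_def interv_sum_list_conv_sum_set_nat atLeast0LessThan)
  note [measurable] = f elem_measurable[OF ok a(1)]
  have zero: "step_value (n k) (\<tau> k) (\<xi> k) s \<omega> = 0" if "s \<notin> {a<..b}" for k s \<omega>
    unfolding step_value_def
  proof (intro sum.neutral ballI)
    fix i assume "i \<in> {..<n k}"
    then have "a \<le> \<tau> k i" "\<tau> k (Suc i) \<le> b" using bnds by auto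
    with that have "s \<notin> {\<tau> k i<..\<tau> k (Suc i)}" by auto
    then show "indicat_real {\<tau> k i<..\<tau> k (Suc i)} s *\<^sub>R \<xi> k i \<omega> = 0" by simp
  qed
  have eq: "(\<integral>\<^sup>+ p. ennreal ((norm (elem_val (L k) p - ?f p))\<^sup>2) \<partial>P) = (\<integral>\<^sup>+ \<omega>. (\<integral>\<^sup>+ s\<in>{a..b}.
            ennreal ((norm (step_value (n k) (\<tau> k) (\<xi> k) s \<omega> - Z s \<omega>))\<^sup>2) \<partial>lborel) \<partial>M)" for k
  proof -
    have "(\<integral>\<^sup>+ p. ennreal ((norm (elem_val (L k) p - ?f p))\<^sup>2) \<partial>P) =
      (\<integral>\<^sup>+ \<omega>. \<integral>\<^sup>+ s. ennreal ((norm (elem_val (L k) (\<omega>, s) - ?f (\<omega>, s)))\<^sup>2) \<partial>lborel \<partial>M)"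
      by (subst lborel.nn_integral_fst[symmetric]) auto
    also have "\<dots> = (\<integral>\<^sup>+ \<omega>. (\<integral>\<^sup>+ s\<in>{a..b}.
            ennreal ((norm (step_value (n k) (\<tau> k) (\<xi> k) s \<omega> - Z s \<omega>))\<^sup>2) \<partial>lborel) \<partial>M)"
    proof (rule nn_integral_cong, rule nn_integral_cong_AE)
      fix \<omega>
      show "AE s in lborel. ennreal ((norm (elem_val (L k) (\<omega>, s) - ?f (\<omega>, s)))\<^sup>2) =
         ennreal ((norm (step_value (n k) (\<tau> k) (\<xi> k) s \<omega> - Z s \<omega>))\<^sup>2) * indicator {a..b} s"
        using AE_lborel_singleton[of a]
      proof eventually_elim
        case (elim s)
        then show ?case
          by (cases "s \<in> {a<..b}") (auto simp: val zero split: split_indicator)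
      qed
    qed
    finally show ?thesis .
  qed
  show ?thesis
    unfolding ito_def tendsto_L2_def
    using ok elem_sq_int[OF a(1) ok] f lim by (intro exI[of _ L]) (auto simp: eq, simp_all add: int)
qed

end

section \<open>An inequality of Ito type in expectation\<close>

text \<open>\<open>f1\<close> and \<open>f2\<close> play the role of the first two derivatives. One
  constant bounds all functions and the remainder, so that products can be estimated by powers of
  C.\<close>

definition cubic_taylor :: "real \<Rightarrow> (real \<Rightarrow> real) \<Rightarrow> (real \<Rightarrow> real) \<Rightarrow> (real \<Rightarrow> real) \<Rightarrow> bool" where
  "cubic_taylor C f f1 f2 \<longleftrightarrow> continuous_on UNIV f \<and> continuous_on UNIV f1 \<and> continuous_on UNIV f2 \<and>
     (\<forall>x. \<bar>f x\<bar> \<le> C \<and> \<bar>f1 x\<bar> \<le> C \<and> \<bar>f2 x\<bar> \<le> C) \<and>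
     (\<forall>x d. \<bar>f (x + d) - (f x + f1 x * d + f2 x / 2 * d\<^sup>2)\<bar> \<le> C * \<bar>d\<bar> ^ 3)"

text \<open>The Taylor remainder of a function with bounded derivatives is controlled by both $d^2$ and $|d|^3$.
  The minimum of the two can be summed over a grid with square integrable integrands: approximate these in
  $L^2$ by elementary ones, use $d^2$ for the error and the Gaussian third moment for the rest.\<close>

definition min_sq_cube :: "real \<Rightarrow> real" where "min_sq_cube d = min (d\<^sup>2) (\<bar>d\<bar> ^ 3)"

section \<open>Pointwise estimates of Taylor remainders\<close>

lemma min_sq_cube_nonneg: "0 \<le> min_sq_cube d" by (simp add: min_sq_cube_def)

lemma min_sq_cube_le_sq: "min_sq_cube d \<le> d\<^sup>2" by (simp add: min_sq_cube_def)

text \<open>The larger of the two summands decides: if it is x, the square is used, otherwise the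
  cube. In the application x is the L2 error of an approximation and e an elementary
  integral.\<close>

lemma min_sq_cube_add: "min_sq_cube (x + e) \<le> 4 * x\<^sup>2 + 8 * \<bar>e\<bar> ^ 3"
proof (cases "\<bar>e\<bar> \<le> \<bar>x\<bar>")
  case True
  then have "(x + e)\<^sup>2 \<le> (2 * x)\<^sup>2" by (intro abs_le_square_iff[THEN iffD1]) auto
  then show ?thesis using min_sq_cube_le_sq[of "x + e"] by (simp add: power_mult_distrib) (smt (verit) zero_le_power abs_ge_zero)
next
  case False
  then have "\<bar>x + e\<bar> ^ 3 \<le> (2 * \<bar>e\<bar>) ^ 3" by (intro power_mono) auto
  then have "min_sq_cube (x + e) \<le> 8 * \<bar>e\<bar> ^ 3" by (simp add: min_sq_cube_def power_mult_distrib min_le_iff_disj)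
  then show ?thesis by (smt (verit) zero_le_power2)
qed

text \<open>The sum is at most twice the larger of |d| and |e|, and 8 = 2^3 covers both
  powers.\<close>

lemma min_sq_cube_sum_le:
  fixes d e :: real
  defines "s \<equiv> \<bar>d\<bar> + \<bar>e\<bar>"
  shows "min (s\<^sup>2) (s ^ 3) \<le> 8 * (min_sq_cube d + min_sq_cube e)"
proof -
  have *: "min (s\<^sup>2) (s ^ 3) \<le> 8 * min_sq_cube m" if "s \<le> 2 * \<bar>m\<bar>" for m
  proof -
    have "s\<^sup>2 \<le> (2 * \<bar>m\<bar>)\<^sup>2" "s ^ 3 \<le> (2 * \<bar>m\<bar>) ^ 3"
      using power_mono[OF that, of 2] power_mono[OF that, of 3] by (auto simp: s_def)
    then have "s\<^sup>2 \<le> 4 * m\<^sup>2" "s ^ 3 \<le> 8 * \<bar>m\<bar> ^ 3" by (simp_all add: power_mult_distrib)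
    moreover have "0 \<le> m\<^sup>2" "0 \<le> \<bar>m\<bar> ^ 3" by simp_all
    ultimately show ?thesis unfolding min_sq_cube_def by linarith
  qed
  show ?thesis
    using *[of d] *[of e] min_sq_cube_nonneg[of d] min_sq_cube_nonneg[of e] by (cases "\<bar>d\<bar> \<le> \<bar>e\<bar>") (auto simp: s_def)
qed

text \<open>Function values are free real variables here, so that the estimate is pure arithmetic.
  For s \<le> 1 every remaining product is of order at least 3 in s; for s > 1 each term separately
  is bounded by a multiple of C^2 s^2. The constant 10 covers the totals 11/2 and 6 of the two
  cases.\<close>

lemma product_taylor_aux:
  fixes a a1 a2 b b1 b2 d e r \<rho> C s :: real
  assumes ab: "\<bar>a\<bar> \<le> C" "\<bar>a1\<bar> \<le> C" "\<bar>a2\<bar> \<le> C" "\<bar>b\<bar> \<le> C" "\<bar>b1\<bar> \<le> C" "\<bar>b2\<bar> \<le> C"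
    and r: "\<bar>r\<bar> \<le> C * \<bar>d\<bar> ^ 3" "\<bar>\<rho>\<bar> \<le> C * \<bar>e\<bar> ^ 3"
    and A: "A = a + a1 * d + a2 / 2 * d\<^sup>2 + r" "\<bar>A\<bar> \<le> C"
    and B: "B = b + b1 * e + b2 / 2 * e\<^sup>2 + \<rho>" "\<bar>B\<bar> \<le> C"
    and s: "s = \<bar>d\<bar> + \<bar>e\<bar>"
  shows "\<bar>A * B - (a * b + (a1 * b * d + a * b1 * e) + (a2 * b * d\<^sup>2 + 2 * a1 * b1 * (d * e) + a * b2 * e\<^sup>2) / 2)\<bar>
     \<le> 10 * C\<^sup>2 * min (s\<^sup>2) (s ^ 3)"
proof -
  have C: "0 \<le> C" and s0: "0 \<le> s" using ab s by auto
  have d: "\<bar>d\<bar> \<le> s" "\<bar>e\<bar> \<le> s" using s by auto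
  have d2: "d\<^sup>2 \<le> s\<^sup>2" "e\<^sup>2 \<le> s\<^sup>2" "\<bar>d * e\<bar> \<le> s\<^sup>2" 
    using d s0 abs_le_square_iff[of d s] abs_le_square_iff[of e s] mult_mono'[OF d]
    by (simp_all add: abs_mult power2_eq_square[of s])
  have d3: "\<bar>d\<bar> ^ 3 \<le> s ^ 3" "\<bar>e\<bar> ^ 3 \<le> s ^ 3" using d by (auto intro!: power_mono)
  have r3: "\<bar>r\<bar> \<le> C * s ^ 3" "\<bar>\<rho>\<bar> \<le> C * s ^ 3"
    using r d3 C by (meson mult_left_mono order_trans)+
  have m: "\<bar>x * y\<bar> \<le> X * Y" if "\<bar>x\<bar> \<le> X" "\<bar>y\<bar> \<le> Y" for x y X Y :: real
    unfolding abs_mult using that by (intro mult_mono') auto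
  show ?thesis
  proof (cases "s \<le> 1")
    case True
    have s4: "s ^ 4 \<le> s ^ 3" "s ^ 5 \<le> s ^ 3" "s ^ 3 \<le> s\<^sup>2" 
      using s0 True by (auto intro!: power_decreasing)
    \<comment> \<open>What the second order polynomial of the product leaves over from the product
      of the two expansions: terms of order at least 3 only.\<close>
    have eq: "A * B - (a * b + (a1 * b * d + a * b1 * e) + (a2 * b * d\<^sup>2 + 2 * a1 * b1 * (d * e) + a * b2 * e\<^sup>2) / 2)
       = a * \<rho> + (a1 * d) * (b2 / 2 * e\<^sup>2 + \<rho>) + (a2 / 2 * d\<^sup>2) * (b1 * e + b2 / 2 * e\<^sup>2 + \<rho>) + r * B"
    proof -
      define X Y U V where "X = a1 * d" and "Y = a2 / 2 * d\<^sup>2" and "U = b1 * e" and "V = b2 / 2 * e\<^sup>2"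
      have 1: "(a1 * b * d + a * b1 * e) + (a2 * b * d\<^sup>2 + 2 * a1 * b1 * (d * e) + a * b2 * e\<^sup>2) / 2
         = X * b + a * U + (Y * b + X * U + a * V)"
        by (simp add: X_def Y_def U_def V_def add_divide_distrib mult.assoc mult.commute[of b])
      have "A = a + X + Y + r" "B = b + U + V + \<rho>" using A(1) B(1) by (simp_all add: X_def Y_def U_def V_def)
      then have "A * B - (a * b + (X * b + a * U + (Y * b + X * U + a * V))) = a * \<rho> + X * (V + \<rho>) + Y * (U + V + \<rho>) + r * B"
        by (simp add: algebra_simps)
      then show ?thesis unfolding add.assoc[of "a * b"] 1 by (simp only: X_def Y_def U_def V_def)
    qed
    have 1: "\<bar>a * \<rho>\<bar> \<le> C * (C * s ^ 3)" "\<bar>r * B\<bar> \<le> (C * s ^ 3) * C"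
      using m[OF ab(1) r3(2)] m[OF r3(1) B(2)] by simp_all
    have e2: "\<bar>b2 / 2 * e\<^sup>2\<bar> \<le> C / 2 * s\<^sup>2" using ab d2 by (intro m) auto
    have rho1: "\<bar>\<rho>\<bar> \<le> C * s\<^sup>2" using r3(2) mult_left_mono[OF s4(3) C] by linarith
    have e1: "\<bar>b1 * e\<bar> \<le> C * s" using ab d by (intro m) auto
    have s2: "C * s\<^sup>2 \<le> C * s" using True s0 C by (simp add: power2_eq_square mult_left_le mult_left_mono)
    have 2: "\<bar>(a1 * d) * (b2 / 2 * e\<^sup>2 + \<rho>)\<bar> \<le> (C * s) * (2 * C * s\<^sup>2)"
    proof (rule m[OF m[OF ab(2) d(1)]])
      have "\<bar>b2 / 2 * e\<^sup>2 + \<rho>\<bar> \<le> C / 2 * s\<^sup>2 + C * s\<^sup>2" using e2 rho1 by linarith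
      also have "\<dots> \<le> 2 * C * s\<^sup>2" using C by (simp add: field_simps)
      finally show "\<bar>b2 / 2 * e\<^sup>2 + \<rho>\<bar> \<le> 2 * C * s\<^sup>2" .
    qed
    have 3: "\<bar>(a2 / 2 * d\<^sup>2) * (b1 * e + b2 / 2 * e\<^sup>2 + \<rho>)\<bar> \<le> (C / 2 * s\<^sup>2) * (3 * C * s)"
    proof (rule m[OF m])
      show "\<bar>a2 / 2\<bar> \<le> C / 2" "\<bar>d\<^sup>2\<bar> \<le> s\<^sup>2" using ab d2 by auto
      have "C / 2 * s\<^sup>2 \<le> C * s" using s2 mult_nonneg_nonneg[OF C s0] by simp
      then show "\<bar>b1 * e + b2 / 2 * e\<^sup>2 + \<rho>\<bar> \<le> 3 * C * s" using e2 rho1 e1 s2 by linarith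
    qed
    have "\<bar>A * B - (a * b + (a1 * b * d + a * b1 * e) + (a2 * b * d\<^sup>2 + 2 * a1 * b1 * (d * e) + a * b2 * e\<^sup>2) / 2)\<bar>
       \<le> 10 * C\<^sup>2 * s ^ 3"
    proof -
      define k where "k = C\<^sup>2 * s ^ 3"
      have k: "0 \<le> k" using s0 by (simp add: k_def)
      have gen: "\<bar>p + q + x + y\<bar> \<le> 10 * k" if "\<bar>p\<bar> \<le> k" "\<bar>q\<bar> \<le> 2 * k" "\<bar>x\<bar> \<le> 3 / 2 * k" "\<bar>y\<bar> \<le> k" for p q x y
        using that k unfolding abs_le_iff by (safe; linarith)
      have "C * (C * s ^ 3) = k" "(C * s ^ 3) * C = k"
        "(C * s) * (2 * C * s\<^sup>2) = 2 * k" "(C / 2 * s\<^sup>2) * (3 * C * s) = 3 / 2 * k"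
        by (simp_all add: k_def power2_eq_square power3_eq_cube)
      with 1 2 3 show ?thesis unfolding eq mult.assoc[of 10] k_def[symmetric] by (intro gen) (simp_all only:)
    qed
    moreover have "min (s\<^sup>2) (s ^ 3) = s ^ 3" using s4 by simp
    ultimately show ?thesis by simp
  next
    case False
    then have s23: "s\<^sup>2 \<le> s ^ 3" "1 \<le> s\<^sup>2" "s \<le> s\<^sup>2"
      by (auto simp: power2_eq_square power3_eq_cube mult_ge1_I mult_le_cancel_left1)
    define k where "k = C * C * s\<^sup>2"
    have C2: "C * C \<le> k" "C * C * s \<le> k"
      using mult_left_mono[OF s23(2), of "C * C"] mult_left_mono[OF s23(3), of "C * C"] by (simp_all add: k_def)
    have "\<bar>A * B\<bar> \<le> C * C" "\<bar>a * b\<bar> \<le> C * C" using ab A B by (auto intro!: m)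
    with C2 have 1: "\<bar>A * B\<bar> \<le> k" "\<bar>a * b\<bar> \<le> k" by linarith+
    have "\<bar>a1 * b * d\<bar> \<le> C * C * s" "\<bar>a * b1 * e\<bar> \<le> C * C * s" using ab d by (auto intro!: m)
    with C2 have 2: "\<bar>a1 * b * d\<bar> \<le> k" "\<bar>a * b1 * e\<bar> \<le> k" by linarith+
    have 3: "\<bar>a2 * b * d\<^sup>2\<bar> \<le> k" "\<bar>a1 * b1 * (d * e)\<bar> \<le> k" "\<bar>a * b2 * e\<^sup>2\<bar> \<le> k"
      unfolding k_def using d2 by (intro m[OF m[OF ab(3,4)]] m[OF m[OF ab(2,5)]] m[OF m[OF ab(1,6)]]; simp)+
    have gen: "\<bar>p - (q + (x + y) + (u + 2 * v + w) / 2)\<bar> \<le> 10 * k" if "\<bar>p\<bar> \<le> k" "\<bar>q\<bar> \<le> k" "\<bar>x\<bar> \<le> k" "\<bar>y\<bar> \<le> k"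
       "\<bar>u\<bar> \<le> k" "\<bar>v\<bar> \<le> k" "\<bar>w\<bar> \<le> k" for p q x y u v w :: real
    proof -
      have 1: "\<bar>x + y\<bar> \<le> 2 * k" using that(3,4) by linarith
      have "\<bar>u + 2 * v + w\<bar> \<le> 4 * k" using that(5-7) by linarith
      then have 2: "\<bar>(u + 2 * v + w) / 2\<bar> \<le> 2 * k" by simp
      have "\<bar>q + (x + y) + (u + 2 * v + w) / 2\<bar> \<le> 5 * k" using that(2) 1 2 by linarith
      with that(1) show ?thesis by linarith
    qed
    have "\<bar>A * B - (a * b + (a1 * b * d + a * b1 * e) + (a2 * b * d\<^sup>2 + 2 * (a1 * b1 * (d * e)) + a * b2 * e\<^sup>2) / 2)\<bar>
       \<le> 10 * k"
      using 1 2 3 by (intro gen)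
    then have "\<bar>A * B - (a * b + (a1 * b * d + a * b1 * e) + (a2 * b * d\<^sup>2 + 2 * a1 * b1 * (d * e) + a * b2 * e\<^sup>2) / 2)\<bar>
       \<le> 10 * (C * C * s\<^sup>2)"
      by (simp add: k_def mult.assoc)
    moreover have "min (s\<^sup>2) (s ^ 3) = s\<^sup>2" using s23 by simp
    ultimately show ?thesis by (simp add: power2_eq_square)
  qed
qed

lemma product_taylor:
  assumes f: "cubic_taylor C f f1 f2" and g: "cubic_taylor C g g1 g2"
  shows "\<bar>f (x + d) * g (y + e) - (f x * g y + (f1 x * g y * d + f x * g1 y * e) +
        (f2 x * g y * d\<^sup>2 + 2 * f1 x * g1 y * (d * e) + f x * g2 y * e\<^sup>2) / 2)\<bar>
     \<le> 10 * C\<^sup>2 * min ((\<bar>d\<bar> + \<bar>e\<bar>)\<^sup>2) ((\<bar>d\<bar> + \<bar>e\<bar>) ^ 3)"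
proof (rule product_taylor_aux)
  show "\<bar>f (x + d) - (f x + f1 x * d + f2 x / 2 * d\<^sup>2)\<bar> \<le> C * \<bar>d\<bar> ^ 3"
    "\<bar>g (y + e) - (g y + g1 y * e + g2 y / 2 * e\<^sup>2)\<bar> \<le> C * \<bar>e\<bar> ^ 3"
    using f g unfolding cubic_taylor_def by blast+
qed (use f g in \<open>auto simp: cubic_taylor_def\<close>)

text \<open>Meant for drift increments d and e, whose sum is small on fine grids for each path but
  not uniformly. If d + e \<le> 1 the error is quadratic, with constant 12; otherwise boundedness of
  f and g makes it linear, with constant 4. The factor min 1 (d + e) expresses both.\<close>

lemma product_first_order:
  assumes f: "cubic_taylor C f f1 f2" and g: "cubic_taylor C g g1 g2" and C: "1 \<le> C"
    and d: "0 \<le> d" "0 \<le> e"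
  shows "f (x + d) * g (y + e) \<le> f x * g y + (f1 x * g y * d + f x * g1 y * e) + 20 * C\<^sup>2 * ((d + e) * min 1 (d + e))"
proof -
  define s where "s = d + e"
  have s: "0 \<le> s" "d \<le> s" "e \<le> s" using d by (auto simp: s_def)
  have b: "\<bar>f x\<bar> \<le> C" "\<bar>f1 x\<bar> \<le> C" "\<bar>f2 x\<bar> \<le> C" "\<bar>g x\<bar> \<le> C" "\<bar>g1 x\<bar> \<le> C" "\<bar>g2 x\<bar> \<le> C" for x
    using f g by (auto simp: cubic_taylor_def)
  have m: "\<bar>x * y\<bar> \<le> C * C" if "\<bar>x\<bar> \<le> C" "\<bar>y\<bar> \<le> C" for x y :: real
    unfolding abs_mult using that by (intro mult_mono') auto
  note m' = m[OF b(1) b(4)] m[OF b(2) b(4)] m[OF b(3) b(4)] m[OF b(1) b(5)] m[OF b(2) b(5)] m[OF b(1) b(6)]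
  have bd: "p * q \<le> C * C * Q" if "\<bar>p\<bar> \<le> C * C" "0 \<le> q" "q \<le> Q" for p q Q
    using that by (intro mult_mono) auto
  have bd': "- (p * q) \<le> C * C * Q" if "\<bar>p\<bar> \<le> C * C" "0 \<le> q" "q \<le> Q" for p q Q
    using bd[of "-p"] that by simp
  have sq: "0 \<le> d\<^sup>2" "d\<^sup>2 \<le> s\<^sup>2" "0 \<le> e\<^sup>2" "e\<^sup>2 \<le> s\<^sup>2" "0 \<le> d * e" "d * e \<le> s\<^sup>2"
    using d s by (auto intro!: power_mono mult_mono simp: power2_eq_square)
  show ?thesis
  proof (cases "s \<le> 1")
    case True
    then have "s ^ 3 \<le> s ^ 2" using s by (intro power_decreasing) auto
    then have mm: "10 * C\<^sup>2 * min (s\<^sup>2) (s ^ 3) \<le> 10 * C\<^sup>2 * s\<^sup>2" by (intro mult_left_mono) auto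
    have "f2 x * g y * d\<^sup>2 \<le> C * C * s\<^sup>2" "f1 x * g1 y * (d * e) \<le> C * C * s\<^sup>2" "f x * g2 y * e\<^sup>2 \<le> C * C * s\<^sup>2"
      using sq by (intro bd m'; simp)+
    then have "(f2 x * g y * d\<^sup>2 + 2 * f1 x * g1 y * (d * e) + f x * g2 y * e\<^sup>2) / 2 \<le> 2 * C\<^sup>2 * s\<^sup>2"
      by (simp add: power2_eq_square[of C])
    moreover have "\<bar>d\<bar> + \<bar>e\<bar> = s" using d by (simp add: s_def)
    ultimately have "f (x + d) * g (y + e) \<le> f x * g y + (f1 x * g y * d + f x * g1 y * e) + 12 * (C\<^sup>2 * s\<^sup>2)"
    proof -
      assume q: "(f2 x * g y * d\<^sup>2 + 2 * f1 x * g1 y * (d * e) + f x * g2 y * e\<^sup>2) / 2 \<le> 2 * C\<^sup>2 * s\<^sup>2"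
        and de: "\<bar>d\<bar> + \<bar>e\<bar> = s"
      show ?thesis
        using product_taylor[OF f g, of x d y e] mm q unfolding de abs_le_iff by linarith
    qed
    also have "12 * (C\<^sup>2 * s\<^sup>2) \<le> 20 * (C\<^sup>2 * s\<^sup>2)" by simp
    also have "\<dots> = 20 * C\<^sup>2 * (s * min 1 s)" using True by (simp add: power2_eq_square)
    finally show ?thesis by (simp add: s_def)
  next
    case False
    have "f (x + d) * g (y + e) \<le> C * C" "- (f x * g y) \<le> C * C"
      using m[OF b(1) b(4), of "x + d" "y + e"] m[OF b(1) b(4), of x y] by linarith+
    moreover have "- (f1 x * g y * d) \<le> C * C * s" "- (f x * g1 y * e) \<le> C * C * s"
      using d s by (intro bd' m'; simp)+
    moreover have "C * C * 1 \<le> C * C * s" using False by (intro mult_left_mono) auto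
    ultimately have "f (x + d) * g (y + e) \<le> f x * g y + (f1 x * g y * d + f x * g1 y * e) + 4 * (C * C * s)"
      by linarith
    also have "4 * (C * C * s) \<le> 20 * (C * C * s)" using s C by simp
    also have "\<dots> = 20 * C\<^sup>2 * (s * min 1 s)" using False by (simp add: power2_eq_square)
    finally show ?thesis by (simp add: s_def)
  qed
qed

section \<open>Uniform grids\<close>

definition grid :: "real \<Rightarrow> real \<Rightarrow> nat \<Rightarrow> nat \<Rightarrow> real" where
  "grid a b n i = a + (b - a) * real i / real (Suc n)"

lemma grid_0[simp]: "grid a b n 0 = a" and grid_last[simp]: "grid a b n (Suc n) = b"
  by (simp_all add: grid_def)

lemma grid_mono: "a \<le> b \<Longrightarrow> i \<le> j \<Longrightarrow> grid a b n i \<le> grid a b n j"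
  by (simp add: grid_def divide_right_mono mult_left_mono)

lemma grid_step: "grid a b n (Suc i) - grid a b n i = (b - a) / real (Suc n)"
proof -
  have "(b - a) * real (Suc i) / real (Suc n) - (b - a) * real i / real (Suc n) = ((b - a) * real (Suc i) - (b - a) * real i) / real (Suc n)"
    by (rule diff_divide_distrib[symmetric])
  also have "(b - a) * real (Suc i) - (b - a) * real i = b - a"
    by (simp add: algebra_simps)
  finally show ?thesis by (simp add: grid_def)
qed

lemma grid_bounds: "a \<le> b \<Longrightarrow> i \<le> Suc n \<Longrightarrow> a \<le> grid a b n i \<and> grid a b n i \<le> b"
  using grid_mono[of a b 0 i n] grid_mono[of a b i "Suc n" n] by simp

text \<open>Cells are open on the left and closed on the right, so the index is a ceiling minus 1.
  The number of cells is \<open>Suc n\<close>, which keeps the mesh meaningful for n = 0.\<close>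

definition grid_idx :: "real \<Rightarrow> real \<Rightarrow> nat \<Rightarrow> real \<Rightarrow> nat" where
  "grid_idx a b n r = nat (\<lceil>(r - a) * real (Suc n) / (b - a)\<rceil> - 1)"

lemma grid_idx:
  assumes "r \<in> {a<..b}"
  shows "grid_idx a b n r < Suc n" "grid a b n (grid_idx a b n r) < r" "r \<le> grid a b n (Suc (grid_idx a b n r))"
proof -
  define x where "x = (r - a) * real (Suc n) / (b - a)"
  have ba: "0 < b - a" using assms by auto
  have x: "0 < x" using assms by (simp add: x_def)
  have "(r - a) * real (Suc n) \<le> (b - a) * real (Suc n)" using assms by (intro mult_right_mono) auto
  then have x': "x \<le> real (Suc n)" using ba unfolding x_def by (simp add: pos_divide_le_eq mult.commute)
  have c: "1 \<le> \<lceil>x\<rceil>" "\<lceil>x\<rceil> \<le> int (Suc n)" using x x' by (simp_all add: one_le_ceiling ceiling_le_iff)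
  have i: "real (grid_idx a b n r) = of_int \<lceil>x\<rceil> - 1" using c by (simp add: grid_idx_def x_def)
  show "grid_idx a b n r < Suc n" using c by (auto simp: grid_idx_def x_def)
  have r: "r = a + (b - a) * x / real (Suc n)"
  proof -
    define N where "N = real (Suc n)"
    have "N \<noteq> 0" by (simp add: N_def)
    then show ?thesis using ba unfolding x_def N_def[symmetric] by simp
  qed
  have "of_int \<lceil>x\<rceil> - 1 < x" "x \<le> of_int \<lceil>x\<rceil>" by linarith+
  then have *: "real (grid_idx a b n r) < x" "x \<le> real (Suc (grid_idx a b n r))" using i by simp_all
  show "grid a b n (grid_idx a b n r) < r"
    unfolding grid_def by (subst (2) r) (use * ba in \<open>intro add_strict_left_mono divide_strict_right_mono mult_strict_left_mono; simp\<close>)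
  show "r \<le> grid a b n (Suc (grid_idx a b n r))"
    unfolding grid_def by (subst (1) r) (use * ba in \<open>intro add_left_mono divide_right_mono mult_left_mono; simp\<close>)
qed

lemma grid_cell_unique:
  assumes "a \<le> b" "r \<in> {grid a b n i<..grid a b n (Suc i)}" "r \<in> {grid a b n j<..grid a b n (Suc j)}"
  shows "i = j"
proof (rule ccontr)
  assume "i \<noteq> j"
  then consider "Suc i \<le> j" | "Suc j \<le> i" by linarith
  then show False
    using grid_mono[OF assms(1), of "Suc i" j n] grid_mono[OF assms(1), of "Suc j" i n] assms(2,3) by cases auto
qed

text \<open>The cells partition (a, b], so at most one indicator is nonzero and the sum collapses to
  the term of the cell that contains r.\<close>

lemma grid_sum:
  fixes h :: "nat \<Rightarrow> real"
  assumes "a \<le> b"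
  shows "(\<Sum>i<Suc n. indicat_real {grid a b n i<..grid a b n (Suc i)} r * h i) = indicat_real {a<..b} r * h (grid_idx a b n r)"
proof (cases "r \<in> {a<..b}")
  case True
  let ?i = "grid_idx a b n r"
  have cell: "r \<in> {grid a b n ?i<..grid a b n (Suc ?i)}" using grid_idx[OF True] by auto
  have "(\<Sum>i<Suc n. indicat_real {grid a b n i<..grid a b n (Suc i)} r * h i) = (\<Sum>i<Suc n. if i = ?i then h i else 0)"
  proof (intro sum.cong refl)
    fix i
    show "indicat_real {grid a b n i<..grid a b n (Suc i)} r * h i = (if i = ?i then h i else 0)"
    proof (cases "i = ?i")
      case True
      then show ?thesis using cell by simp
    next
      case False
      then have "r \<notin> {grid a b n i<..grid a b n (Suc i)}" using grid_cell_unique[OF assms cell] by blast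
      then show ?thesis using False by simp
    qed
  qed
  also have "\<dots> = h ?i" using grid_idx(1)[OF True, of n] by (subst sum.delta) simp_all
  finally show ?thesis using True by simp
next
  case False
  have "indicat_real {grid a b n i<..grid a b n (Suc i)} r = 0" if "i < Suc n" for i
    using grid_bounds[OF assms, of i n] grid_bounds[OF assms, of "Suc i" n] that False by (auto simp: indicator_def)
  then have "(\<Sum>i<Suc n. indicat_real {grid a b n i<..grid a b n (Suc i)} r * h i) = 0"
    by (intro sum.neutral) auto
  then show ?thesis using False by simp
qed

text \<open>A continuous path is the limit of its values at the times floor((n + 1) r) / (n + 1),
  and these depend on r through an integer, that is, through a countable parameter.\<close>

lemma jointly_measurable_continuous:
  fixes X :: "real \<Rightarrow> 'w \<Rightarrow> real"
  assumes m: "\<And>r. X r \<in> borel_measurable M" and c: "\<And>\<omega>. \<omega> \<in> space M \<Longrightarrow> continuous_on UNIV (\<lambda>r. X r \<omega>)"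
  shows "(\<lambda>p. X (snd p) (fst p)) \<in> borel_measurable (M \<Otimes>\<^sub>M lborel)"
proof (rule borel_measurable_LIMSEQ_real)
  fix p :: "'w \<times> real" assume "p \<in> space (M \<Otimes>\<^sub>M lborel)"
  then have cp: "continuous_on UNIV (\<lambda>r. X r (fst p))" using c by (auto simp: space_pair_measure)
  have "(\<lambda>n. of_int \<lfloor>real (Suc n) * snd p\<rfloor> / real (Suc n)) \<longlonglongrightarrow> snd p"
  proof (rule LIMSEQ_I)
    fix e :: real assume "0 < e"
    then obtain N where N: "inverse (real (Suc N)) < e" using reals_Archimedean by blast
    show "\<exists>N. \<forall>n\<ge>N. norm (of_int \<lfloor>real (Suc n) * snd p\<rfloor> / real (Suc n) - snd p) < e"
    proof (intro exI allI impI)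
      fix n assume n: "N \<le> n"
      define y where "y = real (Suc n) * snd p"
      have sp: "snd p = y / real (Suc n)" by (simp add: y_def)
      have "\<bar>of_int \<lfloor>y\<rfloor> - y\<bar> \<le> 1" by linarith
      then have "\<bar>(of_int \<lfloor>y\<rfloor> - y) / real (Suc n)\<bar> \<le> 1 / real (Suc n)"
        by (simp add: abs_divide divide_right_mono)
      also have "\<dots> \<le> inverse (real (Suc N))" using n by (simp add: field_simps)
      finally show "norm (of_int \<lfloor>real (Suc n) * snd p\<rfloor> / real (Suc n) - snd p) < e"
        using N unfolding y_def[symmetric] by (subst sp) (simp add: diff_divide_distrib)
    qed
  qed
  then show "(\<lambda>n. X (of_int \<lfloor>real (Suc n) * snd p\<rfloor> / real (Suc n)) (fst p)) \<longlonglongrightarrow> X (snd p) (fst p)"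
    using continuous_on_tendsto_compose[OF cp] by auto
next
  fix n
  note [measurable] = m
  show "(\<lambda>p. X (of_int \<lfloor>real (Suc n) * snd p\<rfloor> / real (Suc n)) (fst p)) \<in> borel_measurable (M \<Otimes>\<^sub>M lborel)"
    by (rule measurable_compose_countable[where f = "\<lambda>k p. X (of_int k / real (Suc n)) (fst p)"]) measurable
qed

section \<open>Limits of sums over grid cells and cubic error terms\<close>

context brownian_basis
begin

text \<open>H s t is to be evaluated on the cell (s, t] that contains the time of p, and dominated
  convergence applies with majorant D. Convergence is required along all end points closing in on
  that time with S strictly below it, which left continuity of the integrand can guarantee.\<close>

lemma grid_limit:
  fixes H :: "real \<Rightarrow> real \<Rightarrow> 'w \<times> real \<Rightarrow> real"
  assumes ab: "a \<le> b"
    and H: "\<And>s t. a \<le> s \<Longrightarrow> s \<le> t \<Longrightarrow> t \<le> b \<Longrightarrow> H s t \<in> borel_measurable P"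
    and D: "integrable P D" "\<And>s t p. a \<le> s \<Longrightarrow> s < snd p \<Longrightarrow> snd p \<le> t \<Longrightarrow> t \<le> b \<Longrightarrow> p \<in> space P \<Longrightarrow> \<bar>H s t p\<bar> \<le> D p"
    and [measurable]: "H0 \<in> borel_measurable P"
    and lim: "AE p in P. snd p \<in> {a<..b} \<longrightarrow> (\<forall>S R. (\<forall>n. a \<le> S n \<and> S n < snd p \<and> snd p \<le> R n \<and> R n \<le> b) \<longrightarrow>
        S \<longlonglongrightarrow> snd p \<longrightarrow> R \<longlonglongrightarrow> snd p \<longrightarrow> (\<lambda>n. H (S n) (R n) p) \<longlonglongrightarrow> H0 p)"
  shows "\<And>n i. i < Suc n \<Longrightarrow> integrable P (\<lambda>p. indicat_real {grid a b n i<..grid a b n (Suc i)} (snd p) * H (grid a b n i) (grid a b n (Suc i)) p)"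
    and "(\<lambda>n. \<Sum>i<Suc n. \<integral>p. indicat_real {grid a b n i<..grid a b n (Suc i)} (snd p) * H (grid a b n i) (grid a b n (Suc i)) p \<partial>P)
       \<longlonglongrightarrow> (\<integral>p. indicat_real {a<..b} (snd p) * H0 p \<partial>P)"
proof -
  have ok: "a \<le> grid a b n i" "grid a b n i \<le> grid a b n (Suc i)" "grid a b n (Suc i) \<le> b" if "i < Suc n" for n i
    using grid_bounds[OF ab, of i n] grid_bounds[OF ab, of "Suc i" n] grid_mono[OF ab, of i "Suc i" n] that by auto
  show int: "integrable P (\<lambda>p. indicat_real {grid a b n i<..grid a b n (Suc i)} (snd p) * H (grid a b n i) (grid a b n (Suc i)) p)"
    if i: "i < Suc n" for n i
  proof (rule Bochner_Integration.integrable_bound[OF D(1)])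
    note [measurable] = H[OF ok[OF i]]
    show "(\<lambda>p. indicat_real {grid a b n i<..grid a b n (Suc i)} (snd p) * H (grid a b n i) (grid a b n (Suc i)) p) \<in> borel_measurable P"
      by measurable
    show "AE p in P. norm (indicat_real {grid a b n i<..grid a b n (Suc i)} (snd p) * H (grid a b n i) (grid a b n (Suc i)) p) \<le> norm (D p)"
      using D(2)[OF ok(1)[OF i] _ _ ok(3)[OF i]] by (intro AE_I2) (force split: split_indicator)
  qed
  let ?S = "\<lambda>n p. \<Sum>i<Suc n. indicat_real {grid a b n i<..grid a b n (Suc i)} (snd p) * H (grid a b n i) (grid a b n (Suc i)) p"
  have eq: "?S n p = indicat_real {a<..b} (snd p) * H (grid a b n (grid_idx a b n (snd p))) (grid a b n (Suc (grid_idx a b n (snd p)))) p" for n p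
    by (rule grid_sum[OF ab])
  have "(\<lambda>n. \<integral>p. ?S n p \<partial>P) \<longlonglongrightarrow> (\<integral>p. indicat_real {a<..b} (snd p) * H0 p \<partial>P)"
  proof (rule integral_dominated_convergence[where w = "\<lambda>p. \<bar>D p\<bar>"])
    show "integrable P (\<lambda>p. \<bar>D p\<bar>)" using D(1) by simp
    show "(\<lambda>p. indicat_real {a<..b} (snd p) * H0 p) \<in> borel_measurable P" by measurable
    show "?S n \<in> borel_measurable P" for n using int by (intro borel_measurable_sum) auto
    show "AE p in P. norm (?S n p) \<le> \<bar>D p\<bar>" for n
    proof (intro AE_I2)
      fix p assume p: "p \<in> space P"
      show "norm (?S n p) \<le> \<bar>D p\<bar>"
      proof (cases "snd p \<in> {a<..b}")
        case True
        note gi = grid_idx[OF True, of n]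
        show ?thesis unfolding eq
          using D(2)[OF ok(1)[OF gi(1)] gi(2,3) ok(3)[OF gi(1)] p] True by simp
      next
        case False
        then show ?thesis unfolding eq by simp
      qed
    qed
    show "AE p in P. (\<lambda>n. ?S n p) \<longlonglongrightarrow> indicat_real {a<..b} (snd p) * H0 p"
      using lim
    proof eventually_elim
      case (elim p)
      show ?case
      proof (cases "snd p \<in> {a<..b}")
        case True
        define S where "S = (\<lambda>n. grid a b n (grid_idx a b n (snd p)))"
        define R where "R = (\<lambda>n. grid a b n (Suc (grid_idx a b n (snd p))))"
        have b: "\<forall>n. a \<le> S n \<and> S n < snd p \<and> snd p \<le> R n \<and> R n \<le> b"
          using grid_idx[OF True] ok by (auto simp: S_def R_def)
        have RS: "R n - S n = (b - a) / real (Suc n)" for n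
          unfolding R_def S_def by (rule grid_step)
        have z: "(\<lambda>n. (b - a) / real (Suc n)) \<longlonglongrightarrow> 0"
          by (rule LIMSEQ_Suc[OF lim_const_over_n])
        have "S \<longlonglongrightarrow> snd p"
        proof (rule tendsto_sandwich[OF _ _ _ tendsto_const])
          show "\<forall>\<^sub>F n in sequentially. snd p - (b - a) / real (Suc n) \<le> S n" 
          proof (intro always_eventually allI)
            fix n show "snd p - (b - a) / real (Suc n) \<le> S n" using b[rule_format, of n] RS[of n] by linarith
          qed
          show "\<forall>\<^sub>F n in sequentially. S n \<le> snd p" using b by (auto intro!: always_eventually less_imp_le)
          show "(\<lambda>n. snd p - (b - a) / real (Suc n)) \<longlonglongrightarrow> snd p" using tendsto_diff[OF tendsto_const z, of "snd p"] by simp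
        qed
        moreover have "R \<longlonglongrightarrow> snd p"
        proof (rule tendsto_sandwich[OF _ _ tendsto_const])
          show "\<forall>\<^sub>F n in sequentially. R n \<le> snd p + (b - a) / real (Suc n)" 
          proof (intro always_eventually allI)
            fix n show "R n \<le> snd p + (b - a) / real (Suc n)" using b[rule_format, of n] RS[of n] by linarith
          qed
          show "\<forall>\<^sub>F n in sequentially. snd p \<le> R n" using b by (auto intro!: always_eventually)
          show "(\<lambda>n. snd p + (b - a) / real (Suc n)) \<longlonglongrightarrow> snd p" using tendsto_add[OF tendsto_const z, of "snd p"] by simp
        qed
        ultimately have "(\<lambda>n. H (S n) (R n) p) \<longlonglongrightarrow> H0 p"
          using elim True b by blast
        then show ?thesis using True unfolding eq by (simp add: S_def R_def)
      next
        case False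
        then show ?thesis unfolding eq by simp
      qed
    qed
  qed
  also have "(\<lambda>n. \<integral>p. ?S n p \<partial>P) = (\<lambda>n. \<Sum>i<Suc n. \<integral>p. indicat_real {grid a b n i<..grid a b n (Suc i)} (snd p) * H (grid a b n i) (grid a b n (Suc i)) p \<partial>P)"
    using int by (intro ext Bochner_Integration.integral_sum) auto
  finally show "(\<lambda>n. \<Sum>i<Suc n. \<integral>p. indicat_real {grid a b n i<..grid a b n (Suc i)} (snd p) * H (grid a b n i) (grid a b n (Suc i)) p \<partial>P)
       \<longlonglongrightarrow> (\<integral>p. indicat_real {a<..b} (snd p) * H0 p \<partial>P)" .
qed

lemma increment_third_moment:
  assumes st: "0 \<le> s" "s < t"
  defines "c \<equiv> real CARD('d) + 3 * (real CARD('d))\<^sup>2"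
  shows "integrable M (\<lambda>\<omega>. norm (W t \<omega> - W s \<omega>) ^ 3)"
    and "(\<integral>\<omega>. norm (W t \<omega> - W s \<omega>) ^ 3 \<partial>M) \<le> c * ((t - s) * sqrt (t - s))"
proof -
  define h where "h = t - s"
  define k where "k = sqrt h"
  have h: "0 < h" and k: "0 < k" "k\<^sup>2 = h" using st by (auto simp: h_def k_def)
  let ?X = "\<lambda>\<omega>. W t \<omega> - W s \<omega>"
  have mX: "?X \<in> borel_measurable M"
    using st by (intro borel_measurable_diff W_measurable) auto
  note mom = gaussian_vec_moment[OF W_increment(1)[OF st] k(1)[unfolded k_def h_def]]
  have m2: "integrable M (\<lambda>\<omega>. (?X \<omega> $ i)\<^sup>2)" "(\<integral>\<omega>. (?X \<omega> $ i)\<^sup>2 \<partial>M) = h" for i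
    using mom(3)[of i i] mom(4)[of i i] h by (simp_all add: power2_eq_square h_def)
  have "sqrt (t - s) ^ 4 = h\<^sup>2" using k(2) unfolding k_def h_def by (metis power_mult num_double numeral_times_numeral)
  then have m4: "integrable M (\<lambda>\<omega>. (?X \<omega> $ i) ^ 4)" "(\<integral>\<omega>. (?X \<omega> $ i) ^ 4 \<partial>M) = 3 * h\<^sup>2" for i
    using mom(5)[of i] mom(6)[of i] by simp_all
  let ?B = "\<lambda>\<omega>. (k * (\<Sum>i\<in>UNIV. (?X \<omega> $ i)\<^sup>2) + real CARD('d) * (\<Sum>i\<in>UNIV. (?X \<omega> $ i) ^ 4) / k) / 2"
  have B: "norm (?X \<omega>) ^ 3 \<le> ?B \<omega>" for \<omega>
  proof -
    define x where "x = norm (?X \<omega>)"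
    have x2: "x\<^sup>2 = (\<Sum>i\<in>UNIV. (?X \<omega> $ i)\<^sup>2)"
      by (simp add: x_def norm_vec_def L2_set_def sum_nonneg)
    have "x ^ 4 = (\<Sum>i\<in>UNIV. 1 * (?X \<omega> $ i)\<^sup>2)\<^sup>2" using x2 by (simp add: power2_eq_square power4_eq_xxxx)
    also have "\<dots> \<le> (\<Sum>i\<in>(UNIV::'d set). 1\<^sup>2) * (\<Sum>i\<in>UNIV. ((?X \<omega> $ i)\<^sup>2)\<^sup>2)"
      by (rule Cauchy_Schwarz_ineq_sum)
    also have "\<dots> = real CARD('d) * (\<Sum>i\<in>UNIV. (?X \<omega> $ i) ^ 4)" by (simp add: power_mult[symmetric])
    finally have x4: "x ^ 4 \<le> real CARD('d) * (\<Sum>i\<in>UNIV. (?X \<omega> $ i) ^ 4)" .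
    \<comment> \<open>Interpolation between the second and the fourth moment: for k = sqrt h both k
      x^2 and x^4 / k have expectation of order h sqrt h.\<close>
    have "0 \<le> (k - x)\<^sup>2 * x\<^sup>2" by simp
    then have "2 * (k * x ^ 3) \<le> k\<^sup>2 * x\<^sup>2 + x ^ 4" by (simp add: power2_diff algebra_simps power2_eq_square power3_eq_cube power4_eq_xxxx)
    also have "\<dots> \<le> k\<^sup>2 * x\<^sup>2 + real CARD('d) * (\<Sum>i\<in>UNIV. (?X \<omega> $ i) ^ 4)" using x4 by simp
    finally have "x ^ 3 \<le> (k * x\<^sup>2 + real CARD('d) * (\<Sum>i\<in>UNIV. (?X \<omega> $ i) ^ 4) / k) / 2"
      using k by (simp add: field_simps power2_eq_square)
    then show ?thesis unfolding x2 by (simp only: x_def)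
  qed
  have iB: "integrable M ?B" using m2(1) m4(1) by simp
  show i3: "integrable M (\<lambda>\<omega>. norm (?X \<omega>) ^ 3)"
  proof (rule Bochner_Integration.integrable_bound[OF iB])
    show "(\<lambda>\<omega>. norm (?X \<omega>) ^ 3) \<in> borel_measurable M" using mX by measurable
    show "AE \<omega> in M. norm (norm (?X \<omega>) ^ 3) \<le> norm (?B \<omega>)"
    proof (intro AE_I2)
      fix \<omega>
      show "norm (norm (?X \<omega>) ^ 3) \<le> norm (?B \<omega>)"
        using B[of \<omega>] abs_ge_self[of "?B \<omega>"] unfolding real_norm_def by simp
    qed
  qed
  have "(\<integral>\<omega>. norm (?X \<omega>) ^ 3 \<partial>M) \<le> (\<integral>\<omega>. ?B \<omega> \<partial>M)"
    by (rule integral_mono[OF i3 iB B])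
  also have "\<dots> = (k * (real CARD('d) * h) + real CARD('d) * (real CARD('d) * (3 * h\<^sup>2)) / k) / 2"
    using m2 m4 by simp
  also have "\<dots> = (real CARD('d) * (h * k) + 3 * (real CARD('d))\<^sup>2 * (h\<^sup>2 / k)) / 2"
    by (simp add: power2_eq_square mult_ac)
  also have "h\<^sup>2 / k = h * k" using k by (simp add: power2_eq_square field_simps)
  also have "(real CARD('d) * (h * k) + 3 * (real CARD('d))\<^sup>2 * (h * k)) / 2 = c / 2 * (h * k)"
    by (simp add: c_def distrib_right)
  also have "\<dots> \<le> c * (h * k)"
    using h k by (simp add: c_def)
  finally show "(\<integral>\<omega>. norm (?X \<omega>) ^ 3 \<partial>M) \<le> c * ((t - s) * sqrt (t - s))"
    by (simp add: h_def k_def)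
qed

lemma elem_bounded:
  assumes "elem_ok a L"
  shows "\<exists>B\<ge>0. \<forall>p\<in>space P. norm (elem_val L p) \<le> B"
  using assms
proof (induction L)
  case Nil
  then show ?case by (auto intro: exI[of _ 0])
next
  case (Cons e L)
  obtain u v \<xi> where e: "e = (u, v, \<xi>)" by (cases e)
  with Cons obtain C B where C: "\<And>\<omega>. \<omega> \<in> space M \<Longrightarrow> norm (\<xi> \<omega>) \<le> C" and B: "0 \<le> B" "\<And>p. p \<in> space P \<Longrightarrow> norm (elem_val L p) \<le> B"
    by (auto simp: elem_Cons)
  have "norm (elem_val (e # L) p) \<le> \<bar>C\<bar> + B" if p: "p \<in> space P" for p
  proof -
    have "norm (\<xi> (fst p)) \<le> \<bar>C\<bar>" using C[of "fst p"] p by (auto simp: space_pair_measure)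
    then have "norm (indicat_real {u<..v} (snd p) *\<^sub>R \<xi> (fst p)) \<le> \<bar>C\<bar>" by (auto split: split_indicator)
    then show ?thesis unfolding e elem_Cons by (intro norm_triangle_le add_mono B p)
  qed
  then show ?case using B by (intro exI[of _ "\<bar>C\<bar> + B"]) auto
qed

text \<open>Only triples with u < r are active at time r, and their values are already known at time
  u.\<close>

lemma elem_adapted:
  assumes "elem_ok a L"
  shows "(\<lambda>\<omega>. elem_val L (\<omega>, r)) \<in> borel_measurable (F r)"
  using assms
proof (induction L)
  case Nil
  then show ?case by simp
next
  case (Cons e L)
  obtain u v \<xi> where e: "e = (u, v, \<xi>)" by (cases e)
  have "(\<lambda>\<omega>. indicat_real {u<..v} r *\<^sub>R \<xi> \<omega>) \<in> borel_measurable (F r)"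
  proof (cases "u < r")
    case True
    then have "\<xi> \<in> borel_measurable (F r)" using Cons.prems by (auto simp: e elem_Cons intro: measurable_F_mono)
    then show ?thesis by simp
  qed simp
  with Cons show ?case by (simp add: e elem_Cons)
qed

text \<open>Indicators of (u, v] are left continuous. Freezing an elementary integrand at the left
  ends of shrinking cells therefore recovers it in the limit.\<close>

lemma elem_left_continuous:
  assumes S: "S \<longlonglongrightarrow> r" "\<And>n. S n < r"
  shows "(\<lambda>n. elem_val L (\<omega>, S n)) \<longlonglongrightarrow> elem_val L (\<omega>, r)"
proof (induction L)
  case Nil
  then show ?case by simp
next
  case (Cons e L)
  obtain u v \<xi> where e: "e = (u, v, \<xi>)" by (cases e)
  have "\<forall>\<^sub>F n in sequentially. indicat_real {u<..v} (S n) = indicat_real {u<..v} r"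
  proof -
    consider "u < r \<and> r \<le> v" | "r \<le> u" | "v < r" by linarith
    then show ?thesis
    proof cases
      case 1
      then have "\<forall>\<^sub>F n in sequentially. u < S n" using S by (auto dest: order_tendstoD(1))
      then show ?thesis by eventually_elim (use 1 S(2) less_imp_le[OF order_less_le_trans] in \<open>auto simp: indicator_def\<close>)
    next
      case 2
      then show ?thesis using less_le_trans[OF S(2) 2] by (intro always_eventually) (auto simp: indicator_def dest: order_less_imp_not_less)
    next
      case 3
      then have "\<forall>\<^sub>F n in sequentially. v < S n" using S by (auto dest: order_tendstoD(1))
      then show ?thesis by eventually_elim (use 3 in \<open>auto simp: indicator_def\<close>)
    qed
  qed
  then have "(\<lambda>n. indicat_real {u<..v} (S n)) \<longlonglongrightarrow> indicat_real {u<..v} r"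
    by (rule tendsto_eventually)
  then show ?case unfolding e elem_Cons by (auto intro!: tendsto_intros Cons)
qed


lemma AE_fst:
  assumes "AE \<omega> in M. Q \<omega>" shows "AE p in P. Q (fst p)"
proof -
  from assms obtain N where N: "N \<in> null_sets M" "{\<omega> \<in> space M. \<not> Q \<omega>} \<subseteq> N"
    by (auto elim!: AE_E intro: null_setsI)
  show ?thesis
  proof (rule AE_I')
    show "N \<times> UNIV \<in> null_sets P"
      using null_setsD1[OF N(1)] null_setsD2[OF N(1)] lborel.emeasure_pair_measure_Times[of N M UNIV]
      by (intro null_setsI) auto
    show "{p \<in> space P. \<not> Q (fst p)} \<subseteq> N \<times> UNIV" using N(2) by (auto simp: space_pair_measure)
  qed
qed

lemma integrable_strip: "integrable P (\<lambda>p. indicat_real {a<..b} (snd p))"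
proof -
  have "has_bochner_integral lborel (indicat_real {a<..b}) (measure lborel {a<..b})"
  proof (rule has_bochner_integral_real_indicator)
    have "{a<..b} \<subseteq> {a..b}" by auto
    then show "emeasure lborel {a<..b} < \<infinity>"
      using emeasure_bounded_finite[OF bounded_subset[OF bounded_closed_interval]] by simp
  qed simp
  moreover have "has_bochner_integral M (\<lambda>_. 1::real) 1"
    by (simp add: has_bochner_integral_iff prob_space)
  ultimately have "has_bochner_integral P (\<lambda>p. 1 * indicat_real {a<..b} (snd p)) (1 * measure lborel {a<..b})"
    by (intro P.has_bochner_integral_mult)
  then show ?thesis by (simp add: has_bochner_integral_iff)
qed

text \<open>The BSDE provides integrals from t up to the terminal time; subtracting two of them
  gives the integral over a cell, and as an integral started at s it is orthogonal to the past of
  s.\<close>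

lemma ito_cell:
  assumes N: "\<And>t. t \<in> {a..b} \<Longrightarrow> ito t (\<lambda>p. indicat_real {t<..b} (snd p) *\<^sub>R f p) (N t)"
    and st: "a \<le> s" "s \<le> t" "t \<le> b"
  shows "ito s (\<lambda>p. indicat_real {s<..t} (snd p) *\<^sub>R f p) (\<lambda>\<omega>. N s \<omega> - N t \<omega>)"
proof -
  have "(\<lambda>p. indicat_real {s<..b} (snd p) *\<^sub>R f p - indicat_real {t<..b} (snd p) *\<^sub>R f p)
     = (\<lambda>p. indicat_real {s<..t} (snd p) *\<^sub>R f p)"
    using st by (intro ext) (auto split: split_indicator)
  moreover have "ito s (\<lambda>p. indicat_real {s<..b} (snd p) *\<^sub>R f p - indicat_real {t<..b} (snd p) *\<^sub>R f p) (\<lambda>\<omega>. N s \<omega> - N t \<omega>)"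
    using st by (intro ito_diff N ito_mono[OF N]) auto
  ultimately show ?thesis by simp
qed

text \<open>L frozen at s is a single elementary integrand on the cell. Its integral
  \<open>?e\<close> is at most B times the Brownian increment, which gives the cubic part; by the
  isometry, the square of the remaining part has the integral over the cell as its expectation. The
  factors 4 and 8 come from \<open>min_sq_cube_add\<close>.\<close>

lemma ito_cell_min_sq_cube:
  assumes a: "0 \<le> a"
    and N: "\<And>t. t \<in> {a..b} \<Longrightarrow> ito t (\<lambda>p. indicat_real {t<..b} (snd p) *\<^sub>R f p) (N t)"
    and L: "elem_ok a L" and B: "\<And>p. p \<in> space P \<Longrightarrow> norm (elem_val L p) \<le> B"
    and st: "a \<le> s" "s < t" "t \<le> b"
  defines "c \<equiv> real CARD('d) + 3 * (real CARD('d))\<^sup>2"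
  shows "(\<integral>\<omega>. min_sq_cube (N s \<omega> - N t \<omega>) \<partial>M) \<le>
      4 * (\<integral>p. indicat_real {s<..t} (snd p) * (norm (f p - elem_val L (fst p, s)))\<^sup>2 \<partial>P) + 8 * B ^ 3 * c * ((t - s) * sqrt (t - s))"
proof -
  have s0: "0 \<le> s" using a st by simp
  let ?v = "\<lambda>\<omega>. elem_val L (\<omega>, s)"
  have Bv: "norm (?v \<omega>) \<le> B" if "\<omega> \<in> space M" for \<omega>
    using B[of "(\<omega>, s)"] that by (auto simp: space_pair_measure)
  have ok: "elem_ok s [(s, t, ?v)]"
    using st Bv elem_adapted[OF L, of s] by (auto simp: elem_Cons)
  let ?\<delta> = "\<lambda>\<omega>. N s \<omega> - N t \<omega>"
  let ?e = "elem_int [(s, t, ?v)]"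
  have cell: "ito s (\<lambda>p. indicat_real {s<..t} (snd p) *\<^sub>R f p) ?\<delta>"
    using st by (intro ito_cell[OF N]) auto
  have d: "ito s (\<lambda>p. indicat_real {s<..t} (snd p) *\<^sub>R f p - elem_val [(s, t, ?v)] p) (\<lambda>\<omega>. ?\<delta> \<omega> - ?e \<omega>)"
    by (rule ito_diff[OF cell ito_elem[OF s0 ok]])
  have sq: "sq_int M (\<lambda>\<omega>. ?\<delta> \<omega> - ?e \<omega>)" "sq_int M ?\<delta>"
    using ito_sq_int(2)[OF d] ito_sq_int(2)[OF cell] by auto
  have "(\<integral>\<omega>. 1 * ((?\<delta> \<omega> - ?e \<omega>) * (?\<delta> \<omega> - ?e \<omega>)) \<partial>M) =
     (\<integral>p. 1 * ((indicat_real {s<..t} (snd p) *\<^sub>R f p - elem_val [(s, t, ?v)] p) \<bullet> (indicat_real {s<..t} (snd p) *\<^sub>R f p - elem_val [(s, t, ?v)] p)) \<partial>P)"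
    by (rule ito_isometry[OF s0 d d, of _ 1]) auto
  also have "\<dots> = (\<integral>p. indicat_real {s<..t} (snd p) * (norm (f p - elem_val L (fst p, s)))\<^sup>2 \<partial>P)"
    by (intro Bochner_Integration.integral_cong refl) (simp add: elem_Cons power2_norm_eq_inner split: split_indicator)
  finally have iso: "(\<integral>\<omega>. (?\<delta> \<omega> - ?e \<omega>)\<^sup>2 \<partial>M) = (\<integral>p. indicat_real {s<..t} (snd p) * (norm (f p - elem_val L (fst p, s)))\<^sup>2 \<partial>P)"
    by (simp add: power2_eq_square)
  have "space M \<noteq> {}" by (rule not_empty)
  then have B0: "0 \<le> B" using Bv order_trans[OF norm_ge_zero] by blast
  have e3: "\<bar>?e \<omega>\<bar> ^ 3 \<le> B ^ 3 * norm (W t \<omega> - W s \<omega>) ^ 3" if "\<omega> \<in> space M" for \<omega>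
  proof -
    have "\<bar>?e \<omega>\<bar> \<le> B * norm (W t \<omega> - W s \<omega>)"
      using Cauchy_Schwarz_ineq2[of "?v \<omega>" "W t \<omega> - W s \<omega>"] mult_right_mono[OF Bv[OF that] norm_ge_zero[of "W t \<omega> - W s \<omega>"]]
      by (simp add: elem_Cons)
    then show ?thesis by (simp add: power_mult_distrib[symmetric] power_mono)
  qed
  note third = increment_third_moment[OF s0 st(2)]
  have "(\<integral>\<omega>. min_sq_cube (?\<delta> \<omega>) \<partial>M) \<le> (\<integral>\<omega>. 4 * (?\<delta> \<omega> - ?e \<omega>)\<^sup>2 + 8 * (B ^ 3 * norm (W t \<omega> - W s \<omega>) ^ 3) \<partial>M)"
  proof (rule integral_mono)
    have [measurable]: "?\<delta> \<in> borel_measurable M" using sq(2) by (rule sq_int_measurable)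
    have i2: "integrable M (\<lambda>\<omega>. (?\<delta> \<omega>)\<^sup>2)" "integrable M (\<lambda>\<omega>. (?\<delta> \<omega> - ?e \<omega>)\<^sup>2)" using sq by (auto simp: sq_int_def)
    show "integrable M (\<lambda>\<omega>. min_sq_cube (?\<delta> \<omega>))"
    proof (rule Bochner_Integration.integrable_bound[OF i2(1)])
      show "(\<lambda>\<omega>. min_sq_cube (?\<delta> \<omega>)) \<in> borel_measurable M" unfolding min_sq_cube_def by measurable
      show "AE \<omega> in M. norm (min_sq_cube (?\<delta> \<omega>)) \<le> norm ((?\<delta> \<omega>)\<^sup>2)"
        using min_sq_cube_nonneg min_sq_cube_le_sq by (intro AE_I2) auto
    qed
    show "integrable M (\<lambda>\<omega>. 4 * (?\<delta> \<omega> - ?e \<omega>)\<^sup>2 + 8 * (B ^ 3 * norm (W t \<omega> - W s \<omega>) ^ 3))"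
      using i2 third by simp
    fix \<omega> assume "\<omega> \<in> space M"
    then show "min_sq_cube (?\<delta> \<omega>) \<le> 4 * (?\<delta> \<omega> - ?e \<omega>)\<^sup>2 + 8 * (B ^ 3 * norm (W t \<omega> - W s \<omega>) ^ 3)"
      using min_sq_cube_add[of "?\<delta> \<omega> - ?e \<omega>" "?e \<omega>"] e3[of \<omega>] by simp
  qed
  also have "\<dots> = 4 * (\<integral>\<omega>. (?\<delta> \<omega> - ?e \<omega>)\<^sup>2 \<partial>M) + 8 * (B ^ 3 * (\<integral>\<omega>. norm (W t \<omega> - W s \<omega>) ^ 3 \<partial>M))"
    using third sq by (subst Bochner_Integration.integral_add) (auto simp: sq_int_def)
  also have "\<dots> \<le> 4 * (\<integral>\<omega>. (?\<delta> \<omega> - ?e \<omega>)\<^sup>2 \<partial>M) + 8 * (B ^ 3 * (c * ((t - s) * sqrt (t - s))))"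
    using third(2) B0 unfolding c_def by (intro add_left_mono mult_left_mono) auto
  finally show ?thesis unfolding iso by (simp add: mult.assoc)
qed

lemma ito_min_sq_cube_sum:
  assumes a: "0 \<le> a" "a < b"
    and N: "\<And>t. t \<in> {a..b} \<Longrightarrow> ito t (\<lambda>p. indicat_real {t<..b} (snd p) *\<^sub>R f p) (N t)"
    and [measurable]: "f \<in> borel_measurable P"
  shows "(\<lambda>n. \<Sum>i<Suc n. \<integral>\<omega>. min_sq_cube (N (grid a b n i) \<omega> - N (grid a b n (Suc i)) \<omega>) \<partial>M) \<longlonglongrightarrow> 0"
proof (rule LIMSEQ_I)
  fix \<epsilon> :: real assume \<epsilon>: "0 < \<epsilon>"
  let ?f = "\<lambda>p. indicat_real {a<..b} (snd p) *\<^sub>R f p"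
  have Na: "ito a ?f (N a)" using a by (intro N) auto
  then have sqf: "sq_int P ?f" by (rule ito_sq_int)
  from Na obtain Ls where Ls: "\<And>k. elem_ok a (Ls k)" and lim: "tendsto_L2 P (\<lambda>k. elem_val (Ls k)) ?f"
    by (auto simp: ito_def)
  \<comment> \<open>The factor 4 of the cell estimate turns \<epsilon> / 8 into \<epsilon> / 2. The
    rest is left for the Gaussian part, whose sum over the grid is a multiple of sqrt(h n) and tends
    to 0.\<close>
  have "\<forall>\<^sub>F k in sequentially. (\<integral>p. (norm (elem_val (Ls k) p - ?f p))\<^sup>2 \<partial>P) < \<epsilon> / 8"
    using order_tendstoD(2)[OF tendsto_L2_real[OF lim], of "\<epsilon> / 8"] \<epsilon> by simp
  then obtain k where k: "(\<integral>p. (norm (elem_val (Ls k) p - ?f p))\<^sup>2 \<partial>P) < \<epsilon> / 8"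
    by (auto simp: eventually_sequentially)
  define L where "L = Ls k"
  have L: "elem_ok a L" using Ls by (simp add: L_def)
  obtain B where B: "0 \<le> B" "\<And>p. p \<in> space P \<Longrightarrow> norm (elem_val L p) \<le> B"
    using elem_bounded[OF L] by auto
  have [measurable]: "elem_val L \<in> borel_measurable P" using elem_measurable[OF L a(1)] by simp
  define H where "H = (\<lambda>s (t::real) p. (norm (f p - elem_val L (fst p, s)))\<^sup>2)"
  define H0 where "H0 = (\<lambda>p. (norm (f p - elem_val L p))\<^sup>2)"
  define D where "D = (\<lambda>p. 2 * (norm (?f p))\<^sup>2 + 2 * B\<^sup>2 * indicat_real {a<..b} (snd p))"
  have D: "integrable P D"
    using sqf integrable_strip[of a b] by (simp add: D_def sq_int_def)
  have bnd: "(norm (x - y))\<^sup>2 \<le> 2 * (norm x)\<^sup>2 + 2 * B\<^sup>2" if "norm y \<le> B" for x y :: "real ^ 'd"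
    using norm_add_sq_le[of x "- y"] power_mono[OF that, of 2] by simp
  have Hm: "H s t \<in> borel_measurable P" for s t
  proof -
    have "(\<lambda>\<omega>. elem_val L (\<omega>, s)) \<in> borel_measurable M" by measurable
    then have [measurable]: "(\<lambda>p. elem_val L (fst p, s)) \<in> borel_measurable P"
      by (rule measurable_compose[OF measurable_fst])
    show ?thesis unfolding H_def by measurable
  qed
  have H0m: "H0 \<in> borel_measurable P" unfolding H0_def by measurable
  have HD: "\<bar>H s t p\<bar> \<le> D p" if "a \<le> s" "s < snd p" "snd p \<le> t" "t \<le> b" "p \<in> space P" for s t p
    using bnd[OF B(2), of "(fst p, s)" "f p"] that by (auto simp: H_def D_def space_pair_measure)
  have Hlim: "AE p in P. snd p \<in> {a<..b} \<longrightarrow> (\<forall>S R. (\<forall>n. a \<le> S n \<and> S n < snd p \<and> snd p \<le> R n \<and> R n \<le> b) \<longrightarrow>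
        S \<longlonglongrightarrow> snd p \<longrightarrow> R \<longlonglongrightarrow> snd p \<longrightarrow> (\<lambda>n. H (S n) (R n) p) \<longlonglongrightarrow> H0 p)"
  proof (intro AE_I2 impI allI)
    fix p :: "'w \<times> real" and S R assume S: "\<forall>n. a \<le> S n \<and> S n < snd p \<and> snd p \<le> R n \<and> R n \<le> b" "S \<longlonglongrightarrow> snd p"
    then have "(\<lambda>n. elem_val L (fst p, S n)) \<longlonglongrightarrow> elem_val L (fst p, snd p)"
      by (intro elem_left_continuous) auto
    then show "(\<lambda>n. H (S n) (R n) p) \<longlonglongrightarrow> H0 p"
      unfolding H_def H0_def by (auto intro!: tendsto_intros)
  qed
  let ?I = "\<lambda>n. \<Sum>i<Suc n. \<integral>p. indicat_real {grid a b n i<..grid a b n (Suc i)} (snd p) * H (grid a b n i) (grid a b n (Suc i)) p \<partial>P"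
  have GL: "?I \<longlonglongrightarrow> (\<integral>p. indicat_real {a<..b} (snd p) * H0 p \<partial>P)"
    by (rule grid_limit(2)[where H = H, OF less_imp_le[OF a(2)] Hm D HD H0m Hlim])
  have "(\<integral>p. indicat_real {a<..b} (snd p) * H0 p \<partial>P) \<le> (\<integral>p. (norm (elem_val L p - ?f p))\<^sup>2 \<partial>P)"
  proof (rule integral_mono)
    show "integrable P (\<lambda>p. indicat_real {a<..b} (snd p) * H0 p)"
    proof (rule Bochner_Integration.integrable_bound[OF D])
      show "AE p in P. norm (indicat_real {a<..b} (snd p) * H0 p) \<le> norm (D p)"
        using bnd[OF B(2)] by (intro AE_I2) (auto simp: H0_def D_def split: split_indicator)
    qed (use H0m in measurable)
    have "sq_int P (\<lambda>p. elem_val L p - ?f p)"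
      by (rule sq_int_diff[OF elem_sq_int(1)[OF a(1) L] sqf])
    then show "integrable P (\<lambda>p. (norm (elem_val L p - ?f p))\<^sup>2)" by (simp add: sq_int_def)
    show "indicat_real {a<..b} (snd p) * H0 p \<le> (norm (elem_val L p - ?f p))\<^sup>2" for p
      by (auto simp: H0_def norm_minus_commute split: split_indicator)
  qed
  with k have lt: "(\<integral>p. indicat_real {a<..b} (snd p) * H0 p \<partial>P) < \<epsilon> / 8" by (simp add: L_def)
  define c where "c = real CARD('d) + 3 * (real CARD('d))\<^sup>2"
  define h where "h = (\<lambda>n. (b - a) / real (Suc n))"
  have h0: "h \<longlonglongrightarrow> 0" unfolding h_def by (rule LIMSEQ_Suc[OF lim_const_over_n])
  have hpos: "0 < h n" for n using a by (simp add: h_def)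
  have le: "(\<Sum>i<Suc n. \<integral>\<omega>. min_sq_cube (N (grid a b n i) \<omega> - N (grid a b n (Suc i)) \<omega>) \<partial>M)
     \<le> 4 * ?I n + 8 * B ^ 3 * c * ((b - a) * sqrt (h n))" for n
  proof -
    have "(\<Sum>i<Suc n. \<integral>\<omega>. min_sq_cube (N (grid a b n i) \<omega> - N (grid a b n (Suc i)) \<omega>) \<partial>M)
      \<le> (\<Sum>i<Suc n. 4 * (\<integral>p. indicat_real {grid a b n i<..grid a b n (Suc i)} (snd p) * H (grid a b n i) (grid a b n (Suc i)) p \<partial>P)
          + 8 * B ^ 3 * c * (h n * sqrt (h n)))"
    proof (rule sum_mono)
      fix i assume "i \<in> {..<Suc n}"
      then have i: "i < Suc n" by simp
      have b: "a \<le> grid a b n i" "grid a b n (Suc i) \<le> b"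
        using grid_bounds[of a b i n] grid_bounds[of a b "Suc i" n] a i by auto
      have st: "grid a b n (Suc i) - grid a b n i = h n" unfolding h_def by (rule grid_step)
      then have lt: "grid a b n i < grid a b n (Suc i)" using hpos[of n] by linarith
      show "(\<integral>\<omega>. min_sq_cube (N (grid a b n i) \<omega> - N (grid a b n (Suc i)) \<omega>) \<partial>M) \<le>
        4 * (\<integral>p. indicat_real {grid a b n i<..grid a b n (Suc i)} (snd p) * H (grid a b n i) (grid a b n (Suc i)) p \<partial>P)
          + 8 * B ^ 3 * c * (h n * sqrt (h n))"
        using ito_cell_min_sq_cube[OF a(1) N L B(2) b(1) lt b(2)] unfolding st H_def c_def by simp
    qed
    also have "\<dots> = 4 * ?I n + real (Suc n) * (8 * B ^ 3 * c * (h n * sqrt (h n)))"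
      by (simp only: sum.distrib sum_distrib_left sum_constant card_lessThan)
    also have "real (Suc n) * (8 * B ^ 3 * c * (h n * sqrt (h n))) = 8 * B ^ 3 * c * ((real (Suc n) * h n) * sqrt (h n))"
      by (simp only: mult_ac)
    also have "real (Suc n) * h n = b - a" by (simp add: h_def del: of_nat_Suc)
    finally show ?thesis .
  qed
  have "(\<lambda>n. 4 * ?I n + 8 * B ^ 3 * c * ((b - a) * sqrt (h n))) \<longlonglongrightarrow>
     4 * (\<integral>p. indicat_real {a<..b} (snd p) * H0 p \<partial>P) + 8 * B ^ 3 * c * ((b - a) * sqrt 0)"
    by (intro tendsto_intros GL h0)
  then have "\<forall>\<^sub>F n in sequentially. 4 * ?I n + 8 * B ^ 3 * c * ((b - a) * sqrt (h n)) < \<epsilon>"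
    by (rule order_tendstoD(2)) (use lt \<epsilon> in simp)
  then obtain n0 where n0: "\<And>n. n0 \<le> n \<Longrightarrow> 4 * ?I n + 8 * B ^ 3 * c * ((b - a) * sqrt (h n)) < \<epsilon>"
    by (auto simp: eventually_sequentially)
  have nn: "0 \<le> (\<Sum>i<Suc n. \<integral>\<omega>. min_sq_cube (N (grid a b n i) \<omega> - N (grid a b n (Suc i)) \<omega>) \<partial>M)" for n
    by (intro sum_nonneg Bochner_Integration.integral_nonneg min_sq_cube_nonneg)
  show "\<exists>n0. \<forall>n\<ge>n0. norm ((\<Sum>i<Suc n. \<integral>\<omega>. min_sq_cube (N (grid a b n i) \<omega> - N (grid a b n (Suc i)) \<omega>) \<partial>M) - 0) < \<epsilon>"
  proof (intro exI allI impI)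
    fix n assume "n0 \<le> n"
    from le[of n] n0[OF this] nn[of n]
    show "norm ((\<Sum>i<Suc n. \<integral>\<omega>. min_sq_cube (N (grid a b n i) \<omega> - N (grid a b n (Suc i)) \<omega>) \<partial>M) - 0) < \<epsilon>"
      by (simp only: real_norm_def diff_0_right abs_of_nonneg)
  qed
qed

end

lemma cubic_taylor_bounded:
  assumes "cubic_taylor C f f1 f2" "cubic_taylor C g g1 g2"
  shows "\<bar>f x * g y\<bar> \<le> C * C" "\<bar>f1 x * g y\<bar> \<le> C * C" "\<bar>f2 x * g y\<bar> \<le> C * C"
    "\<bar>f x * g1 y\<bar> \<le> C * C" "\<bar>f1 x * g1 y\<bar> \<le> C * C" "\<bar>f x * g2 y\<bar> \<le> C * C"
  using assms unfolding cubic_taylor_def abs_mult by (auto intro!: mult_mono')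

lemma cubic_taylor_measurable:
  assumes "cubic_taylor C f f1 f2"
  shows "f \<in> borel_measurable borel" "f1 \<in> borel_measurable borel" "f2 \<in> borel_measurable borel"
  using assms by (auto simp: cubic_taylor_def intro: borel_measurable_continuous_onI)

section \<open>The inequality on one cell and its limit over the grid\<close>

context brownian_basis
begin

text \<open>For drift terms Fubini takes the place of orthogonality, so a bounded weight that is
  merely measurable is enough. The weights may thus sit at the right end of a cell.\<close>

lemma drift_fubini:
  fixes \<xi> :: "'w \<Rightarrow> real" and U :: "'w \<times> real \<Rightarrow> real"
  assumes U: "integrable P U" and [measurable]: "\<xi> \<in> borel_measurable M" and b: "\<And>\<omega>. \<omega> \<in> space M \<Longrightarrow> \<bar>\<xi> \<omega>\<bar> \<le> C"
  shows "integrable P (\<lambda>p. indicat_real {s<..t} (snd p) * (\<xi> (fst p) * U p))"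
    and "has_bochner_integral M (\<lambda>\<omega>. \<xi> \<omega> * (\<integral>r. indicat_real {s<..t} r * U (\<omega>, r) \<partial>lborel))
      (\<integral>p. indicat_real {s<..t} (snd p) * (\<xi> (fst p) * U p) \<partial>P)"
proof -
  have [measurable]: "U \<in> borel_measurable P" using U by auto
  show i: "integrable P (\<lambda>p. indicat_real {s<..t} (snd p) * (\<xi> (fst p) * U p))"
  proof (rule Bochner_Integration.integrable_bound[OF integrable_mult_right[OF U, of "\<bar>C\<bar>"]])
    show "(\<lambda>p. indicat_real {s<..t} (snd p) * (\<xi> (fst p) * U p)) \<in> borel_measurable P" by measurable
    show "AE p in P. norm (indicat_real {s<..t} (snd p) * (\<xi> (fst p) * U p)) \<le> norm (\<bar>C\<bar> * U p)"
    proof (intro AE_I2)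
      fix p assume "p \<in> space P"
      then have "\<bar>\<xi> (fst p)\<bar> \<le> \<bar>C\<bar>" using b[of "fst p"] by (auto simp: space_pair_measure)
      then show "norm (indicat_real {s<..t} (snd p) * (\<xi> (fst p) * U p)) \<le> norm (\<bar>C\<bar> * U p)"
        by (auto simp: abs_mult mult_right_mono split: split_indicator)
    qed
  qed
  have eq: "(\<integral>r. indicat_real {s<..t} r * (\<xi> \<omega> * U (\<omega>, r)) \<partial>lborel) = \<xi> \<omega> * (\<integral>r. indicat_real {s<..t} r * U (\<omega>, r) \<partial>lborel)" for \<omega>
    by (subst integral_mult_right_zero[symmetric]) (simp add: mult_ac)
  show "has_bochner_integral M (\<lambda>\<omega>. \<xi> \<omega> * (\<integral>r. indicat_real {s<..t} r * U (\<omega>, r) \<partial>lborel))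
      (\<integral>p. indicat_real {s<..t} (snd p) * (\<xi> (fst p) * U p) \<partial>P)"
    using P.integrable_fst'[OF i] P.integral_fst'[OF i] by (simp add: has_bochner_integral_iff eq)
qed

text \<open>Orthogonality and isometry together with the integrability that is required to add up
  the terms of a cell.\<close>

lemma ito_weighted:
  assumes s: "0 \<le> s" and I: "ito s f I" and J: "ito s g J"
    and \<xi>: "\<xi> \<in> borel_measurable (F s)" "\<And>\<omega>. \<omega> \<in> space M \<Longrightarrow> \<bar>\<xi> \<omega>\<bar> \<le> C"
  shows "has_bochner_integral M (\<lambda>\<omega>. \<xi> \<omega> * I \<omega>) 0"
    and "has_bochner_integral M (\<lambda>\<omega>. \<xi> \<omega> * (I \<omega> * J \<omega>)) (\<integral>p. \<xi> (fst p) * (f p \<bullet> g p) \<partial>P)"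
    and "integrable P (\<lambda>p. \<xi> (fst p) * (f p \<bullet> g p))"
proof -
  have [measurable]: "\<xi> \<in> borel_measurable M" using \<xi>(1) by (rule measurable_F_M)
  have b: "\<And>\<omega>. \<omega> \<in> space M \<Longrightarrow> \<bar>\<xi> \<omega>\<bar> \<le> \<bar>C\<bar>" using \<xi>(2) by fastforce
  note sI = ito_sq_int[OF I] and sJ = ito_sq_int[OF J]
  show "has_bochner_integral M (\<lambda>\<omega>. \<xi> \<omega> * I \<omega>) 0"
    using ito_mean[OF s I \<xi>] sq_int_inner(1)[OF sI(2) sq_int_const[of 1], of \<xi> "\<bar>C\<bar>"] b
    by (simp add: has_bochner_integral_iff)
  show "has_bochner_integral M (\<lambda>\<omega>. \<xi> \<omega> * (I \<omega> * J \<omega>)) (\<integral>p. \<xi> (fst p) * (f p \<bullet> g p) \<partial>P)"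
    using ito_isometry[OF s I J \<xi>] sq_int_inner(1)[OF sI(2) sJ(2), of \<xi> "\<bar>C\<bar>"] b
    by (simp add: has_bochner_integral_iff)
  show "integrable P (\<lambda>p. \<xi> (fst p) * (f p \<bullet> g p))"
    by (rule sq_int_inner(1)[OF sI(1) sJ(1), of _ "\<bar>C\<bar>"]) (auto simp: space_pair_measure b)
qed

lemma min_sq_cube_integrable:
  assumes "sq_int M \<delta>" shows "integrable M (\<lambda>\<omega>. min_sq_cube (\<delta> \<omega>))"
proof -
  note [measurable] = sq_int_measurable[OF assms]
  have i: "integrable M (\<lambda>\<omega>. (\<delta> \<omega>)\<^sup>2)" using assms by (simp add: sq_int_def)
  show ?thesis
  proof (rule Bochner_Integration.integrable_bound[OF i])
    show "(\<lambda>\<omega>. min_sq_cube (\<delta> \<omega>)) \<in> borel_measurable M" unfolding min_sq_cube_def by measurable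
    show "AE \<omega> in M. norm (min_sq_cube (\<delta> \<omega>)) \<le> norm ((\<delta> \<omega>)\<^sup>2)"
      using min_sq_cube_nonneg min_sq_cube_le_sq by (intro AE_I2) auto
  qed
qed

text \<open>Martingale increments are expanded around the left end x, where the weights belong to
  the past and the first order terms vanish in mean; drift increments are expanded around the right
  end y. Since \<alpha> and \<beta> are monotone and nonnegative, the value at x + \<delta> is at
  most the one at y plus the drift, which joins the two expansions. So one-sided bounds on the
  increments suffice, and no mixed terms of drift and martingale part occur.\<close>

lemma ito_cell_inequality:
  fixes f1 f2 :: "'w \<times> real \<Rightarrow> real ^ 'd" and U1 U2 :: "'w \<times> real \<Rightarrow> real"
  assumes st: "0 \<le> s" "s \<le> t"
    and \<delta>: "ito s (\<lambda>p. indicat_real {s<..t} (snd p) *\<^sub>R f1 p) \<delta>1" "ito s (\<lambda>p. indicat_real {s<..t} (snd p) *\<^sub>R f2 p) \<delta>2"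
    and x: "x1 \<in> borel_measurable (F s)" "x2 \<in> borel_measurable (F s)"
    and y: "y1 \<in> borel_measurable M" "y2 \<in> borel_measurable M"
    and U: "integrable P U1" "integrable P U2" "\<And>p. p \<in> space P \<Longrightarrow> 0 \<le> U1 p" "\<And>p. p \<in> space P \<Longrightarrow> 0 \<le> U2 p"
    and inc: "AE \<omega> in M. \<delta>1 \<omega> - (\<integral>r. indicat_real {s<..t} r * U1 (\<omega>, r) \<partial>lborel) \<le> y1 \<omega> - x1 \<omega>"
       "AE \<omega> in M. \<delta>2 \<omega> - (\<integral>r. indicat_real {s<..t} r * U2 (\<omega>, r) \<partial>lborel) \<le> y2 \<omega> - x2 \<omega>"
    and \<alpha>: "cubic_taylor C \<alpha> \<alpha>1 \<alpha>2" "mono \<alpha>" "\<And>x. 0 \<le> \<alpha> x"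
    and \<beta>: "cubic_taylor C \<beta> \<beta>1 \<beta>2" "mono \<beta>" "\<And>x. 0 \<le> \<beta> x"
    and C: "1 \<le> C"
  defines "w \<equiv> \<lambda>\<omega>. \<integral>r. indicat_real {s<..t} r * (U1 (\<omega>, r) + U2 (\<omega>, r)) \<partial>lborel"
  shows "(\<integral>p. indicat_real {s<..t} (snd p) * 
     ((\<alpha>2 (x1 (fst p)) * \<beta> (x2 (fst p)) * (f1 p \<bullet> f1 p) + 2 * (\<alpha>1 (x1 (fst p)) * \<beta>1 (x2 (fst p)) * (f1 p \<bullet> f2 p))
        + \<alpha> (x1 (fst p)) * \<beta>2 (x2 (fst p)) * (f2 p \<bullet> f2 p)) / 2
      - (\<alpha>1 (y1 (fst p)) * \<beta> (y2 (fst p)) * U1 p + \<alpha> (y1 (fst p)) * \<beta>1 (y2 (fst p)) * U2 p)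
      - 20 * C\<^sup>2 * (min 1 (w (fst p)) * (U1 p + U2 p))) \<partial>P)
     - 80 * C\<^sup>2 * ((\<integral>\<omega>. min_sq_cube (\<delta>1 \<omega>) \<partial>M) + (\<integral>\<omega>. min_sq_cube (\<delta>2 \<omega>) \<partial>M))
     \<le> (\<integral>\<omega>. \<alpha> (y1 \<omega>) * \<beta> (y2 \<omega>) \<partial>M) - (\<integral>\<omega>. \<alpha> (x1 \<omega>) * \<beta> (x2 \<omega>) \<partial>M)"
proof -
  note bd = cubic_taylor_bounded[OF \<alpha>(1) \<beta>(1)]
  note am = cubic_taylor_measurable[OF \<alpha>(1)] and bm = cubic_taylor_measurable[OF \<beta>(1)]
  have mF: "(\<lambda>\<omega>. h (x1 \<omega>) * k (x2 \<omega>)) \<in> borel_measurable (F s)" if "h \<in> borel_measurable borel" "k \<in> borel_measurable borel" for h k :: "real \<Rightarrow> real"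
    using measurable_compose[OF x(1) that(1)] measurable_compose[OF x(2) that(2)] by (rule borel_measurable_times)
  have mM: "(\<lambda>\<omega>. h (y1 \<omega>) * k (y2 \<omega>)) \<in> borel_measurable M" if "h \<in> borel_measurable borel" "k \<in> borel_measurable borel" for h k :: "real \<Rightarrow> real"
    using measurable_compose[OF y(1) that(1)] measurable_compose[OF y(2) that(2)] by (rule borel_measurable_times)
  let ?i = "\<lambda>p. indicat_real {s<..t} (snd p)"
  let ?u1 = "\<lambda>\<omega>. \<integral>r. indicat_real {s<..t} r * U1 (\<omega>, r) \<partial>lborel" and ?u2 = "\<lambda>\<omega>. \<integral>r. indicat_real {s<..t} r * U2 (\<omega>, r) \<partial>lborel"
  have U12: "integrable P (\<lambda>p. U1 p + U2 p)" using U by simp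
  have wm: "w \<in> borel_measurable M"
    using drift_fubini(2)[OF U12, of "\<lambda>_. 1" 1 s t] by (simp add: w_def has_bochner_integral_iff borel_measurable_integrable)
  have nn: "0 \<le> ?u1 \<omega>" "0 \<le> ?u2 \<omega>" "0 \<le> w \<omega>" if "\<omega> \<in> space M" for \<omega>
    using U(3,4) that unfolding w_def by (auto intro!: integral_nonneg mult_nonneg_nonneg add_nonneg_nonneg simp: space_pair_measure)
  have weq: "AE \<omega> in M. w \<omega> = ?u1 \<omega> + ?u2 \<omega>"
    using P.AE_integrable_fst'[OF U(1)] P.AE_integrable_fst'[OF U(2)]
  proof eventually_elim
    case (elim \<omega>)
    have "integrable lborel (\<lambda>r. indicat_real {s<..t} r * U1 (\<omega>, r))" "integrable lborel (\<lambda>r. indicat_real {s<..t} r * U2 (\<omega>, r))"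
      using integrable_mult_indicator[OF _ elim(1), of "{s<..t}"] integrable_mult_indicator[OF _ elim(2), of "{s<..t}"] by auto
    then show ?case unfolding w_def by (simp add: distrib_left)
  qed
  have mw: "(\<lambda>\<omega>. min 1 (w \<omega>)) \<in> borel_measurable M" using wm by simp
  have bw: "\<bar>min 1 (w \<omega>)\<bar> \<le> 1" if "\<omega> \<in> space M" for \<omega> using nn(3)[OF that] by simp
  note A1 = ito_weighted(1)[OF st(1) \<delta>(1) \<delta>(1) mF[OF am(2) bm(1)] bd(2)]
  note A2 = ito_weighted(1)[OF st(1) \<delta>(2) \<delta>(2) mF[OF am(1) bm(2)] bd(4)]
  note B1 = ito_weighted(2,3)[OF st(1) \<delta>(1) \<delta>(1) mF[OF am(3) bm(1)] bd(3)]
  note B2 = ito_weighted(2,3)[OF st(1) \<delta>(1) \<delta>(2) mF[OF am(2) bm(2)] bd(5)]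
  note B3 = ito_weighted(2,3)[OF st(1) \<delta>(2) \<delta>(2) mF[OF am(1) bm(3)] bd(6)]
  note D1 = drift_fubini[OF U(1) mM[OF am(2) bm(1)] bd(2), of s t]
  note D2 = drift_fubini[OF U(2) mM[OF am(1) bm(2)] bd(4), of s t]
  have w_eq: "(\<integral>r. indicat_real {s<..t} r * (U1 (\<omega>, r) + U2 (\<omega>, r)) \<partial>lborel) = w \<omega>" for \<omega>
    by (simp add: w_def)
  note D3 = drift_fubini[OF U12 mw bw, of s t, unfolded w_eq]
  note m1 = min_sq_cube_integrable[OF ito_sq_int(2)[OF \<delta>(1)]] and m2 = min_sq_cube_integrable[OF ito_sq_int(2)[OF \<delta>(2)]]
  have iy: "integrable M (\<lambda>\<omega>. \<alpha> (y1 \<omega>) * \<beta> (y2 \<omega>))"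
    by (rule integrable_const_bound[of _ "C * C"]) (use bd(1) mM[OF am(1) bm(1)] in auto)
  have ix: "integrable M (\<lambda>\<omega>. \<alpha> (x1 \<omega>) * \<beta> (x2 \<omega>))"
    by (rule integrable_const_bound[of _ "C * C"]) (use bd(1) measurable_F_M[OF mF[OF am(1) bm(1)]] in auto)
  let ?R = "\<lambda>\<omega>. \<alpha> (x1 \<omega>) * \<beta> (x2 \<omega>) + (\<alpha>1 (x1 \<omega>) * \<beta> (x2 \<omega>) * \<delta>1 \<omega> + \<alpha> (x1 \<omega>) * \<beta>1 (x2 \<omega>) * \<delta>2 \<omega>)
     + (\<alpha>2 (x1 \<omega>) * \<beta> (x2 \<omega>) * (\<delta>1 \<omega> * \<delta>1 \<omega>) + 2 * (\<alpha>1 (x1 \<omega>) * \<beta>1 (x2 \<omega>) * (\<delta>1 \<omega> * \<delta>2 \<omega>)) + \<alpha> (x1 \<omega>) * \<beta>2 (x2 \<omega>) * (\<delta>2 \<omega> * \<delta>2 \<omega>)) / 2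
     - 80 * C\<^sup>2 * (min_sq_cube (\<delta>1 \<omega>) + min_sq_cube (\<delta>2 \<omega>))
     - (\<alpha>1 (y1 \<omega>) * \<beta> (y2 \<omega>) * ?u1 \<omega> + \<alpha> (y1 \<omega>) * \<beta>1 (y2 \<omega>) * ?u2 \<omega>)
     - 20 * C\<^sup>2 * (min 1 (w \<omega>) * w \<omega>)"
  have pt: "AE \<omega> in M. ?R \<omega> \<le> \<alpha> (y1 \<omega>) * \<beta> (y2 \<omega>)"
    using inc weq AE_space
  proof eventually_elim
    case (elim \<omega>)
    have "\<alpha> (y1 \<omega> + ?u1 \<omega>) * \<beta> (y2 \<omega> + ?u2 \<omega>) \<le> \<alpha> (y1 \<omega>) * \<beta> (y2 \<omega>)
       + (\<alpha>1 (y1 \<omega>) * \<beta> (y2 \<omega>) * ?u1 \<omega> + \<alpha> (y1 \<omega>) * \<beta>1 (y2 \<omega>) * ?u2 \<omega>) + 20 * C\<^sup>2 * (w \<omega> * min 1 (w \<omega>))"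
      using product_first_order[OF \<alpha>(1) \<beta>(1) C nn(1,2)[OF elim(4)], of "y1 \<omega>" "y2 \<omega>"] unfolding elim(3) .
    moreover have "\<alpha> (x1 \<omega> + \<delta>1 \<omega>) * \<beta> (x2 \<omega> + \<delta>2 \<omega>) \<le> \<alpha> (y1 \<omega> + ?u1 \<omega>) * \<beta> (y2 \<omega> + ?u2 \<omega>)"
      using elim(1,2) by (intro mult_mono monoD[OF \<alpha>(2)] monoD[OF \<beta>(2)] \<alpha>(3) \<beta>(3)) linarith+
    moreover have "\<alpha> (x1 \<omega>) * \<beta> (x2 \<omega>) + (\<alpha>1 (x1 \<omega>) * \<beta> (x2 \<omega>) * \<delta>1 \<omega> + \<alpha> (x1 \<omega>) * \<beta>1 (x2 \<omega>) * \<delta>2 \<omega>)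
     + (\<alpha>2 (x1 \<omega>) * \<beta> (x2 \<omega>) * (\<delta>1 \<omega> * \<delta>1 \<omega>) + 2 * (\<alpha>1 (x1 \<omega>) * \<beta>1 (x2 \<omega>) * (\<delta>1 \<omega> * \<delta>2 \<omega>)) + \<alpha> (x1 \<omega>) * \<beta>2 (x2 \<omega>) * (\<delta>2 \<omega> * \<delta>2 \<omega>)) / 2
     - 80 * C\<^sup>2 * (min_sq_cube (\<delta>1 \<omega>) + min_sq_cube (\<delta>2 \<omega>)) \<le> \<alpha> (x1 \<omega> + \<delta>1 \<omega>) * \<beta> (x2 \<omega> + \<delta>2 \<omega>)"
    proof -
      let ?m = "min ((\<bar>\<delta>1 \<omega>\<bar> + \<bar>\<delta>2 \<omega>\<bar>)\<^sup>2) ((\<bar>\<delta>1 \<omega>\<bar> + \<bar>\<delta>2 \<omega>\<bar>) ^ 3)"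
      \<comment> \<open>The constant 80 is the 10 of \<open>product_taylor\<close> times the 8 of
        \<open>min_sq_cube_sum_le\<close>.\<close>
      have "10 * C\<^sup>2 * ?m \<le> 10 * C\<^sup>2 * (8 * (min_sq_cube (\<delta>1 \<omega>) + min_sq_cube (\<delta>2 \<omega>)))"
        by (intro mult_left_mono min_sq_cube_sum_le) simp
      moreover have "10 * C\<^sup>2 * (8 * (min_sq_cube (\<delta>1 \<omega>) + min_sq_cube (\<delta>2 \<omega>))) = 80 * C\<^sup>2 * (min_sq_cube (\<delta>1 \<omega>) + min_sq_cube (\<delta>2 \<omega>))" by simp
      moreover note product_taylor[OF \<alpha>(1) \<beta>(1), of "x1 \<omega>" "\<delta>1 \<omega>" "x2 \<omega>" "\<delta>2 \<omega>", unfolded power2_eq_square[of "\<delta>1 \<omega>"] power2_eq_square[of "\<delta>2 \<omega>"] abs_le_iff, THEN conjunct2]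
      ultimately show ?thesis by (simp only: mult.assoc)
    qed
    moreover have "20 * C\<^sup>2 * (w \<omega> * min 1 (w \<omega>)) = 20 * C\<^sup>2 * (min 1 (w \<omega>) * w \<omega>)" by simp
    ultimately show ?case by linarith
  qed
  let ?a1 = "\<integral>p. ?i p * (\<alpha>1 (y1 (fst p)) * \<beta> (y2 (fst p)) * U1 p) \<partial>P"
  let ?a2 = "\<integral>p. ?i p * (\<alpha> (y1 (fst p)) * \<beta>1 (y2 (fst p)) * U2 p) \<partial>P"
  let ?a3 = "\<integral>p. ?i p * (min 1 (w (fst p)) * (U1 p + U2 p)) \<partial>P"
  let ?b1 = "\<integral>p. \<alpha>2 (x1 (fst p)) * \<beta> (x2 (fst p)) * ((?i p *\<^sub>R f1 p) \<bullet> (?i p *\<^sub>R f1 p)) \<partial>P"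
  let ?b2 = "\<integral>p. \<alpha>1 (x1 (fst p)) * \<beta>1 (x2 (fst p)) * ((?i p *\<^sub>R f1 p) \<bullet> (?i p *\<^sub>R f2 p)) \<partial>P"
  let ?b3 = "\<integral>p. \<alpha> (x1 (fst p)) * \<beta>2 (x2 (fst p)) * ((?i p *\<^sub>R f2 p) \<bullet> (?i p *\<^sub>R f2 p)) \<partial>P"
  have hR: "has_bochner_integral M ?R ((\<integral>\<omega>. \<alpha> (x1 \<omega>) * \<beta> (x2 \<omega>) \<partial>M) + (0 + 0) + (?b1 + 2 * ?b2 + ?b3) / 2
      - 80 * C\<^sup>2 * ((\<integral>\<omega>. min_sq_cube (\<delta>1 \<omega>) \<partial>M) + (\<integral>\<omega>. min_sq_cube (\<delta>2 \<omega>) \<partial>M)) - (?a1 + ?a2) - 20 * C\<^sup>2 * ?a3)"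
    by (intro has_bochner_integral_add has_bochner_integral_diff has_bochner_integral_divide_zero has_bochner_integral_mult_right
      has_bochner_integral_integrable A1 A2 B1(1) B2(1) B3(1) D1(2) D2(2) D3(2) m1 m2 ix)
  have "integral\<^sup>L M ?R \<le> (\<integral>\<omega>. \<alpha> (y1 \<omega>) * \<beta> (y2 \<omega>) \<partial>M)"
    using pt iy hR by (intro integral_mono_AE) (auto simp: has_bochner_integral_iff)
  moreover have "(\<integral>p. ?i p * 
     ((\<alpha>2 (x1 (fst p)) * \<beta> (x2 (fst p)) * (f1 p \<bullet> f1 p) + 2 * (\<alpha>1 (x1 (fst p)) * \<beta>1 (x2 (fst p)) * (f1 p \<bullet> f2 p))
        + \<alpha> (x1 (fst p)) * \<beta>2 (x2 (fst p)) * (f2 p \<bullet> f2 p)) / 2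
      - (\<alpha>1 (y1 (fst p)) * \<beta> (y2 (fst p)) * U1 p + \<alpha> (y1 (fst p)) * \<beta>1 (y2 (fst p)) * U2 p)
      - 20 * C\<^sup>2 * (min 1 (w (fst p)) * (U1 p + U2 p))) \<partial>P) = (?b1 + 2 * ?b2 + ?b3) / 2 - (?a1 + ?a2) - 20 * C\<^sup>2 * ?a3" (is "?L = _")
  proof -
    have "has_bochner_integral P (\<lambda>p. (\<alpha>2 (x1 (fst p)) * \<beta> (x2 (fst p)) * ((?i p *\<^sub>R f1 p) \<bullet> (?i p *\<^sub>R f1 p))
       + 2 * (\<alpha>1 (x1 (fst p)) * \<beta>1 (x2 (fst p)) * ((?i p *\<^sub>R f1 p) \<bullet> (?i p *\<^sub>R f2 p)))
       + \<alpha> (x1 (fst p)) * \<beta>2 (x2 (fst p)) * ((?i p *\<^sub>R f2 p) \<bullet> (?i p *\<^sub>R f2 p))) / 2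
      - (?i p * (\<alpha>1 (y1 (fst p)) * \<beta> (y2 (fst p)) * U1 p) + ?i p * (\<alpha> (y1 (fst p)) * \<beta>1 (y2 (fst p)) * U2 p))
      - 20 * C\<^sup>2 * (?i p * (min 1 (w (fst p)) * (U1 p + U2 p)))) ((?b1 + 2 * ?b2 + ?b3) / 2 - (?a1 + ?a2) - 20 * C\<^sup>2 * ?a3)"
      by (intro has_bochner_integral_add has_bochner_integral_diff has_bochner_integral_divide_zero has_bochner_integral_mult_right
      has_bochner_integral_integrable B1(2) B2(2) B3(2) D1(1) D2(1) D3(1))
    then have "(?b1 + 2 * ?b2 + ?b3) / 2 - (?a1 + ?a2) - 20 * C\<^sup>2 * ?a3 = (\<integral>p. (\<alpha>2 (x1 (fst p)) * \<beta> (x2 (fst p)) * ((?i p *\<^sub>R f1 p) \<bullet> (?i p *\<^sub>R f1 p))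
       + 2 * (\<alpha>1 (x1 (fst p)) * \<beta>1 (x2 (fst p)) * ((?i p *\<^sub>R f1 p) \<bullet> (?i p *\<^sub>R f2 p)))
       + \<alpha> (x1 (fst p)) * \<beta>2 (x2 (fst p)) * ((?i p *\<^sub>R f2 p) \<bullet> (?i p *\<^sub>R f2 p))) / 2
      - (?i p * (\<alpha>1 (y1 (fst p)) * \<beta> (y2 (fst p)) * U1 p) + ?i p * (\<alpha> (y1 (fst p)) * \<beta>1 (y2 (fst p)) * U2 p))
      - 20 * C\<^sup>2 * (?i p * (min 1 (w (fst p)) * (U1 p + U2 p))) \<partial>P)"
      by (rule has_bochner_integral_integral_eq[symmetric])
    also have "\<dots> = ?L"
      by (intro Bochner_Integration.integral_cong refl) (simp split: split_indicator)
    finally show ?thesis by (rule sym)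
  qed
  ultimately show ?thesis
    using has_bochner_integral_integral_eq[OF hR] by linarith
qed


text \<open>G is the drift that Ito's formula gives for the product when the drifts of X1 and X2 are
  - U1 and - U2. Summed over the grid, the right sides of the cell inequalities telescope; on the
  left the cubic terms vanish by \<open>ito_min_sq_cube_sum\<close>, and the factor min 1 w tends to
  0 because the pathwise drift over a shrinking cell does.\<close>

lemma ito_inequality:
  fixes f1 f2 :: "'w \<times> real \<Rightarrow> real ^ 'd" and U1 U2 :: "'w \<times> real \<Rightarrow> real" and X1 X2 :: "real \<Rightarrow> 'w \<Rightarrow> real"
  assumes ab: "0 \<le> a" "a < b"
    and N: "\<And>t. t \<in> {a..b} \<Longrightarrow> ito t (\<lambda>p. indicat_real {t<..b} (snd p) *\<^sub>R f1 p) (N1 t)"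
       "\<And>t. t \<in> {a..b} \<Longrightarrow> ito t (\<lambda>p. indicat_real {t<..b} (snd p) *\<^sub>R f2 p) (N2 t)"
    and fm: "f1 \<in> borel_measurable P" "f2 \<in> borel_measurable P"
    and X: "\<And>t. t \<in> {a..b} \<Longrightarrow> X1 t \<in> borel_measurable (F t)" "\<And>t. t \<in> {a..b} \<Longrightarrow> X2 t \<in> borel_measurable (F t)"
    and XM: "\<And>t. X1 t \<in> borel_measurable M" "\<And>t. X2 t \<in> borel_measurable M"
    and Xc: "\<And>\<omega>. \<omega> \<in> space M \<Longrightarrow> continuous_on UNIV (\<lambda>r. X1 r \<omega>)" "\<And>\<omega>. \<omega> \<in> space M \<Longrightarrow> continuous_on UNIV (\<lambda>r. X2 r \<omega>)"
    and U: "integrable P U1" "integrable P U2" "\<And>p. p \<in> space P \<Longrightarrow> 0 \<le> U1 p" "\<And>p. p \<in> space P \<Longrightarrow> 0 \<le> U2 p"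
    and inc: "\<And>s t. a \<le> s \<Longrightarrow> s \<le> t \<Longrightarrow> t \<le> b \<Longrightarrow>
         AE \<omega> in M. N1 s \<omega> - N1 t \<omega> - (\<integral>r. indicat_real {s<..t} r * U1 (\<omega>, r) \<partial>lborel) \<le> X1 t \<omega> - X1 s \<omega>"
       "\<And>s t. a \<le> s \<Longrightarrow> s \<le> t \<Longrightarrow> t \<le> b \<Longrightarrow>
         AE \<omega> in M. N2 s \<omega> - N2 t \<omega> - (\<integral>r. indicat_real {s<..t} r * U2 (\<omega>, r) \<partial>lborel) \<le> X2 t \<omega> - X2 s \<omega>"
    and \<alpha>: "cubic_taylor C \<alpha> \<alpha>1 \<alpha>2" "mono \<alpha>" "\<And>x. 0 \<le> \<alpha> x"
    and \<beta>: "cubic_taylor C \<beta> \<beta>1 \<beta>2" "mono \<beta>" "\<And>x. 0 \<le> \<beta> x"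
    and C: "1 \<le> C"
  defines "x \<equiv> \<lambda>p. X1 (snd p) (fst p)" and "y \<equiv> \<lambda>p. X2 (snd p) (fst p)"
  defines "G \<equiv> \<lambda>p. (\<alpha>2 (x p) * \<beta> (y p) * (f1 p \<bullet> f1 p) + 2 * (\<alpha>1 (x p) * \<beta>1 (y p) * (f1 p \<bullet> f2 p))
        + \<alpha> (x p) * \<beta>2 (y p) * (f2 p \<bullet> f2 p)) / 2 - (\<alpha>1 (x p) * \<beta> (y p) * U1 p + \<alpha> (x p) * \<beta>1 (y p) * U2 p)"
  shows "integrable P (\<lambda>p. indicat_real {a<..b} (snd p) * G p)"
    and "(\<integral>p. indicat_real {a<..b} (snd p) * G p \<partial>P) \<le> (\<integral>\<omega>. \<alpha> (X1 b \<omega>) * \<beta> (X2 b \<omega>) \<partial>M) - (\<integral>\<omega>. \<alpha> (X1 a \<omega>) * \<beta> (X2 a \<omega>) \<partial>M)"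
proof -
  note bd = cubic_taylor_bounded[OF \<alpha>(1) \<beta>(1)]
  note [measurable] = cubic_taylor_measurable[OF \<alpha>(1)] cubic_taylor_measurable[OF \<beta>(1)] XM fm
    borel_measurable_integrable[OF U(1)] borel_measurable_integrable[OF U(2)]
  have cont: "continuous_on UNIV \<alpha>" "continuous_on UNIV \<alpha>1" "continuous_on UNIV \<alpha>2" "continuous_on UNIV \<beta>" "continuous_on UNIV \<beta>1" "continuous_on UNIV \<beta>2"
    using \<alpha>(1) \<beta>(1) by (auto simp: cubic_taylor_def)
  have lims: "(\<lambda>n. h (z n)) \<longlonglongrightarrow> h l" if "continuous_on UNIV h" "z \<longlonglongrightarrow> l" for h :: "real \<Rightarrow> real" and z l
    using continuous_on_tendsto_compose[OF that] by simp
  have [measurable]: "x \<in> borel_measurable P" "y \<in> borel_measurable P"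
    unfolding x_def y_def using XM Xc by (auto intro: jointly_measurable_continuous)
  define w where "w = (\<lambda>s t \<omega>. \<integral>r. indicat_real {s<..t} r * (U1 (\<omega>, r) + U2 (\<omega>, r)) \<partial>lborel)"
  \<comment> \<open>The contribution of a cell: second order terms at its left end, drift terms at
    its right end. By continuity of the paths both approach the corresponding parts of G.\<close>
  define H where "H = (\<lambda>s t p. (\<alpha>2 (X1 s (fst p)) * \<beta> (X2 s (fst p)) * (f1 p \<bullet> f1 p) + 2 * (\<alpha>1 (X1 s (fst p)) * \<beta>1 (X2 s (fst p)) * (f1 p \<bullet> f2 p))
        + \<alpha> (X1 s (fst p)) * \<beta>2 (X2 s (fst p)) * (f2 p \<bullet> f2 p)) / 2
      - (\<alpha>1 (X1 t (fst p)) * \<beta> (X2 t (fst p)) * U1 p + \<alpha> (X1 t (fst p)) * \<beta>1 (X2 t (fst p)) * U2 p)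
      - 20 * C\<^sup>2 * (min 1 (w s t (fst p)) * (U1 p + U2 p)))"
  have wn: "0 \<le> w s t \<omega>" if "\<omega> \<in> space M" for s t \<omega>
    unfolding w_def using U(3,4) that
    by (auto intro!: Bochner_Integration.integral_nonneg mult_nonneg_nonneg add_nonneg_nonneg simp: space_pair_measure)
  have wm: "w s t \<in> borel_measurable M" for s t
    unfolding w_def by measurable
  \<comment> \<open>A majorant that does not depend on the cell: every product of derivatives of the
    test functions is at most C^2, and min 1 w is at most 1.\<close>
  define D where "D = (\<lambda>p. C * C * ((norm (indicat_real {a<..b} (snd p) *\<^sub>R f1 p))\<^sup>2 + (norm (indicat_real {a<..b} (snd p) *\<^sub>R f2 p))\<^sup>2)
      + (C * C + 20 * C\<^sup>2) * (U1 p + U2 p))"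
  have sq: "sq_int P (\<lambda>p. indicat_real {a<..b} (snd p) *\<^sub>R f1 p)" "sq_int P (\<lambda>p. indicat_real {a<..b} (snd p) *\<^sub>R f2 p)"
    using ito_sq_int(1)[OF N(1)[of a]] ito_sq_int(1)[OF N(2)[of a]] ab by auto
  have D: "integrable P D"
    unfolding D_def using sq U by (intro Bochner_Integration.integrable_add integrable_mult_right) (auto simp: sq_int_def)
  have quad: "\<bar>(A * (f1 p \<bullet> f1 p) + 2 * (B * (f1 p \<bullet> f2 p)) + E * (f2 p \<bullet> f2 p)) / 2\<bar> \<le> C * C * ((norm (f1 p))\<^sup>2 + (norm (f2 p))\<^sup>2)"
    if "\<bar>A\<bar> \<le> C * C" "\<bar>B\<bar> \<le> C * C" "\<bar>E\<bar> \<le> C * C" for A B E p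
  proof -
    have 1: "\<bar>A * (f1 p \<bullet> f1 p)\<bar> \<le> C * C * (norm (f1 p))\<^sup>2" "\<bar>E * (f2 p \<bullet> f2 p)\<bar> \<le> C * C * (norm (f2 p))\<^sup>2"
      unfolding abs_mult power2_norm_eq_inner using that by (auto intro!: mult_mono')
    have "2 * \<bar>f1 p \<bullet> f2 p\<bar> \<le> (norm (f1 p))\<^sup>2 + (norm (f2 p))\<^sup>2"
      using Cauchy_Schwarz_ineq2[of "f1 p" "f2 p"] sum_squares_bound[of "norm (f1 p)" "norm (f2 p)"] by linarith
    then have "\<bar>B\<bar> * (2 * \<bar>f1 p \<bullet> f2 p\<bar>) \<le> C * C * ((norm (f1 p))\<^sup>2 + (norm (f2 p))\<^sup>2)"
      using that by (intro mult_mono) auto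
    then have 2: "\<bar>2 * (B * (f1 p \<bullet> f2 p))\<bar> \<le> C * C * (norm (f1 p))\<^sup>2 + C * C * (norm (f2 p))\<^sup>2"
      by (simp add: abs_mult algebra_simps)
    have gen: "\<bar>(u + v + z) / 2\<bar> \<le> k + l" if "\<bar>u\<bar> \<le> k" "\<bar>v\<bar> \<le> k + l" "\<bar>z\<bar> \<le> l" for u v z k l :: real
    proof -
      have "\<bar>u + v + z\<bar> \<le> 2 * k + 2 * l" using that by linarith
      then show ?thesis by simp
    qed
    show ?thesis using gen[OF 1(1) 2 1(2)] by (simp add: distrib_left)
  qed
  have HD: "\<bar>H s t p\<bar> \<le> D p" if st: "a \<le> s" "s < snd p" "snd p \<le> t" "t \<le> b" and p: "p \<in> space P" for s t p
  proof -
    have u: "0 \<le> U1 p" "0 \<le> U2 p" using U p by auto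
    have i1: "indicat_real {a<..b} (snd p) = 1" using st by auto
    have 1: "\<bar>(\<alpha>2 (X1 s (fst p)) * \<beta> (X2 s (fst p)) * (f1 p \<bullet> f1 p) + 2 * (\<alpha>1 (X1 s (fst p)) * \<beta>1 (X2 s (fst p)) * (f1 p \<bullet> f2 p))
        + \<alpha> (X1 s (fst p)) * \<beta>2 (X2 s (fst p)) * (f2 p \<bullet> f2 p)) / 2\<bar> \<le> C * C * ((norm (f1 p))\<^sup>2 + (norm (f2 p))\<^sup>2)"
      by (rule quad[OF bd(3,5,6)])
    have 2: "\<bar>\<alpha>1 (X1 t (fst p)) * \<beta> (X2 t (fst p)) * U1 p\<bar> \<le> C * C * U1 p" "\<bar>\<alpha> (X1 t (fst p)) * \<beta>1 (X2 t (fst p)) * U2 p\<bar> \<le> C * C * U2 p"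
      unfolding abs_mult[of _ "U1 p"] abs_mult[of _ "U2 p"] using u bd by (auto intro!: mult_mono')
    have fp: "fst p \<in> space M" using p by (auto simp: space_pair_measure)
    have "min 1 (w s t (fst p)) * (U1 p + U2 p) \<le> 1 * (U1 p + U2 p)" "0 \<le> min 1 (w s t (fst p)) * (U1 p + U2 p)"
      using wn[OF fp] u by (intro mult_right_mono mult_nonneg_nonneg; simp)+
    then have 3: "20 * C\<^sup>2 * (min 1 (w s t (fst p)) * (U1 p + U2 p)) \<le> 20 * C\<^sup>2 * (U1 p + U2 p)" "0 \<le> 20 * C\<^sup>2 * (min 1 (w s t (fst p)) * (U1 p + U2 p))"
      by (auto intro!: mult_left_mono)
    have gen: "\<bar>X - (Y + Z) - V\<bar> \<le> K + (c1 + c2 + l)" if "\<bar>X\<bar> \<le> K" "\<bar>Y\<bar> \<le> c1" "\<bar>Z\<bar> \<le> c2" "V \<le> l" "0 \<le> V" for X Y Z V K c1 c2 l :: real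
      using that by linarith
    show ?thesis
      using gen[OF 1 2 3] unfolding H_def D_def i1 by (simp add: algebra_simps)
  qed
  have Hm: "H s t \<in> borel_measurable P" for s t
  proof -
    note [measurable] = wm[of s t]
    show ?thesis unfolding H_def by measurable
  qed
  have Gm: "G \<in> borel_measurable P" unfolding G_def by measurable
  have Hlim: "AE p in P. snd p \<in> {a<..b} \<longrightarrow> (\<forall>S R. (\<forall>n. a \<le> S n \<and> S n < snd p \<and> snd p \<le> R n \<and> R n \<le> b) \<longrightarrow>
        S \<longlonglongrightarrow> snd p \<longrightarrow> R \<longlonglongrightarrow> snd p \<longrightarrow> (\<lambda>n. H (S n) (R n) p) \<longlonglongrightarrow> G p)"
    using AE_fst[OF P.AE_integrable_fst'[OF U(1)]] AE_fst[OF P.AE_integrable_fst'[OF U(2)]] AE_space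
  proof (eventually_elim, intro impI allI)
    fix p S R 
    assume i: "integrable lborel (\<lambda>r. U1 (fst p, r))" "integrable lborel (\<lambda>r. U2 (fst p, r))" and p: "p \<in> space P"
      and S: "\<forall>n. a \<le> S n \<and> S n < snd p \<and> snd p \<le> R n \<and> R n \<le> b" "S \<longlonglongrightarrow> snd p" and R: "R \<longlonglongrightarrow> snd p"
    have fp: "fst p \<in> space M" using p by (auto simp: space_pair_measure)
    have i12: "integrable lborel (\<lambda>r. U1 (fst p, r) + U2 (fst p, r))" using i by simp
    have "(\<lambda>n. w (S n) (R n) (fst p)) \<longlonglongrightarrow> (\<integral>(r::real). 0 \<partial>lborel)"
      unfolding w_def
    proof (rule integral_dominated_convergence[where M = lborel and w = "\<lambda>r. \<bar>U1 (fst p, r) + U2 (fst p, r)\<bar>" and f = "\<lambda>_. 0"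
          and s = "\<lambda>n r. indicat_real {S n<..R n} r * (U1 (fst p, r) + U2 (fst p, r))"])
      show "integrable lborel (\<lambda>r. \<bar>U1 (fst p, r) + U2 (fst p, r)\<bar>)" using i12 by simp
      show "(\<lambda>r. indicat_real {S n<..R n} r * (U1 (fst p, r) + U2 (fst p, r))) \<in> borel_measurable lborel" for n
        using borel_measurable_integrable[OF i12] by measurable
      show "AE r in lborel. norm (indicat_real {S n<..R n} r * (U1 (fst p, r) + U2 (fst p, r))) \<le> \<bar>U1 (fst p, r) + U2 (fst p, r)\<bar>" for n
        by (intro AE_I2) (simp split: split_indicator)
      show "AE r in lborel. (\<lambda>n. indicat_real {S n<..R n} r * (U1 (fst p, r) + U2 (fst p, r))) \<longlonglongrightarrow> 0"
        using AE_lborel_singleton[of "snd p"]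
      proof eventually_elim
        case (elim r)
        have "\<forall>\<^sub>F n in sequentially. r \<notin> {S n<..R n}"
        proof (cases "r < snd p")
          case True
          from order_tendstoD(1)[OF S(2) True] show ?thesis by eventually_elim auto
        next
          case False
          with elim have "snd p < r" by simp
          from order_tendstoD(2)[OF R this] show ?thesis by eventually_elim auto
        qed
        then show ?case by (intro tendsto_eventually) (auto elim: eventually_mono)
      qed
    qed simp
    then have w0: "(\<lambda>n. w (S n) (R n) (fst p)) \<longlonglongrightarrow> 0" by simp
    have XS: "(\<lambda>n. X1 (S n) (fst p)) \<longlonglongrightarrow> x p" "(\<lambda>n. X2 (S n) (fst p)) \<longlonglongrightarrow> y p"
      "(\<lambda>n. X1 (R n) (fst p)) \<longlonglongrightarrow> x p" "(\<lambda>n. X2 (R n) (fst p)) \<longlonglongrightarrow> y p"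
      unfolding x_def y_def using continuous_on_tendsto_compose[OF Xc(1)[OF fp] S(2)] continuous_on_tendsto_compose[OF Xc(2)[OF fp] S(2)]
        continuous_on_tendsto_compose[OF Xc(1)[OF fp] R] continuous_on_tendsto_compose[OF Xc(2)[OF fp] R] by auto
    have "(\<lambda>n. H (S n) (R n) p) \<longlonglongrightarrow> (\<alpha>2 (x p) * \<beta> (y p) * (f1 p \<bullet> f1 p) + 2 * (\<alpha>1 (x p) * \<beta>1 (y p) * (f1 p \<bullet> f2 p))
        + \<alpha> (x p) * \<beta>2 (y p) * (f2 p \<bullet> f2 p)) / 2 - (\<alpha>1 (x p) * \<beta> (y p) * U1 p + \<alpha> (x p) * \<beta>1 (y p) * U2 p)
        - 20 * C\<^sup>2 * (min 1 0 * (U1 p + U2 p))"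
      unfolding H_def by (intro tendsto_intros tendsto_min w0 lims[OF cont(1)] lims[OF cont(2)] lims[OF cont(3)] lims[OF cont(4)] lims[OF cont(5)] lims[OF cont(6)] XS) simp_all
    then show "(\<lambda>n. H (S n) (R n) p) \<longlonglongrightarrow> G p" by (simp add: G_def)
  qed
  let ?I = "\<lambda>n. \<Sum>i<Suc n. \<integral>p. indicat_real {grid a b n i<..grid a b n (Suc i)} (snd p) * H (grid a b n i) (grid a b n (Suc i)) p \<partial>P"
  have GL: "?I \<longlonglongrightarrow> (\<integral>p. indicat_real {a<..b} (snd p) * G p \<partial>P)"
    by (rule grid_limit(2)[where H = H, OF less_imp_le[OF ab(2)] Hm D HD Gm Hlim])
  show "integrable P (\<lambda>p. indicat_real {a<..b} (snd p) * G p)"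
  proof (rule Bochner_Integration.integrable_bound[OF D])
    show "(\<lambda>p. indicat_real {a<..b} (snd p) * G p) \<in> borel_measurable P" using Gm by measurable
    show "AE p in P. norm (indicat_real {a<..b} (snd p) * G p) \<le> norm (D p)"
    proof (intro AE_I2)
      fix p assume p: "p \<in> space P"
      show "norm (indicat_real {a<..b} (snd p) * G p) \<le> norm (D p)"
      proof (cases "snd p \<in> {a<..b}")
        case True
        have u: "0 \<le> U1 p" "0 \<le> U2 p" using U p by auto
        have 1: "\<bar>(\<alpha>2 (x p) * \<beta> (y p) * (f1 p \<bullet> f1 p) + 2 * (\<alpha>1 (x p) * \<beta>1 (y p) * (f1 p \<bullet> f2 p))
            + \<alpha> (x p) * \<beta>2 (y p) * (f2 p \<bullet> f2 p)) / 2\<bar> \<le> C * C * ((norm (f1 p))\<^sup>2 + (norm (f2 p))\<^sup>2)"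
          by (rule quad[OF bd(3,5,6)])
        have 2: "\<bar>\<alpha>1 (x p) * \<beta> (y p) * U1 p\<bar> \<le> C * C * U1 p" "\<bar>\<alpha> (x p) * \<beta>1 (y p) * U2 p\<bar> \<le> C * C * U2 p"
          unfolding abs_mult[of _ "U1 p"] abs_mult[of _ "U2 p"] using u bd by (auto intro!: mult_mono')
        have 3: "0 \<le> 20 * C\<^sup>2 * (U1 p + U2 p)" using u by simp
        have gen: "\<bar>X - (Y + Z)\<bar> \<le> K + (c1 + c2 + l)" if "\<bar>X\<bar> \<le> K" "\<bar>Y\<bar> \<le> c1" "\<bar>Z\<bar> \<le> c2" "0 \<le> l" for X Y Z K c1 c2 l :: real
          using that by linarith
        have "\<bar>G p\<bar> \<le> D p"
          using gen[OF 1 2 3] True unfolding G_def D_def by (simp add: algebra_simps)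
        then show ?thesis using True by simp
      qed simp
    qed
  qed
  let ?m1 = "\<lambda>n. \<Sum>i<Suc n. \<integral>\<omega>. min_sq_cube (N1 (grid a b n i) \<omega> - N1 (grid a b n (Suc i)) \<omega>) \<partial>M"
  let ?m2 = "\<lambda>n. \<Sum>i<Suc n. \<integral>\<omega>. min_sq_cube (N2 (grid a b n i) \<omega> - N2 (grid a b n (Suc i)) \<omega>) \<partial>M"
  let ?\<Phi> = "\<lambda>t. \<integral>\<omega>. \<alpha> (X1 t \<omega>) * \<beta> (X2 t \<omega>) \<partial>M"
  have mu1: "?m1 \<longlonglongrightarrow> 0" by (rule ito_min_sq_cube_sum[OF ab N(1) fm(1)])
  have mu2: "?m2 \<longlonglongrightarrow> 0" by (rule ito_min_sq_cube_sum[OF ab N(2) fm(2)])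
  have le: "?I n - 80 * C\<^sup>2 * (?m1 n + ?m2 n) \<le> ?\<Phi> b - ?\<Phi> a" for n
  proof -
    have cell: "(\<integral>p. indicat_real {grid a b n i<..grid a b n (Suc i)} (snd p) * H (grid a b n i) (grid a b n (Suc i)) p \<partial>P)
       - 80 * C\<^sup>2 * ((\<integral>\<omega>. min_sq_cube (N1 (grid a b n i) \<omega> - N1 (grid a b n (Suc i)) \<omega>) \<partial>M) + (\<integral>\<omega>. min_sq_cube (N2 (grid a b n i) \<omega> - N2 (grid a b n (Suc i)) \<omega>) \<partial>M))
       \<le> ?\<Phi> (grid a b n (Suc i)) - ?\<Phi> (grid a b n i)" if i: "i < Suc n" for i
    proof -
      have g: "a \<le> grid a b n i" "grid a b n i \<le> grid a b n (Suc i)" "grid a b n (Suc i) \<le> b" "0 \<le> grid a b n i"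
        using grid_bounds[of a b i n] grid_bounds[of a b "Suc i" n] grid_mono[of a b i "Suc i" n] ab i by auto
      show ?thesis
        unfolding H_def w_def
        by (rule ito_cell_inequality[OF g(4) g(2) ito_cell[OF N(1) g(1-3)] ito_cell[OF N(2) g(1-3)] X(1) X(2) XM(1) XM(2) U
            inc(1)[OF g(1-3)] inc(2)[OF g(1-3)] \<alpha> \<beta> C]) (use g in auto)
    qed
    have "?I n - 80 * C\<^sup>2 * (?m1 n + ?m2 n) = (\<Sum>i<Suc n. (\<integral>p. indicat_real {grid a b n i<..grid a b n (Suc i)} (snd p) * H (grid a b n i) (grid a b n (Suc i)) p \<partial>P)
       - 80 * C\<^sup>2 * ((\<integral>\<omega>. min_sq_cube (N1 (grid a b n i) \<omega> - N1 (grid a b n (Suc i)) \<omega>) \<partial>M) + (\<integral>\<omega>. min_sq_cube (N2 (grid a b n i) \<omega> - N2 (grid a b n (Suc i)) \<omega>) \<partial>M)))"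
      by (simp only: sum_subtractf sum_distrib_left sum.distrib distrib_left)
    also have "\<dots> \<le> (\<Sum>i<Suc n. ?\<Phi> (grid a b n (Suc i)) - ?\<Phi> (grid a b n i))"
      by (intro sum_mono cell) simp
    also have "\<dots> = ?\<Phi> b - ?\<Phi> a"
      by (subst sum_lessThan_telescope) (simp only: grid_0 grid_last)
    finally show ?thesis .
  qed
  have "(\<lambda>n. ?I n - 80 * C\<^sup>2 * (?m1 n + ?m2 n)) \<longlonglongrightarrow> (\<integral>p. indicat_real {a<..b} (snd p) * G p \<partial>P) - 80 * C\<^sup>2 * (0 + 0)"
    by (intro tendsto_intros GL mu1 mu2)
  then have "(\<integral>p. indicat_real {a<..b} (snd p) * G p \<partial>P) - 80 * C\<^sup>2 * (0 + 0) \<le> ?\<Phi> b - ?\<Phi> a"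
    by (rule LIMSEQ_le_const2) (use le in auto)
  then show "(\<integral>p. indicat_real {a<..b} (snd p) * G p \<partial>P) \<le> ?\<Phi> b - ?\<Phi> a" by simp
qed

end

section \<open>The test function\<close>

text \<open>Both test functions are functions of a variable s with values in [0, 1] whose derivative
  is again a function of s. All derivatives are then continuous functions of s on a compact
  interval, hence bounded on the whole line, and the third one bounds the Taylor remainder.\<close>

lemma cubic_taylor_comp:
  fixes f0 f1 f2 f3 s :: "real \<Rightarrow> real"
  assumes D: "\<And>x. ((\<lambda>x. f0 (s x)) has_real_derivative f1 (s x)) (at x)"
       "\<And>x. ((\<lambda>x. f1 (s x)) has_real_derivative f2 (s x)) (at x)"
       "\<And>x. ((\<lambda>x. f2 (s x)) has_real_derivative f3 (s x)) (at x)"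
    and s: "\<And>x. 0 \<le> s x" "\<And>x. s x \<le> 1"
    and c: "continuous_on {0..1} f0" "continuous_on {0..1} f1" "continuous_on {0..1} f2" "continuous_on {0..1} f3"
  shows "\<exists>C0. \<forall>C\<ge>C0. cubic_taylor C (\<lambda>x. f0 (s x)) (\<lambda>x. f1 (s x)) (\<lambda>x. f2 (s x))"
proof -
  have bnd: "\<exists>B. \<forall>x. \<bar>f (s x)\<bar> \<le> B" if "continuous_on {0..1} f" for f :: "real \<Rightarrow> real"
  proof -
    have "bounded (f ` {0..1})" by (intro compact_imp_bounded compact_continuous_image that) auto
    then show ?thesis using s by (fastforce simp: bounded_iff)
  qed
  obtain B0 B1 B2 B3 where B: "\<And>x. \<bar>f0 (s x)\<bar> \<le> B0" "\<And>x. \<bar>f1 (s x)\<bar> \<le> B1" "\<And>x. \<bar>f2 (s x)\<bar> \<le> B2" "\<And>x. \<bar>f3 (s x)\<bar> \<le> B3"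
    using bnd[OF c(1)] bnd[OF c(2)] bnd[OF c(3)] bnd[OF c(4)] by metis
  show ?thesis
  proof (intro exI allI impI)
    fix C assume C: "max (max B0 B1) (max B2 B3) \<le> C"
    have "\<bar>f0 (s (x + d)) - (f0 (s x) + f1 (s x) * d + f2 (s x) / 2 * d\<^sup>2)\<bar> \<le> C * \<bar>d\<bar> ^ 3" for x d
    proof -
      define diff where "diff = (\<lambda>m::nat. if m = 0 then (\<lambda>d. f0 (s (x + d))) else if m = 1 then (\<lambda>d. f1 (s (x + d)))
         else if m = 2 then (\<lambda>d. f2 (s (x + d))) else (\<lambda>d. f3 (s (x + d))))"
      have "\<forall>m t. m < 3 \<and> \<bar>t\<bar> \<le> \<bar>d\<bar> \<longrightarrow> DERIV (diff m) t :> diff (Suc m) t"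
      proof (intro allI impI)
        fix m :: nat and t assume "m < 3 \<and> \<bar>t\<bar> \<le> \<bar>d\<bar>"
        then consider "m = 0" | "m = 1" | "m = 2" by linarith
        then show "DERIV (diff m) t :> diff (Suc m) t"
          using D[of "x + t"] DERIV_shift[of _ _ t x] by cases (auto simp: diff_def add.commute)
      qed
      from Maclaurin_bi_le[OF _ this, of "\<lambda>d. f0 (s (x + d))"]
      obtain t where "f0 (s (x + d)) = (\<Sum>m<3. diff m 0 / fact m * d ^ m) + diff 3 t / fact 3 * d ^ 3"
        by (auto simp: diff_def)
      also have "\<dots> = (f0 (s x) + f1 (s x) * d + f2 (s x) / 2 * d\<^sup>2) + f3 (s (x + t)) / 6 * d ^ 3"
        by (simp add: diff_def eval_nat_numeral fact_numeral)
      finally have eq: "f0 (s (x + d)) - (f0 (s x) + f1 (s x) * d + f2 (s x) / 2 * d\<^sup>2) = f3 (s (x + t)) / 6 * d ^ 3" by simp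
      have "\<bar>f3 (s (x + t))\<bar> / 6 \<le> C" using B(4)[of "x + t"] C abs_ge_zero[of "f3 (s (x + t))"] by linarith
      then have "\<bar>f3 (s (x + t)) / 6\<bar> \<le> C" by simp
      then show ?thesis unfolding eq abs_mult power_abs by (rule mult_right_mono) simp
    qed
    then show "cubic_taylor C (\<lambda>x. f0 (s x)) (\<lambda>x. f1 (s x)) (\<lambda>x. f2 (s x))"
      unfolding cubic_taylor_def
      using B C D by (auto intro!: DERIV_continuous_on[where s = UNIV] order_trans[OF B(1)] order_trans[OF B(2)] order_trans[OF B(3)])
  qed
qed

section \<open>Powers of the saturated positive part\<close>

definition pos_sat :: "real \<Rightarrow> real" where "pos_sat x = 1 - 1 / (1 + max x 0)"

lemma pos_sat_bounds: "0 \<le> pos_sat x" "pos_sat x \<le> 1" "pos_sat x \<le> max x 0"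
proof -
  have "pos_sat x = max x 0 / (1 + max x 0)" by (simp add: pos_sat_def field_simps)
  moreover have "max x 0 / (1 + max x 0) \<le> max x 0" by (simp add: divide_le_eq max_def mult_le_cancel_left1)
  moreover have "0 \<le> max x 0 / (1 + max x 0)" by simp
  ultimately show "0 \<le> pos_sat x" "pos_sat x \<le> max x 0" by auto
  show "pos_sat x \<le> 1" by (simp add: pos_sat_def)
qed

lemma pos_sat_mono: "mono pos_sat"
  by (rule monoI) (auto simp: pos_sat_def intro!: divide_left_mono)

lemma pos_sat_nonpos: "x \<le> 0 \<Longrightarrow> pos_sat x = 0"
  by (simp add: pos_sat_def max_def)

lemma pos_sat_pos: "0 < x \<Longrightarrow> 1 - pos_sat x = 1 / (1 + x)"
  by (simp add: pos_sat_def max_def)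

text \<open>The derivative of \<open>pos_sat\<close> is its complement squared on the right of 0 and
  0 on the left. The kink at 0 is harmless since f' 0 = 0: from 0 < pos_sat h \<le> h for h > 0, the
  difference quotient of the composition is bounded by that of f at pos_sat h.\<close>

lemma pos_sat_comp_deriv:
  assumes f: "\<And>x. (f has_real_derivative f' x) (at x)" and f0: "f' 0 = 0"
  shows "((\<lambda>x. f (pos_sat x)) has_real_derivative f' (pos_sat x) * (1 - pos_sat x)\<^sup>2) (at x)"
proof -
  consider "x < 0" | "x = 0" | "0 < x" by linarith
  then show ?thesis
  proof cases
    case 1
    have "((\<lambda>x. f 0) has_real_derivative 0) (at x)" by simp
    then have "((\<lambda>x. f (pos_sat x)) has_real_derivative 0) (at x)"
      by (rule has_field_derivative_transform_within_open[of _ _ _ "{..<0}"]) (use 1 in \<open>auto simp: pos_sat_nonpos\<close>)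
    then show ?thesis using 1 f0 by (simp add: pos_sat_nonpos)
  next
    case 2
    have "((\<lambda>h. (f (pos_sat h) - f 0) / h) \<longlongrightarrow> 0) (at 0)"
    proof (rule Lim_null_comparison)
      \<comment> \<open>The modulus of the difference quotient of f at 0, with value 0 there. Being
        continuous at 0, it can be composed with \<open>pos_sat\<close>, which also takes the value
        0 at arguments other than 0.\<close>
      define q where "q = (\<lambda>h. if h = 0 then 0 else \<bar>(f h - f 0) / h\<bar>)"
      have "((\<lambda>h. (f h - f 0) / h) \<longlongrightarrow> 0) (at 0)"
        using f[of 0] f0 by (simp add: DERIV_def)
      then have "((\<lambda>h. \<bar>(f h - f 0) / h\<bar>) \<longlongrightarrow> 0) (at 0)" by (rule tendsto_rabs_zero)
      then have "(q \<longlongrightarrow> 0) (at 0)"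
        by (rule Lim_transform_eventually) (auto simp: q_def eventually_at_filter)
      then have q: "isCont q 0" by (simp add: isCont_def q_def)
      have tau0: "isCont pos_sat 0" unfolding pos_sat_def by (intro continuous_intros) auto
      have "isCont (\<lambda>h. q (pos_sat h)) 0"
        by (rule isCont_o2[OF tau0]) (use q in \<open>simp add: pos_sat_nonpos\<close>)
      then show "((\<lambda>h. q (pos_sat h)) \<longlongrightarrow> 0) (at 0)" by (simp add: isCont_def pos_sat_nonpos q_def)
      show "\<forall>\<^sub>F h in at 0. norm ((f (pos_sat h) - f 0) / h) \<le> q (pos_sat h)"
      proof (rule eventually_at_filter[THEN iffD2], intro always_eventually allI impI)
        fix h :: real assume "h \<noteq> 0"
        show "norm ((f (pos_sat h) - f 0) / h) \<le> q (pos_sat h)"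
        proof (cases "pos_sat h = 0")
          case True
          then show ?thesis by (simp add: q_def)
        next
          case False
          then have h: "0 < h" using pos_sat_nonpos[of h] by force
          have t: "0 < pos_sat h" "pos_sat h \<le> h" using pos_sat_bounds[of h] False h by auto
          have "\<bar>f (pos_sat h) - f 0\<bar> / h \<le> \<bar>f (pos_sat h) - f 0\<bar> / pos_sat h"
            using t h by (intro divide_left_mono) auto
          then show ?thesis using False t h by (simp add: q_def abs_divide)
        qed
      qed
    qed
    then have "((\<lambda>x. f (pos_sat x)) has_real_derivative 0) (at 0)"
      by (simp add: DERIV_def pos_sat_nonpos)
    then show ?thesis using 2 f0 by (simp add: pos_sat_nonpos)
  next
    case 3
    have "((\<lambda>x. 1 - 1 / (1 + x)) has_real_derivative (1 / (1 + x))\<^sup>2) (at x)"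
      using 3 by (auto intro!: derivative_eq_intros simp: power2_eq_square field_simps)
    then have "(pos_sat has_real_derivative (1 / (1 + x))\<^sup>2) (at x)"
      by (rule has_field_derivative_transform_within_open[of _ _ _ "{0<..}"]) (use 3 in \<open>auto simp: pos_sat_def max_def\<close>)
    from DERIV_chain2[OF f[of "pos_sat x"] this] show ?thesis using 3 by (simp add: pos_sat_pos)
  qed
qed

text \<open>The exponent is at least 4 so that three derivatives are continuous across 0.\<close>

definition pow_test :: "nat \<Rightarrow> real \<Rightarrow> real" where "pow_test n x = pos_sat x ^ (n + 4)"
definition pow_test1 :: "nat \<Rightarrow> real \<Rightarrow> real" where
  "pow_test1 n x = real (n + 4) * pos_sat x ^ (n + 3) * (1 - pos_sat x)\<^sup>2"
definition pow_test2 :: "nat \<Rightarrow> real \<Rightarrow> real" where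
  "pow_test2 n x = real (n + 4) * (real (n + 3) * pos_sat x ^ (n + 2) * (1 - pos_sat x) ^ 4 - 2 * pos_sat x ^ (n + 3) * (1 - pos_sat x) ^ 3)"

lemma pow_test_taylor: "\<exists>C0. \<forall>C\<ge>C0. cubic_taylor C (pow_test n) (pow_test1 n) (pow_test2 n)"
proof -
  define f0 f1 f2 where "f0 = (\<lambda>x::real. x ^ (n + 4))" and "f1 = (\<lambda>x. real (n + 4) * x ^ (n + 3) * (1 - x)\<^sup>2)"
    and "f2 = (\<lambda>x. real (n + 4) * (real (n + 3) * x ^ (n + 2) * (1 - x) ^ 4 - 2 * x ^ (n + 3) * (1 - x) ^ 3))"
  \<comment> \<open>Derivatives of \<open>f0\<close>, \<open>f1\<close>, \<open>f2\<close> with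
    respect to s = pos_sat x; the factor (1 - s)^2 converts them into derivatives with respect to
    x.\<close>
  define g0 g1 g2 where "g0 = (\<lambda>x. real (n + 4) * x ^ (n + 3))"
    and "g1 = (\<lambda>x. real (n + 4) * (real (n + 3) * x ^ (n + 2) * (1 - x)\<^sup>2 - 2 * x ^ (n + 3) * (1 - x)))"
    and "g2 = (\<lambda>x. real (n + 4) * (real (n + 3) * (real (n + 2) * x ^ (n + 1) * (1 - x) ^ 4 - 4 * x ^ (n + 2) * (1 - x) ^ 3)
        - 2 * (real (n + 3) * x ^ (n + 2) * (1 - x) ^ 3 - 3 * x ^ (n + 3) * (1 - x)\<^sup>2)))"
  have d0: "(f0 has_real_derivative g0 x) (at x)" for x
    unfolding f0_def g0_def by (auto intro!: derivative_eq_intros simp: add.commute)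
  have d1: "(f1 has_real_derivative g1 x) (at x)" for x
    unfolding f1_def g1_def
    by (rule derivative_eq_intros refl)+ (simp add: algebra_simps power2_eq_square)
  have d2: "(f2 has_real_derivative g2 x) (at x)" for x
    unfolding f2_def g2_def
    by (rule derivative_eq_intros refl)+ (simp add: algebra_simps)
  have h: "g0 x * (1 - x)\<^sup>2 = f1 x" "g1 x * (1 - x)\<^sup>2 = f2 x" for x
    by (simp_all add: g0_def f1_def g1_def f2_def algebra_simps power2_eq_square power3_eq_cube power4_eq_xxxx)
  have z: "g0 0 = 0" "g1 0 = 0" "g2 0 = 0" by (simp_all add: g0_def g1_def g2_def)
  have "\<exists>C0. \<forall>C\<ge>C0. cubic_taylor C (\<lambda>x. f0 (pos_sat x)) (\<lambda>x. f1 (pos_sat x)) (\<lambda>x. f2 (pos_sat x))"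
  proof (rule cubic_taylor_comp[where ?f3.0 = "\<lambda>x. g2 x * (1 - x)\<^sup>2"])
    show "((\<lambda>x. f0 (pos_sat x)) has_real_derivative f1 (pos_sat x)) (at x)" for x
      using pos_sat_comp_deriv[OF d0 z(1)] unfolding h .
    show "((\<lambda>x. f1 (pos_sat x)) has_real_derivative f2 (pos_sat x)) (at x)" for x
      using pos_sat_comp_deriv[OF d1 z(2)] unfolding h .
    show "((\<lambda>x. f2 (pos_sat x)) has_real_derivative g2 (pos_sat x) * (1 - pos_sat x)\<^sup>2) (at x)" for x
      using pos_sat_comp_deriv[OF d2 z(3)] .
    show "continuous_on {0..1} f0" "continuous_on {0..1} f1" "continuous_on {0..1} f2" "continuous_on {0..1} (\<lambda>x. g2 x * (1 - x)\<^sup>2)"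
      unfolding f0_def f1_def f2_def g2_def by (intro continuous_intros)+
  qed (use pos_sat_bounds in auto)
  then show ?thesis
    by (simp add: f0_def f1_def f2_def pow_test_def[abs_def] pow_test1_def[abs_def] pow_test2_def[abs_def])
qed

lemma pow_test_mono: "mono (pow_test n)"
  using pos_sat_mono pos_sat_bounds unfolding pow_test_def[abs_def] by (auto intro!: monoI power_mono dest: monoD)

lemma pow_test_nonneg: "0 \<le> pow_test n x"
  by (simp add: pow_test_def pos_sat_bounds)

section \<open>The exponential of a logistic function\<close>

definition logistic :: "real \<Rightarrow> real \<Rightarrow> real \<Rightarrow> real" where "logistic l m y = 1 / (1 + exp (- (l * (y - m))))"

lemma logistic_bounds: "0 < logistic l m y" "logistic l m y < 1"
  by (simp_all add: logistic_def add_pos_pos divide_less_eq)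

lemma logistic_deriv: "(logistic l m has_real_derivative l * (logistic l m y * (1 - logistic l m y))) (at y)"
proof -
  define e where "e = exp (- (l * (y - m)))"
  have e: "0 < 1 + e" "1 + e \<noteq> 0" by (simp_all add: e_def add_pos_pos less_imp_neq[symmetric])
  have "1 + exp (- (l * (y - m))) \<noteq> 0" using e by (simp add: e_def)
  then have "(logistic l m has_real_derivative - (exp (- (l * (y - m))) * - l) / ((1 + exp (- (l * (y - m)))) * (1 + exp (- (l * (y - m)))))) (at y)"
    unfolding logistic_def[abs_def] by (auto intro!: derivative_eq_intros)
  moreover have "- (e * - l) / ((1 + e) * (1 + e)) = l * (1 / (1 + e) * (1 - 1 / (1 + e)))"
    using e by (simp add: field_simps)
  ultimately show ?thesis by (simp add: e_def logistic_def)
qed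

text \<open>This is e^v with v equal to A times the logistic function. In the definitions that
  follow, \<open>logistic_slope\<close> is v', and l (1 - 2 s) v', with s the logistic value, is
  v''.\<close>

definition exp_test :: "real \<Rightarrow> real \<Rightarrow> real \<Rightarrow> real \<Rightarrow> real" where "exp_test A l m y = exp (A * logistic l m y)"
definition logistic_slope :: "real \<Rightarrow> real \<Rightarrow> real \<Rightarrow> real \<Rightarrow> real" where "logistic_slope A l m y = A * l * (logistic l m y * (1 - logistic l m y))"
definition exp_test1 :: "real \<Rightarrow> real \<Rightarrow> real \<Rightarrow> real \<Rightarrow> real" where "exp_test1 A l m y = logistic_slope A l m y * exp_test A l m y"
definition exp_test2 :: "real \<Rightarrow> real \<Rightarrow> real \<Rightarrow> real \<Rightarrow> real" where
  "exp_test2 A l m y = (l * (1 - 2 * logistic l m y) * logistic_slope A l m y + (logistic_slope A l m y)\<^sup>2) * exp_test A l m y"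

lemma exp_test_taylor: "\<exists>C0. \<forall>C\<ge>C0. cubic_taylor C (exp_test A l m) (exp_test1 A l m) (exp_test2 A l m)"
proof -
  define f0 f1 f2 where "f0 = (\<lambda>x::real. exp (A * x))" and "f1 = (\<lambda>x. A * l * (x * (1 - x)) * exp (A * x))"
    and "f2 = (\<lambda>x. (l * (1 - 2 * x) * (A * l * (x * (1 - x))) + (A * l * (x * (1 - x)))\<^sup>2) * exp (A * x))"
  define g0 g1 g2 where "g0 = (\<lambda>x. A * exp (A * x))"
    and "g1 = (\<lambda>x. (A * l * (1 - 2 * x) + A * l * (x * (1 - x)) * A) * exp (A * x))"
    and "g2 = (\<lambda>x. (- 2 * l * (A * l * (x * (1 - x))) + l * (1 - 2 * x) * (A * l * (1 - 2 * x))
        + 2 * (A * l * (x * (1 - x))) * (A * l * (1 - 2 * x)) 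
        + (l * (1 - 2 * x) * (A * l * (x * (1 - x))) + (A * l * (x * (1 - x)))\<^sup>2) * A) * exp (A * x))"
  have d0: "(f0 has_real_derivative g0 x) (at x)" for x
    unfolding f0_def g0_def by (auto intro!: derivative_eq_intros)
  have d1: "(f1 has_real_derivative g1 x) (at x)" for x
    unfolding f1_def g1_def by (rule derivative_eq_intros refl)+ (simp add: algebra_simps)
  have d2: "(f2 has_real_derivative g2 x) (at x)" for x
    unfolding f2_def g2_def by (rule derivative_eq_intros refl)+ (simp add: algebra_simps power2_eq_square)
  have h: "g0 x * (l * (x * (1 - x))) = f1 x" "g1 x * (l * (x * (1 - x))) = f2 x" for x
    by (simp_all add: g0_def f1_def g1_def f2_def algebra_simps power2_eq_square)
  have "\<exists>C0. \<forall>C\<ge>C0. cubic_taylor C (\<lambda>x. f0 (logistic l m x)) (\<lambda>x. f1 (logistic l m x)) (\<lambda>x. f2 (logistic l m x))"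
  proof (rule cubic_taylor_comp[where ?f3.0 = "\<lambda>x. g2 x * (l * (x * (1 - x)))"])
    show "((\<lambda>x. f0 (logistic l m x)) has_real_derivative f1 (logistic l m x)) (at x)" for x
      using DERIV_chain2[OF d0 logistic_deriv, of l m x] unfolding h .
    show "((\<lambda>x. f1 (logistic l m x)) has_real_derivative f2 (logistic l m x)) (at x)" for x
      using DERIV_chain2[OF d1 logistic_deriv, of l m x] unfolding h .
    show "((\<lambda>x. f2 (logistic l m x)) has_real_derivative g2 (logistic l m x) * (l * (logistic l m x * (1 - logistic l m x)))) (at x)" for x
      using DERIV_chain2[OF d2 logistic_deriv, of l m x] .
    show "continuous_on {0..1} f0" "continuous_on {0..1} f1" "continuous_on {0..1} f2" "continuous_on {0..1} (\<lambda>x. g2 x * (l * (x * (1 - x))))"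
      unfolding f0_def f1_def f2_def g2_def by (intro continuous_intros)+
  qed (simp_all add: logistic_bounds less_imp_le)
  then show ?thesis
    by (simp add: f0_def f1_def f2_def exp_test_def[abs_def] exp_test1_def[abs_def] exp_test2_def[abs_def] logistic_slope_def[abs_def])
qed

lemma exp_test_mono: assumes "0 \<le> A" "0 \<le> l" shows "mono (exp_test A l m)"
proof (rule monoI)
  fix x y :: real assume "x \<le> y"
  then have "l * (x - m) \<le> l * (y - m)" using assms by (intro mult_left_mono) auto
  then have "exp (- (l * (y - m))) \<le> exp (- (l * (x - m)))" by simp
  then have "logistic l m x \<le> logistic l m y"
    unfolding logistic_def by (intro divide_left_mono) (auto simp: add_pos_pos)
  then show "exp_test A l m x \<le> exp_test A l m y" using assms by (simp add: exp_test_def mult_left_mono)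
qed

lemma exp_test_bounds: assumes "0 \<le> A" shows "1 \<le> exp_test A l m y" "exp_test A l m y \<le> exp A"
  using assms logistic_bounds[of l m y] by (simp_all add: exp_test_def mult_left_le)

section \<open>The differential inequality satisfied by the test function\<close>

lemma quadratic_form_bound:
  fixes p p2 :: real
  assumes p: "0 \<le> p" "0 < p2" and S: "V\<^sup>2 * p \<le> p2 * S"
  shows "p * (w * s * V) \<le> p * p2 * w\<^sup>2 / 2 + s\<^sup>2 * S / 2"
proof -
  \<comment> \<open>Completing the square in w; the hypothesis on V is the discriminant
    condition.\<close>
  have "0 \<le> p * p2 * (w - s * V / p2)\<^sup>2 / 2" using p by simp
  also have "\<dots> = p * p2 * w\<^sup>2 / 2 - p * (w * s * V) + s\<^sup>2 * (V\<^sup>2 * p / p2) / 2"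
    using p by (simp add: power2_eq_square field_simps)
  finally have 1: "p * (w * s * V) \<le> p * p2 * w\<^sup>2 / 2 + s\<^sup>2 * (V\<^sup>2 * p / p2) / 2" by linarith
  have "V\<^sup>2 * p / p2 \<le> S" using S p by (simp add: divide_le_eq mult.commute)
  then have 2: "s\<^sup>2 * (V\<^sup>2 * p / p2) \<le> s\<^sup>2 * S" by (intro mult_left_mono) auto
  show ?thesis by (rule order_trans[OF 1], intro add_left_mono divide_right_mono 2) simp
qed

text \<open>The inequality after division by \<beta> and by the power of t = pos_sat x of exponent p
  - 2; here e = 1 - t, q and z are the norms of Z - Zb and Zb, and w = e^2 q. From p (p - 1) w^2 / 2
  three amounts are spent, each times p w^2: 1 + R on the negative part of \<alpha>'', L (1 + R)^2
  on the drift L q^2, and 1/2 on the drift L q. What is left is p p2 w^2 / 2, which is the origin of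
  \<open>p2\<close>; \<open>quadratic_form_bound\<close> sets it against the cross terms v' and 2
  L.\<close>

lemma scaled_inequality:
  fixes p q z t e x R L K a c v1 v2 \<gamma> :: real
  assumes p: "0 \<le> p" and q: "0 \<le> q" "0 \<le> z" and t: "0 \<le> t" "t \<le> 1" and e: "0 \<le> e" "e \<le> 1" "x * e = t" "1 \<le> (1 + R) * e"
    and nn: "0 \<le> L" "0 \<le> K" "0 \<le> a" "0 \<le> v1" and c: "- (q * z) \<le> c"
    and p2: "p2 = p - 2 - (2 * (1 + R) + 2 * L * (1 + R)\<^sup>2)" "0 < p2"
    and S: "(v1 + 2 * L)\<^sup>2 * p \<le> p2 * (v2 + v1\<^sup>2 - \<gamma> * v1)"
  shows "- ((p * L\<^sup>2 / 2 + p * K) * t\<^sup>2 + p * K * (t * a)) \<le>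
      (p * ((p - 1) * e ^ 4 * q\<^sup>2 - 2 * t * e ^ 3 * q\<^sup>2) + 2 * (p * t * e\<^sup>2 * v1 * c) + t\<^sup>2 * (v2 + v1\<^sup>2) * z\<^sup>2) / 2
      - (p * t * e\<^sup>2 * (K * x + L * (1 + 2 * z + q) * q + K * a) + t\<^sup>2 * v1 * (\<gamma> / 2 * z\<^sup>2))"
proof -
  define w where "w = e\<^sup>2 * q"
  have w0: "0 \<le> w" using q by (simp add: w_def)
  have w2: "w\<^sup>2 = e ^ 4 * q\<^sup>2" by (simp add: w_def power_mult_distrib)
  \<comment> \<open>As t \<le> 1 \<le> (1 + R) e, the factor t may be exchanged for (1 + R) e to
    complete the powers of e in w^2. This is where the upper bound R on x enters.\<close>
  have g1: "t * (e ^ 3 * q\<^sup>2) \<le> (1 + R) * w\<^sup>2"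
  proof -
    have "t * (e ^ 3 * q\<^sup>2) \<le> 1 * (e ^ 3 * q\<^sup>2)" using t e by (intro mult_right_mono) auto
    also have "\<dots> \<le> ((1 + R) * e) * (e ^ 3 * q\<^sup>2)" using e by (intro mult_right_mono) auto
    finally show ?thesis unfolding w2 by (simp add: power4_eq_xxxx power3_eq_cube power2_eq_square mult_ac)
  qed
  have g2: "t * (e\<^sup>2 * q\<^sup>2) \<le> (1 + R)\<^sup>2 * w\<^sup>2"
  proof -
    have "t * (e\<^sup>2 * q\<^sup>2) \<le> 1 * (e\<^sup>2 * q\<^sup>2)" using t e by (intro mult_right_mono) auto
    also have "\<dots> \<le> (((1 + R) * e)\<^sup>2) * (e\<^sup>2 * q\<^sup>2)"
      using power_mono[OF e(4), of 2] by (intro mult_right_mono) auto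
    finally show ?thesis unfolding w2 by (simp add: power4_eq_xxxx power2_eq_square mult_ac)
  qed
  have g3: "t * (e\<^sup>2 * x) \<le> t\<^sup>2"
  proof -
    have "t * (e\<^sup>2 * x) = t * (e * (x * e))" by (simp add: power2_eq_square)
    also have "\<dots> = t\<^sup>2 * e" unfolding e(3) by (simp add: power2_eq_square)
    also have "t\<^sup>2 * e \<le> t\<^sup>2 * 1" using e by (intro mult_left_mono) auto
    finally show ?thesis by simp
  qed
  have g4: "- (v1 * (t * (w * z))) \<le> t * e\<^sup>2 * v1 * c"
  proof -
    have "(t * e\<^sup>2 * v1) * (- (q * z)) \<le> t * e\<^sup>2 * v1 * c" using t nn c by (intro mult_left_mono) auto
    then show ?thesis by (simp add: w_def mult_ac)
  qed
  have g5: "L * (t * w) \<le> w\<^sup>2 / 2 + L\<^sup>2 * t\<^sup>2 / 2"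
    using sum_squares_bound[of w "L * t"] by (simp add: power_mult_distrib mult_ac)
  have g6: "p * (w * (t * z) * (v1 + 2 * L)) \<le> p * p2 * w\<^sup>2 / 2 + (t * z)\<^sup>2 * (v2 + v1\<^sup>2 - \<gamma> * v1) / 2"
    by (rule quadratic_form_bound[OF p p2(2) S])
  have g7: "t * e\<^sup>2 * a \<le> t * a"
  proof -
    have "e\<^sup>2 \<le> 1" using e by (simp add: power_le_one)
    then have "(t * a) * e\<^sup>2 \<le> (t * a) * 1" using t nn by (intro mult_left_mono) auto
    then show ?thesis by (simp add: mult_ac)
  qed
  have h1: "p * (t * (e ^ 3 * q\<^sup>2)) \<le> p * ((1 + R) * w\<^sup>2)" by (rule mult_left_mono[OF g1 p])
  have h2: "p * L * (t * (e\<^sup>2 * q\<^sup>2)) \<le> p * L * ((1 + R)\<^sup>2 * w\<^sup>2)" using p nn by (intro mult_left_mono[OF g2]) auto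
  have h3: "p * K * (t * (e\<^sup>2 * x)) \<le> p * K * t\<^sup>2" using p nn by (intro mult_left_mono[OF g3]) auto
  have h4: "p * - (v1 * (t * (w * z))) \<le> p * (t * e\<^sup>2 * v1 * c)" by (rule mult_left_mono[OF g4 p])
  have h5: "p * (L * (t * w)) \<le> p * (w\<^sup>2 / 2 + L\<^sup>2 * t\<^sup>2 / 2)" by (rule mult_left_mono[OF g5 p])
  have h7: "p * K * (t * e\<^sup>2 * a) \<le> p * K * (t * a)" using p nn by (intro mult_left_mono[OF g7]) auto
  have lhs: "(p * ((p - 1) * e ^ 4 * q\<^sup>2 - 2 * t * e ^ 3 * q\<^sup>2) + 2 * (p * t * e\<^sup>2 * v1 * c) + t\<^sup>2 * (v2 + v1\<^sup>2) * z\<^sup>2) / 2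
      - (p * t * e\<^sup>2 * (K * x + L * (1 + 2 * z + q) * q + K * a) + t\<^sup>2 * v1 * (\<gamma> / 2 * z\<^sup>2))
    = p * (p - 1) * w\<^sup>2 / 2 - p * (t * (e ^ 3 * q\<^sup>2)) + p * (t * e\<^sup>2 * v1 * c) + (t * z)\<^sup>2 * (v2 + v1\<^sup>2 - \<gamma> * v1) / 2
      - p * K * (t * (e\<^sup>2 * x)) - p * (L * (t * w)) - 2 * (p * (L * (t * w * z))) - p * L * (t * (e\<^sup>2 * q\<^sup>2)) - p * K * (t * e\<^sup>2 * a)"
    unfolding w2 unfolding w_def by (simp add: field_simps power_mult_distrib power2_eq_square)
  have k: "p * (p - 1) * w\<^sup>2 / 2 = p * p2 * w\<^sup>2 / 2 + p * (w\<^sup>2 / 2) + p * ((1 + R) * w\<^sup>2) + p * L * ((1 + R)\<^sup>2 * w\<^sup>2)"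
    unfolding p2(1) by (simp add: field_simps)
  have k6: "p * (w * (t * z) * (v1 + 2 * L)) = p * (v1 * (t * (w * z))) + 2 * (p * (L * (t * w * z)))"
    by (simp add: algebra_simps)
  have k5: "p * (w\<^sup>2 / 2 + L\<^sup>2 * t\<^sup>2 / 2) = p * (w\<^sup>2 / 2) + p * L\<^sup>2 / 2 * t\<^sup>2" by (simp add: field_simps)
  have k4: "p * - (v1 * (t * (w * z))) = - (p * (v1 * (t * (w * z))))" by simp
  have k0: "- ((p * L\<^sup>2 / 2 + p * K) * t\<^sup>2 + p * K * (t * a)) = - (p * L\<^sup>2 / 2 * t\<^sup>2) - p * K * t\<^sup>2 - p * K * (t * a)"
    by (simp add: algebra_simps)
  show ?thesis
    unfolding lhs k k0 using h1 h2 h3 h4[unfolded k4] h5[unfolded k5] h7 g6[unfolded k6] by linarith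
qed

text \<open>For x \<le> 0 everything that contains \<alpha> or its derivatives vanishes; for x > 0 a
  common factor reduces the claim to \<open>scaled_inequality\<close>. In E, the part p L^2 / 2 + p
  K comes from there, a further p K from separating the mean-field term a from t, and p K exp A
  arises because the power of a stands alone, where \<beta> is replaced by its bound exp A.\<close>

lemma test_function_inequality:
  fixes u v :: "'b::real_inner"
  assumes R: "0 \<le> R" and nn: "0 \<le> L" "0 \<le> K" "0 \<le> a" and x: "x \<le> R" and A: "0 \<le> A"
    and p2: "p2 = real (n + 4) - 2 - (2 * (1 + R) + 2 * L * (1 + R)\<^sup>2)" "0 < p2"
    and v1: "0 \<le> logistic_slope A l m y"
    and S: "(logistic_slope A l m y + 2 * L)\<^sup>2 * real (n + 4) \<le> p2 * (l * (1 - 2 * logistic l m y) * logistic_slope A l m y + (logistic_slope A l m y)\<^sup>2 - \<gamma> * logistic_slope A l m y)"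
  defines "p \<equiv> real (n + 4)"
  defines "E \<equiv> p * L\<^sup>2 / 2 + 2 * (p * K) + p * K * exp A"
  shows "- E * (pow_test n x * exp_test A l m y + a ^ (n + 4)) \<le>
    (pow_test2 n x * exp_test A l m y * (u \<bullet> u) + 2 * (pow_test1 n x * exp_test1 A l m y * (u \<bullet> v)) + pow_test n x * exp_test2 A l m y * (v \<bullet> v)) / 2
    - (pow_test1 n x * exp_test A l m y * (K * \<bar>x\<bar> + L * (1 + 2 * norm v + norm u) * norm u + K * a) + pow_test n x * exp_test1 A l m y * (\<gamma> / 2 * (norm v)\<^sup>2))"
proof -
  have p0: "0 \<le> p" by (simp add: p_def)
  have E0: "0 \<le> E" unfolding E_def using p0 nn by simp
  show ?thesis
  proof (cases "x \<le> 0")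
    case True
    then have "pow_test n x = 0" "pow_test1 n x = 0" "pow_test2 n x = 0"
      by (simp_all add: pow_test_def pow_test1_def pow_test2_def pos_sat_nonpos)
    then show ?thesis using E0 nn by simp
  next
    case False
    define t e q z b v2 where "t = pos_sat x" and "e = 1 - pos_sat x" and "q = norm u" and "z = norm v" and "b = exp_test A l m y"
      and "v2 = l * (1 - 2 * logistic l m y) * logistic_slope A l m y"
    define v1 where "v1 = logistic_slope A l m y"
    have e: "e = 1 / (1 + x)" using pos_sat_pos[of x] False by (simp add: e_def)
    have xe: "x * e = t" using False by (simp add: t_def e[symmetric]) (simp add: e pos_sat_def max_def field_simps)
    have eR: "1 \<le> (1 + R) * e" using False x by (simp add: e le_divide_eq)
    have t: "0 \<le> t" "t \<le> 1" "0 \<le> e" "e \<le> 1" using pos_sat_bounds[of x] by (auto simp: t_def e_def)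
    have c: "- (q * z) \<le> u \<bullet> v" using Cauchy_Schwarz_ineq2[of u v] by (simp add: q_def z_def abs_le_iff)
    define g where "g = (p * ((p - 1) * e ^ 4 * q\<^sup>2 - 2 * t * e ^ 3 * q\<^sup>2) + 2 * (p * t * e\<^sup>2 * v1 * (u \<bullet> v)) + t\<^sup>2 * (v2 + v1\<^sup>2) * z\<^sup>2) / 2
      - (p * t * e\<^sup>2 * (K * x + L * (1 + 2 * z + q) * q + K * a) + t\<^sup>2 * v1 * (\<gamma> / 2 * z\<^sup>2))"
    have sc: "- ((p * L\<^sup>2 / 2 + p * K) * t\<^sup>2 + p * K * (t * a)) \<le> g"
      unfolding g_def
      by (rule scaled_inequality[OF p0 _ _ t xe eR nn _ c p2[folded p_def]])
         (use v1 S in \<open>auto simp: q_def z_def v1_def v2_def p_def\<close>)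
    have t3: "t ^ (n + 3) = t ^ (n + 2) * t" and t4: "t ^ (n + 4) = t ^ (n + 2) * t\<^sup>2" and p1: "real (n + 3) = p - 1"
      by (simp_all add: eval_nat_numeral p_def)
    have et: "1 - t = e" by (simp add: t_def e_def)
    have al: "pow_test n x = t ^ (n + 2) * t\<^sup>2" "pow_test1 n x = t ^ (n + 2) * (p * t * e\<^sup>2)"
      "pow_test2 n x = t ^ (n + 2) * (p * ((p - 1) * e ^ 4 - 2 * t * e ^ 3))"
      unfolding pow_test_def pow_test1_def pow_test2_def t_def[symmetric] et p_def[symmetric] t3 t4 p1
      by (simp_all only: mult_ac right_diff_distrib)
    have be: "exp_test1 A l m y = v1 * b" "exp_test2 A l m y = (v2 + v1\<^sup>2) * b"
      by (simp_all add: exp_test1_def exp_test2_def v1_def v2_def b_def)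
    have Geq: "(pow_test2 n x * exp_test A l m y * (u \<bullet> u) + 2 * (pow_test1 n x * exp_test1 A l m y * (u \<bullet> v)) + pow_test n x * exp_test2 A l m y * (v \<bullet> v)) / 2
    - (pow_test1 n x * exp_test A l m y * (K * \<bar>x\<bar> + L * (1 + 2 * norm v + norm u) * norm u + K * a) + pow_test n x * exp_test1 A l m y * (\<gamma> / 2 * (norm v)\<^sup>2))
      = b * t ^ (n + 2) * g"
      unfolding al be g_def b_def[symmetric] q_def[symmetric] z_def[symmetric] power2_norm_eq_inner[symmetric]
      using False by (simp add: field_simps)
    have b: "1 \<le> b" "b \<le> exp A" using exp_test_bounds[OF A] by (auto simp: b_def)
    have bt: "0 \<le> b * t ^ (n + 2)" using b t by simp
    \<comment> \<open>A crude Young inequality: the larger of t and a takes over the whole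
      power.\<close>
    have young: "t ^ (n + 2) * (t * a) \<le> t ^ (n + 4) + a ^ (n + 4)"
    proof (cases "a \<le> t")
      case True
      have "t ^ (n + 2) * (t * a) \<le> t ^ (n + 2) * (t * t)" using t True by (intro mult_left_mono) auto
      also have "\<dots> = t ^ (n + 4)" by (simp add: power_add power4_eq_xxxx power2_eq_square)
      finally show ?thesis using nn by (simp add: add_increasing2)
    next
      case False
      have "t ^ (n + 2) * (t * a) \<le> a ^ (n + 2) * (a * a)" using t False nn by (intro mult_mono power_mono) auto
      also have "\<dots> = a ^ (n + 4)" by (simp add: power_add power4_eq_xxxx power2_eq_square)
      finally show ?thesis using t by (simp add: add_increasing)
    qed
    have al0: "pow_test n x = t ^ (n + 4)" by (simp add: pow_test_def t_def)
    have "b * (p * K * (t ^ (n + 2) * (t * a))) \<le> b * (p * K * (t ^ (n + 4) + a ^ (n + 4)))"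
      using young b p0 nn by (intro mult_left_mono) auto
    also have "\<dots> = p * K * (b * pow_test n x) + b * (p * K * a ^ (n + 4))" by (simp add: al0 algebra_simps)
    also have "b * (p * K * a ^ (n + 4)) \<le> exp A * (p * K * a ^ (n + 4))"
      using b p0 nn by (intro mult_right_mono) auto
    finally have 1: "b * (p * K * (t ^ (n + 2) * (t * a))) \<le> p * K * (b * pow_test n x) + exp A * (p * K * a ^ (n + 4))" by simp
    have "b * t ^ (n + 2) * - ((p * L\<^sup>2 / 2 + p * K) * t\<^sup>2 + p * K * (t * a)) \<le> b * t ^ (n + 2) * g"
      by (rule mult_left_mono[OF sc bt])
    moreover have "b * t ^ (n + 2) * - ((p * L\<^sup>2 / 2 + p * K) * t\<^sup>2 + p * K * (t * a))
       = - ((p * L\<^sup>2 / 2 + p * K) * (b * pow_test n x)) - b * (p * K * (t ^ (n + 2) * (t * a)))"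
      unfolding al(1) by (simp add: algebra_simps)
    moreover have "E * (pow_test n x * b + a ^ (n + 4)) \<ge> (p * L\<^sup>2 / 2 + p * K) * (b * pow_test n x) + p * K * (b * pow_test n x) + exp A * (p * K * a ^ (n + 4))"
    proof -
      have "0 \<le> (p * K * exp A) * (b * pow_test n x)" "0 \<le> (p * L\<^sup>2 / 2 + 2 * (p * K)) * a ^ (n + 4)"
        using p0 nn b pow_test_nonneg[of n x] by simp_all
      then show ?thesis unfolding E_def by (simp add: algebra_simps)
    qed
    ultimately have "- (E * (pow_test n x * b + a ^ (n + 4))) \<le> b * t ^ (n + 2) * g" using 1 by linarith
    then show ?thesis unfolding Geq by (simp only: b_def mult_minus_left)
  qed
qed

text \<open>With s the logistic value, v'' = l (1 - 2 s) v' is at least l v' / 2 = 2 k v' as soon as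
  s \<le> 1/4. Of the two copies of k v', one is 4 L v' + \<gamma> v' by the choice of k, and the
  other is at least 4 L^2 + 1 by the size of A. This leaves (v' + 2 L)^2 + 1 \<le> v'' + v'^2 -
  \<gamma> v', with a spare 1 for finite exponents.\<close>

lemma test_function_parameters:
  assumes R: "0 \<le> R" and L: "0 \<le> L" and \<gamma>: "0 < \<gamma>"
  shows "\<exists>A l m n p2. 0 \<le> A \<and> 0 \<le> l \<and> p2 = real (2 * n + 4) - 2 - (2 * (1 + R) + 2 * L * (1 + R)\<^sup>2) \<and> 0 < p2 \<and>
    (\<forall>y\<le>R. - R \<le> y \<longrightarrow> 0 \<le> logistic_slope A l m y \<and>
      (logistic_slope A l m y + 2 * L)\<^sup>2 * real (2 * n + 4) \<le> p2 * (l * (1 - 2 * logistic l m y) * logistic_slope A l m y + (logistic_slope A l m y)\<^sup>2 - \<gamma> * logistic_slope A l m y))"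
proof -
  define k where "k = 4 * L + \<gamma>"
  have k: "0 < k" using L \<gamma> by (simp add: k_def)
  define l where "l = 4 * k"
  have l: "0 < l" using k by (simp add: l_def)
  \<comment> \<open>For y \<le> R the shift by ln 3 / l makes the exponential in the logistic
    function at least 3, so that its value is at most 1/4.\<close>
  define m where "m = R + ln 3 / l"
  define smin where "smin = logistic l m (- R)"
  have smin: "0 < smin" using logistic_bounds by (simp add: smin_def)
  \<comment> \<open>On [-R, R] the logistic value is at least \<open>smin\<close> and its complement
    at least 3/4, so this A gives k v' \<ge> 4 L^2 + 1.\<close>
  define A where "A = (4 * L\<^sup>2 + 1) / (k * (l * smin * (3 / 4)))"
  have A: "0 < A" unfolding A_def using k l smin by (intro divide_pos_pos mult_pos_pos add_nonneg_pos) auto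
  define \<kappa> where "\<kappa> = 2 * (1 + R) + 2 * L * (1 + R)\<^sup>2"
  have \<kappa>: "0 \<le> \<kappa>" using R L by (simp add: \<kappa>_def)
  define Vm where "Vm = A * l + 2 * L"
  obtain n where n: "(2 + \<kappa>) * Vm\<^sup>2 + \<kappa> < real n" using reals_Archimedean2 by blast
  define p2 where "p2 = real (2 * n + 4) - 2 - \<kappa>"
  have "0 \<le> (2 + \<kappa>) * Vm\<^sup>2" using \<kappa> by simp
  then have p2: "0 < p2" "(2 + \<kappa>) * Vm\<^sup>2 \<le> p2" using n unfolding p2_def by simp_all
  have main: "0 \<le> logistic_slope A l m y \<and>
      (logistic_slope A l m y + 2 * L)\<^sup>2 * real (2 * n + 4) \<le> p2 * (l * (1 - 2 * logistic l m y) * logistic_slope A l m y + (logistic_slope A l m y)\<^sup>2 - \<gamma> * logistic_slope A l m y)"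
    if y: "y \<le> R" "- R \<le> y" for y
  proof -
    define s where "s = logistic l m y"
    define v where "v = logistic_slope A l m y"
    have s: "0 < s" "s < 1" using logistic_bounds by (auto simp: s_def)
    have "l * (y - m) \<le> - ln 3" using y l by (simp add: m_def algebra_simps)
    then have "exp (ln 3) \<le> exp (- (l * (y - m)))" by (subst exp_le_cancel_iff) simp
    then have e3: "3 \<le> exp (- (l * (y - m)))" by simp
    then have s4: "s \<le> 1 / 4" unfolding s_def logistic_def by (intro frac_le) auto
    have "smin \<le> s"
    proof -
      have "l * (- R - m) \<le> l * (y - m)" using y l by (intro mult_left_mono) auto
      then have "exp (- (l * (y - m))) \<le> exp (- (l * (- R - m)))" by simp
      then show ?thesis unfolding smin_def s_def logistic_def by (intro divide_left_mono) (auto simp: add_pos_pos)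
    qed
    then have "smin * (3 / 4) \<le> s * (1 - s)" using s s4 smin by (intro mult_mono) auto
    then have "A * l * (smin * (3 / 4)) \<le> v"
      unfolding v_def logistic_slope_def s_def[symmetric] using A l by (intro mult_left_mono) auto
    moreover have "k * (A * l * (smin * (3 / 4))) = 4 * L\<^sup>2 + 1"
      using k l smin by (simp add: A_def field_simps)
    ultimately have kv: "4 * L\<^sup>2 + 1 \<le> k * v" using mult_left_mono[of "A * l * (smin * (3 / 4))" v k] k by simp
    have v0: "0 \<le> v" unfolding v_def logistic_slope_def s_def[symmetric] using A l s by simp
    have "s * (1 - s) \<le> 1 * 1" using s by (intro mult_mono) auto
    then have "A * l * (s * (1 - s)) \<le> A * l * 1" using A l by (intro mult_left_mono) auto
    then have "v \<le> A * l" unfolding v_def logistic_slope_def s_def[symmetric] by simp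
    then have Vm: "(v + 2 * L)\<^sup>2 \<le> Vm\<^sup>2" unfolding Vm_def using v0 L by (intro power_mono) auto
    have "1 / 2 * (l * v) \<le> (1 - 2 * s) * (l * v)" using s4 l v0 by (intro mult_right_mono) auto
    then have lv: "2 * (k * v) \<le> l * (1 - 2 * s) * v" by (simp add: l_def mult_ac)
    have S: "(v + 2 * L)\<^sup>2 + 1 \<le> l * (1 - 2 * s) * v + v\<^sup>2 - \<gamma> * v"
    proof -
      have "(v + 2 * L)\<^sup>2 = v\<^sup>2 + 4 * L * v + 4 * L\<^sup>2" by (simp add: power2_sum power_mult_distrib)
      moreover have "k * v = 4 * L * v + \<gamma> * v" by (simp add: k_def algebra_simps)
      ultimately show ?thesis using lv kv by linarith
    qed
    have "(v + 2 * L)\<^sup>2 * real (2 * n + 4) = p2 * (v + 2 * L)\<^sup>2 + (2 + \<kappa>) * (v + 2 * L)\<^sup>2"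
      by (simp add: p2_def algebra_simps)
    also have "\<dots> \<le> p2 * (v + 2 * L)\<^sup>2 + (2 + \<kappa>) * Vm\<^sup>2" using Vm \<kappa> by (intro add_left_mono mult_left_mono) auto
    also have "\<dots> \<le> p2 * ((v + 2 * L)\<^sup>2 + 1)" using p2 by (simp add: algebra_simps)
    also have "\<dots> \<le> p2 * (l * (1 - 2 * s) * v + v\<^sup>2 - \<gamma> * v)" using S p2 by (intro mult_left_mono) auto
    finally show ?thesis using v0 by (simp add: v_def s_def)
  qed
  show ?thesis
    by (intro exI[of _ A] exI[of _ l] exI[of _ m] exI[of _ n] exI[of _ p2]) (use A l p2 main in \<open>auto simp: p2_def \<kappa>_def\<close>)
qed

section \<open>Comparison\<close>

lemma gronwall_backward:
  fixes u :: "real \<Rightarrow> real"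
  assumes C: "0 \<le> C" and u: "\<And>t. t \<in> {0..T} \<Longrightarrow> 0 \<le> u t" "\<And>t. t \<in> {0..T} \<Longrightarrow> u t \<le> B"
    and int: "integrable lborel (\<lambda>s. indicat_real {0<..T} s * u s)"
    and le: "\<And>t. t \<in> {0..T} \<Longrightarrow> u t \<le> C * (\<integral>s. indicat_real {t<..T} s * u s \<partial>lborel)"
    and t: "t \<in> {0..T}"
  shows "u t = 0"
proof -
  \<comment> \<open>In the supremum norm weighted by exp (l t) the backward integral operator has
    norm at most C / l. This l makes it at most 1/2, so the weighted supremum satisfies S \<le> S /
    2.\<close>
  define l where "l = 2 * C + 1"
  have l: "0 < l" "C / l \<le> 1 / 2" using C by (auto simp: l_def divide_le_eq)
  define S where "S = (SUP t\<in>{0..T}. exp (l * t) * u t)"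
  have B0: "0 \<le> B" using u[OF t] by linarith
  have bdd: "bdd_above ((\<lambda>t. exp (l * t) * u t) ` {0..T})"
  proof (rule bdd_aboveI2)
    fix t assume "t \<in> {0..T}"
    then show "exp (l * t) * u t \<le> exp (l * T) * B" using u[of t] l B0 by (intro mult_mono) auto
  qed
  have S: "exp (l * t) * u t \<le> S" if "t \<in> {0..T}" for t
    unfolding S_def using that bdd by (rule cSUP_upper)
  have S0: "0 \<le> S" using S[OF t] u(1)[OF t] by (meson exp_ge_zero mult_nonneg_nonneg order_trans)
  have us: "u s \<le> S * exp (- (l * s))" if "s \<in> {0..T}" for s
    using S[OF that] by (simp add: exp_minus field_simps)
  have half: "exp (l * t) * u t \<le> S / 2" if t: "t \<in> {0..T}" for t
  proof -
    have eint: "has_bochner_integral lborel (\<lambda>s. indicat_real {t..T} s *\<^sub>R (S * exp (- (l * s)))) (- S / l * exp (- (l * T)) - (- S / l * exp (- (l * t))))"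
    proof (rule has_bochner_integral_FTC_Icc[where F = "\<lambda>s. - S / l * exp (- (l * s))"])
      show "t \<le> T" using t by simp
      show "((\<lambda>s. - S / l * exp (- (l * s))) has_vector_derivative S * exp (- (l * x))) (at x within {t..T})" for x
        using l by (auto intro!: derivative_eq_intros simp: has_real_derivative_iff_has_vector_derivative[symmetric])
      show "continuous_on {t..T} (\<lambda>s. S * exp (- (l * s)))" by (intro continuous_intros)
    qed
    have it: "integrable lborel (\<lambda>s. indicat_real {t<..T} s * u s)"
    proof -
      have "integrable lborel (\<lambda>s. indicat_real {t<..T} s * (indicat_real {0<..T} s * u s))"
        using integrable_mult_indicator[OF _ int, of "{t<..T}"] by simp
      moreover have "indicat_real {t<..T} s * (indicat_real {0<..T} s * u s) = indicat_real {t<..T} s * u s" for s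
        using t by (auto split: split_indicator)
      ultimately show ?thesis by simp
    qed
    have "(\<integral>s. indicat_real {t<..T} s * u s \<partial>lborel) \<le> (\<integral>s. indicat_real {t..T} s *\<^sub>R (S * exp (- (l * s))) \<partial>lborel)"
    proof (rule integral_mono[OF it])
      show "integrable lborel (\<lambda>s. indicat_real {t..T} s *\<^sub>R (S * exp (- (l * s))))" using eint by (simp add: has_bochner_integral_iff)
      show "indicat_real {t<..T} s * u s \<le> indicat_real {t..T} s *\<^sub>R (S * exp (- (l * s)))" for s
        using us[of s] t S0 by (auto split: split_indicator)
    qed
    also have "\<dots> = - S / l * exp (- (l * T)) - (- S / l * exp (- (l * t)))" using eint by (simp add: has_bochner_integral_iff)
    also have "\<dots> \<le> S / l * exp (- (l * t))" using S0 l by simp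
    finally have "u t \<le> C * (S / l * exp (- (l * t)))"
      using le[OF t] C by (meson mult_left_mono order_trans)
    then have "exp (l * t) * u t \<le> exp (l * t) * (C * (S / l * exp (- (l * t))))" by (rule mult_left_mono) simp
    also have "\<dots> = (C / l) * S" by (simp add: exp_minus field_simps)
    also have "\<dots> \<le> 1 / 2 * S" using l S0 by (intro mult_right_mono) auto
    finally show ?thesis by simp
  qed
  have "S \<le> S / 2" unfolding S_def[symmetric] 
    by (subst S_def, rule cSUP_least) (use t half in auto)
  then have "S = 0" using S0 by simp
  then have "exp (l * t) * u t \<le> 0" using S[OF t] by simp
  then have "u t \<le> 0" by (simp add: mult_le_0_iff)
  with u(1)[OF t] show ?thesis by simp
qed

text \<open>Jensen's inequality for the j-th power, obtained by applying Bernoulli's inequality to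
  X^2 divided by its mean. It bridges the gap between the second moment in the mean-field term and
  the high power in the test function.\<close>

lemma (in prob_space) second_moment_power_le:
  fixes X :: "'a \<Rightarrow> real"
  assumes [measurable]: "X \<in> borel_measurable M" and X: "\<And>\<omega>. \<omega> \<in> space M \<Longrightarrow> \<bar>X \<omega>\<bar> \<le> B" and j: "0 < j"
  shows "(\<integral>\<omega>. (X \<omega>)\<^sup>2 \<partial>M) ^ j \<le> (\<integral>\<omega>. X \<omega> ^ (2 * j) \<partial>M)"
proof -
  have int: "integrable M (\<lambda>\<omega>. X \<omega> ^ k)" for k
    by (rule integrable_const_bound[of _ "B ^ k"]) (use X in \<open>auto simp: power_abs intro!: power_mono\<close>)
  define s where "s = (\<integral>\<omega>. (X \<omega>)\<^sup>2 \<partial>M)"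
  have s0: "0 \<le> s" by (simp add: s_def)
  show ?thesis
  proof (cases "s = 0")
    case True
    have "0 \<le> (\<integral>\<omega>. X \<omega> ^ (2 * j) \<partial>M)" by (simp add: power_mult)
    then show ?thesis unfolding s_def[symmetric] True zero_power[OF j] .
  next
    case False
    with s0 have s: "0 < s" by simp
    have "(\<integral>\<omega>. s ^ j * (1 + real j * ((X \<omega>)\<^sup>2 / s - 1)) \<partial>M) \<le> (\<integral>\<omega>. X \<omega> ^ (2 * j) \<partial>M)"
    proof (rule integral_mono)
      show "integrable M (\<lambda>\<omega>. s ^ j * (1 + real j * ((X \<omega>)\<^sup>2 / s - 1)))" using int[of 2] by simp
      show "integrable M (\<lambda>\<omega>. X \<omega> ^ (2 * j))" by (rule int)
      fix \<omega>
      have "1 + real j * ((X \<omega>)\<^sup>2 / s - 1) \<le> (1 + ((X \<omega>)\<^sup>2 / s - 1)) ^ j"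
        by (rule Bernoulli_inequality) (use s in simp)
      then have "s ^ j * (1 + real j * ((X \<omega>)\<^sup>2 / s - 1)) \<le> s ^ j * ((X \<omega>)\<^sup>2 / s) ^ j"
        using s by (intro mult_left_mono) auto
      also have "\<dots> = X \<omega> ^ (2 * j)" using s by (simp add: power_divide power_mult)
      finally show "s ^ j * (1 + real j * ((X \<omega>)\<^sup>2 / s - 1)) \<le> X \<omega> ^ (2 * j)" .
    qed
    also have "(\<integral>\<omega>. s ^ j * (1 + real j * ((X \<omega>)\<^sup>2 / s - 1)) \<partial>M) = s ^ j * (1 + real j * (s / s - 1))"
      using int[of 2] by (simp add: s_def prob_space)
    finally show ?thesis using s by (simp add: s_def)
  qed
qed

lemma wasserstein2_nonneg: "0 \<le> wasserstein2 \<mu> \<nu>"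
  by (simp add: wasserstein2_def)

text \<open>Each coupling bounds the infimum from above. The couplings used below are the diagonal
  one and the one with a point mass at 0.\<close>

lemma wasserstein2_le:
  assumes "\<pi> \<in> couplings \<mu> \<nu>" "(\<integral>\<^sup>+ p. ennreal ((dist (fst p) (snd p))\<^sup>2) \<partial>\<pi>) \<le> ennreal (B\<^sup>2)" "0 \<le> B"
  shows "wasserstein2 \<mu> \<nu> \<le> B"
proof -
  have "(INF \<pi>\<in>couplings \<mu> \<nu>. \<integral>\<^sup>+ p. ennreal ((dist (fst p) (snd p))\<^sup>2) \<partial>\<pi>) \<le> ennreal (B\<^sup>2)"
    using assms(1,2) by (rule INF_lower2)
  then have "enn2real (INF \<pi>\<in>couplings \<mu> \<nu>. \<integral>\<^sup>+ p. ennreal ((dist (fst p) (snd p))\<^sup>2) \<partial>\<pi>) \<le> B\<^sup>2"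
    by (simp add: enn2real_leI)
  then show ?thesis unfolding wasserstein2_def using assms(3) by (simp add: real_le_lsqrt)
qed

lemma wasserstein2_self:
  assumes "sets \<mu> = sets borel"
  shows "wasserstein2 \<mu> \<mu> = 0"
proof -
  have [measurable_cong]: "sets \<mu> = sets borel" by fact
  have m: "(\<lambda>x. (x, x)) \<in> measurable \<mu> (borel \<Otimes>\<^sub>M borel)" by measurable
  let ?\<pi> = "distr \<mu> (borel \<Otimes>\<^sub>M borel) (\<lambda>x. (x, x))"
  have "distr ?\<pi> borel fst = \<mu>" "distr ?\<pi> borel snd = \<mu>"
    using assms by (simp_all add: distr_distr[OF _ m] comp_def distr_id2)
  then have "?\<pi> \<in> couplings \<mu> \<mu>" by (simp add: couplings_def)
  moreover have "(\<integral>\<^sup>+ p. ennreal ((dist (fst p) (snd p))\<^sup>2) \<partial>?\<pi>) \<le> ennreal (0\<^sup>2)"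
    by (subst nn_integral_distr[OF m]) simp_all
  ultimately have "wasserstein2 \<mu> \<mu> \<le> 0" by (rule wasserstein2_le) simp
  then show ?thesis using wasserstein2_nonneg[of \<mu> \<mu>] by simp
qed

lemma (in prob_space) wasserstein2_law_zero_le:
  fixes X :: "'a \<Rightarrow> 'b::euclidean_space"
  assumes [measurable]: "X \<in> borel_measurable M" and X: "AE \<omega> in M. norm (X \<omega>) \<le> B" and B: "0 \<le> B"
  shows "wasserstein2 (law M X) (return borel 0) \<le> B"
proof -
  have m: "(\<lambda>\<omega>. (X \<omega>, 0 :: 'b)) \<in> measurable M (borel \<Otimes>\<^sub>M borel)" by measurable
  let ?\<pi> = "distr M (borel \<Otimes>\<^sub>M borel) (\<lambda>\<omega>. (X \<omega>, 0 :: 'b))"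
  have "distr ?\<pi> borel fst = law M X" "distr ?\<pi> borel snd = return borel 0"
    by (simp_all add: distr_distr[OF _ m] comp_def distr_const)
  then have "?\<pi> \<in> couplings (law M X) (return borel 0)" by (simp add: couplings_def)
  moreover have "(\<integral>\<^sup>+ p. ennreal ((dist (fst p) (snd p))\<^sup>2) \<partial>?\<pi>) \<le> ennreal (B\<^sup>2)"
  proof -
    have "(\<integral>\<^sup>+ p. ennreal ((dist (fst p) (snd p))\<^sup>2) \<partial>?\<pi>) = (\<integral>\<^sup>+ \<omega>. ennreal ((norm (X \<omega>))\<^sup>2) \<partial>M)"
      by (subst nn_integral_distr[OF m]) simp_all
    also have "\<dots> \<le> (\<integral>\<^sup>+ \<omega>. ennreal (B\<^sup>2) \<partial>M)"
      using X by (intro nn_integral_mono_AE) (auto elim!: eventually_mono intro!: ennreal_leI power_mono)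
    also have "\<dots> = ennreal (B\<^sup>2)" by (simp add: emeasure_space_1)
    finally show ?thesis .
  qed
  ultimately show ?thesis using B by (rule wasserstein2_le)
qed

lemma (in prob_space) law_in_P2:
  fixes X :: "'a \<Rightarrow> 'b::euclidean_space"
  assumes [measurable]: "X \<in> borel_measurable M" and X: "(\<integral>\<^sup>+ \<omega>. ennreal ((norm (X \<omega>))\<^sup>2) \<partial>M) < \<infinity>"
  shows "law M X \<in> P2"
  using X by (simp add: P2_def prob_space_distr nn_integral_distr)

section \<open>Progressive processes and their time integrals\<close>

context brownian_basis
begin

text \<open>Cutting off outside [0, t] replaces the restricted time interval by the whole line,
  ready for integration with respect to \<open>lborel\<close>. The version over F t keeps time
  integrals adapted.\<close>

lemma prog_measurable_strip:
  fixes X :: "real \<Rightarrow> 'w \<Rightarrow> 'b::euclidean_space"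
  assumes X: "prog_measurable F T X" and t: "t \<in> {0..T}"
  shows "(\<lambda>p. indicat_real {0..t} (snd p) *\<^sub>R X (snd p) (fst p)) \<in> borel_measurable (F t \<Otimes>\<^sub>M lborel)"
    and "(\<lambda>p. indicat_real {0..t} (snd p) *\<^sub>R X (snd p) (fst p)) \<in> borel_measurable P"
proof -
  let ?\<Omega> = "space M \<times> {0..t}"
  let ?N = "F t \<Otimes>\<^sub>M (lborel :: real measure)"
  have \<Omega>: "?\<Omega> \<in> sets ?N" using sets.top[of "F t"] by (intro pair_measureI) auto
  have "(\<lambda>(s, \<omega>). X s \<omega>) \<in> borel_measurable (restrict_space borel {0..t} \<Otimes>\<^sub>M F t)"
    using X t by (auto simp: prog_measurable_def)
  moreover have "(\<lambda>p. (snd p, fst p)) \<in> measurable (restrict_space ?N ?\<Omega>) (restrict_space borel {0..t} \<Otimes>\<^sub>M F t)"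
  proof (rule measurable_Pair)
    show "snd \<in> measurable (restrict_space ?N ?\<Omega>) (restrict_space borel {0..t})"
      using measurable_restrict_space1[OF measurable_snd, of "F t" "lborel :: real measure" ?\<Omega>]
      by (intro measurable_restrict_space2) (auto simp: space_restrict_space)
    show "fst \<in> measurable (restrict_space ?N ?\<Omega>) (F t)"
      by (rule measurable_restrict_space1[OF measurable_fst])
  qed
  ultimately have "(\<lambda>p. X (snd p) (fst p)) \<in> borel_measurable (restrict_space ?N ?\<Omega>)"
    by (auto dest!: measurable_compose[rotated])
  then have "(\<lambda>p. indicat_real ?\<Omega> p *\<^sub>R X (snd p) (fst p)) \<in> borel_measurable ?N"
    using \<Omega> by (subst (asm) borel_measurable_restrict_space_iff) auto
  also have "?this \<longleftrightarrow> (\<lambda>p. indicat_real {0..t} (snd p) *\<^sub>R X (snd p) (fst p)) \<in> borel_measurable ?N"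
    by (intro measurable_cong) (auto simp: space_pair_measure split: split_indicator)
  finally show m: "(\<lambda>p. indicat_real {0..t} (snd p) *\<^sub>R X (snd p) (fst p)) \<in> borel_measurable ?N" .
  have "(\<lambda>x. x) \<in> measurable M (F t)" by (rule measurable_F_M[OF measurable_ident[unfolded id_def]])
  then have "(\<lambda>p. (fst p, snd p)) \<in> measurable P ?N"
    by (intro measurable_Pair measurable_compose[OF measurable_fst] measurable_snd) auto
  from measurable_compose[OF this m]
  show "(\<lambda>p. indicat_real {0..t} (snd p) *\<^sub>R X (snd p) (fst p)) \<in> borel_measurable P" by simp
qed

lemma prog_measurable_adapted:
  fixes X :: "real \<Rightarrow> 'w \<Rightarrow> 'b::euclidean_space"
  assumes X: "prog_measurable F T X" and t: "t \<in> {0..T}"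
  shows "X t \<in> borel_measurable (F t)"
proof -
  have "(\<lambda>\<omega>. (\<omega>, t)) \<in> measurable (F t) (F t \<Otimes>\<^sub>M lborel)" by measurable
  from measurable_compose[OF this prog_measurable_strip(1)[OF X t]] show ?thesis using t by simp
qed

text \<open>The integral of \<theta> is set to 0 off the event G on which the square integral is at
  most K3. The complement of G is null and so belongs to every F t: the modification stays adapted,
  while continuity and the bound hold for every \<omega>.\<close>

lemma integrated_process:
  assumes \<theta>: "prog_measurable F T \<theta>" "\<And>\<omega> t. \<omega> \<in> space M \<Longrightarrow> t \<in> {0..T} \<Longrightarrow> 0 \<le> (\<theta> t \<omega> :: real)"
    and K3: "AE \<omega> in M. (\<integral>\<^sup>+t\<in>{0..T}. ennreal ((\<theta> t \<omega>)\<^sup>2) \<partial>lborel) \<le> ennreal K3" "0 \<le> K3" and T: "0 < T"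
  shows "\<exists>\<Theta>. (\<forall>t\<in>{0..T}. \<Theta> t \<in> borel_measurable (F t)) \<and> (\<forall>t. \<Theta> t \<in> borel_measurable M) \<and>
     (\<forall>\<omega>\<in>space M. continuous_on UNIV (\<lambda>t. \<Theta> t \<omega>)) \<and> (\<forall>\<omega>\<in>space M. \<forall>t. 0 \<le> \<Theta> t \<omega> \<and> \<Theta> t \<omega> \<le> T + K3) \<and>
     (AE \<omega> in M. integrable lborel (\<lambda>r. indicat_real {0..T} r * \<theta> r \<omega>) \<and>
        (\<forall>s t. 0 \<le> s \<longrightarrow> s \<le> t \<longrightarrow> t \<le> T \<longrightarrow> \<Theta> t \<omega> - \<Theta> s \<omega> = (\<integral>r. indicat_real {s<..t} r * \<theta> r \<omega> \<partial>lborel)))"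
proof -
  define h where "h = (\<lambda>p. indicat_real {0..T} (snd p) * \<theta> (snd p) (fst p))"
  have hm[measurable]: "h \<in> borel_measurable P"
    using prog_measurable_strip(2)[OF \<theta>(1), of T] T by (simp add: h_def)
  define G where "G = {\<omega> \<in> space M. (\<integral>\<^sup>+r. ennreal ((h (\<omega>, r))\<^sup>2) \<partial>lborel) \<le> ennreal K3}"
  have Gm: "G \<in> sets M" unfolding G_def by measurable
  have heq: "(\<integral>\<^sup>+r. ennreal ((h (\<omega>, r))\<^sup>2) \<partial>lborel) = (\<integral>\<^sup>+t\<in>{0..T}. ennreal ((\<theta> t \<omega>)\<^sup>2) \<partial>lborel)" for \<omega>
    by (intro nn_integral_cong) (simp add: h_def split: split_indicator)
  have AEG: "AE \<omega> in M. \<omega> \<in> G"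
    using K3(1) AE_space by eventually_elim (simp add: G_def heq)
  then have "{\<omega> \<in> space M. \<omega> \<notin> G} \<in> null_sets M" using Gm by (subst (asm) AE_iff_null_sets) (auto simp: set_diff_eq)
  then have null: "space M - G \<in> null_sets M" by (simp add: set_diff_eq)
  have GF: "G \<in> sets (F t)" for t
  proof -
    have "space (F t) - (space M - G) \<in> sets (F t)" using null by (intro sets.compl_sets null_sets_F)
    moreover have "space (F t) - (space M - G) = G" by (auto simp: G_def)
    ultimately show ?thesis by simp
  qed
  have GS: "G \<inter> space M = G" by (auto simp: G_def)
  have hsec: "(\<lambda>r. h (\<omega>, r)) \<in> borel_measurable lborel" if "\<omega> \<in> space M" for \<omega>
    using that by (intro measurable_compose[OF _ hm]) simp
  have h0: "0 \<le> h (\<omega>, r)" if "\<omega> \<in> space M" for \<omega> r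
    using \<theta>(2)[OF that] by (simp add: h_def split: split_indicator)
  have strip: "integrable lborel (indicat_real {0..T})" "(\<integral>r. indicat_real {0..T} r \<partial>lborel) = T" using T by simp_all
  have hint: "integrable lborel (\<lambda>r. h (\<omega>, r))" "(\<integral>r. h (\<omega>, r) \<partial>lborel) \<le> T + K3" if "\<omega> \<in> G" for \<omega>
  proof -
    have \<omega>: "\<omega> \<in> space M" and le: "(\<integral>\<^sup>+r. ennreal ((h (\<omega>, r))\<^sup>2) \<partial>lborel) \<le> ennreal K3" using that by (auto simp: G_def)
    note [measurable] = hsec[OF \<omega>]
    have i2: "integrable lborel (\<lambda>r. (h (\<omega>, r))\<^sup>2)"
      using le by (intro integrableI_bounded) (auto simp: le_less_trans[OF _ ennreal_less_top])
    have "ennreal (\<integral>r. (h (\<omega>, r))\<^sup>2 \<partial>lborel) \<le> ennreal K3" using le i2 by (simp add: nn_integral_eq_integral)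
    then have k: "(\<integral>r. (h (\<omega>, r))\<^sup>2 \<partial>lborel) \<le> K3" using K3(2) by (simp add: ennreal_le_iff)
    have pt: "h (\<omega>, r) \<le> indicat_real {0..T} r + (h (\<omega>, r))\<^sup>2" for r
    proof (cases "r \<in> {0..T}")
      case True
      have "2 * (1 * h (\<omega>, r)) \<le> 1\<^sup>2 + (h (\<omega>, r))\<^sup>2" using sum_squares_bound[of 1 "h (\<omega>, r)"] by simp
      then show ?thesis using True h0[OF \<omega>, of r] by simp
    qed (auto simp: h_def)
    show i: "integrable lborel (\<lambda>r. h (\<omega>, r))"
      by (rule Bochner_Integration.integrable_bound[OF Bochner_Integration.integrable_add[OF strip(1) i2]])
         (use pt h0[OF \<omega>] in \<open>auto intro!: AE_I2 order_trans[OF pt]\<close>)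
    have "(\<integral>r. h (\<omega>, r) \<partial>lborel) \<le> (\<integral>r. indicat_real {0..T} r + (h (\<omega>, r))\<^sup>2 \<partial>lborel)"
      by (rule integral_mono[OF i Bochner_Integration.integrable_add[OF strip(1) i2] pt])
    also have "\<dots> = T + (\<integral>r. (h (\<omega>, r))\<^sup>2 \<partial>lborel)"
      using Bochner_Integration.integral_add[OF strip(1) i2] strip(2) by simp
    finally show "(\<integral>r. h (\<omega>, r) \<partial>lborel) \<le> T + K3" using k by simp
  qed
  define \<Theta> where "\<Theta> = (\<lambda>t \<omega>. if \<omega> \<in> G then \<integral>r. indicat_real {0<..t} r * h (\<omega>, r) \<partial>lborel else 0)"
  have iind: "integrable lborel (\<lambda>r. indicat_real {s<..t} r * h (\<omega>, r))" if "\<omega> \<in> G" for s t \<omega>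
    using integrable_mult_indicator[OF _ hint(1)[OF that], of "{s<..t}"] by simp
  have "\<Theta> t \<in> borel_measurable (F t)" if t: "t \<in> {0..T}" for t
  proof -
    have [measurable]: "(\<lambda>p. indicat_real {0..t} (snd p) *\<^sub>R \<theta> (snd p) (fst p)) \<in> borel_measurable (F t \<Otimes>\<^sub>M lborel)"
      by (rule prog_measurable_strip(1)[OF \<theta>(1) t])
    have "(\<lambda>\<omega>. \<integral>r. indicat_real {0<..t} r * (indicat_real {0..t} (snd (\<omega>, r)) *\<^sub>R \<theta> (snd (\<omega>, r)) (fst (\<omega>, r))) \<partial>lborel) \<in> borel_measurable (F t)"
      by (intro lborel.borel_measurable_lebesgue_integral) measurable
    moreover have "(\<integral>r. indicat_real {0<..t} r * (indicat_real {0..t} (snd (\<omega>, r)) *\<^sub>R \<theta> (snd (\<omega>, r)) (fst (\<omega>, r))) \<partial>lborel)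
        = (\<integral>r. indicat_real {0<..t} r * h (\<omega>, r) \<partial>lborel)" for \<omega>
      using t by (intro Bochner_Integration.integral_cong refl) (auto simp: h_def split: split_indicator)
    ultimately have "(\<lambda>\<omega>. \<integral>r. indicat_real {0<..t} r * h (\<omega>, r) \<partial>lborel) \<in> borel_measurable (F t)" by simp
    then show ?thesis unfolding \<Theta>_def using GF GS by (intro measurable_If_set) auto
  qed
  moreover have "\<Theta> t \<in> borel_measurable M" for t
    unfolding \<Theta>_def using Gm GS by (intro measurable_If_set) auto
  moreover have "continuous_on UNIV (\<lambda>t. \<Theta> t \<omega>)" if \<omega>: "\<omega> \<in> space M" for \<omega>
  proof (cases "\<omega> \<in> G")
    case True
    have "(\<lambda>n. \<integral>r. indicat_real {0<..x n} r * h (\<omega>, r) \<partial>lborel) \<longlonglongrightarrow> (\<integral>r. indicat_real {0<..a} r * h (\<omega>, r) \<partial>lborel)"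
      if "x \<longlonglongrightarrow> a" for x a
    proof (rule integral_dominated_convergence[where w = "\<lambda>r. \<bar>h (\<omega>, r)\<bar>"])
      show "integrable lborel (\<lambda>r. \<bar>h (\<omega>, r)\<bar>)" using hint(1)[OF True] by simp
      show "AE r in lborel. norm (indicat_real {0<..x n} r * h (\<omega>, r)) \<le> \<bar>h (\<omega>, r)\<bar>" for n
        by (intro AE_I2) (simp split: split_indicator)
      show "AE r in lborel. (\<lambda>n. indicat_real {0<..x n} r * h (\<omega>, r)) \<longlonglongrightarrow> indicat_real {0<..a} r * h (\<omega>, r)"
        using AE_lborel_singleton[of a]
      proof eventually_elim
        case (elim r)
        have "\<forall>\<^sub>F n in sequentially. indicat_real {0<..x n} r = indicat_real {0<..a} r"
        proof (cases "r < a")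
          case True
          from order_tendstoD(1)[OF that True] show ?thesis by eventually_elim (use True in \<open>auto simp: indicator_def\<close>)
        next
          case False
          with elim have "a < r" by simp
          from order_tendstoD(2)[OF that this] show ?thesis by eventually_elim (use \<open>a < r\<close> in \<open>auto simp: indicator_def\<close>)
        qed
        then have "(\<lambda>n. indicat_real {0<..x n} r) \<longlonglongrightarrow> indicat_real {0<..a} r" by (rule tendsto_eventually)
        then show ?case by (intro tendsto_intros)
      qed
    qed (use iind[OF True] in auto)
    then show ?thesis using True by (auto simp: continuous_on_sequentially \<Theta>_def comp_def)
  qed (simp add: \<Theta>_def)
  moreover have "0 \<le> \<Theta> t \<omega> \<and> \<Theta> t \<omega> \<le> T + K3" if \<omega>: "\<omega> \<in> space M" for \<omega> t
  proof (cases "\<omega> \<in> G")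
    case True
    have "0 \<le> (\<integral>r. indicat_real {0<..t} r * h (\<omega>, r) \<partial>lborel)"
      using h0[OF \<omega>] by (intro Bochner_Integration.integral_nonneg) simp
    moreover have "(\<integral>r. indicat_real {0<..t} r * h (\<omega>, r) \<partial>lborel) \<le> (\<integral>r. h (\<omega>, r) \<partial>lborel)"
      using h0[OF \<omega>] by (intro integral_mono iind[OF True] hint(1)[OF True]) (simp split: split_indicator)
    ultimately show ?thesis using hint(2)[OF True] True by (simp add: \<Theta>_def)
  qed (use T K3 in \<open>simp add: \<Theta>_def\<close>)
  moreover have "AE \<omega> in M. integrable lborel (\<lambda>r. indicat_real {0..T} r * \<theta> r \<omega>) \<and>
        (\<forall>s t. 0 \<le> s \<longrightarrow> s \<le> t \<longrightarrow> t \<le> T \<longrightarrow> \<Theta> t \<omega> - \<Theta> s \<omega> = (\<integral>r. indicat_real {s<..t} r * \<theta> r \<omega> \<partial>lborel))"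
    using AEG
  proof eventually_elim
    case (elim \<omega>)
    have "\<Theta> t \<omega> - \<Theta> s \<omega> = (\<integral>r. indicat_real {s<..t} r * \<theta> r \<omega> \<partial>lborel)" if "0 \<le> s" "s \<le> t" "t \<le> T" for s t
    proof -
      have "\<Theta> t \<omega> - \<Theta> s \<omega> = (\<integral>r. indicat_real {0<..t} r * h (\<omega>, r) - indicat_real {0<..s} r * h (\<omega>, r) \<partial>lborel)"
        using elim iind[OF elim] by (simp add: \<Theta>_def)
      also have "\<dots> = (\<integral>r. indicat_real {s<..t} r * \<theta> r \<omega> \<partial>lborel)"
        using that by (intro Bochner_Integration.integral_cong refl) (auto simp: h_def split: split_indicator)
      finally show ?thesis .
    qed
    then show ?case using hint(1)[OF elim] by (simp add: h_def)
  qed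
  ultimately show ?thesis by (intro exI[of _ \<Theta>]) blast
qed

end

text \<open>The driver evaluated along a solution is not known to be jointly measurable; bounding its pathwise
  integral by that of a jointly measurable majorant avoids the question.\<close>

lemma lebesgue_integral_le_lborel:
  fixes b U :: "real \<Rightarrow> real"
  assumes b: "integrable lebesgue (\<lambda>r. indicat_real {0..T} r * b r)" and U: "integrable lborel U"
    and le: "AE r in lborel. r \<in> {0..T} \<longrightarrow> b r \<le> U r" and st: "0 \<le> s" "t \<le> T"
  shows "(\<integral>r. indicat_real {s<..t} r * b r \<partial>lebesgue) \<le> (\<integral>r. indicat_real {s<..t} r * U r \<partial>lborel)"
proof -
  have iU: "integrable lborel (\<lambda>r. indicat_real {s<..t} r * U r)"
    using integrable_mult_indicator[OF _ U, of "{s<..t}"] by simp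
  have mU: "(\<lambda>r. indicat_real {s<..t} r * U r) \<in> borel_measurable lborel" using iU by auto
  have "integrable lebesgue (\<lambda>r. indicat_real {s<..t} r * (indicat_real {0..T} r * b r))"
    using integrable_mult_indicator[OF _ b, of "{s<..t}"] by simp
  moreover have "indicat_real {s<..t} r * (indicat_real {0..T} r * b r) = indicat_real {s<..t} r * b r" for r
    using st by (auto split: split_indicator)
  ultimately have ib: "integrable lebesgue (\<lambda>r. indicat_real {s<..t} r * b r)" by simp
  have "(\<integral>r. indicat_real {s<..t} r * b r \<partial>lebesgue) \<le> (\<integral>r. indicat_real {s<..t} r * U r \<partial>lebesgue)"
  proof (rule integral_mono_AE[OF ib])
    show "integrable lebesgue (\<lambda>r. indicat_real {s<..t} r * U r)" using iU by (subst integrable_completion[OF mU])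
    have "AE r in lebesgue. r \<in> {0..T} \<longrightarrow> b r \<le> U r" using le by (rule AE_completion)
    then show "AE r in lebesgue. indicat_real {s<..t} r * b r \<le> indicat_real {s<..t} r * U r"
      by eventually_elim (use st in \<open>auto split: split_indicator\<close>)
  qed
  also have "\<dots> = (\<integral>r. indicat_real {s<..t} r * U r \<partial>lborel)" by (rule integral_completion[OF mU])
  finally show ?thesis .
qed

text \<open>On a range bounded by R, saturation costs no more than the factor 1 + R. This returns
  from powers of \<open>pos_sat\<close> to moments of the positive part.\<close>

lemma max_le_pos_sat: "x \<le> R \<Longrightarrow> 0 \<le> R \<Longrightarrow> max x 0 \<le> (1 + R) * pos_sat x"
proof -
  assume x: "x \<le> R" "0 \<le> R"
  define y where "y = max x 0"
  have y: "0 \<le> y" "y \<le> R" using x by (auto simp: y_def)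
  have "pos_sat x = y / (1 + y)" unfolding pos_sat_def y_def[symmetric] using y by (simp add: field_simps)
  moreover have "y * (1 + y) \<le> (1 + R) * y" using y mult_left_mono[of "1 + y" "1 + R" y] by (simp add: mult.commute)
  ultimately show "max x 0 \<le> (1 + R) * pos_sat x" using y by (simp add: y_def[symmetric] le_divide_eq)
qed

lemma pos_sat_zero: "pos_sat x = 0 \<Longrightarrow> x \<le> 0"
  using max_le_pos_sat[of x "max x 0"] by auto

section \<open>The comparison argument for abstract drivers\<close>

context brownian_basis
begin

text \<open>The processes are continuous and bounded for every \<omega> and every real time, so
  measurability and domination need no exceptional sets. The drivers b1 and b2 enter through
  pathwise integrals and one-sided bounds, which is all that \<open>ito_inequality\<close> asks of a
  drift.\<close>

lemma comparison_core:
  fixes Y1 Y2 :: "real \<Rightarrow> 'w \<Rightarrow> real" and Z1 Z2 :: "'w \<times> real \<Rightarrow> real ^ 'd" and b1 b2 :: "'w \<Rightarrow> real \<Rightarrow> real"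
  assumes T: "0 < T"
    and YF: "\<And>t. t \<in> {0..T} \<Longrightarrow> Y1 t \<in> borel_measurable (F t)" "\<And>t. t \<in> {0..T} \<Longrightarrow> Y2 t \<in> borel_measurable (F t)"
    and YM: "\<And>t. Y1 t \<in> borel_measurable M" "\<And>t. Y2 t \<in> borel_measurable M"
    and Yc: "\<And>\<omega>. \<omega> \<in> space M \<Longrightarrow> continuous_on UNIV (\<lambda>t. Y1 t \<omega>)" "\<And>\<omega>. \<omega> \<in> space M \<Longrightarrow> continuous_on UNIV (\<lambda>t. Y2 t \<omega>)"
    and YB: "\<And>t \<omega>. \<omega> \<in> space M \<Longrightarrow> \<bar>Y1 t \<omega>\<bar> \<le> B" "\<And>t \<omega>. \<omega> \<in> space M \<Longrightarrow> \<bar>Y2 t \<omega>\<bar> \<le> B"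
    and Z: "sq_int P Z1" "sq_int P Z2"
    and N: "\<And>t. t \<in> {0..T} \<Longrightarrow> ito t (\<lambda>p. indicat_real {t<..T} (snd p) *\<^sub>R Z1 p) (N1 t)"
       "\<And>t. t \<in> {0..T} \<Longrightarrow> ito t (\<lambda>p. indicat_real {t<..T} (snd p) *\<^sub>R Z2 p) (N2 t)"
    and b: "AE \<omega> in M. integrable lebesgue (\<lambda>r. indicat_real {0..T} r * b1 \<omega> r)" "AE \<omega> in M. integrable lebesgue (\<lambda>r. indicat_real {0..T} r * b2 \<omega> r)"
    and eq: "\<And>s t. 0 \<le> s \<Longrightarrow> s \<le> t \<Longrightarrow> t \<le> T \<Longrightarrow>
        AE \<omega> in M. Y1 t \<omega> - Y1 s \<omega> = N1 s \<omega> - N1 t \<omega> - (\<integral>r. indicat_real {s<..t} r * b1 \<omega> r \<partial>lebesgue)"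
      "\<And>s t. 0 \<le> s \<Longrightarrow> s \<le> t \<Longrightarrow> t \<le> T \<Longrightarrow>
        AE \<omega> in M. Y2 t \<omega> - Y2 s \<omega> = N2 s \<omega> - N2 t \<omega> - (\<integral>r. indicat_real {s<..t} r * b2 \<omega> r \<partial>lebesgue)"
    and diff: "AE \<omega> in M. AE r in lborel. r \<in> {0..T} \<longrightarrow> b1 \<omega> r - b2 \<omega> r \<le> K * \<bar>Y1 r \<omega> - Y2 r \<omega>\<bar>
        + L * (1 + norm (Z1 (\<omega>, r)) + norm (Z2 (\<omega>, r))) * norm (Z1 (\<omega>, r) - Z2 (\<omega>, r)) + K * L2_norm M (\<lambda>\<omega>'. max (Y1 r \<omega>' - Y2 r \<omega>') 0)"
    and growth: "AE \<omega> in M. AE r in lborel. r \<in> {0..T} \<longrightarrow> b2 \<omega> r \<le> \<theta> r \<omega> + c + \<gamma> / 2 * (norm (Z2 (\<omega>, r)))\<^sup>2"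
    and \<theta>: "prog_measurable F T \<theta>" "\<And>\<omega> t. \<omega> \<in> space M \<Longrightarrow> t \<in> {0..T} \<Longrightarrow> 0 \<le> (\<theta> t \<omega> :: real)"
    and K3: "AE \<omega> in M. (\<integral>\<^sup>+t\<in>{0..T}. ennreal ((\<theta> t \<omega>)\<^sup>2) \<partial>lborel) \<le> ennreal K3" "0 \<le> K3"
    and end_le: "AE \<omega> in M. Y1 T \<omega> \<le> Y2 T \<omega>"
    and nn: "0 \<le> K" "0 \<le> L" "0 < \<gamma>" "0 \<le> c"
    and t: "t \<in> {0..T}"
  shows "AE \<omega> in M. Y1 t \<omega> \<le> Y2 t \<omega>"
proof -
  obtain \<Theta> where \<Theta>F: "\<And>t. t \<in> {0..T} \<Longrightarrow> \<Theta> t \<in> borel_measurable (F t)" and \<Theta>M: "\<And>t. \<Theta> t \<in> borel_measurable M"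
    and \<Theta>c: "\<And>\<omega>. \<omega> \<in> space M \<Longrightarrow> continuous_on UNIV (\<lambda>t. \<Theta> t \<omega>)" and \<Theta>B: "\<And>\<omega> t. \<omega> \<in> space M \<Longrightarrow> 0 \<le> \<Theta> t \<omega> \<and> \<Theta> t \<omega> \<le> T + K3"
    and \<Theta>eq: "AE \<omega> in M. integrable lborel (\<lambda>r. indicat_real {0..T} r * \<theta> r \<omega>) \<and>
        (\<forall>s t. 0 \<le> s \<longrightarrow> s \<le> t \<longrightarrow> t \<le> T \<longrightarrow> \<Theta> t \<omega> - \<Theta> s \<omega> = (\<integral>r. indicat_real {s<..t} r * \<theta> r \<omega> \<partial>lborel))"
    using integrated_process[OF \<theta> K3 T] by blast
  obtain \<omega>0 where \<omega>0: "\<omega>0 \<in> space M" using not_empty by blast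
  have B0: "0 \<le> B" using YB(1)[OF \<omega>0, of 0] by linarith
  define X1 where "X1 = (\<lambda>t \<omega>. Y1 t \<omega> - Y2 t \<omega>)"
  \<comment> \<open>This is the variable m; time is clipped to [0, T] to keep it bounded and
    continuous on the whole line.\<close>
  define X2 where "X2 = (\<lambda>t \<omega>. Y2 t \<omega> + \<Theta> t \<omega> + c * max 0 (min t T))"
  \<comment> \<open>A common bound: it limits X1 from above for
    \<open>test_function_inequality\<close> and confines X2 to the interval on which the logistic
    parameters are valid.\<close>
  define R where "R = 2 * B + (T + K3) + c * T"
  have R0: "0 \<le> R" "2 * B \<le> R" using B0 T K3 nn by (simp_all add: R_def)
  have X1B: "\<bar>X1 r \<omega>\<bar> \<le> 2 * B" if "\<omega> \<in> space M" for r \<omega>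
    using YB(1)[OF that, of r] YB(2)[OF that, of r] by (simp add: X1_def)
  have X2B: "\<bar>X2 r \<omega>\<bar> \<le> R" if "\<omega> \<in> space M" for r \<omega>
  proof -
    define d where "d = c * max 0 (min r T)"
    have "0 \<le> d" "d \<le> c * T" using nn T by (auto simp: d_def intro!: mult_left_mono)
    then show ?thesis using YB(2)[OF that, of r] \<Theta>B[OF that, of r] B0
      unfolding X2_def R_def d_def[symmetric] abs_le_iff by linarith
  qed
  have XF: "X1 r \<in> borel_measurable (F r)" "X2 r \<in> borel_measurable (F r)" if "r \<in> {0..T}" for r
    unfolding X1_def X2_def using YF[OF that] \<Theta>F[OF that] by auto
  have XM[measurable]: "X1 r \<in> borel_measurable M" "X2 r \<in> borel_measurable M" for r
    unfolding X1_def X2_def using YM \<Theta>M by auto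
  have Xc: "continuous_on UNIV (\<lambda>r. X1 r \<omega>)" "continuous_on UNIV (\<lambda>r. X2 r \<omega>)" if "\<omega> \<in> space M" for \<omega>
    unfolding X1_def X2_def using Yc[OF that] \<Theta>c[OF that] by (auto intro!: continuous_intros)
  obtain A l m n p2 where par: "0 \<le> A" "0 \<le> l" "p2 = real (2 * n + 4) - 2 - (2 * (1 + R) + 2 * L * (1 + R)\<^sup>2)" "0 < p2"
    and logistic_slope: "\<And>y. y \<le> R \<Longrightarrow> - R \<le> y \<Longrightarrow> 0 \<le> logistic_slope A l m y \<and>
      (logistic_slope A l m y + 2 * L)\<^sup>2 * real (2 * n + 4) \<le> p2 * (l * (1 - 2 * logistic l m y) * logistic_slope A l m y + (logistic_slope A l m y)\<^sup>2 - \<gamma> * logistic_slope A l m y)"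
    using test_function_parameters[OF R0(1) nn(2,3)] by blast
  \<comment> \<open>The exponent is taken even so that it equals 2 (n + 2) and
    \<open>second_moment_power_le\<close> applies with j = n + 2.\<close>
  define k where "k = 2 * n + 4"
  have kk: "2 * (n + 2) = k" by (simp add: k_def)
  let ?\<alpha> = "pow_test (2 * n)" and ?\<beta> = "exp_test A l m"
  obtain C1 where C1: "\<And>C. C1 \<le> C \<Longrightarrow> cubic_taylor C ?\<alpha> (pow_test1 (2 * n)) (pow_test2 (2 * n))" using pow_test_taylor by blast
  obtain C2 where C2: "\<And>C. C2 \<le> C \<Longrightarrow> cubic_taylor C ?\<beta> (exp_test1 A l m) (exp_test2 A l m)" using exp_test_taylor by blast
  define C where "C = max 1 (max C1 C2)"
  have C: "1 \<le> C" "cubic_taylor C ?\<alpha> (pow_test1 (2 * n)) (pow_test2 (2 * n))" "cubic_taylor C ?\<beta> (exp_test1 A l m) (exp_test2 A l m)"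
    using C1[of C] C2[of C] by (auto simp: C_def)
  have \<beta>0: "0 \<le> ?\<beta> y" "1 \<le> ?\<beta> y" for y using exp_test_bounds(1)[OF par(1), of l m y] by auto
  note tm[measurable] = cubic_taylor_measurable[OF C(2)] cubic_taylor_measurable[OF C(3)]
  define a where "a = (\<lambda>r. L2_norm M (\<lambda>\<omega>. max (X1 r \<omega>) 0))"
  have Xj[measurable]: "(\<lambda>p. X1 (snd p) (fst p)) \<in> borel_measurable P" "(\<lambda>p. X2 (snd p) (fst p)) \<in> borel_measurable P"
    using XM Xc by (auto intro: jointly_measurable_continuous)
  have a_sq: "a r = sqrt (\<integral>\<omega>. (max (X1 r \<omega>) 0)\<^sup>2 \<partial>M)" for r
    by (simp add: a_def L2_norm_def)
  have mX: "\<bar>max (X1 r \<omega>) 0\<bar> \<le> 2 * B" if "\<omega> \<in> space M" for r \<omega>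
    using X1B[OF that, of r] B0 by auto
  have mX2: "(max (X1 r \<omega>) 0)\<^sup>2 \<le> (2 * B)\<^sup>2" if "\<omega> \<in> space M" for r \<omega>
    using mX[OF that, of r] by (intro power_mono) auto
  have a0: "0 \<le> a r" for r by (simp add: a_sq)
  have aB: "a r \<le> 2 * B" for r
  proof -
    have "(\<integral>\<omega>. (max (X1 r \<omega>) 0)\<^sup>2 \<partial>M) \<le> (\<integral>\<omega>. (2 * B)\<^sup>2 \<partial>M)"
    proof (rule integral_mono)
      show "integrable M (\<lambda>\<omega>. (max (X1 r \<omega>) 0)\<^sup>2)"
      proof (rule integrable_const_bound[of _ "(2 * B)\<^sup>2"])
        show "AE \<omega> in M. norm ((max (X1 r \<omega>) 0)\<^sup>2) \<le> (2 * B)\<^sup>2"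
          by (intro AE_I2) (use mX2 in simp)
      qed measurable
      show "(max (X1 r \<omega>) 0)\<^sup>2 \<le> (2 * B)\<^sup>2" if "\<omega> \<in> space M" for \<omega>
        by (rule mX2[OF that])
    qed simp
    then show ?thesis unfolding a_sq using B0 by (intro real_le_lsqrt) (simp_all add: prob_space)
  qed
  have am[measurable]: "a \<in> borel_measurable lborel"
  proof -
    have "(\<lambda>p. max (X1 (snd p) (fst p)) 0) \<in> borel_measurable P" by measurable
    from measurable_compose[OF measurable_pair_swap' this]
    have [measurable]: "(\<lambda>q. max (X1 (fst q) (snd q)) 0) \<in> borel_measurable (lborel \<Otimes>\<^sub>M M)" by (simp add: split_beta)
    have "(\<lambda>r. \<integral>\<omega>. (max (X1 (fst (r, \<omega>)) (snd (r, \<omega>))) 0)\<^sup>2 \<partial>M) \<in> borel_measurable lborel"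
      by (intro borel_measurable_lebesgue_integral) measurable
    then show ?thesis unfolding a_sq[abs_def] by simp
  qed
  note [measurable] = sq_int_measurable[OF Z(1)] sq_int_measurable[OF Z(2)]
  define V where "V = (\<lambda>p. Z1 p - Z2 p)"
  have sV: "sq_int P V" unfolding V_def by (rule sq_int_diff[OF Z])
  note [measurable] = sq_int_measurable[OF sV]
  \<comment> \<open>The norm of Z1 is bounded by that of Z2 plus that of V, so that the majorant
    involves only V and Z2, the integrands of the martingale parts of X1 and X2.\<close>
  define u1 where "u1 = (\<lambda>p. K * \<bar>X1 (snd p) (fst p)\<bar> + L * (1 + 2 * norm (Z2 p) + norm (V p)) * norm (V p) + K * a (snd p))"
  define U1 where "U1 = (\<lambda>p. indicat_real {0..T} (snd p) * u1 p)"
  define U2 where "U2 = (\<lambda>p. \<gamma> / 2 * (norm (Z2 p))\<^sup>2)"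
  have u1: "0 \<le> u1 p" for p using nn a0 by (simp add: u1_def)
  have U0: "0 \<le> U1 p" "0 \<le> U2 p" for p using u1 nn by (simp_all add: U1_def U2_def)
  \<comment> \<open>Strips are open on the left; starting at -1 includes the time 0.\<close>
  have strip: "integrable P (\<lambda>p. indicat_real {-1<..T} (snd p))" by (rule integrable_strip)
  have U2i: "integrable P U2" using Z unfolding U2_def by (simp add: sq_int_def)
  have U1i: "integrable P U1"
  proof (rule Bochner_Integration.integrable_bound)
    show "integrable P (\<lambda>p. (4 * K * B + L) * indicat_real {-1<..T} (snd p) + L * (3 * (norm (V p))\<^sup>2 + (norm (Z2 p))\<^sup>2))"
      using strip sV Z by (simp add: sq_int_def)
    show "U1 \<in> borel_measurable P" unfolding U1_def u1_def by measurable
    show "AE p in P. norm (U1 p) \<le> norm ((4 * K * B + L) * indicat_real {-1<..T} (snd p) + L * (3 * (norm (V p))\<^sup>2 + (norm (Z2 p))\<^sup>2))"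
    proof (intro AE_I2)
      fix p assume p: "p \<in> space P"
      let ?q = "norm (V p)" and ?z = "norm (Z2 p)"
      show "norm (U1 p) \<le> norm ((4 * K * B + L) * indicat_real {-1<..T} (snd p) + L * (3 * ?q\<^sup>2 + ?z\<^sup>2))"
      proof (cases "snd p \<in> {0..T}")
        case True
        have fp: "fst p \<in> space M" using p by (auto simp: space_pair_measure)
        have "K * \<bar>X1 (snd p) (fst p)\<bar> \<le> K * (2 * B)" "K * a (snd p) \<le> K * (2 * B)"
          using X1B[OF fp] aB nn by (auto intro!: mult_left_mono)
        moreover have "L * ((1 + 2 * ?z + ?q) * ?q) \<le> L * (1 + 3 * ?q\<^sup>2 + ?z\<^sup>2)"
        proof (rule mult_left_mono)
          have "2 * ?z * ?q \<le> ?z\<^sup>2 + ?q\<^sup>2" "2 * 1 * ?q \<le> 1\<^sup>2 + ?q\<^sup>2" by (rule sum_squares_bound)+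
          then have "?q + 2 * ?z * ?q + ?q * ?q \<le> 1 + 3 * ?q\<^sup>2 + ?z\<^sup>2" using mult_nonneg_nonneg[OF norm_ge_zero norm_ge_zero, of "V p" "V p"] unfolding power2_eq_square by linarith
          then show "(1 + 2 * ?z + ?q) * ?q \<le> 1 + 3 * ?q\<^sup>2 + ?z\<^sup>2" by (simp add: distrib_right)
        qed (use nn in simp)
        ultimately have "u1 p \<le> (4 * K * B + L) + L * (3 * ?q\<^sup>2 + ?z\<^sup>2)"
          unfolding u1_def by (simp add: algebra_simps)
        then show ?thesis using True u1[of p] by (simp add: U1_def)
      qed (simp add: U1_def)
    qed
  qed
  have N3: "ito t (\<lambda>p. indicat_real {t<..T} (snd p) *\<^sub>R V p) (\<lambda>\<omega>. N1 t \<omega> - N2 t \<omega>)" if "t \<in> {0..T}" for t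
    using ito_diff[OF N(1)[OF that] N(2)[OF that]] by (simp add: V_def scaleR_diff_right)
  have inc1: "AE \<omega> in M. (N1 s \<omega> - N2 s \<omega>) - (N1 t \<omega> - N2 t \<omega>) - (\<integral>r. indicat_real {s<..t} r * U1 (\<omega>, r) \<partial>lborel) \<le> X1 t \<omega> - X1 s \<omega>"
    if st: "0 \<le> s" "s \<le> t" "t \<le> T" for s t
    using eq(1)[OF st] eq(2)[OF st] b diff P.AE_integrable_fst'[OF U1i] AE_space
  proof eventually_elim
    case (elim \<omega>)
    have i12: "integrable lebesgue (\<lambda>r. indicat_real {0..T} r * (b1 \<omega> r - b2 \<omega> r))"
      using Bochner_Integration.integrable_diff[OF elim(3,4)] by (simp add: right_diff_distrib)
    have le: "(\<integral>r. indicat_real {s<..t} r * (b1 \<omega> r - b2 \<omega> r) \<partial>lebesgue) \<le> (\<integral>r. indicat_real {s<..t} r * U1 (\<omega>, r) \<partial>lborel)"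
    proof (rule lebesgue_integral_le_lborel[OF i12 elim(6) _ st(1,3)])
      show "AE r in lborel. r \<in> {0..T} \<longrightarrow> b1 \<omega> r - b2 \<omega> r \<le> U1 (\<omega>, r)"
        using elim(5)
      proof (eventually_elim, intro impI)
        fix r assume r: "r \<in> {0..T} \<longrightarrow> b1 \<omega> r - b2 \<omega> r \<le> K * \<bar>Y1 r \<omega> - Y2 r \<omega>\<bar>
          + L * (1 + norm (Z1 (\<omega>, r)) + norm (Z2 (\<omega>, r))) * norm (Z1 (\<omega>, r) - Z2 (\<omega>, r)) + K * L2_norm M (\<lambda>\<omega>'. max (Y1 r \<omega>' - Y2 r \<omega>') 0)" "r \<in> {0..T}"
        have "norm (Z1 (\<omega>, r)) \<le> norm (Z2 (\<omega>, r)) + norm (V (\<omega>, r))"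
          using norm_triangle_sub[of "Z1 (\<omega>, r)" "Z2 (\<omega>, r)"] by (simp add: V_def)
        then have "L * (1 + norm (Z1 (\<omega>, r)) + norm (Z2 (\<omega>, r))) * norm (V (\<omega>, r)) \<le> L * (1 + 2 * norm (Z2 (\<omega>, r)) + norm (V (\<omega>, r))) * norm (V (\<omega>, r))"
          using nn by (intro mult_right_mono mult_left_mono) auto
        with r show "b1 \<omega> r - b2 \<omega> r \<le> U1 (\<omega>, r)"
          by (simp add: U1_def u1_def a_def X1_def V_def)
      qed
    qed
    have "integrable lebesgue (\<lambda>r. indicat_real {s<..t} r * b1 \<omega> r)" "integrable lebesgue (\<lambda>r. indicat_real {s<..t} r * b2 \<omega> r)"
    proof -
      have ind: "indicat_real {s<..t} r * (indicat_real {0..T} r * x) = indicat_real {s<..t} r * x" for r x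
        using st by (auto split: split_indicator)
      show "integrable lebesgue (\<lambda>r. indicat_real {s<..t} r * b1 \<omega> r)" "integrable lebesgue (\<lambda>r. indicat_real {s<..t} r * b2 \<omega> r)"
        using integrable_mult_indicator[OF _ elim(3), of "{s<..t}"] integrable_mult_indicator[OF _ elim(4), of "{s<..t}"]
        unfolding real_scaleR_def ind by simp_all
    qed
    then have "(\<integral>r. indicat_real {s<..t} r * (b1 \<omega> r - b2 \<omega> r) \<partial>lebesgue) =
      (\<integral>r. indicat_real {s<..t} r * b1 \<omega> r \<partial>lebesgue) - (\<integral>r. indicat_real {s<..t} r * b2 \<omega> r \<partial>lebesgue)"
      by (simp add: right_diff_distrib)
    with le elim(1,2) show ?case unfolding X1_def by linarith
  qed
  have inc2: "AE \<omega> in M. N2 s \<omega> - N2 t \<omega> - (\<integral>r. indicat_real {s<..t} r * U2 (\<omega>, r) \<partial>lborel) \<le> X2 t \<omega> - X2 s \<omega>"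
    if st: "0 \<le> s" "s \<le> t" "t \<le> T" for s t
    using eq(2)[OF st] b(2) growth P.AE_integrable_fst'[OF U2i] \<Theta>eq
  proof eventually_elim
    case (elim \<omega>)
    \<comment> \<open>An upper bound for b2. Its first two summands are compensated exactly by the
      increments of \<Theta> and of the clipped linear term in X2, so only U2 is left.\<close>
    define W' where "W' = (\<lambda>r. indicat_real {0..T} r * \<theta> r \<omega> + c * indicat_real {0..T} r + U2 (\<omega>, r))"
    have i\<theta>: "integrable lborel (\<lambda>r. indicat_real {0..T} r * \<theta> r \<omega>)" using elim(5) by simp
    have iW: "integrable lborel W'"
      unfolding W'_def using T by (intro Bochner_Integration.integrable_add i\<theta> elim(4) integrable_mult_right) simp
    have le: "(\<integral>r. indicat_real {s<..t} r * b2 \<omega> r \<partial>lebesgue) \<le> (\<integral>r. indicat_real {s<..t} r * W' r \<partial>lborel)"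
      by (rule lebesgue_integral_le_lborel[OF elim(2) iW _ st(1,3)])
         (use elim(3) in \<open>eventually_elim, auto simp: W'_def U2_def\<close>)
    have ind: "indicat_real {s<..t} r * (indicat_real {0..T} r * x) = indicat_real {s<..t} r * x" for r x
      using st by (auto split: split_indicator)
    have i1: "integrable lborel (\<lambda>r. indicat_real {s<..t} r * \<theta> r \<omega>)"
      using integrable_mult_indicator[OF _ i\<theta>, of "{s<..t}"] unfolding real_scaleR_def ind by simp
    have i2: "integrable lborel (\<lambda>r. c * indicat_real {s<..t} r)" "(\<integral>r. c * indicat_real {s<..t} r \<partial>lborel) = c * (t - s)"
      using st by simp_all
    have i3: "integrable lborel (\<lambda>r. indicat_real {s<..t} r * U2 (\<omega>, r))"
      using integrable_mult_indicator[OF _ elim(4), of "{s<..t}"] by simp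
    have "(\<integral>r. indicat_real {s<..t} r * W' r \<partial>lborel) = (\<integral>r. indicat_real {s<..t} r * \<theta> r \<omega> + c * indicat_real {s<..t} r + indicat_real {s<..t} r * U2 (\<omega>, r) \<partial>lborel)"
      unfolding W'_def using st by (intro Bochner_Integration.integral_cong refl) (auto split: split_indicator)
    also have "\<dots> = (\<integral>r. indicat_real {s<..t} r * \<theta> r \<omega> \<partial>lborel) + c * (t - s) + (\<integral>r. indicat_real {s<..t} r * U2 (\<omega>, r) \<partial>lborel)"
      using Bochner_Integration.integral_add[OF Bochner_Integration.integrable_add[OF i1 i2(1)] i3] Bochner_Integration.integral_add[OF i1 i2(1)] i2(2) by simp
    also have "(\<integral>r. indicat_real {s<..t} r * \<theta> r \<omega> \<partial>lborel) = \<Theta> t \<omega> - \<Theta> s \<omega>" using elim(5) st by simp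
    finally have le': "(\<integral>r. indicat_real {s<..t} r * b2 \<omega> r \<partial>lebesgue) \<le> \<Theta> t \<omega> - \<Theta> s \<omega> + c * (t - s) + (\<integral>r. indicat_real {s<..t} r * U2 (\<omega>, r) \<partial>lborel)"
      using le by simp
    have "X2 t \<omega> - X2 s \<omega> = Y2 t \<omega> - Y2 s \<omega> + (\<Theta> t \<omega> - \<Theta> s \<omega>) + c * (t - s)"
      using st by (simp add: X2_def right_diff_distrib min_def max_def)
    with le' elim(1) show ?case by linarith
  qed
  define u where "u = (\<lambda>r. \<integral>\<omega>. ?\<alpha> (X1 r \<omega>) * ?\<beta> (X2 r \<omega>) \<partial>M)"
  define \<Phi> where "\<Phi> = (\<lambda>p. ?\<alpha> (X1 (snd p) (fst p)) * ?\<beta> (X2 (snd p) (fst p)))"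
  have \<Phi>m[measurable]: "\<Phi> \<in> borel_measurable P" unfolding \<Phi>_def by measurable
  note bd = cubic_taylor_bounded(1)[OF C(2,3)]
  have \<Phi>B: "0 \<le> \<Phi> p" "\<Phi> p \<le> C * C" for p
    using bd pow_test_nonneg \<beta>0 by (auto simp: \<Phi>_def intro: abs_le_D1)
  have iu: "integrable M (\<lambda>\<omega>. ?\<alpha> (X1 r \<omega>) * ?\<beta> (X2 r \<omega>))" for r
    by (rule integrable_const_bound[of _ "C * C"]) (use bd in auto)
  have u0: "0 \<le> u r" "u r \<le> C * C" for r
  proof -
    show "0 \<le> u r" unfolding u_def using pow_test_nonneg \<beta>0 by (intro Bochner_Integration.integral_nonneg) auto
    have "u r \<le> (\<integral>\<omega>. C * C \<partial>M)" unfolding u_def using bd by (intro integral_mono iu) (auto intro: abs_le_D1)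
    then show "u r \<le> C * C" by (simp add: prob_space)
  qed
  \<comment> \<open>Jensen moves the power under the integral, \<open>max_le_pos_sat\<close>
    replaces the positive part, and \<beta> \<ge> 1 inserts the second factor. The mean-field term
    is thus bounded by \<open>u\<close> itself, which closes the argument for Gronwall.\<close>
  have ak: "a r ^ k \<le> (1 + R) ^ k * u r" for r
  proof -
    have "a r ^ k = (\<integral>\<omega>. (max (X1 r \<omega>) 0)\<^sup>2 \<partial>M) ^ (n + 2)"
    proof -
      have "k = 2 * (n + 2)" by (simp add: k_def)
      then have "a r ^ k = ((a r)\<^sup>2) ^ (n + 2)" by (simp only: power_mult)
      then show ?thesis by (simp add: a_sq)
    qed
    also have "\<dots> \<le> (\<integral>\<omega>. (max (X1 r \<omega>) 0) ^ (2 * (n + 2)) \<partial>M)"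
      by (rule second_moment_power_le[OF _ mX]) auto
    also have "\<dots> \<le> (\<integral>\<omega>. (1 + R) ^ k * (?\<alpha> (X1 r \<omega>) * ?\<beta> (X2 r \<omega>)) \<partial>M)"
    proof (rule integral_mono)
      show "integrable M (\<lambda>\<omega>. (max (X1 r \<omega>) 0) ^ (2 * (n + 2)))"
      proof (rule integrable_const_bound[of _ "(2 * B) ^ (2 * (n + 2))"])
        have "norm (max (X1 r \<omega>) 0 ^ (2 * (n + 2))) \<le> (2 * B) ^ (2 * (n + 2))" if "\<omega> \<in> space M" for \<omega>
          unfolding norm_power using mX[OF that, of r] by (intro power_mono) auto
        then show "AE \<omega> in M. norm (max (X1 r \<omega>) 0 ^ (2 * (n + 2))) \<le> (2 * B) ^ (2 * (n + 2))" by (intro AE_I2)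
      qed measurable
      show "integrable M (\<lambda>\<omega>. (1 + R) ^ k * (?\<alpha> (X1 r \<omega>) * ?\<beta> (X2 r \<omega>)))" using iu by simp
      fix \<omega> assume \<omega>: "\<omega> \<in> space M"
      have "X1 r \<omega> \<le> R" using X1B[OF \<omega>, of r] R0 by auto
      from max_le_pos_sat[OF this R0(1)]
      have "max (X1 r \<omega>) 0 ^ k \<le> ((1 + R) * pos_sat (X1 r \<omega>)) ^ k" by (intro power_mono) auto
      also have "\<dots> = (1 + R) ^ k * (?\<alpha> (X1 r \<omega>) * 1)" by (simp add: power_mult_distrib pow_test_def k_def)
      also have "\<dots> \<le> (1 + R) ^ k * (?\<alpha> (X1 r \<omega>) * ?\<beta> (X2 r \<omega>))"
        using \<beta>0(2) pow_test_nonneg R0 by (intro mult_left_mono) auto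
      finally show "max (X1 r \<omega>) 0 ^ (2 * (n + 2)) \<le> (1 + R) ^ k * (?\<alpha> (X1 r \<omega>) * ?\<beta> (X2 r \<omega>))"
        unfolding kk .
    qed
    also have "\<dots> = (1 + R) ^ k * u r" by (simp add: u_def)
    finally show ?thesis .
  qed
  define E where "E = real k * L\<^sup>2 / 2 + 2 * (real k * K) + real k * K * exp A"
  have E0: "0 \<le> E" using nn by (simp add: E_def)
  have uT: "u T = 0"
  proof -
    have "AE \<omega> in M. ?\<alpha> (X1 T \<omega>) * ?\<beta> (X2 T \<omega>) = 0"
      using end_le by eventually_elim (simp add: X1_def pow_test_def pos_sat_nonpos)
    then show ?thesis unfolding u_def by (simp add: integral_cong_AE[of _ _ "\<lambda>_. 0"])
  qed
  \<comment> \<open>The loss permitted by \<open>test_function_inequality\<close>, up to the factor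
    E. Integrating over \<omega> first turns its integral into one of u plus the power of a over
    time.\<close>
  define Q where "Q = (\<lambda>s p. indicat_real {s<..T} (snd p) * (\<Phi> p + a (snd p) ^ k))"
  have Qi: "integrable P (Q s)" for s
  proof (rule Bochner_Integration.integrable_bound[OF integrable_mult_right[OF integrable_strip[of s T], of "C * C + (2 * B) ^ k"]])
    show "Q s \<in> borel_measurable P" unfolding Q_def by measurable
    have b: "\<bar>\<Phi> p + a (snd p) ^ k\<bar> \<le> \<bar>C * C + (2 * B) ^ k\<bar>" for p
      using \<Phi>B[of p] power_mono[OF aB a0, of "snd p" k] zero_le_power[OF a0[of "snd p"], of k] by linarith
    show "AE p in P. norm (Q s p) \<le> norm ((C * C + (2 * B) ^ k) * indicat_real {s<..T} (snd p))"
    proof (intro AE_I2)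
      fix p
      show "norm (Q s p) \<le> norm ((C * C + (2 * B) ^ k) * indicat_real {s<..T} (snd p))"
        unfolding Q_def real_norm_def abs_mult using b[of p] by (cases "snd p \<in> {s<..T}") simp_all
    qed
  qed
  have Qfub: "integrable lborel (\<lambda>r. indicat_real {s<..T} r * (u r + a r ^ k))"
    "(\<integral>p. Q s p \<partial>P) = (\<integral>r. indicat_real {s<..T} r * (u r + a r ^ k) \<partial>lborel)" for s
  proof -
    have in_eq: "(\<integral>\<omega>. Q s (\<omega>, r) \<partial>M) = indicat_real {s<..T} r * (u r + a r ^ k)" for r
      using iu[of r] by (simp add: Q_def \<Phi>_def u_def prob_space)
    show "integrable lborel (\<lambda>r. indicat_real {s<..T} r * (u r + a r ^ k))"
      using P.integrable_snd[of "\<lambda>\<omega> r. Q s (\<omega>, r)"] Qi by (simp add: in_eq)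
    show "(\<integral>p. Q s p \<partial>P) = (\<integral>r. indicat_real {s<..T} r * (u r + a r ^ k) \<partial>lborel)"
      using P.integral_snd[of "\<lambda>\<omega> r. Q s (\<omega>, r)"] Qi by (simp add: in_eq)
  qed
  have ui: "integrable lborel (\<lambda>r. indicat_real {s<..T} r * u r)" for s
  proof (rule Bochner_Integration.integrable_bound[OF Qfub(1)[of s]])
    have "(\<lambda>r. \<integral>\<omega>. \<Phi> (snd (r, \<omega>), fst (r, \<omega>)) \<partial>M) \<in> borel_measurable lborel"
      using measurable_compose[OF measurable_pair_swap' \<Phi>m] by (intro borel_measurable_lebesgue_integral) (simp add: split_beta)
    then have [measurable]: "u \<in> borel_measurable lborel" by (simp add: u_def \<Phi>_def)
    show "(\<lambda>r. indicat_real {s<..T} r * u r) \<in> borel_measurable lborel" by measurable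
    show "AE r in lborel. norm (indicat_real {s<..T} r * u r) \<le> norm (indicat_real {s<..T} r * (u r + a r ^ k))"
      using u0 a0 by (intro AE_I2) (auto split: split_indicator)
  qed
  define C' where "C' = E * (1 + (1 + R) ^ k)"
  have C'0: "0 \<le> C'" using E0 R0 by (simp add: C'_def)
  have gr: "u s \<le> C' * (\<integral>r. indicat_real {s<..T} r * u r \<partial>lborel)" if s: "s \<in> {0..T}" for s
  proof (cases "s = T")
    case True
    then show ?thesis using uT by simp
  next
    case False
    then have sT: "0 \<le> s" "s < T" using s by auto
    let ?G = "\<lambda>p. (pow_test2 (2 * n) (X1 (snd p) (fst p)) * exp_test A l m (X2 (snd p) (fst p)) * (V p \<bullet> V p)
        + 2 * (pow_test1 (2 * n) (X1 (snd p) (fst p)) * exp_test1 A l m (X2 (snd p) (fst p)) * (V p \<bullet> Z2 p))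
        + ?\<alpha> (X1 (snd p) (fst p)) * exp_test2 A l m (X2 (snd p) (fst p)) * (Z2 p \<bullet> Z2 p)) / 2
        - (pow_test1 (2 * n) (X1 (snd p) (fst p)) * exp_test A l m (X2 (snd p) (fst p)) * U1 p
           + ?\<alpha> (X1 (snd p) (fst p)) * exp_test1 A l m (X2 (snd p) (fst p)) * U2 p)"
    have N': "\<And>t. t \<in> {s..T} \<Longrightarrow> t \<in> {0..T}" using s by auto
    have ito: "integrable P (\<lambda>p. indicat_real {s<..T} (snd p) * ?G p)"
      "(\<integral>p. indicat_real {s<..T} (snd p) * ?G p \<partial>P) \<le> u T - u s"
      unfolding u_def
      using ito_inequality[OF sT N3[OF N'] N(2)[OF N'] sq_int_measurable[OF sV] sq_int_measurable[OF Z(2)] XF(1)[OF N'] XF(2)[OF N'] XM Xc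
          U1i U2i U0 inc1 inc2 C(2) pow_test_mono pow_test_nonneg C(3) exp_test_mono[OF par(1,2)] \<beta>0(1) C(1)] sT by simp_all
    have "- E * (\<integral>p. Q s p \<partial>P) = (\<integral>p. - E * Q s p \<partial>P)" by simp
    also have "\<dots> \<le> (\<integral>p. indicat_real {s<..T} (snd p) * ?G p \<partial>P)"
    proof (rule integral_mono[OF _ ito(1)])
      show "integrable P (\<lambda>p. - E * Q s p)" using Qi by simp
      fix p assume p: "p \<in> space P"
      show "- E * Q s p \<le> indicat_real {s<..T} (snd p) * ?G p"
      proof (cases "snd p \<in> {s<..T}")
        case True
        have fp: "fst p \<in> space M" using p by (auto simp: space_pair_measure)
        have y: "X2 (snd p) (fst p) \<le> R" "- R \<le> X2 (snd p) (fst p)" using X2B[OF fp, of "snd p"] by auto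
        have x: "X1 (snd p) (fst p) \<le> R" using X1B[OF fp, of "snd p"] R0 by auto
        have "- E * (\<Phi> p + a (snd p) ^ k) \<le> ?G p"
          using test_function_inequality[OF R0(1) nn(2,1) a0[of "snd p"] x par(1,3,4) conjunct1[OF logistic_slope[OF y]] conjunct2[OF logistic_slope[OF y]], of "V p" "Z2 p"] True s
          unfolding E_def \<Phi>_def k_def U1_def U2_def u1_def by simp
        then show ?thesis using True by (simp add: Q_def)
      qed (simp add: Q_def)
    qed
    also note ito(2)
    finally have "u s \<le> E * (\<integral>p. Q s p \<partial>P)" using uT by simp
    also have "(\<integral>p. Q s p \<partial>P) \<le> (\<integral>r. (1 + (1 + R) ^ k) * (indicat_real {s<..T} r * u r) \<partial>lborel)"
      unfolding Qfub(2)
    proof (rule integral_mono[OF Qfub(1)])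
      show "integrable lborel (\<lambda>r. (1 + (1 + R) ^ k) * (indicat_real {s<..T} r * u r))" using ui by simp
      show "indicat_real {s<..T} r * (u r + a r ^ k) \<le> (1 + (1 + R) ^ k) * (indicat_real {s<..T} r * u r)" for r
        using ak[of r] by (simp add: distrib_right split: split_indicator)
    qed
    finally show ?thesis using E0 by (simp add: C'_def mult.assoc mult_left_mono)
  qed
  have "u t = 0"
    by (rule gronwall_backward[OF C'0 u0(1) u0(2) ui gr t])
  then have "AE \<omega> in M. ?\<alpha> (X1 t \<omega>) * ?\<beta> (X2 t \<omega>) = 0"
    unfolding u_def using iu[of t] pow_test_nonneg \<beta>0 by (subst (asm) integral_nonneg_eq_0_iff_AE) auto
  then show ?thesis
  proof eventually_elim
    case (elim \<omega>)
    then have "pos_sat (X1 t \<omega>) = 0" using \<beta>0(2)[of "X2 t \<omega>"] by (auto simp: pow_test_def)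
    from pos_sat_zero[OF this] show ?case by (simp add: X1_def)
  qed
qed


section \<open>From solutions of the equations to the abstract setting\<close>

lemma AE_strip:
  assumes "AE (\<omega>, t) in M \<Otimes>\<^sub>M restrict_space lborel {0..T}. Q \<omega> t"
  shows "AE \<omega> in M. AE t in lborel. t \<in> {0..T::real} \<longrightarrow> Q \<omega> t"
proof -
  interpret R: sigma_finite_measure "restrict_space lborel {0..T}"
    by (rule sigma_finite_measure_restrict_space) (auto intro: lborel.sigma_finite_measure_axioms)
  interpret Q: pair_sigma_finite M "restrict_space lborel {0..T}" ..
  have "AE \<omega> in M. AE t in restrict_space lborel {0..T}. Q \<omega> t"
    using Q.AE_pair[OF assms] by simp
  then show ?thesis by (simp add: AE_restrict_space_iff)
qed

text \<open>Continuity and boundedness hold almost surely and on [0, T]. The exceptional null set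
  belongs to every F t, so putting the process to 0 there preserves adaptedness, and clipping time
  extends it to the line.\<close>

lemma S_inf_modification:
  assumes Y: "Y \<in> S_inf M F T" and T: "0 < T"
  shows "\<exists>Y' B. 0 \<le> B \<and> (\<forall>t\<in>{0..T}. Y' t \<in> borel_measurable (F t)) \<and> (\<forall>t. Y' t \<in> borel_measurable M) \<and>
    (\<forall>\<omega>\<in>space M. continuous_on UNIV (\<lambda>t. Y' t \<omega>)) \<and> (\<forall>\<omega>\<in>space M. \<forall>t. \<bar>Y' t \<omega>\<bar> \<le> B) \<and>
    (AE \<omega> in M. \<forall>t\<in>{0..T}. Y' t \<omega> = Y t \<omega>)"
proof -
  from Y obtain C where m: "\<And>t. t \<in> {0..T} \<Longrightarrow> Y t \<in> borel_measurable (F t)"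
    and c: "AE \<omega> in M. continuous_on {0..T} (\<lambda>t. Y t \<omega>)" and b: "AE \<omega> in M. \<forall>t\<in>{0..T}. \<bar>Y t \<omega>\<bar> \<le> C"
    by (auto simp: S_inf_def)
  have "AE \<omega> in M. continuous_on {0..T} (\<lambda>t. Y t \<omega>) \<and> (\<forall>t\<in>{0..T}. \<bar>Y t \<omega>\<bar> \<le> C)"
    using c b by eventually_elim simp
  then obtain N where N: "N \<in> null_sets M" "\<And>\<omega>. \<omega> \<in> space M \<Longrightarrow> \<omega> \<notin> N \<Longrightarrow> continuous_on {0..T} (\<lambda>t. Y t \<omega>) \<and> (\<forall>t\<in>{0..T}. \<bar>Y t \<omega>\<bar> \<le> C)"
    by (elim AE_E) (auto intro!: null_setsI)
  define clip where "clip = (\<lambda>t. max 0 (min t T))"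
  have clip: "clip t \<in> {0..T}" for t using T by (auto simp: clip_def)
  have clip_id: "clip t = t" if "t \<in> {0..T}" for t using that by (auto simp: clip_def)
  define Y' where "Y' = (\<lambda>t \<omega>. if \<omega> \<in> N then 0 else Y (clip t) \<omega>)"
  have NF: "N \<inter> space M \<in> sets (F t)" for t
  proof -
    have "N \<inter> space M = N" using N(1) sets.sets_into_space by (auto dest: null_setsD2)
    then show ?thesis using null_sets_F[OF N(1)] by simp
  qed
  have F': "Y' t \<in> borel_measurable (F (clip t))" for t
    unfolding Y'_def using NF m[OF clip] by (intro measurable_If_set) auto
  have "Y' t \<in> borel_measurable (F t)" if "t \<in> {0..T}" for t using F'[of t] clip_id[OF that] by simp
  moreover have "Y' t \<in> borel_measurable M" for t by (rule measurable_F_M[OF F'])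
  moreover have "continuous_on UNIV (\<lambda>t. Y' t \<omega>)" if "\<omega> \<in> space M" for \<omega>
  proof (cases "\<omega> \<in> N")
    case False
    then have c1: "continuous_on {0..T} (\<lambda>t. Y t \<omega>)" using N(2)[OF that] by simp
    have c2: "continuous_on UNIV clip" unfolding clip_def by (intro continuous_intros)
    have "range clip \<subseteq> {0..T}" using clip by blast
    then have "continuous_on UNIV (\<lambda>t. Y (clip t) \<omega>)" by (rule continuous_on_compose2[OF c1 c2])
    then show ?thesis using False by (simp add: Y'_def)
  qed (simp add: Y'_def)
  moreover have "\<bar>Y' t \<omega>\<bar> \<le> max C 0" if "\<omega> \<in> space M" for t \<omega>
  proof (cases "\<omega> \<in> N")
    case False
    then have "\<bar>Y (clip t) \<omega>\<bar> \<le> C" using N(2)[OF that] clip[of t] by blast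
    then show ?thesis using False by (simp add: Y'_def)
  qed (simp add: Y'_def)
  moreover have "AE \<omega> in M. \<forall>t\<in>{0..T}. Y' t \<omega> = Y t \<omega>"
    using AE_not_in[OF N(1)] by eventually_elim (simp add: Y'_def clip_id)
  ultimately show ?thesis by (intro exI[of _ Y'] exI[of _ "max C 0"]) auto
qed

lemma Z2_space_sq_int:
  assumes Z: "Z \<in> Z2_space M F T" and T: "0 < T"
  shows "sq_int P (\<lambda>p. indicat_real {0..T} (snd p) *\<^sub>R Z (snd p) (fst p))"
proof -
  let ?Z = "\<lambda>p. indicat_real {0..T} (snd p) *\<^sub>R Z (snd p) (fst p)"
  from Z have pm: "prog_measurable F T Z" and fin: "(\<integral>\<^sup>+ \<omega>. (\<integral>\<^sup>+ s\<in>{0..T}. ennreal ((norm (Z s \<omega>))\<^sup>2) \<partial>lborel) \<partial>M) < \<infinity>"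
    by (auto simp: Z2_space_def)
  have m[measurable]: "?Z \<in> borel_measurable P" using prog_measurable_strip(2)[OF pm, of T] T by simp
  have m2: "(\<lambda>p. (norm (?Z p))\<^sup>2) \<in> borel_measurable P"
    by (intro borel_measurable_power measurable_compose[OF m borel_measurable_norm])
  have "(\<integral>\<^sup>+ p. ennreal ((norm (?Z p))\<^sup>2) \<partial>P) = (\<integral>\<^sup>+ \<omega>. \<integral>\<^sup>+ s. ennreal ((norm (?Z (\<omega>, s)))\<^sup>2) \<partial>lborel \<partial>M)"
    by (rule lborel.nn_integral_fst[OF measurable_compose[OF m2 measurable_ennreal], symmetric])
  also have "\<dots> = (\<integral>\<^sup>+ \<omega>. (\<integral>\<^sup>+ s\<in>{0..T}. ennreal ((norm (Z s \<omega>))\<^sup>2) \<partial>lborel) \<partial>M)"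
    by (intro nn_integral_cong) (simp split: split_indicator)
  finally have "(\<integral>\<^sup>+ p. ennreal ((norm (?Z p))\<^sup>2) \<partial>P) < \<infinity>" using fin by simp
  with m2 have "integrable P (\<lambda>p. (norm (?Z p))\<^sup>2)"
    by (intro integrableI_bounded) (auto simp only: real_norm_def abs_power2)
  then show ?thesis using m by (simp add: sq_int_def)
qed

text \<open>The backward equation is turned into increments between two times. Its closed time
  intervals and the half-open ones of the grid differ by null sets.\<close>

lemma solution_processes:
  assumes sol: "global_solution M F W T f \<zeta> Y Z" and T: "0 < T"
  defines "b \<equiv> \<lambda>\<omega> s. f \<omega> s (Y s \<omega>) (Z s \<omega>) (law M (Y s)) (law M (Z s))"
    and "Z' \<equiv> \<lambda>p. indicat_real {0..T} (snd p) *\<^sub>R Z (snd p) (fst p)"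
  shows "AE \<omega> in M. integrable lebesgue (\<lambda>r. indicat_real {0..T} r * b \<omega> r)"
    and "AE \<omega> in M. Y T \<omega> = \<zeta> \<omega>"
    and "\<exists>N. (\<forall>t\<in>{0..T}. ito t (\<lambda>p. indicat_real {t<..T} (snd p) *\<^sub>R Z' p) (N t)) \<and>
       (\<forall>s t. 0 \<le> s \<longrightarrow> s \<le> t \<longrightarrow> t \<le> T \<longrightarrow>
         (AE \<omega> in M. Y t \<omega> - Y s \<omega> = N s \<omega> - N t \<omega> - (\<integral>r. indicat_real {s<..t} r * b \<omega> r \<partial>lebesgue)))"
proof -
  have Z: "Z \<in> Z2_space M F T" and bi: "AE \<omega> in M. set_integrable lebesgue {0..T} (b \<omega>)"
    using sol by (simp_all add: global_solution_def b_def)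
  from bi show b: "AE \<omega> in M. integrable lebesgue (\<lambda>r. indicat_real {0..T} r * b \<omega> r)"
    by (simp add: set_integrable_def)
  have Z'm[measurable]: "Z' \<in> borel_measurable P"
    unfolding Z'_def using Z2_space_sq_int[OF Z T] by (simp add: sq_int_def)
  have "\<forall>t\<in>{0..T}. \<exists>I. has_ito_integral M F W t T Z I \<and> (AE \<omega> in M. Y t \<omega> = \<zeta> \<omega> + (LINT s:{t..T}|lebesgue. b \<omega> s) - I \<omega>)"
    using sol by (simp add: global_solution_def b_def)
  then obtain N where N: "\<And>t. t \<in> {0..T} \<Longrightarrow> has_ito_integral M F W t T Z (N t)"
    and YN: "\<And>t. t \<in> {0..T} \<Longrightarrow> AE \<omega> in M. Y t \<omega> = \<zeta> \<omega> + (LINT s:{t..T}|lebesgue. b \<omega> s) - N t \<omega>"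
    by metis
  have ito: "ito t (\<lambda>p. indicat_real {t<..T} (snd p) *\<^sub>R Z' p) (N t)" if t: "t \<in> {0..T}" for t
  proof -
    have eq: "(\<lambda>p. indicat_real {t<..T} (snd p) *\<^sub>R Z (snd p) (fst p)) = (\<lambda>p. indicat_real {t<..T} (snd p) *\<^sub>R Z' p)"
      using t by (intro ext) (auto simp: Z'_def split: split_indicator)
    have "(\<lambda>p. indicat_real {t<..T} (snd p) *\<^sub>R Z (snd p) (fst p)) \<in> borel_measurable P"
      unfolding eq by measurable
    from has_ito_integral_ito[OF N[OF t] _ _ this] t show ?thesis unfolding eq by simp
  qed
  \<comment> \<open>The isometry over the empty interval shows that the integral from T to T is 0,
    so the equation at T returns the terminal value.\<close>
  have NT: "AE \<omega> in M. N T \<omega> = 0"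
  proof -
    have itoT: "ito T (\<lambda>p. indicat_real {T<..T} (snd p) *\<^sub>R Z' p) (N T)" using T by (intro ito) simp
    have "(\<integral>\<omega>. 1 * (N T \<omega> * N T \<omega>) \<partial>M) = (\<integral>p. 1 * ((indicat_real {T<..T} (snd p) *\<^sub>R Z' p) \<bullet> (indicat_real {T<..T} (snd p) *\<^sub>R Z' p)) \<partial>P)"
      by (rule ito_isometry[OF _ itoT itoT, of _ 1]) (use T in auto)
    then have "(\<integral>\<omega>. (N T \<omega>)\<^sup>2 \<partial>M) = 0" by (simp add: power2_eq_square)
    moreover have "integrable M (\<lambda>\<omega>. (N T \<omega>)\<^sup>2)" using ito_sq_int(2)[OF itoT] by (simp add: sq_int_def)
    ultimately have "AE \<omega> in M. (N T \<omega>)\<^sup>2 = 0" by (subst (asm) integral_nonneg_eq_0_iff_AE) auto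
    then show ?thesis by simp
  qed
  have null: "(LINT s:{T..T}|lebesgue. h s) = 0" for h :: "real \<Rightarrow> real"
  proof -
    have "AE x in lebesgue. x \<noteq> T" by (rule AE_completion[OF AE_lborel_singleton])
    then have "AE x in lebesgue. indicator {T..T} x *\<^sub>R h x = 0" by eventually_elim auto
    then show ?thesis unfolding set_lebesgue_integral_def by (rule integral_eq_zero_AE)
  qed
  have "T \<in> {0..T}" using T by simp
  from YN[OF this] NT show "AE \<omega> in M. Y T \<omega> = \<zeta> \<omega>"
    by eventually_elim (simp add: null[simplified])
  have inc: "AE \<omega> in M. Y t \<omega> - Y s \<omega> = N s \<omega> - N t \<omega> - (\<integral>r. indicat_real {s<..t} r * b \<omega> r \<partial>lebesgue)"
    if st: "0 \<le> s" "s \<le> t" "t \<le> T" for s t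
  proof -
    have "s \<in> {0..T}" "t \<in> {0..T}" using st by auto
    from YN[OF this(1)] YN[OF this(2)] b show ?thesis
    proof eventually_elim
      case (elim \<omega>)
      have sub: "integrable lebesgue (\<lambda>r. indicat_real A r * b \<omega> r)" if "A \<in> sets lebesgue" "A \<subseteq> {0..T}" for A
      proof -
        have ind: "indicat_real A r * (indicat_real {0..T} r * b \<omega> r) = indicat_real A r * b \<omega> r" for r
          using that(2) by (auto split: split_indicator)
        show ?thesis using integrable_mult_indicator[OF that(1) elim(3)] unfolding real_scaleR_def ind .
      qed
      have i: "integrable lebesgue (\<lambda>r. indicat_real {s..T} r * b \<omega> r)" "integrable lebesgue (\<lambda>r. indicat_real {t..T} r * b \<omega> r)"
        "integrable lebesgue (\<lambda>r. indicat_real {s<..t} r * b \<omega> r)"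
        using st by (auto intro!: sub)
      have "(\<integral>r. indicat_real {s..T} r * b \<omega> r \<partial>lebesgue) - (\<integral>r. indicat_real {t..T} r * b \<omega> r \<partial>lebesgue)
         = (\<integral>r. indicat_real {s..T} r * b \<omega> r - indicat_real {t..T} r * b \<omega> r \<partial>lebesgue)"
        using i by simp
      also have "\<dots> = (\<integral>r. indicat_real {s<..t} r * b \<omega> r \<partial>lebesgue)"
      proof (rule integral_cong_AE)
        show "AE r in lebesgue. indicat_real {s..T} r * b \<omega> r - indicat_real {t..T} r * b \<omega> r = indicat_real {s<..t} r * b \<omega> r"
          using AE_completion[OF AE_lborel_singleton[of s]] AE_completion[OF AE_lborel_singleton[of t]]
          by eventually_elim (use st in \<open>auto split: split_indicator\<close>)
      qed (use i in auto)
      finally show ?case using elim(1,2) by (simp add: set_lebesgue_integral_def)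
    qed
  qed
  show "\<exists>N. (\<forall>t\<in>{0..T}. ito t (\<lambda>p. indicat_real {t<..T} (snd p) *\<^sub>R Z' p) (N t)) \<and>
       (\<forall>s t. 0 \<le> s \<longrightarrow> s \<le> t \<longrightarrow> t \<le> T \<longrightarrow>
         (AE \<omega> in M. Y t \<omega> - Y s \<omega> = N s \<omega> - N t \<omega> - (\<integral>r. indicat_real {s<..t} r * b \<omega> r \<partial>lebesgue)))"
    using ito inc by blast
qed


text \<open>Square integrability on the product space gives a finite second moment of Z r for almost
  every r, and exactly this makes the law of Z r an admissible argument of the generator.\<close>

lemma solution_norm_integrable:
  assumes sol: "global_solution M F W T f \<zeta> Y Z" and T: "0 < T"
  shows "AE r in lborel. r \<in> {0..T} \<longrightarrow> Z r \<in> L2_space M (F r) \<and> law M (Z r) \<in> P2"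
proof -
  have Z: "Z \<in> Z2_space M F T" using sol by (simp add: global_solution_def)
  then have pm: "prog_measurable F T Z" by (simp add: Z2_space_def)
  have i: "integrable P (case_prod (\<lambda>\<omega> r. (norm (indicat_real {0..T} r *\<^sub>R Z r \<omega>))\<^sup>2))"
    using Z2_space_sq_int[OF Z T] unfolding sq_int_def split_beta by (rule conjunct2)
  from P.AE_integrable_snd[OF i] show ?thesis
  proof (eventually_elim, intro impI)
    fix r assume i: "integrable M (\<lambda>\<omega>. (norm (indicat_real {0..T} r *\<^sub>R Z r \<omega>))\<^sup>2)" and r: "r \<in> {0..T}"
    from i r have i2: "integrable M (\<lambda>\<omega>. (norm (Z r \<omega>))\<^sup>2)" by simp
    have m: "Z r \<in> borel_measurable (F r)" by (rule prog_measurable_adapted[OF pm r])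
    have "law M (Z r) \<in> P2"
      using i2 by (intro law_in_P2 measurable_F_M[OF m]) (simp add: nn_integral_eq_integral)
    with m i2 show "Z r \<in> L2_space M (F r) \<and> law M (Z r) \<in> P2" by (simp add: L2_space_def)
  qed
qed

lemma bounded_in_L2_space:
  fixes X :: "'w \<Rightarrow> real"
  assumes m: "X \<in> borel_measurable (F r)" and b: "AE \<omega> in M. \<bar>X \<omega>\<bar> \<le> B"
  shows "X \<in> L2_space M (F r)" "law M X \<in> P2" "0 \<le> B" "wasserstein2 (law M X) (return borel 0) \<le> B"
proof -
  note mM = measurable_F_M[OF m]
  have "AE \<omega> in M. (0::real) \<le> B" using b by eventually_elim linarith
  then show B: "0 \<le> B" by simp
  have i: "integrable M (\<lambda>\<omega>. (norm (X \<omega>))\<^sup>2)"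
  proof (rule integrable_const_bound[of _ "B\<^sup>2"])
    show "AE \<omega> in M. norm ((norm (X \<omega>))\<^sup>2) \<le> B\<^sup>2"
      using b by eventually_elim (simp add: abs_le_square_iff[symmetric])
  qed (use mM in simp)
  then show "X \<in> L2_space M (F r)" using m by (simp add: L2_space_def)
  show "law M X \<in> P2" using i by (intro law_in_P2 mM) (simp add: nn_integral_eq_integral)
  show "wasserstein2 (law M X) (return borel 0) \<le> B"
    using b by (intro wasserstein2_law_zero_le mM B) simp
qed

text \<open>The second law is frozen at that of V r, so its Wasserstein term is 0. The passage goes
  first through (y, z) at fixed laws by the Lipschitz condition, where \<phi> is at most \<phi> B,
  and then through the first law by monotonicity, which is what produces the positive part of Y - Yb
  only.\<close>

lemma driver_increment:
  fixes h :: "('w, 'd) generator"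
  assumes lip: "lipschitz_condition M T \<phi> K h" and K: "0 < K"
    and \<phi>: "mono_on {0..} \<phi>" "\<And>x. 0 \<le> x \<Longrightarrow> 0 \<le> \<phi> x"
    and mon: "nondecreasing_mu1 M F T h"
    and Y: "\<And>r. r \<in> {0..T} \<Longrightarrow> Y r \<in> borel_measurable (F r)" "\<And>r. r \<in> {0..T} \<Longrightarrow> Yb r \<in> borel_measurable (F r)"
    and B: "AE \<omega> in M. \<forall>r\<in>{0..T}. \<bar>Y r \<omega>\<bar> \<le> B \<and> \<bar>Yb r \<omega>\<bar> \<le> B"
    and V: "AE r in lborel. r \<in> {0..T} \<longrightarrow> V r \<in> L2_space M (F r) \<and> law M (V r) \<in> P2"
  shows "\<exists>K'\<ge>0. \<exists>L\<ge>0. AE \<omega> in M. AE r in lborel. r \<in> {0..T} \<longrightarrow>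
       h \<omega> r (Y r \<omega>) (Z r \<omega>) (law M (Y r)) (law M (V r)) - h \<omega> r (Yb r \<omega>) (Zb r \<omega>) (law M (Yb r)) (law M (V r))
        \<le> K' * \<bar>Y r \<omega> - Yb r \<omega>\<bar> + L * (1 + norm (Z r \<omega>) + norm (Zb r \<omega>)) * norm (Z r \<omega> - Zb r \<omega>)
          + K' * L2_norm M (\<lambda>\<omega>. max (Y r \<omega> - Yb r \<omega>) 0)"
proof (cases "0 \<le> T")
  case True
  from mon obtain Km where Km: "0 < Km" "\<And>\<omega> t y z \<xi> \<xi>' \<zeta>. \<omega> \<in> space M \<Longrightarrow> t \<in> {0..T} \<Longrightarrow> \<xi> \<in> L2_space M (F t) \<Longrightarrow> \<xi>' \<in> L2_space M (F t) \<Longrightarrow> \<zeta> \<in> L2_space M (F t) \<Longrightarrow>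
      h \<omega> t y z (law M \<xi>) (law M \<zeta>) - h \<omega> t y z (law M \<xi>') (law M \<zeta>) \<le> Km * L2_norm M (\<lambda>\<omega>'. max (\<xi> \<omega>' - \<xi>' \<omega>') 0)"
    unfolding nondecreasing_mu1_def by blast
  have Bd: "AE \<omega> in M. \<bar>Y r \<omega>\<bar> \<le> B" "AE \<omega> in M. \<bar>Yb r \<omega>\<bar> \<le> B" if "r \<in> {0..T}" for r
    using B that by (auto elim: AE_mp)
  note Yl = bounded_in_L2_space[OF Y(1) Bd(1)] and Ybl = bounded_in_L2_space[OF Y(2) Bd(2)]
  have L2n: "0 \<le> L2_norm M X" for X :: "'w \<Rightarrow> real" by (simp add: L2_norm_def)
  have "AE \<omega> in M. AE r in lborel. r \<in> {0..T} \<longrightarrow>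
       h \<omega> r (Y r \<omega>) (Z r \<omega>) (law M (Y r)) (law M (V r)) - h \<omega> r (Yb r \<omega>) (Zb r \<omega>) (law M (Yb r)) (law M (V r))
        \<le> (K + Km) * \<bar>Y r \<omega> - Yb r \<omega>\<bar> + \<phi> B * (1 + norm (Z r \<omega>) + norm (Zb r \<omega>)) * norm (Z r \<omega> - Zb r \<omega>)
          + (K + Km) * L2_norm M (\<lambda>\<omega>. max (Y r \<omega> - Yb r \<omega>) 0)"
    using AE_strip[OF lip[unfolded lipschitz_condition_def]] B AE_space
  proof eventually_elim
    case (elim \<omega>)
    from elim(1) V show ?case
    proof (eventually_elim, intro impI)
      fix r
      let ?y = "Y r \<omega>" and ?y' = "Yb r \<omega>" and ?z = "Z r \<omega>" and ?z' = "Zb r \<omega>"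
        and ?\<mu> = "law M (Y r)" and ?\<mu>' = "law M (Yb r)" and ?\<nu> = "law M (V r)"
        and ?p = "L2_norm M (\<lambda>\<omega>. max (Y r \<omega> - Yb r \<omega>) 0)" and ?w = "wasserstein2 (law M (Y r)) (return borel 0)"
      let ?q = "(1 + norm ?z + norm ?z') * norm (?z - ?z')"
      assume l: "r \<in> {0..T} \<longrightarrow> (\<forall>y y' z z'. \<forall>\<mu>1\<in>P2. \<forall>\<mu>1'\<in>P2. \<forall>\<mu>2\<in>P2. \<forall>\<mu>2'\<in>P2.
          \<bar>h \<omega> r y z \<mu>1 \<mu>2 - h \<omega> r y' z' \<mu>1' \<mu>2'\<bar>
            \<le> K * (\<bar>y - y'\<bar> + wasserstein2 \<mu>1 \<mu>1') +
              \<phi> (max (max \<bar>y\<bar> \<bar>y'\<bar>)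
                     (max (wasserstein2 \<mu>1 (return borel 0)) (wasserstein2 \<mu>1' (return borel 0)))) *
              ((1 + norm z + norm z') * norm (z - z') + wasserstein2 \<mu>2 \<mu>2'))"
        and Vr: "r \<in> {0..T} \<longrightarrow> V r \<in> L2_space M (F r) \<and> law M (V r) \<in> P2" and r: "r \<in> {0..T}"
      let ?x = "max (max \<bar>?y\<bar> \<bar>?y'\<bar>) (max ?w ?w)"
      have x: "0 \<le> ?x" "?x \<le> B" using elim(2) r Yl(4)[OF r r] by auto
      have "\<phi> ?x \<le> \<phi> B" using \<phi>(1) x by (auto simp: mono_on_def)
      then have \<phi>B: "\<phi> ?x * ?q \<le> \<phi> B * ?q" by (intro mult_right_mono) auto
      have w0: "wasserstein2 ?\<mu> ?\<mu> = 0" "wasserstein2 ?\<nu> ?\<nu> = 0" by (simp_all add: wasserstein2_self)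
      have "\<bar>h \<omega> r ?y ?z ?\<mu> ?\<nu> - h \<omega> r ?y' ?z' ?\<mu> ?\<nu>\<bar> \<le> K * (\<bar>?y - ?y'\<bar> + wasserstein2 ?\<mu> ?\<mu>) + \<phi> ?x * (?q + wasserstein2 ?\<nu> ?\<nu>)"
        using l r Vr Yl(2)[OF r r] by blast
      then have 1: "h \<omega> r ?y ?z ?\<mu> ?\<nu> - h \<omega> r ?y' ?z' ?\<mu> ?\<nu> \<le> K * \<bar>?y - ?y'\<bar> + \<phi> B * ?q"
        using \<phi>B unfolding w0 add_0_right by linarith
      have 2: "h \<omega> r ?y' ?z' ?\<mu> ?\<nu> - h \<omega> r ?y' ?z' ?\<mu>' ?\<nu> \<le> Km * ?p"
        using Vr r by (intro Km(2)[OF elim(3) r Yl(1)[OF r r] Ybl(1)[OF r r]]) simp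
      have "0 \<le> Km * \<bar>?y - ?y'\<bar>" "0 \<le> K * ?p" using K Km(1) L2n by simp_all
      with 1 2 show "h \<omega> r ?y ?z ?\<mu> ?\<nu> - h \<omega> r ?y' ?z' ?\<mu>' ?\<nu>
        \<le> (K + Km) * \<bar>?y - ?y'\<bar> + \<phi> B * (1 + norm ?z + norm ?z') * norm (?z - ?z') + (K + Km) * ?p"
        unfolding distrib_right mult.assoc by linarith
    qed
  qed
  moreover have "0 \<le> \<phi> B" using Yl(3)[of 0] True by (intro \<phi>(2)) simp
  moreover have "0 \<le> K + Km" using K Km(1) by simp
  ultimately show ?thesis by blast
qed auto

text \<open>The generator that ignores the second law may be evaluated at the law of Z of the other
  solution. There g \<le> gb exchanges the generators, and what remains is an increment of the
  monotone generator at one fixed second law, estimated by \<open>driver_increment\<close>.\<close>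

lemma mean_field_comparison:
  fixes g gb :: "('w, 'd) generator"
  assumes T: "0 < T"
    and qg: "quadratic_data M F T g \<eta>" and qgb: "quadratic_data M F T gb \<eta>b"
    and sol: "global_solution M F W T g \<eta> Y Z" and solb: "global_solution M F W T gb \<eta>b Yb Zb"
    and cases: "(independent_of_mu2 M T g \<and> nondecreasing_mu1 M F T gb) \<or>
         (independent_of_mu2 M T gb \<and> nondecreasing_mu1 M F T g)"
    and \<eta>: "AE \<omega> in M. \<eta> \<omega> \<le> \<eta>b \<omega>"
    and gle: "AE \<omega> in M. \<forall>t\<in>{0..T}. \<forall>y z. \<forall>\<mu>1\<in>P2. \<forall>\<mu>2\<in>P2. g \<omega> t y z \<mu>1 \<mu>2 \<le> gb \<omega> t y z \<mu>1 \<mu>2"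
    and t: "t \<in> {0..T}"
  shows "AE \<omega> in M. Y t \<omega> \<le> Yb t \<omega>"
proof -
  have SY: "Y \<in> S_inf M F T" "Yb \<in> S_inf M F T" using sol solb by (simp_all add: global_solution_def)
  obtain Y1 B1 where B1: "0 \<le> B1" and Y1F: "\<And>t. t \<in> {0..T} \<Longrightarrow> Y1 t \<in> borel_measurable (F t)" and Y1M: "\<And>t. Y1 t \<in> borel_measurable M"
    and Y1c: "\<And>\<omega>. \<omega> \<in> space M \<Longrightarrow> continuous_on UNIV (\<lambda>t. Y1 t \<omega>)" and Y1B: "\<And>\<omega> t. \<omega> \<in> space M \<Longrightarrow> \<bar>Y1 t \<omega>\<bar> \<le> B1"
    and Y1eq: "AE \<omega> in M. \<forall>t\<in>{0..T}. Y1 t \<omega> = Y t \<omega>"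
    using S_inf_modification[OF SY(1) T] by blast
  obtain Y2 B2 where B2: "0 \<le> B2" and Y2F: "\<And>t. t \<in> {0..T} \<Longrightarrow> Y2 t \<in> borel_measurable (F t)" and Y2M: "\<And>t. Y2 t \<in> borel_measurable M"
    and Y2c: "\<And>\<omega>. \<omega> \<in> space M \<Longrightarrow> continuous_on UNIV (\<lambda>t. Y2 t \<omega>)" and Y2B: "\<And>\<omega> t. \<omega> \<in> space M \<Longrightarrow> \<bar>Y2 t \<omega>\<bar> \<le> B2"
    and Y2eq: "AE \<omega> in M. \<forall>t\<in>{0..T}. Y2 t \<omega> = Yb t \<omega>"
    using S_inf_modification[OF SY(2) T] by blast
  define B where "B = max B1 B2"
  have B: "0 \<le> B" "\<And>\<omega> t. \<omega> \<in> space M \<Longrightarrow> \<bar>Y1 t \<omega>\<bar> \<le> B" "\<And>\<omega> t. \<omega> \<in> space M \<Longrightarrow> \<bar>Y2 t \<omega>\<bar> \<le> B"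
    using B1 Y1B Y2B by (auto simp: B_def le_max_iff_disj)
  have YF: "Y t \<in> borel_measurable (F t)" "Yb t \<in> borel_measurable (F t)" if "t \<in> {0..T}" for t
    using sol solb that by (auto simp: global_solution_def S_inf_def)
  have YB: "AE \<omega> in M. \<bar>Y t \<omega>\<bar> \<le> B" "AE \<omega> in M. \<bar>Yb t \<omega>\<bar> \<le> B" if "t \<in> {0..T}" for t
  proof -
    show "AE \<omega> in M. \<bar>Y t \<omega>\<bar> \<le> B" using Y1eq AE_space by eventually_elim (metis B(2) that)
    show "AE \<omega> in M. \<bar>Yb t \<omega>\<bar> \<le> B" using Y2eq AE_space by eventually_elim (metis B(3) that)
  qed
  note Yl = bounded_in_L2_space[OF YF(1) YB(1)] and Ybl = bounded_in_L2_space[OF YF(2) YB(2)]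
  have Zl: "AE r in lborel. r \<in> {0..T} \<longrightarrow> Z r \<in> L2_space M (F r) \<and> law M (Z r) \<in> P2"
    by (rule solution_norm_integrable[OF sol T])
  have Zbl: "AE r in lborel. r \<in> {0..T} \<longrightarrow> Zb r \<in> L2_space M (F r) \<and> law M (Zb r) \<in> P2"
    by (rule solution_norm_integrable[OF solb T])
  define b1 where "b1 = (\<lambda>\<omega> s. g \<omega> s (Y s \<omega>) (Z s \<omega>) (law M (Y s)) (law M (Z s)))"
  define b2 where "b2 = (\<lambda>\<omega> s. gb \<omega> s (Yb s \<omega>) (Zb s \<omega>) (law M (Yb s)) (law M (Zb s)))"
  define Z1 where "Z1 = (\<lambda>p. indicat_real {0..T} (snd p) *\<^sub>R Z (snd p) (fst p))"
  define Z2 where "Z2 = (\<lambda>p. indicat_real {0..T} (snd p) *\<^sub>R Zb (snd p) (fst p))"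
  have S1: "AE \<omega> in M. integrable lebesgue (\<lambda>r. indicat_real {0..T} r * b1 \<omega> r)"
    unfolding b1_def by (rule solution_processes(1)[OF sol T])
  have S2: "AE \<omega> in M. integrable lebesgue (\<lambda>r. indicat_real {0..T} r * b2 \<omega> r)"
    unfolding b2_def by (rule solution_processes(1)[OF solb T])
  have "\<exists>N. (\<forall>t\<in>{0..T}. ito t (\<lambda>p. indicat_real {t<..T} (snd p) *\<^sub>R Z1 p) (N t)) \<and>
       (\<forall>s t. 0 \<le> s \<longrightarrow> s \<le> t \<longrightarrow> t \<le> T \<longrightarrow>
         (AE \<omega> in M. Y t \<omega> - Y s \<omega> = N s \<omega> - N t \<omega> - (\<integral>r. indicat_real {s<..t} r * b1 \<omega> r \<partial>lebesgue)))"
    unfolding b1_def Z1_def by (rule solution_processes(3)[OF sol T])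
  then obtain N1 where N1: "\<And>t. t \<in> {0..T} \<Longrightarrow> ito t (\<lambda>p. indicat_real {t<..T} (snd p) *\<^sub>R Z1 p) (N1 t)"
    and eq1: "\<And>s t. 0 \<le> s \<Longrightarrow> s \<le> t \<Longrightarrow> t \<le> T \<Longrightarrow>
         AE \<omega> in M. Y t \<omega> - Y s \<omega> = N1 s \<omega> - N1 t \<omega> - (\<integral>r. indicat_real {s<..t} r * b1 \<omega> r \<partial>lebesgue)"
    by blast
  have "\<exists>N. (\<forall>t\<in>{0..T}. ito t (\<lambda>p. indicat_real {t<..T} (snd p) *\<^sub>R Z2 p) (N t)) \<and>
       (\<forall>s t. 0 \<le> s \<longrightarrow> s \<le> t \<longrightarrow> t \<le> T \<longrightarrow>
         (AE \<omega> in M. Yb t \<omega> - Yb s \<omega> = N s \<omega> - N t \<omega> - (\<integral>r. indicat_real {s<..t} r * b2 \<omega> r \<partial>lebesgue)))"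
    unfolding b2_def Z2_def by (rule solution_processes(3)[OF solb T])
  then obtain N2 where N2: "\<And>t. t \<in> {0..T} \<Longrightarrow> ito t (\<lambda>p. indicat_real {t<..T} (snd p) *\<^sub>R Z2 p) (N2 t)"
    and eq2: "\<And>s t. 0 \<le> s \<Longrightarrow> s \<le> t \<Longrightarrow> t \<le> T \<Longrightarrow>
         AE \<omega> in M. Yb t \<omega> - Yb s \<omega> = N2 s \<omega> - N2 t \<omega> - (\<integral>r. indicat_real {s<..t} r * b2 \<omega> r \<partial>lebesgue)"
    by blast
  have sqZ: "sq_int P Z1" "sq_int P Z2"
    unfolding Z1_def Z2_def using sol solb T by (auto intro!: Z2_space_sq_int simp: global_solution_def)
  have L2eq: "L2_norm M (\<lambda>\<omega>. max (Y r \<omega> - Yb r \<omega>) 0) = L2_norm M (\<lambda>\<omega>. max (Y1 r \<omega> - Y2 r \<omega>) 0)" if r: "r \<in> {0..T}" for r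
  proof -
    note [measurable] = measurable_F_M[OF YF(1)[OF r]] measurable_F_M[OF YF(2)[OF r]] Y1M Y2M
    have "AE \<omega> in M. (norm (max (Y r \<omega> - Yb r \<omega>) 0))\<^sup>2 = (norm (max (Y1 r \<omega> - Y2 r \<omega>) 0))\<^sup>2"
      using Y1eq Y2eq by eventually_elim (use r in auto)
    then show ?thesis unfolding L2_norm_def by (intro arg_cong[of _ _ sqrt] integral_cong_AE) measurable
  qed
  have YB': "AE \<omega> in M. \<forall>r\<in>{0..T}. \<bar>Y r \<omega>\<bar> \<le> B \<and> \<bar>Yb r \<omega>\<bar> \<le> B"
    using Y1eq Y2eq AE_space by eventually_elim (metis B(2,3))
  have "\<exists>K\<ge>0. \<exists>L\<ge>0. AE \<omega> in M. AE r in lborel. r \<in> {0..T} \<longrightarrow> b1 \<omega> r - b2 \<omega> r \<le> K * \<bar>Y r \<omega> - Yb r \<omega>\<bar>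
        + L * (1 + norm (Z r \<omega>) + norm (Zb r \<omega>)) * norm (Z r \<omega> - Zb r \<omega>) + K * L2_norm M (\<lambda>\<omega>. max (Y r \<omega> - Yb r \<omega>) 0)"
    (is "\<exists>K\<ge>0. \<exists>L\<ge>0. AE \<omega> in M. AE r in lborel. _ \<longrightarrow> _ \<le> ?b K L \<omega> r")
    using cases
  proof (elim disjE conjE)
    assume ind: "independent_of_mu2 M T g" and mon: "nondecreasing_mu1 M F T gb"
    from qgb obtain \<phi> K where \<phi>: "mono_on {0..} \<phi>" "\<And>x. 0 \<le> x \<Longrightarrow> 0 \<le> \<phi> x" "0 < K" "lipschitz_condition M T \<phi> K gb"
      unfolding quadratic_data_def by blast
    \<comment> \<open>Frozen at the law of \<open>Zb\<close>, the argument that gb has along its own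
      solution; g \<le> gb is then applied along (Y, Z).\<close>
    from driver_increment[OF \<phi>(4,3,1,2) mon YF YB' Zbl, of Z Zb] obtain K' L where K': "0 \<le> K'" "0 \<le> L"
      and inc: "AE \<omega> in M. AE r in lborel. r \<in> {0..T} \<longrightarrow>
        gb \<omega> r (Y r \<omega>) (Z r \<omega>) (law M (Y r)) (law M (Zb r)) - gb \<omega> r (Yb r \<omega>) (Zb r \<omega>) (law M (Yb r)) (law M (Zb r)) \<le> ?b K' L \<omega> r"
      by blast
    have "AE \<omega> in M. AE r in lborel. r \<in> {0..T} \<longrightarrow> b1 \<omega> r - b2 \<omega> r \<le> ?b K' L \<omega> r"
      using inc gle AE_space
    proof eventually_elim
      case (elim \<omega>)
      from elim(1) Zl Zbl show ?case
      proof (eventually_elim, intro impI)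
        fix r assume inc: "r \<in> {0..T} \<longrightarrow>
            gb \<omega> r (Y r \<omega>) (Z r \<omega>) (law M (Y r)) (law M (Zb r)) - gb \<omega> r (Yb r \<omega>) (Zb r \<omega>) (law M (Yb r)) (law M (Zb r)) \<le> ?b K' L \<omega> r"
          and Zr: "r \<in> {0..T} \<longrightarrow> Z r \<in> L2_space M (F r) \<and> law M (Z r) \<in> P2"
            "r \<in> {0..T} \<longrightarrow> Zb r \<in> L2_space M (F r) \<and> law M (Zb r) \<in> P2" and r: "r \<in> {0..T}"
        have "g \<omega> r (Y r \<omega>) (Z r \<omega>) (law M (Y r)) (law M (Z r)) = g \<omega> r (Y r \<omega>) (Z r \<omega>) (law M (Y r)) (law M (Zb r))"
          using ind elim(3) r Yl(2)[OF r r] Zr unfolding independent_of_mu2_def by blast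
        moreover have "g \<omega> r (Y r \<omega>) (Z r \<omega>) (law M (Y r)) (law M (Zb r)) \<le> gb \<omega> r (Y r \<omega>) (Z r \<omega>) (law M (Y r)) (law M (Zb r))"
          using elim(2) r Yl(2)[OF r r] Zr by blast
        ultimately show "b1 \<omega> r - b2 \<omega> r \<le> ?b K' L \<omega> r"
          using inc[rule_format, OF r] unfolding b1_def b2_def by linarith
      qed
    qed
    then show ?thesis using K' by blast
  next
    assume ind: "independent_of_mu2 M T gb" and mon: "nondecreasing_mu1 M F T g"
    from qg obtain \<phi> K where \<phi>: "mono_on {0..} \<phi>" "\<And>x. 0 \<le> x \<Longrightarrow> 0 \<le> \<phi> x" "0 < K" "lipschitz_condition M T \<phi> K g"
      unfolding quadratic_data_def by blast
    \<comment> \<open>The mirror image: frozen at the law of \<open>Z\<close>, with g \<le> gb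
      applied along (Yb, Zb).\<close>
    from driver_increment[OF \<phi>(4,3,1,2) mon YF YB' Zl, of Z Zb] obtain K' L where K': "0 \<le> K'" "0 \<le> L"
      and inc: "AE \<omega> in M. AE r in lborel. r \<in> {0..T} \<longrightarrow>
        g \<omega> r (Y r \<omega>) (Z r \<omega>) (law M (Y r)) (law M (Z r)) - g \<omega> r (Yb r \<omega>) (Zb r \<omega>) (law M (Yb r)) (law M (Z r)) \<le> ?b K' L \<omega> r"
      by blast
    have "AE \<omega> in M. AE r in lborel. r \<in> {0..T} \<longrightarrow> b1 \<omega> r - b2 \<omega> r \<le> ?b K' L \<omega> r"
      using inc gle AE_space
    proof eventually_elim
      case (elim \<omega>)
      from elim(1) Zl Zbl show ?case
      proof (eventually_elim, intro impI)
        fix r assume inc: "r \<in> {0..T} \<longrightarrow>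
            g \<omega> r (Y r \<omega>) (Z r \<omega>) (law M (Y r)) (law M (Z r)) - g \<omega> r (Yb r \<omega>) (Zb r \<omega>) (law M (Yb r)) (law M (Z r)) \<le> ?b K' L \<omega> r"
          and Zr: "r \<in> {0..T} \<longrightarrow> Z r \<in> L2_space M (F r) \<and> law M (Z r) \<in> P2"
            "r \<in> {0..T} \<longrightarrow> Zb r \<in> L2_space M (F r) \<and> law M (Zb r) \<in> P2" and r: "r \<in> {0..T}"
        have "gb \<omega> r (Yb r \<omega>) (Zb r \<omega>) (law M (Yb r)) (law M (Z r)) = gb \<omega> r (Yb r \<omega>) (Zb r \<omega>) (law M (Yb r)) (law M (Zb r))"
          using ind elim(3) r Ybl(2)[OF r r] Zr unfolding independent_of_mu2_def by blast
        moreover have "g \<omega> r (Yb r \<omega>) (Zb r \<omega>) (law M (Yb r)) (law M (Z r)) \<le> gb \<omega> r (Yb r \<omega>) (Zb r \<omega>) (law M (Yb r)) (law M (Z r))"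
          using elim(2) r Ybl(2)[OF r r] Zr by blast
        ultimately show "b1 \<omega> r - b2 \<omega> r \<le> ?b K' L \<omega> r"
          using inc[rule_format, OF r] unfolding b1_def b2_def by linarith
      qed
    qed
    then show ?thesis using K' by blast
  qed
  then obtain K L where KL: "0 \<le> K" "0 \<le> L"
    and diff0: "AE \<omega> in M. AE r in lborel. r \<in> {0..T} \<longrightarrow> b1 \<omega> r - b2 \<omega> r \<le> K * \<bar>Y r \<omega> - Yb r \<omega>\<bar>
        + L * (1 + norm (Z r \<omega>) + norm (Zb r \<omega>)) * norm (Z r \<omega> - Zb r \<omega>) + K * L2_norm M (\<lambda>\<omega>'. max (Y r \<omega>' - Yb r \<omega>') 0)"
    by blast
  have diff: "AE \<omega> in M. AE r in lborel. r \<in> {0..T} \<longrightarrow> b1 \<omega> r - b2 \<omega> r \<le> K * \<bar>Y1 r \<omega> - Y2 r \<omega>\<bar>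
        + L * (1 + norm (Z1 (\<omega>, r)) + norm (Z2 (\<omega>, r))) * norm (Z1 (\<omega>, r) - Z2 (\<omega>, r)) + K * L2_norm M (\<lambda>\<omega>'. max (Y1 r \<omega>' - Y2 r \<omega>') 0)"
    using diff0 Y1eq Y2eq
  proof eventually_elim
    case (elim \<omega>)
    from elim(1) show ?case
      by eventually_elim (use elim(2,3) L2eq in \<open>simp add: Z1_def Z2_def\<close>)
  qed
  \<comment> \<open>The second variable of the test function is built from \<open>Yb\<close>, so in
    both cases the growth bound is the one of gb along its own solution.\<close>
  from qgb obtain \<theta> \<gamma> Kg K3 where \<theta>: "prog_measurable F T \<theta>" "\<And>\<omega> t. \<omega> \<in> space M \<Longrightarrow> t \<in> {0..T} \<Longrightarrow> 0 \<le> \<theta> t \<omega>"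
    and \<gamma>: "0 < \<gamma>" "0 < Kg" "0 < K3" and gr: "growth_condition M T \<theta> \<gamma> Kg gb"
    and es: "esssup M (\<lambda>\<omega>. \<integral>\<^sup>+ t\<in>{0..T}. ennreal ((\<theta> t \<omega>)\<^sup>2) \<partial>lborel) \<le> ennreal K3"
    unfolding quadratic_data_def by blast
  have K3: "AE \<omega> in M. (\<integral>\<^sup>+ t\<in>{0..T}. ennreal ((\<theta> t \<omega>)\<^sup>2) \<partial>lborel) \<le> ennreal K3"
    using esssup_AE[of "\<lambda>\<omega>. \<integral>\<^sup>+ t\<in>{0..T}. ennreal ((\<theta> t \<omega>)\<^sup>2) \<partial>lborel" M] by eventually_elim (use es in \<open>auto intro: order_trans\<close>)
  \<comment> \<open>The constant 2 Kg B collects the term in |Yb| and the Wasserstein distance to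
    the point mass at 0, each contributing at most Kg B.\<close>
  have growth: "AE \<omega> in M. AE r in lborel. r \<in> {0..T} \<longrightarrow> b2 \<omega> r \<le> \<theta> r \<omega> + 2 * (Kg * B) + \<gamma> / 2 * (norm (Z2 (\<omega>, r)))\<^sup>2"
    using AE_strip[OF gr[unfolded growth_condition_def]] Y2eq AE_space
  proof eventually_elim
    case (elim \<omega>)
    from elim(1) Zbl show ?case
    proof (eventually_elim, intro impI)
      fix r assume l: "r \<in> {0..T} \<longrightarrow> (\<forall>y z. \<forall>\<mu>1\<in>P2. \<forall>\<mu>2\<in>P2. \<bar>gb \<omega> r y z \<mu>1 \<mu>2\<bar>
            \<le> \<theta> r \<omega> + Kg * \<bar>y\<bar> + \<gamma> / 2 * (norm z)\<^sup>2 + Kg * wasserstein2 \<mu>1 (return borel 0))"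
        and Zr: "r \<in> {0..T} \<longrightarrow> Zb r \<in> L2_space M (F r) \<and> law M (Zb r) \<in> P2" and r: "r \<in> {0..T}"
      have "\<bar>b2 \<omega> r\<bar> \<le> \<theta> r \<omega> + Kg * \<bar>Yb r \<omega>\<bar> + \<gamma> / 2 * (norm (Zb r \<omega>))\<^sup>2 + Kg * wasserstein2 (law M (Yb r)) (return borel 0)"
        unfolding b2_def using l r Zr Ybl(2)[OF r r] by blast
      moreover have "\<bar>Yb r \<omega>\<bar> \<le> B" using elim(2,3) r B(3)[of \<omega> r] by auto
      then have "Kg * \<bar>Yb r \<omega>\<bar> \<le> Kg * B" using \<gamma> by (intro mult_left_mono) auto
      moreover have "Kg * wasserstein2 (law M (Yb r)) (return borel 0) \<le> Kg * B"
        using \<gamma> Ybl(4)[OF r r] by (intro mult_left_mono) auto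
      ultimately show "b2 \<omega> r \<le> \<theta> r \<omega> + 2 * (Kg * B) + \<gamma> / 2 * (norm (Z2 (\<omega>, r)))\<^sup>2"
        using r by (simp add: Z2_def)
    qed
  qed
  have eq1': "AE \<omega> in M. Y1 t \<omega> - Y1 s \<omega> = N1 s \<omega> - N1 t \<omega> - (\<integral>r. indicat_real {s<..t} r * b1 \<omega> r \<partial>lebesgue)"
    if "0 \<le> s" "s \<le> t" "t \<le> T" for s t
    using eq1[OF that] Y1eq by eventually_elim (use that in simp)
  have eq2': "AE \<omega> in M. Y2 t \<omega> - Y2 s \<omega> = N2 s \<omega> - N2 t \<omega> - (\<integral>r. indicat_real {s<..t} r * b2 \<omega> r \<partial>lebesgue)"
    if "0 \<le> s" "s \<le> t" "t \<le> T" for s t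
    using eq2[OF that] Y2eq by eventually_elim (use that in simp)
  have end_le: "AE \<omega> in M. Y1 T \<omega> \<le> Y2 T \<omega>"
    using solution_processes(2)[OF sol T] solution_processes(2)[OF solb T] \<eta> Y1eq Y2eq by eventually_elim (use T in simp)
  have "AE \<omega> in M. Y1 t \<omega> \<le> Y2 t \<omega>"
    using \<gamma> KL B(1)
    by (intro comparison_core[OF T Y1F Y2F Y1M Y2M Y1c Y2c B(2,3) sqZ N1 N2 S1 S2 eq1' eq2' diff growth \<theta> K3 _ end_le _ _ _ _ t]) auto
  then show ?thesis using Y1eq Y2eq by eventually_elim (use t in simp)
qed

end

theorem theorem4p1:
  fixes M :: "'w measure" and W :: "real \<Rightarrow> 'w \<Rightarrow> real ^ 'd" and T :: real
    and F :: "real \<Rightarrow> 'w measure"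
    and g gb :: "('w, 'd::finite) generator" and \<eta> \<eta>b :: "'w \<Rightarrow> real"
    and Y Yb :: "real \<Rightarrow> 'w \<Rightarrow> real" and Z Zb :: "real \<Rightarrow> 'w \<Rightarrow> real ^ 'd"
  assumes "brownian_basis M W" and "0 < T"
    and "F = brownian_filtration M W"
    and "quadratic_data M F T g \<eta>" and "quadratic_data M F T gb \<eta>b"
    and "global_solution M F W T g \<eta> Y Z" and "global_solution M F W T gb \<eta>b Yb Zb"
    and "(independent_of_mu2 M T g \<and> nondecreasing_mu1 M F T gb) \<or>
         (independent_of_mu2 M T gb \<and> nondecreasing_mu1 M F T g)"
    and "AE \<omega> in M. \<eta> \<omega> \<le> \<eta>b \<omega>"
    and "AE \<omega> in M. \<forall>t\<in>{0..T}. \<forall>y z. \<forall>\<mu>1\<in>P2. \<forall>\<mu>2\<in>P2.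
           g \<omega> t y z \<mu>1 \<mu>2 \<le> gb \<omega> t y z \<mu>1 \<mu>2"
  shows "\<forall>t\<in>{0..T}. AE \<omega> in M. Y t \<omega> \<le> Yb t \<omega>"
proof
  interpret brownian_basis M W by fact
  fix t assume "t \<in> {0..T}"
  then show "AE \<omega> in M. Y t \<omega> \<le> Yb t \<omega>"
    using assms(2,4-10) unfolding assms(3) by (intro mean_field_comparison)
qed

end
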